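(* Let $n\ge2$, $\alpha>-1$ and let $u$ be a solution of problem (P0). If $\alpha\in(-1,0)$ or $n\alpha-1\in2\mathbb{N}$, then $u\in C^\infty(\mathbb{R}^n\setminus\{0\})\cap C^s_{loc}(\mathbb{R}^n)$ for every $s<n(1+\alpha)$. If $\alpha>0$ and $n\alpha\notin\mathbb{N}$, then $u\in C^\infty(\mathbb{R}^n\setminus\{0\})\cap C^{n(1+\alpha)}_{loc}(\mathbb{R}^n)$. If $n\alpha\in2\mathbb{N}$, then $u\in C^\infty(\mathbb{R}^n)$.
   Context: For an open set $\Omega$ and $s>0$, $C^s(\Omega):=\{u\in C^{\lfloor s\rfloor}(\Omega): D^{\lfloor s\rfloor}u\in C^{0,s-\lfloor s\rfloor}(\Omega)\}$ where $\lfloor s\rfloor\in\mathbb{N}$ with $s-1<\lfloor s\rfloor\le s$; $C^s_{loc}(\mathbb{R}^n):=\{u\in C^0(\mathbb{R}^n):u|_\Omega\in C^s(\Omega)\ \forall\,\Omega\Subset\mathbb{R}^n\}$. $|S^n|$ is the volume of the unit $n$-sphere. For $s>0$, $L_s(\mathbb{R}^n):=\{w\in L^1_{loc}:\int\frac{|w|}{1+|x|^{n+2s}}dx<\infty\}$; for Schwartz $\varphi$, $(-\Delta)^s\varphi:=\mathcal F^{-1}(|\xi|^{2s}\mathcal F\varphi)$. Given $m\ge1$ and tempered $f$, $u$ solves $(-\Delta)^{m/2}u=f$ if: for $m$ even, $u\in L^1_{loc}$ and $\int u(-\Delta)^{m/2}\varphi=\langle f,\varphi\rangle$ for all $\varphi\in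 C^\infty_c$; for $m$ odd, $u\in L_{m/2}$ and the identity holds for all Schwartz $\varphi$. Problem (P0): $(-\Delta)^{n/2}u=|x|^{n\alpha}e^{nu}$ on $\mathbb{R}^n$ in this sense, with $\int_{\mathbb{R}^n}|x|^{n\alpha}e^{nu}dx<\infty$. *)

theory Defs
  imports "HOL-Analysis.Analysis"
begin

definition partial :: "'a::euclidean_space \<Rightarrow> ('a \<Rightarrow> 'b::real_normed_vector) \<Rightarrow> 'a \<Rightarrow> 'b" where
  "partial i f x = vector_derivative (\<lambda>t::real. f (x + t *\<^sub>R i)) (at 0)"

text \<open>Iterated partial derivative D^beta, the multi-index given as a list of basis vectors.\<close>
fun dpart :: "'a::euclidean_space list \<Rightarrow> ('a \<Rightarrow> 'b::real_normed_vector) \<Rightarrow> 'a \<Rightarrow> 'b" where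
  "dpart [] f = f"
| "dpart (i # is) f = partial i (dpart is f)"

definition Ck_on :: "nat \<Rightarrow> 'a::euclidean_space set \<Rightarrow> ('a \<Rightarrow> 'b::real_normed_vector) \<Rightarrow> bool" where
  "Ck_on k \<Omega> f \<longleftrightarrow>
     (\<forall>is. set is \<subseteq> Basis \<and> length is < k \<longrightarrow>
        (\<forall>i\<in>Basis. \<forall>x\<in>\<Omega>. (\<lambda>t::real. dpart is f (x + t *\<^sub>R i)) differentiable (at 0))) \<and>
     (\<forall>is. set is \<subseteq> Basis \<and> length is \<le> k \<longrightarrow> continuous_on \<Omega> (dpart is f))"

definition smooth_on :: "'a::euclidean_space set \<Rightarrow> ('a \<Rightarrow> 'b::real_normed_vector) \<Rightarrow> bool" where
  "smooth_on \<Omega> f \<longleftrightarrow> (\<forall>k. Ck_on k \<Omega> f)"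

definition holder_on :: "real \<Rightarrow> 'a::euclidean_space set \<Rightarrow> ('a \<Rightarrow> 'b::real_normed_vector) \<Rightarrow> bool" where
  "holder_on \<gamma> \<Omega> g \<longleftrightarrow> continuous_on \<Omega> g \<and>
     (\<exists>C. \<forall>x\<in>\<Omega>. \<forall>y\<in>\<Omega>. norm (g x - g y) \<le> C * dist x y powr \<gamma>)"

definition ipart :: "real \<Rightarrow> nat" where
  "ipart s = nat \<lfloor>s\<rfloor>"

definition Cs_on :: "real \<Rightarrow> 'a::euclidean_space set \<Rightarrow> ('a \<Rightarrow> real) \<Rightarrow> bool" where
  "Cs_on s \<Omega> u \<longleftrightarrow> Ck_on (ipart s) \<Omega> u \<and>
     (\<forall>is. set is \<subseteq> Basis \<and> length is = ipart s \<longrightarrow> holder_on (s - real (ipart s)) \<Omega> (dpart is u))"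

definition Cs_loc :: "real \<Rightarrow> ('a::euclidean_space \<Rightarrow> real) \<Rightarrow> bool" where
  "Cs_loc s u \<longleftrightarrow> continuous_on UNIV u \<and>
     (\<forall>\<Omega>. open \<Omega> \<and> bounded \<Omega> \<longrightarrow> Cs_on s \<Omega> u)"

definition schwartz :: "('a::euclidean_space \<Rightarrow> complex) \<Rightarrow> bool" where
  "schwartz \<phi> \<longleftrightarrow> smooth_on UNIV \<phi> \<and>
     (\<forall>is (k::nat). set is \<subseteq> Basis \<longrightarrow> bdd_above (range (\<lambda>x. norm x ^ k * norm (dpart is \<phi> x))))"

definition test_fun :: "('a::euclidean_space \<Rightarrow> complex) \<Rightarrow> bool" where
  "test_fun \<phi> \<longleftrightarrow> smooth_on UNIV \<phi> \<and> (\<exists>K. compact K \<and> (\<forall>x. x \<notin> K \<longrightarrow> \<phi> x = 0))"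

definition fourier :: "('a::euclidean_space \<Rightarrow> complex) \<Rightarrow> 'a \<Rightarrow> complex" where
  "fourier \<phi> \<xi> = (LINT x|lborel. cis (- (x \<bullet> \<xi>)) * \<phi> x)"

definition inv_fourier :: "('a::euclidean_space \<Rightarrow> complex) \<Rightarrow> 'a \<Rightarrow> complex" where
  "inv_fourier g x = complex_of_real (1 / (2 * pi) ^ DIM('a)) * (LINT \<xi>|lborel. cis (x \<bullet> \<xi>) * g \<xi>)"

definition frac_lap :: "real \<Rightarrow> ('a::euclidean_space \<Rightarrow> complex) \<Rightarrow> 'a \<Rightarrow> complex" where
  "frac_lap s \<phi> = inv_fourier (\<lambda>\<xi>. complex_of_real (norm \<xi> powr (2 * s)) * fourier \<phi> \<xi>)"

definition loc_integrable :: "('a::euclidean_space \<Rightarrow> real) \<Rightarrow> bool" where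
  "loc_integrable w \<longleftrightarrow> (\<forall>K. compact K \<longrightarrow> set_integrable lborel K w)"

definition L_s :: "real \<Rightarrow> ('a::euclidean_space \<Rightarrow> real) \<Rightarrow> bool" where
  "L_s s w \<longleftrightarrow> loc_integrable w \<and>
     integrable lborel (\<lambda>x. \<bar>w x\<bar> / (1 + norm x powr (real DIM('a) + 2 * s)))"

text \<open>u solves (-Delta)^{m/2} u = f in the sense of the paper, f a locally integrable function
  acting as the tempered distribution phi |-> integral f phi.\<close>
definition solves_fl :: "nat \<Rightarrow> ('a::euclidean_space \<Rightarrow> real) \<Rightarrow> ('a \<Rightarrow> real) \<Rightarrow> bool" where
  "solves_fl m f u \<longleftrightarrow>
     (if even m then
        loc_integrable u \<and>
        (\<forall>\<phi>. test_fun \<phi> \<longrightarrow>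
           (LINT x|lborel. complex_of_real (u x) * frac_lap (real m / 2) \<phi> x) =
           (LINT x|lborel. complex_of_real (f x) * \<phi> x))
      else
        L_s (real m / 2) u \<and>
        (\<forall>\<phi>. schwartz \<phi> \<longrightarrow>
           (LINT x|lborel. complex_of_real (u x) * frac_lap (real m / 2) \<phi> x) =
           (LINT x|lborel. complex_of_real (f x) * \<phi> x)))"

definition P0 :: "real \<Rightarrow> ('a::euclidean_space \<Rightarrow> real) \<Rightarrow> bool" where
  "P0 \<alpha> u \<longleftrightarrow>
     solves_fl DIM('a) (\<lambda>x. norm x powr (real DIM('a) * \<alpha>) * exp (real DIM('a) * u x)) u \<and>
     integrable lborel (\<lambda>x. norm x powr (real DIM('a) * \<alpha>) * exp (real DIM('a) * u x))"

end

theory Submission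
 imports Defs "HOL-Probability.Probability"
begin

text \<open>Up to a smooth function, the solution is a potential $c\,(\Phi * f)$ of $f = |x|^{n\alpha} e^{nu}$, where $\Phi$ is
 the integral of $t^{n/2-1}$ times the heat kernel over $0 < t < 1$, a localized logarithmic kernel. To see this, test
 the equation with the truncations of $\Phi$ to $\epsilon < t < 1$: the product of $|\xi|^n$ with their Fourier transform
 is a multiple of $Q(\epsilon|\xi|^2) - Q(|\xi|^2)$, so the operator turns them into an approximate identity minus a fixed
 smooth decaying kernel, and let $\epsilon \to 0$. (For even $n$ only compactly supported test functions are admitted, and
 the truncations are multiplied by a cutoff.) Since potentials of small mass have high exponential integrability, $u$ is
 locally bounded, and heat kernel estimates of Schauder type bootstrap its regularity, up to the limit that
 $|x|^{n\alpha}$ imposes at the origin.\<close>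

text \<open>The kernel is a superposition of heat kernels, not the logarithm itself, because then
  every Fourier transform is a Gaussian integral and each estimate follows from parabolic scaling.
  For even n = 2(j+1) the weight t^j matches |xi|^(2(j+1)), and the symbols are incomplete gamma
  functions of integer order. For odd n = 2k+1 a factor (t |xi|^2)^(-1/2) is left over; it is
  written as a Gamma(1/2) integral of exponentials exp(-S t |xi|^2), so that the odd case becomes an
  average over S of formulas of the even type. The price is nonlocality: the fixed kernel decays
  only like |x|^(-2n), just enough to be paired with \<open>L_s\<close>. On the growth of u at
  infinity nothing is known beyond the definition of a solution; all terms except the local
  potential of f are u or f integrated against a smooth kernel, hence smooth. Since u is a class
  modulo null sets, the weak equation is integrated over boxes in the centre of the test function.
  The regular object is a representative v, defined everywhere by the representation, for which f =
  |x|^(n alpha) e^(n v) holds almost everywhere.\<close>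

lemmas integrable_dom = Bochner_Integration.integrable_bound

abbreviation cor :: "real \<Rightarrow> complex" where "cor \<equiv> complex_of_real"

abbreviation "Lint \<equiv> integrable lborel"

abbreviation "sq x \<equiv> x \<bullet> x"

abbreviation "ind \<equiv> indicator"

abbreviation "bmeas \<equiv> borel_measurable borel"

section \<open>Partial derivatives\<close>

text \<open>\<open>partial\<close> is a choice of derivative and carries no information on
  existence; this relation keeps existence and value together.\<close>

definition has_partial :: "'a::euclidean_space => ('a => 'b::real_normed_vector) => 'a => 'b => bool" where
 "has_partial i f x d \<longleftrightarrow> ((%t::real. f (x + t *\<^sub>R i)) has_vector_derivative d) (at 0)"

lemma has_partial_imp: "has_partial i f x d ==> partial i f x = d"
 unfolding has_partial_def partial_def by (rule vector_derivative_at)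

lemma has_partial_iff:
 "(%t::real. f (x + t *\<^sub>R i)) differentiable (at 0) \<longleftrightarrow> has_partial i f x (partial i f x)"
 unfolding has_partial_def partial_def by (rule vector_derivative_works)

lemma has_partial_cong:
 assumes "open \<Omega>" "x : \<Omega>" "!!y. y : \<Omega> ==> f y = g y"
 shows "has_partial i f x d \<longleftrightarrow> has_partial i g x d"
proof -
 have o: "open ((%t::real. x + t *\<^sub>R i) -` \<Omega>)"
  by (intro open_vimage assms continuous_intros)
 have "0 : (%t::real. x + t *\<^sub>R i) -` \<Omega>" using assms by simp
 thus ?thesis unfolding has_partial_def
  using assms(3) by (auto intro: has_vector_derivative_transform_within_open[OF _ o])
qed

lemma partial_cong:
 assumes "open \<Omega>" "x : \<Omega>" "!!y. y : \<Omega> ==> f y = g y"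
 shows "partial i f x = partial i g x"
 unfolding partial_def vector_derivative_def
 using has_partial_cong[of \<Omega> x f g, OF assms] unfolding has_partial_def by simp

lemma dpart_append: "dpart (xs @ ys) f = dpart xs (dpart ys f)"
 by (induction xs) auto

lemma dpart_cong:
 assumes "open \<Omega>" "!!y. y : \<Omega> ==> f y = g y" "x : \<Omega>"
 shows "dpart is f x = dpart is g x"
 using assms(3)
proof (induction "is" arbitrary: x)
 case Nil thus ?case using assms by simp
next
 case (Cons i "is") thus ?case using partial_cong[of \<Omega> x "dpart is f" "dpart is g", OF assms(1) Cons.prems] by simp
qed

lemma Ck_on_0 [simp]: "Ck_on 0 \<Omega> f \<longleftrightarrow> continuous_on \<Omega> f"
 unfolding Ck_on_def by auto

text \<open>Turns the list-based definition into a recursion on the order, the form in which closure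
  properties are proved. Since \<open>dpart\<close> applies the head of the list last, the recursion
  removes the last entry, which is the derivative applied first.\<close>

lemma Ck_on_Suc:
 "Ck_on (Suc k) \<Omega> f \<longleftrightarrow> continuous_on \<Omega> f &
   (ALL i:Basis. (ALL x:\<Omega>. has_partial i f x (partial i f x)) & Ck_on k \<Omega> (partial i f))"
 (is "?l \<longleftrightarrow> ?r")
proof
 assume l: ?l
 have c: "continuous_on \<Omega> f" using l unfolding Ck_on_def by (elim conjE allE[of _ "[]"]) auto
 have "(ALL x:\<Omega>. has_partial i f x (partial i f x)) & Ck_on k \<Omega> (partial i f)" if i: "i : Basis" for i
 proof
  have "ALL i:Basis. ALL x:\<Omega>. (%t. dpart [] f (x + t *\<^sub>R i)) differentiable at 0"
   using l unfolding Ck_on_def by (elim conjE allE[of _ "[]"]) auto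
  thus "ALL x:\<Omega>. has_partial i f x (partial i f x)"
   using i by (simp add: has_partial_iff)
  show "Ck_on k \<Omega> (partial i f)"
   unfolding Ck_on_def
  proof (intro conjI allI impI)
   fix "is" :: "'a list" assume h: "set is <= Basis & length is < k"
   hence "set (is @ [i]) <= Basis & length (is @ [i]) < Suc k" using i by auto
   hence "ALL j:Basis. ALL x:\<Omega>. (%t. dpart (is @ [i]) f (x + t *\<^sub>R j)) differentiable at 0"
    using l unfolding Ck_on_def by blast
   thus "ALL j:Basis. ALL x:\<Omega>. (%t. dpart is (partial i f) (x + t *\<^sub>R j)) differentiable at 0"
    by (simp add: dpart_append)
  next
   fix "is" :: "'a list" assume h: "set is <= Basis & length is <= k"
   hence "set (is @ [i]) <= Basis & length (is @ [i]) <= Suc k" using i by auto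
   hence "continuous_on \<Omega> (dpart (is @ [i]) f)"
    using l unfolding Ck_on_def by blast
   thus "continuous_on \<Omega> (dpart is (partial i f))"
    by (simp add: dpart_append)
  qed
 qed
 thus ?r using c by blast
next
 assume r: ?r
 show ?l unfolding Ck_on_def
 proof (intro conjI allI impI)
  fix "is" :: "'a list" assume h: "set is <= Basis & length is < Suc k"
  show "ALL j:Basis. ALL x:\<Omega>. (%t. dpart is f (x + t *\<^sub>R j)) differentiable at 0"
  proof (cases "is" rule: rev_cases)
   case Nil thus ?thesis using r by (simp add: has_partial_iff)
  next
   case (snoc ys i)
   hence "Ck_on k \<Omega> (partial i f)" "set ys <= Basis & length ys < k" using r h by auto
   thus ?thesis unfolding Ck_on_def snoc dpart_append by simp
  qed
 next
  fix "is" :: "'a list" assume h: "set is <= Basis & length is <= Suc k"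
  show "continuous_on \<Omega> (dpart is f)"
  proof (cases "is" rule: rev_cases)
   case Nil thus ?thesis using r by simp
  next
   case (snoc ys i)
   hence "Ck_on k \<Omega> (partial i f)" "set ys <= Basis & length ys <= k" using r h by auto
   thus ?thesis unfolding Ck_on_def snoc dpart_append by simp
  qed
 qed
qed

lemma Ck_on_mono: "Ck_on k \<Omega> f ==> k' <= k ==> \<Omega>' <= \<Omega> ==> Ck_on k' \<Omega>' f"
 unfolding Ck_on_def by (meson continuous_on_subset le_trans less_le_trans subsetD)

lemma Ck_on_continuous: "Ck_on k \<Omega> f ==> continuous_on \<Omega> f"
 using Ck_on_mono[of k \<Omega> f 0] by auto

lemma Ck_on_dpart_continuous:
 "Ck_on k \<Omega> f ==> set is <= Basis ==> length is <= k ==> continuous_on \<Omega> (dpart is f)"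
 unfolding Ck_on_def by auto

lemma Ck_on_dpart_has_partial:
 "Ck_on k \<Omega> f ==> set is <= Basis ==> length is < k ==> i : Basis ==> x : \<Omega> ==>
  has_partial i (dpart is f) x (dpart (i # is) f x)"
 unfolding Ck_on_def by (auto simp: has_partial_iff)

lemma Ck_on_dpart:
 fixes f :: "'a::euclidean_space => 'b::real_normed_vector"
 assumes "Ck_on (k + length is) \<Omega> f" "set is <= Basis"
 shows "Ck_on k \<Omega> (dpart is f)"
 unfolding Ck_on_def
proof (intro conjI allI impI)
 fix js :: "'a list" assume "set js <= Basis & length js < k"
 hence "set (js @ is) <= Basis & length (js @ is) < k + length is" using assms by auto
 thus "ALL i:Basis. ALL x:\<Omega>. (%t. dpart js (dpart is f) (x + t *\<^sub>R i)) differentiable at 0"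
  using assms(1) unfolding Ck_on_def by (metis dpart_append)
next
 fix js :: "'a list" assume "set js <= Basis & length js <= k"
 hence "set (js @ is) <= Basis & length (js @ is) <= k + length is" using assms by auto
 thus "continuous_on \<Omega> (dpart js (dpart is f))"
  using assms(1) unfolding Ck_on_def by (metis dpart_append)
qed

lemma Ck_on_cong:
 assumes "open \<Omega>" "!!y. y : \<Omega> ==> f y = g y"
 shows "Ck_on k \<Omega> f \<longleftrightarrow> Ck_on k \<Omega> g"
 using assms(2)
proof (induction k arbitrary: f g)
 case 0 thus ?case by (simp cong: continuous_on_cong)
next
 case (Suc k)
 have p: "partial i f x = partial i g x" if "x : \<Omega>" for i x
  using partial_cong[of \<Omega> x f g, OF assms(1) that Suc.prems] .
 have "Ck_on k \<Omega> (partial i f) \<longleftrightarrow> Ck_on k \<Omega> (partial i g)" for i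
  by (rule Suc.IH) (rule p)
 moreover have "continuous_on \<Omega> f \<longleftrightarrow> continuous_on \<Omega> g"
  using Suc.prems by (simp cong: continuous_on_cong)
 moreover have "has_partial i f x d \<longleftrightarrow> has_partial i g x d" if "x : \<Omega>" for i x d
  using has_partial_cong[of \<Omega> x f g, OF assms(1) that Suc.prems] .
 ultimately show ?case unfolding Ck_on_Suc using p by simp
qed

text \<open>Both clauses of \<open>Ck_on\<close> are local, so regularity may be proved on one ball
  around each point, where a potential splits into a singular and a smooth part.\<close>

lemma Ck_on_local:
 fixes f :: "'a::euclidean_space => 'b::real_normed_vector"
 assumes "!!x. x : \<Omega> ==> EX U. open U & x : U & Ck_on k U f"
 shows "Ck_on k \<Omega> f"
 unfolding Ck_on_def
proof (intro conjI allI impI ballI)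
 fix "is" :: "'a list" and i x :: 'a assume "set is <= Basis & length is < k" "i : Basis" "x : \<Omega>"
 thus "(%t. dpart is f (x + t *\<^sub>R i)) differentiable at 0"
  using assms[of x] unfolding Ck_on_def by blast
next
 fix "is" :: "'a list" assume h: "set is <= Basis & length is <= k"
 show "continuous_on \<Omega> (dpart is f)"
 proof (rule continuous_at_imp_continuous_on, intro ballI)
  fix x assume "x : \<Omega>"
  then obtain U where "open U" "x : U" "Ck_on k U f" using assms by blast
  hence "continuous_on U (dpart is f)" using h unfolding Ck_on_def by blast
  thus "isCont (dpart is f) x" using \<open>open U\<close> \<open>x : U\<close>
   by (simp add: continuous_on_eq_continuous_at)
 qed
qed

lemma Ck_on_SucI:
 fixes f :: "'a::euclidean_space => 'b::real_normed_vector"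
 assumes "open \<Omega>" "continuous_on \<Omega> f"
  and "!!i. i : Basis ==> EX f'. (ALL x:\<Omega>. has_partial i f x (f' x)) & Ck_on k \<Omega> f'"
 shows "Ck_on (Suc k) \<Omega> f"
 unfolding Ck_on_Suc
proof (intro conjI ballI assms)
 fix i :: 'a assume i: "i : Basis"
 obtain f' where f': "!!x. x : \<Omega> ==> has_partial i f x (f' x)" "Ck_on k \<Omega> f'" using assms(3)[OF i] by blast
 have e: "!!x. x : \<Omega> ==> partial i f x = f' x" using f' has_partial_imp by blast
 show "Ck_on k \<Omega> (partial i f)" using f'(2) Ck_on_cong[of \<Omega> "partial i f" f', OF assms(1) e] by blast
 show "has_partial i f x (partial i f x)" if "x : \<Omega>" for x using f' e that by simp
qed

section \<open>Calculus rules and closure properties of C^k\<close>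

lemma has_partial_const [simp]: "has_partial i (%x. c) x 0"
 unfolding has_partial_def by simp

lemma has_partial_add:
 "has_partial i f x d ==> has_partial i g x e ==> has_partial i (%x. f x + g x) x (d + e)"
 unfolding has_partial_def by (rule has_vector_derivative_add)

lemma has_partial_mult:
 fixes f g :: "'a::euclidean_space => 'b::real_normed_algebra"
 shows "has_partial i f x d ==> has_partial i g x e ==> has_partial i (%x. f x * g x) x (f x * e + d * g x)"
 unfolding has_partial_def
 using has_vector_derivative_mult[of "%t. f (x + t *\<^sub>R i)" d 0 UNIV "%t. g (x + t *\<^sub>R i)" e] by simp

lemma has_partial_linear:
 "bounded_linear L ==> has_partial i f x d ==> has_partial i (%x. L (f x)) x (L d)"
 unfolding has_partial_def by (rule bounded_linear.has_vector_derivative)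

lemma has_partial_inner: "has_partial i (%x. x \<bullet> b) x (i \<bullet> b)"
 unfolding has_partial_def
 by (auto intro!: derivative_eq_intros simp: inner_simps has_vector_derivative_def)

lemma has_partial_affine:
 assumes "has_partial i f (c *\<^sub>R x + b) d"
 shows "has_partial i (%x. f (c *\<^sub>R x + b)) x (c *\<^sub>R d)"
proof -
 have "((%t::real. f (c *\<^sub>R x + b + t *\<^sub>R i)) has_vector_derivative d) (at (c * 0))"
  using assms unfolding has_partial_def by simp
 moreover have "((%t. c * t) has_vector_derivative c) (at (0::real))"
  by (auto intro!: derivative_eq_intros simp: has_vector_derivative_def)
 ultimately have "((%t::real. f (c *\<^sub>R x + b + t *\<^sub>R i)) \<circ> (%t. c * t) has_vector_derivative c *\<^sub>R d) (at 0)"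
  by (intro vector_diff_chain_at) simp_all
 thus ?thesis unfolding has_partial_def by (simp add: o_def algebra_simps)
qed

lemma has_partial_compose:
 fixes H :: "real => real"
 assumes "has_partial i q x d" "(H has_real_derivative e) (at (q x))"
 shows "has_partial i (%x. H (q x)) x (e * d)"
proof -
 have "(H has_vector_derivative e) (at (q (x + 0 *\<^sub>R i)))"
  using assms(2) by (simp add: has_real_derivative_iff_has_vector_derivative)
 hence "(H \<circ> (%t. q (x + t *\<^sub>R i)) has_vector_derivative d *\<^sub>R e) (at 0)"
  using assms(1) unfolding has_partial_def by (intro vector_diff_chain_at)
 thus ?thesis unfolding has_partial_def by (simp add: o_def mult.commute)
qed

lemma Ck_on_const [simp]: "Ck_on k (\<Omega> :: 'a::euclidean_space set) (%x. c)"
proof (induction k arbitrary: c)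
 case (Suc k)
 have "partial i (%x::'a. c) = (%x. 0)" for i using has_partial_imp[OF has_partial_const] by blast
 thus ?case unfolding Ck_on_Suc using Suc by simp
qed simp

lemma Ck_on_add:
 fixes \<Omega> :: "'a::euclidean_space set"
 shows "open \<Omega> ==> Ck_on k \<Omega> f ==> Ck_on k \<Omega> g ==> Ck_on k \<Omega> (%x. f x + g x)"
proof (induction k arbitrary: f g)
 case 0 thus ?case by (simp add: continuous_on_add)
next
 case (Suc k)
 show ?case
 proof (rule Ck_on_SucI[OF Suc.prems(1)])
  show "continuous_on \<Omega> (%x. f x + g x)" using Suc.prems by (simp add: Ck_on_continuous continuous_on_add)
  fix i :: 'a assume "i : Basis"
  thus "EX f'. (ALL x:\<Omega>. has_partial i (%x. f x + g x) x (f' x)) & Ck_on k \<Omega> f'"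
   using Suc by (intro exI[of _ "%x. partial i f x + partial i g x"]) (auto simp: Ck_on_Suc intro: has_partial_add)
 qed
qed

lemma Ck_on_linear:
 fixes \<Omega> :: "'a::euclidean_space set"
 shows "bounded_linear L ==> open \<Omega> ==> Ck_on k \<Omega> f ==> Ck_on k \<Omega> (%x. L (f x))"
proof (induction k arbitrary: f)
 case 0 thus ?case by (simp add: bounded_linear.continuous_on)
next
 case (Suc k)
 show ?case
 proof (rule Ck_on_SucI[OF Suc.prems(2)])
  show "continuous_on \<Omega> (%x. L (f x))" using Suc.prems by (simp add: Ck_on_continuous bounded_linear.continuous_on)
  fix i :: 'a assume "i : Basis"
  thus "EX f'. (ALL x:\<Omega>. has_partial i (%x. L (f x)) x (f' x)) & Ck_on k \<Omega> f'"
   using Suc by (intro exI[of _ "%x. L (partial i f x)"]) (auto simp: Ck_on_Suc intro: has_partial_linear)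
 qed
qed

lemma Ck_on_mult:
 fixes f g :: "'a::euclidean_space => 'b::real_normed_algebra"
 shows "open \<Omega> ==> Ck_on k \<Omega> f ==> Ck_on k \<Omega> g ==> Ck_on k \<Omega> (%x. f x * g x)"
proof (induction k arbitrary: f g)
 case 0 thus ?case by (simp add: continuous_on_mult)
next
 case (Suc k)
 have m: "Ck_on k \<Omega> f" "Ck_on k \<Omega> g" using Suc.prems Ck_on_mono by (metis le_SucI order_refl)+
 show ?case
 proof (rule Ck_on_SucI[OF Suc.prems(1)])
  show "continuous_on \<Omega> (%x. f x * g x)" using Suc.prems by (simp add: Ck_on_continuous continuous_on_mult)
  fix i :: 'a assume "i : Basis"
  thus "EX f'. (ALL x:\<Omega>. has_partial i (%x. f x * g x) x (f' x)) & Ck_on k \<Omega> f'"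
   using Suc m by (intro exI[of _ "%x. f x * partial i g x + partial i f x * g x"])
    (auto simp: Ck_on_Suc intro!: has_partial_mult Ck_on_add)
 qed
qed

lemma Ck_on_sum:
 "open (\<Omega> :: 'a::euclidean_space set) ==> (!!j. j : J ==> Ck_on k \<Omega> (f j)) ==> Ck_on k \<Omega> (%x. \<Sum>j\<in>J. f j x)"
 by (induction J rule: infinite_finite_induct) (auto intro: Ck_on_add)

lemma Ck_on_inner: "open (\<Omega> :: 'a::euclidean_space set) ==> Ck_on k \<Omega> (%x. x \<bullet> b)"
proof (cases k)
 case 0 thus ?thesis by (auto intro!: continuous_intros)
next
 case (Suc m)
 assume o: "open \<Omega>"
 show ?thesis unfolding Suc
 proof (rule Ck_on_SucI[OF o])
  show "EX f'. (ALL x:\<Omega>. has_partial i (%x. x \<bullet> b) x (f' x)) & Ck_on m \<Omega> f'" for i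
   by (intro exI[of _ "%x. i \<bullet> b"]) (auto intro: has_partial_inner)
 qed (auto intro!: continuous_intros)
qed

lemma Ck_on_affine:
 fixes \<Omega> :: "'a::euclidean_space set"
 shows "open \<Omega> ==> Ck_on k \<Omega> f ==> Ck_on k ((%x. c *\<^sub>R x + b) -` \<Omega>) (%x. f (c *\<^sub>R x + b))"
proof (induction k arbitrary: f)
 case 0 thus ?case by (auto intro!: continuous_on_compose2[of \<Omega> f] continuous_intros)
next
 case (Suc k)
 have o: "open ((%x. c *\<^sub>R x + b) -` \<Omega>)" using Suc.prems by (auto intro!: open_vimage continuous_intros)
 show ?case
 proof (rule Ck_on_SucI[OF o])
  show "continuous_on ((%x. c *\<^sub>R x + b) -` \<Omega>) (%x. f (c *\<^sub>R x + b))"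
   using Ck_on_continuous[OF Suc.prems(2)] by (auto intro!: continuous_on_compose2[of \<Omega> f] continuous_intros)
  fix i :: 'a assume i: "i : Basis"
  have "Ck_on k \<Omega> (%x. c *\<^sub>R partial i f x)"
   using Suc.prems i by (intro Ck_on_linear[OF bounded_linear_scaleR_right]) (auto simp: Ck_on_Suc)
  hence "Ck_on k ((%x. c *\<^sub>R x + b) -` \<Omega>) (%x. c *\<^sub>R partial i f (c *\<^sub>R x + b))"
   using Suc.IH[OF Suc.prems(1), of "%x. c *\<^sub>R partial i f x"] by simp
  thus "EX f'. (ALL x:(%x. c *\<^sub>R x + b) -` \<Omega>. has_partial i (%x. f (c *\<^sub>R x + b)) x (f' x)) & Ck_on k ((%x. c *\<^sub>R x + b) -` \<Omega>) f'"
   using Suc.prems i by (intro exI[of _ "%x. c *\<^sub>R partial i f (c *\<^sub>R x + b)"]) (auto simp: Ck_on_Suc intro: has_partial_affine)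
 qed
qed

lemma dpart_affine:
 assumes "Ck_on (length is) UNIV f" "set is <= Basis"
 shows "dpart is (%x. f (c *\<^sub>R x + b)) x = c ^ length is *\<^sub>R dpart is f (c *\<^sub>R x + b)"
 using assms
proof (induction "is" arbitrary: x)
 case (Cons i "is")
 have "Ck_on (length is) UNIV f" using Cons.prems Ck_on_mono by (metis length_Cons le_SucI order_refl)
 hence "dpart is (%x. f (c *\<^sub>R x + b)) = (%x. c ^ length is *\<^sub>R dpart is f (c *\<^sub>R x + b))"
  using Cons by auto
 moreover have "has_partial i (%x. c ^ length is *\<^sub>R dpart is f (c *\<^sub>R x + b)) x
   (c ^ length is *\<^sub>R (c *\<^sub>R dpart (i # is) f (c *\<^sub>R x + b)))"
  by (rule has_partial_linear[OF bounded_linear_scaleR_right], rule has_partial_affine)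
   (rule Ck_on_dpart_has_partial[OF Cons.prems(1)], use Cons.prems in auto)
 ultimately show ?case using has_partial_imp by (fastforce simp: mult.commute)
qed simp

lemma dpart_add:
 assumes "open \<Omega>" "Ck_on (length is) \<Omega> f" "Ck_on (length is) \<Omega> g" "set is <= Basis" "x : \<Omega>"
 shows "dpart is (%x. f x + g x) x = dpart is f x + dpart is g x"
 using assms(2-5)
proof (induction "is" arbitrary: x)
 case (Cons i "is")
 have "Ck_on (length is) \<Omega> f" "Ck_on (length is) \<Omega> g" using Cons.prems Ck_on_mono by (metis length_Cons le_SucI order_refl)+
 hence e: "dpart is (%x. f x + g x) y = dpart is f y + dpart is g y" if "y : \<Omega>" for y
  using Cons that by auto
 have "has_partial i (%x. dpart is f x + dpart is g x) x (dpart (i # is) f x + dpart (i # is) g x)"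
  by (intro has_partial_add Ck_on_dpart_has_partial[OF Cons.prems(1)] Ck_on_dpart_has_partial[OF Cons.prems(2)])
    (use Cons.prems in auto)
 hence "has_partial i (dpart is (%x. f x + g x)) x (dpart (i # is) f x + dpart (i # is) g x)"
  using has_partial_cong[of \<Omega> x "dpart is (%x. f x + g x)" "%x. dpart is f x + dpart is g x", OF assms(1) \<open>x : \<Omega>\<close> e] by blast
 thus ?case using has_partial_imp by fastforce
qed simp

lemma dpart_linear:
 assumes "bounded_linear L" "open \<Omega>" "Ck_on (length is) \<Omega> f" "set is <= Basis" "x : \<Omega>"
 shows "dpart is (%x. L (f x)) x = L (dpart is f x)"
 using assms(3-5)
proof (induction "is" arbitrary: x)
 case (Cons i "is")
 have "Ck_on (length is) \<Omega> f" using Cons.prems Ck_on_mono by (metis length_Cons le_SucI order_refl)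
 hence e: "dpart is (%x. L (f x)) y = L (dpart is f y)" if "y : \<Omega>" for y
  using Cons that by auto
 have "has_partial i (%x. L (dpart is f x)) x (L (dpart (i # is) f x))"
  by (intro has_partial_linear[OF assms(1)] Ck_on_dpart_has_partial[OF Cons.prems(1)]) (use Cons.prems in auto)
 hence "has_partial i (dpart is (%x. L (f x))) x (L (dpart (i # is) f x))"
  using has_partial_cong[of \<Omega> x "dpart is (%x. L (f x))" "%x. L (dpart is f x)", OF assms(2) \<open>x : \<Omega>\<close> e] by blast
 thus ?case using has_partial_imp by fastforce
qed simp

text \<open>A real function has the single direction 1, so \<open>partial 1 H\<close> is its
  ordinary derivative; the induction runs over H with q fixed.\<close>

lemma Ck_on_compose:
 fixes H :: "real => real" and q :: "'a::euclidean_space => real"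
 assumes "open \<Omega>" "open S"
 shows "Ck_on k S H ==> Ck_on k \<Omega> q ==> q ` \<Omega> <= S ==> Ck_on k \<Omega> (%x. H (q x))"
proof (induction k arbitrary: H)
 case 0 thus ?case by (auto intro: continuous_on_compose2)
next
 case (Suc k)
 show ?case
 proof (rule Ck_on_SucI[OF assms(1)])
  show "continuous_on \<Omega> (%x. H (q x))"
   using Suc.prems by (auto intro: continuous_on_compose2 dest: Ck_on_continuous)
  fix i :: 'a assume i: "i : Basis"
  have q: "Ck_on k \<Omega> q" using Suc.prems Ck_on_mono by (metis le_SucI order_refl)
  have d: "(H has_real_derivative partial 1 H y) (at y)" if "y : S" for y
  proof -
   have "has_partial 1 H y (partial 1 H y)" using Suc.prems(1) that by (simp add: Ck_on_Suc)
   hence "((%t. H (t + y)) has_real_derivative partial 1 H y) (at 0)"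
    unfolding has_partial_def by (simp add: has_real_derivative_iff_has_vector_derivative add.commute)
   thus ?thesis using DERIV_shift[of H _ 0 y] by simp
  qed
  have "Ck_on k \<Omega> (%x. partial 1 H (q x) * partial i q x)"
   using Suc q i by (intro Ck_on_mult[OF assms(1)]) (auto simp: Ck_on_Suc)
  thus "EX f'. (ALL x:\<Omega>. has_partial i (%x. H (q x)) x (f' x)) & Ck_on k \<Omega> f'"
   using Suc.prems(2,3) i by (intro exI[of _ "%x. partial 1 H (q x) * partial i q x"] conjI ballI has_partial_compose d)
    (auto simp: Ck_on_Suc)
 qed
qed

lemma has_partial_real: "(H has_real_derivative d) (at x) ==> has_partial 1 H (x::real) d"
 unfolding has_partial_def has_real_derivative_iff_has_vector_derivative[symmetric]
 using DERIV_shift[of H d 0 x] by (simp add: add.commute)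

lemma Ck_on_real_SucI:
 fixes H :: "real => real"
 assumes "open S" "!!y. y : S ==> (H has_real_derivative H' y) (at y)" "Ck_on k S H'"
 shows "Ck_on (Suc k) S H"
 using assms by (intro Ck_on_SucI)
  (auto intro!: exI[of _ H'] has_partial_real continuous_at_imp_continuous_on intro: DERIV_isCont)

lemma Ck_on_exp: "Ck_on k (UNIV::real set) (exp :: real => real)"
 by (induction k) (auto intro!: Ck_on_real_SucI continuous_intros)

lemma Ck_on_powr: "Ck_on k {0::real<..} (%x. x powr p)"
proof (induction k arbitrary: p)
 case 0 thus ?case by (auto intro!: continuous_intros)
next
 case (Suc k)
 show ?case
  by (rule Ck_on_real_SucI[of _ _ "%x. p * x powr (p - 1)"])
   (auto intro!: Ck_on_mult Suc has_real_derivative_powr)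
qed

lemma Ck_on_inverse: "Ck_on k {0::real<..} (%x. inverse x)"
 using Ck_on_powr[of k "-1"] Ck_on_cong[of "{0::real<..}" "%x. x powr -1" inverse k]
 by (simp add: powr_minus)

section \<open>Lipschitz bounds from partial derivatives\<close>

lemma line_lipschitz:
 fixes \<phi> :: "real => 'b::real_normed_vector"
 assumes "!!s. s : closed_segment 0 h ==> (\<phi> has_vector_derivative D s) (at s)"
  "!!s. s : closed_segment 0 h ==> norm (D s) <= M"
 shows "norm (\<phi> h - \<phi> 0) <= M * \<bar>h\<bar>"
proof -
 have "norm (\<phi> h - \<phi> 0) <= M * norm (h - 0)"
 proof (rule differentiable_bound[where S="closed_segment 0 h" and f'="%s t. t *\<^sub>R D s"])
  fix s assume s: "s : closed_segment 0 h"
  show "(\<phi> has_derivative (%t. t *\<^sub>R D s)) (at s within closed_segment 0 h)"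
   using assms(1)[OF s] unfolding has_vector_derivative_def by (rule has_derivative_at_withinI)
  show "onorm (%t. t *\<^sub>R D s) <= M"
   using assms(2)[OF s] by (intro onorm_le) (simp add: mult.commute[of M] mult_left_mono)
 qed auto
 thus ?thesis by simp
qed

lemma has_partial_line:
 assumes "has_partial i f (x + s *\<^sub>R i) d"
 shows "((%t. f (x + t *\<^sub>R i)) has_vector_derivative d) (at s)"
proof -
 have "((%t. f (x + t *\<^sub>R i)) \<circ> (+) s has_vector_derivative d) (at 0)"
  using assms unfolding has_partial_def by (simp add: o_def algebra_simps)
 hence "((%t. f (x + t *\<^sub>R i)) \<circ> (+) s has_vector_derivative d) (at (s - s))" by simp
 moreover have "((%t. t - s) has_vector_derivative 1) (at s)"
  by (auto intro!: derivative_eq_intros simp: has_vector_derivative_def)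
 ultimately have "((%t. f (x + t *\<^sub>R i)) \<circ> (+) s \<circ> (%t. t - s) has_vector_derivative 1 *\<^sub>R d) (at s)"
  by (intro vector_diff_chain_at)
 thus ?thesis by (simp add: o_def)
qed

text \<open>Only partial derivatives are at hand, so y is moved to x one coordinate at a time. The
  path stays inside a box, as it might not inside a ball, and costs the factor
  \<open>DIM('a)\<close>.\<close>

lemma lipschitz_partial:
 fixes f :: "'a::euclidean_space => 'b::real_normed_vector"
 assumes d: "!!z i. z : cbox a b ==> i : Basis ==> has_partial i f z (D i z)"
  and M: "!!z i. z : cbox a b ==> i : Basis ==> norm (D i z) <= M"
  and xy: "x : cbox a b" "y : cbox a b"
 shows "norm (f x - f y) <= M * real DIM('a) * dist x y"
proof -
 \<comment> \<open>Coordinates of x on B and of y elsewhere: B grows from the empty set (the point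
   y) to \<open>Basis\<close> (the point x).\<close>
 define z where "z B = (\<Sum>i\<in>Basis. (if i : B then x \<bullet> i else y \<bullet> i) *\<^sub>R i)" for B
 have zi: "z B \<bullet> i = (if i : B then x \<bullet> i else y \<bullet> i)" if "i : Basis" for B i
  unfolding z_def using that by (simp add: inner_sum_left_Basis)
 have M0: "0 <= M" using M[OF xy(1) SOME_Basis] norm_ge_zero order_trans by blast
 have "norm (f (z B) - f y) <= M * (\<Sum>i\<in>B. dist x y)" if "finite B" "B <= Basis" for B
  using that
 proof (induction B rule: finite_induct)
  case empty
  have "z {} = y" by (rule euclidean_eqI) (simp add: zi)
  thus ?case by simp
 next
  case (insert i B)
  have i: "i : Basis" using insert by auto
  define h where "h = x \<bullet> i - y \<bullet> i"
  have zz: "z (insert i B) = z B + h *\<^sub>R i"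
   by (rule euclidean_eqI) (use insert i in \<open>auto simp: zi inner_add_left inner_Basis h_def\<close>)
  have inb: "z B + s *\<^sub>R i : cbox a b" if "s : closed_segment 0 h" for s
  proof -
   have "y \<bullet> i + s : closed_segment (y \<bullet> i) (x \<bullet> i)"
    using that unfolding h_def closed_segment_eq_real_ivl by (auto split: if_splits)
   hence "a \<bullet> i <= y \<bullet> i + s & y \<bullet> i + s <= b \<bullet> i"
    using xy i unfolding closed_segment_eq_real_ivl by (force simp: mem_box split: if_splits)
   thus ?thesis using xy i insert by (auto simp: mem_box inner_add_left zi inner_Basis)
  qed
  have "norm (f (z B + h *\<^sub>R i) - f (z B + 0 *\<^sub>R i)) <= M * \<bar>h\<bar>"
   by (rule line_lipschitz[where D="%s. D i (z B + s *\<^sub>R i)"])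
    (auto intro!: has_partial_line d M inb i)
  moreover have "\<bar>h\<bar> <= dist x y"
   unfolding h_def using Basis_le_norm[OF i, of "x - y"] by (simp add: dist_norm inner_diff_left)
  ultimately have "norm (f (z (insert i B)) - f (z B)) <= M * dist x y"
   unfolding zz using M0 by simp (meson mult_left_mono order_trans)
  moreover have "norm (f (z B) - f y) <= M * (\<Sum>i\<in>B. dist x y)" using insert by auto
  moreover have "norm (f (z (insert i B)) - f y) <= norm (f (z (insert i B)) - f (z B)) + norm (f (z B) - f y)"
   by (rule norm_diff_triangle_ineq[of _ "f (z B)" "f (z B)", simplified])
  ultimately show ?case using insert by (simp add: algebra_simps)
 qed
 from this[of Basis] have "norm (f (z Basis) - f y) <= M * (real DIM('a) * dist x y)" by simp
 moreover have "z Basis = x" by (rule euclidean_eqI) (simp add: zi)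
 ultimately show ?thesis by (simp add: mult.assoc)
qed

lemma in_common_cbox: "EX a b. x : cbox a b & y : cbox a (b::'a::euclidean_space)"
proof -
 have b: "bounded {x, y}" by simp
 obtain c where "{x, y} <= cbox (- c) c" using bounded_subset_cbox_symmetric[OF b] .
 thus ?thesis by (intro exI[of _ "- c"] exI[of _ c]) simp
qed

lemma lipschitz_partial_UNIV:
 fixes f :: "'a::euclidean_space => 'b::real_normed_vector"
 assumes "!!z i. i : Basis ==> has_partial i f z (D i z)" "!!z i. i : Basis ==> norm (D i z) <= M"
 shows "norm (f x - f y) <= M * real DIM('a) * dist x y"
proof -
 obtain a b where "x : cbox a b" "y : cbox a b" using in_common_cbox by blast
 thus ?thesis using assms by (intro lipschitz_partial[of a b f D M x y])
qed

section \<open>Differentiation under the integral sign\<close>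

lemma has_partial_tendsto:
 "has_partial i f x d \<longleftrightarrow> ((%t. (1 / t) *\<^sub>R (f (x + t *\<^sub>R i) - f x)) \<longlongrightarrow> d) (at 0)"
proof -
 have e: "norm ((1 / t) *\<^sub>R (f (x + t *\<^sub>R i) - f x) - d) = norm (f (x + t *\<^sub>R i) - f x - t *\<^sub>R d) / norm t"
  if "t ~= 0" for t
 proof -
  have "(1 / t) *\<^sub>R (f (x + t *\<^sub>R i) - f x) - d = (1 / t) *\<^sub>R (f (x + t *\<^sub>R i) - f x - t *\<^sub>R d)"
   using that by (simp add: algebra_simps)
  thus ?thesis by simp
 qed
 have "((%t. (1 / t) *\<^sub>R (f (x + t *\<^sub>R i) - f x)) \<longlongrightarrow> d) (at 0) \<longleftrightarrow>
  ((%t. norm ((1 / t) *\<^sub>R (f (x + t *\<^sub>R i) - f x) - d)) \<longlongrightarrow> 0) (at 0)"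
  by (subst Lim_null) (simp add: tendsto_norm_zero_iff)
 also have "\<dots> \<longleftrightarrow> ((%t. norm (f (x + t *\<^sub>R i) - f x - t *\<^sub>R d) / norm t) \<longlongrightarrow> 0) (at 0)"
  by (rule tendsto_cong) (use e in \<open>auto simp: eventually_at intro!: exI[of _ 1]\<close>)
 also have "\<dots> \<longleftrightarrow> has_partial i f x d"
  unfolding has_partial_def has_vector_derivative_def has_derivative_at
  by (simp add: bounded_linear_scaleR_left)
 finally show ?thesis by simp
qed

text \<open>The mean value inequality bounds every difference quotient by w, so dominated
  convergence applies along each sequence t -> 0. Integrability of the derivative is part of the
  conclusion, which makes the lemma iterable.\<close>

lemma has_partial_integral:
 fixes k :: "'z => 'a::euclidean_space => 'b::{banach, second_countable_topology}"
 assumes "open U" "x : U" and i: "i : Basis"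
  and int: "!!y. y : U ==> integrable M (%z. k z y)"
  and der: "!!z y. z : space M ==> y : U ==> has_partial i (k z) y (k' z y)"
  and bd: "!!z y. z : space M ==> y : U ==> norm (k' z y) <= w z"
  and w: "integrable M w"
 shows "has_partial i (%y. \<integral>z. k z y \<partial>M) x (\<integral>z. k' z x \<partial>M)" "integrable M (%z. k' z x)"
proof -
 obtain \<delta> where \<delta>: "0 < \<delta>" "ball x \<delta> <= U" using assms(1,2) openE by blast
 have inU: "x + t *\<^sub>R i : U" if "\<bar>t\<bar> < \<delta>" for t
  using \<delta> that i by (auto intro!: subsetD[OF \<delta>(2)] simp: dist_norm)
 have lip: "norm ((1 / t) *\<^sub>R (k z (x + t *\<^sub>R i) - k z x)) <= w z" if "\<bar>t\<bar> < \<delta>" "t ~= 0" "z : space M" for t z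
 proof -
  have s: "\<bar>s\<bar> < \<delta>" if "s : closed_segment 0 t" for s
   using that \<open>\<bar>t\<bar> < \<delta>\<close> by (auto simp: closed_segment_eq_real_ivl split: if_splits)
  have "norm (k z (x + t *\<^sub>R i) - k z (x + 0 *\<^sub>R i)) <= w z * \<bar>t\<bar>"
   by (rule line_lipschitz[where D="%s. k' z (x + s *\<^sub>R i)"])
    (use that s in \<open>auto intro!: has_partial_line der bd inU\<close>)
  hence "norm (k z (x + t *\<^sub>R i) - k z x) / \<bar>t\<bar> <= w z" using that by (simp add: field_simps)
  thus ?thesis unfolding norm_scaleR by simp
 qed
 have seq: "(%n. \<integral>z. (1 / X n) *\<^sub>R (k z (x + X n *\<^sub>R i) - k z x) \<partial>M) \<longlonglongrightarrow> (\<integral>z. k' z x \<partial>M) &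
   integrable M (%z. k' z x)"
  if X: "!!n. \<bar>X n\<bar> < \<delta>" "!!n. X n ~= 0" "X \<longlonglongrightarrow> 0" for X
 proof -
  have lim: "(%n. (1 / X n) *\<^sub>R (k z (x + X n *\<^sub>R i) - k z x)) \<longlonglongrightarrow> k' z x" if "z : space M" for z
  proof -
   have "filterlim X (at 0) sequentially" using X by (auto simp: filterlim_at)
   moreover have "((%t. (1 / t) *\<^sub>R (k z (x + t *\<^sub>R i) - k z x)) \<longlongrightarrow> k' z x) (at 0)"
    using der[OF that assms(2)] by (simp add: has_partial_tendsto)
   ultimately show ?thesis by (rule filterlim_compose[rotated])
  qed
  have m: "(%z. (1 / X n) *\<^sub>R (k z (x + X n *\<^sub>R i) - k z x)) : borel_measurable M" for n
   using int[OF inU[OF X(1)]] int[OF assms(2)]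
   by (intro borel_measurable_scaleR borel_measurable_diff borel_measurable_const borel_measurable_integrable)
  \<comment> \<open>Measurability of \<open>k'\<close> comes for free, as a pointwise limit of
    measurable difference quotients.\<close>
  have mk: "(%z. k' z x) : borel_measurable M"
   by (rule borel_measurable_LIMSEQ_metric[OF m lim])
  have l: "AE z in M. (%n. (1 / X n) *\<^sub>R (k z (x + X n *\<^sub>R i) - k z x)) \<longlonglongrightarrow> k' z x"
   using lim by simp
  have b: "AE z in M. norm ((1 / X n) *\<^sub>R (k z (x + X n *\<^sub>R i) - k z x)) <= w z" for n
   using lip[OF X(1,2)] by (intro AE_I2)
  show ?thesis
   using integral_dominated_convergence[OF mk m w l b] integrable_dominated_convergence[OF mk m w l b] by blast
 qed
 \<comment> \<open>One explicit null sequence inside the radius, enough to extract integrability of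
   \<open>k'\<close> at x.\<close>
 have X0: "\<bar>\<delta> / 2 ^ Suc n\<bar> < \<delta>" for n
 proof -
  have "1 < (2::real) ^ Suc n" by (rule one_less_power) auto
  thus ?thesis using \<delta>(1) by (simp add: field_simps del: power_Suc)
 qed
 have "(%n. \<delta> * inverse (2 ^ Suc n)) \<longlonglongrightarrow> \<delta> * 0"
  by (intro tendsto_mult tendsto_const LIMSEQ_Suc LIMSEQ_inverse_realpow_zero) simp
 hence X1: "(%n. \<delta> / 2 ^ Suc n) \<longlonglongrightarrow> 0" by (simp only: divide_inverse mult_zero_right)
 have X2: "\<delta> / 2 ^ Suc n ~= 0" for n using \<delta>(1) by simp
 show "integrable M (%z. k' z x)"
  by (rule conjunct2[OF seq[OF X0 X2 X1]])
 show "has_partial i (%y. \<integral>z. k z y \<partial>M) x (\<integral>z. k' z x \<partial>M)"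
  unfolding has_partial_tendsto
 proof -
  have a: "at 0 within ball 0 \<delta> = at (0::real)"
   by (rule at_within_open) (use \<delta>(1) in simp_all)
  have "((%t. (1 / t) *\<^sub>R ((\<integral>z. k z (x + t *\<^sub>R i) \<partial>M) - (\<integral>z. k z x \<partial>M))) \<longlongrightarrow> (\<integral>z. k' z x \<partial>M)) (at 0 within ball 0 \<delta>)"
   unfolding tendsto_at_iff_sequentially
  proof (intro allI impI)
   fix X :: "nat => real" assume X: "ALL n. X n : ball 0 \<delta> - {0}" "X \<longlonglongrightarrow> 0"
   hence X': "\<bar>X n\<bar> < \<delta>" "X n ~= 0" for n by auto
   have "(1 / X n) *\<^sub>R ((\<integral>z. k z (x + X n *\<^sub>R i) \<partial>M) - (\<integral>z. k z x \<partial>M)) =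
     (\<integral>z. (1 / X n) *\<^sub>R (k z (x + X n *\<^sub>R i) - k z x) \<partial>M)" for n
    using int[OF inU[OF X'(1)]] int[OF assms(2)] by simp
   thus "((%t. (1 / t) *\<^sub>R ((\<integral>z. k z (x + t *\<^sub>R i) \<partial>M) - (\<integral>z. k z x \<partial>M))) \<circ> X) \<longlonglongrightarrow> (\<integral>z. k' z x \<partial>M)"
    using seq[of X] X' X(2) by (simp add: o_def)
  qed
  thus "((%t. (1 / t) *\<^sub>R ((\<integral>z. k z (x + t *\<^sub>R i) \<partial>M) - (\<integral>z. k z x \<partial>M))) \<longlongrightarrow> (\<integral>z. k' z x \<partial>M)) (at 0)"
   unfolding a .
 qed
qed

lemma continuous_on_integral_dom:
 fixes k :: "'z => 'a::euclidean_space => 'b::{banach, second_countable_topology}"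
 assumes "open \<Omega>"
  and meas: "!!x. x : \<Omega> ==> (%z. k z x) : borel_measurable M"
  and cont: "!!z. z : space M ==> continuous_on \<Omega> (k z)"
  and dom: "!!x0. x0 : \<Omega> ==> EX U w. open U & x0 : U & U <= \<Omega> & integrable M w &
    (ALL z:space M. ALL x:U. norm (k z x) <= w z)"
 shows "continuous_on \<Omega> (%x. \<integral>z. k z x \<partial>M)"
proof (rule continuous_at_imp_continuous_on, intro ballI)
 fix x0 assume x0: "x0 : \<Omega>"
 obtain U w where U: "open U" "x0 : U" "U <= \<Omega>" "integrable M w" "!!z x. z : space M ==> x : U ==> norm (k z x) <= w z"
  using dom[OF x0] by blast
 have "((%x. \<integral>z. k z x \<partial>M) \<longlongrightarrow> (\<integral>z. k z x0 \<partial>M)) (at x0 within U)"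
  unfolding tendsto_at_iff_sequentially
 proof (intro allI impI)
  fix X assume X: "ALL n. X n : U - {x0}" "X \<longlonglongrightarrow> x0"
  have X\<Omega>: "X n : \<Omega>" for n using X(1) U(3) by blast
  show "((%x. \<integral>z. k z x \<partial>M) \<circ> X) \<longlonglongrightarrow> (\<integral>z. k z x0 \<partial>M)" unfolding o_def
  proof (rule integral_dominated_convergence[OF _ _ U(4)])
   show "AE z in M. (%n. k z (X n)) \<longlonglongrightarrow> k z x0"
   proof (rule AE_I2)
    fix z assume z: "z : space M"
    have "isCont (k z) x0" using cont[OF z] x0 assms(1) by (simp add: continuous_on_eq_continuous_at)
    thus "(%n. k z (X n)) \<longlonglongrightarrow> k z x0" using X(2) by (rule isCont_tendsto_compose)
   qed
  qed (use X U meas[OF X\<Omega>] meas x0 in auto)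
 qed
 thus "isCont (%x. \<integral>z. k z x \<partial>M) x0"
  unfolding isCont_def using at_within_open[OF U(2,1)] by simp
qed

text \<open>The dominating function may depend on the multi-index and on the neighbourhood; the
  latter matters when a weight dominates only for base points in a bounded set.\<close>

lemma Ck_on_integral:
 fixes k :: "'z => 'a::euclidean_space => 'b::{banach, second_countable_topology}"
 assumes "open \<Omega>"
  and "!!x. x : \<Omega> ==> (%z. k z x) : borel_measurable M"
  and "!!z. z : space M ==> Ck_on N \<Omega> (k z)"
  and "!!is x0. set is <= Basis ==> length is <= N ==> x0 : \<Omega> ==>
    EX U w. open U & x0 : U & U <= \<Omega> & integrable M w & (ALL z:space M. ALL x:U. norm (dpart is (k z) x) <= w z)"
 shows "Ck_on N \<Omega> (%x. \<integral>z. k z x \<partial>M)"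
  and "set is <= Basis ==> length is <= N ==> x : \<Omega> ==>
    integrable M (%z. dpart is (k z) x) & dpart is (%x. \<integral>z. k z x \<partial>M) x = (\<integral>z. dpart is (k z) x \<partial>M)"
proof -
 have "Ck_on N \<Omega> (%x. \<integral>z. k z x \<partial>M) & (ALL is x. set is <= Basis --> length is <= N --> x : \<Omega> -->
    integrable M (%z. dpart is (k z) x) & dpart is (%x. \<integral>z. k z x \<partial>M) x = (\<integral>z. dpart is (k z) x \<partial>M))"
  using assms(2-)
 proof (induction N arbitrary: k)
  case 0
  have "integrable M (%z. k z x)" if x: "x : \<Omega>" for x
  proof -
   obtain U w where "x : U" "integrable M w" "!!z x. z : space M ==> x : U ==> norm (k z x) <= w z"
    using 0(3)[of "[]" x] x by auto
   thus ?thesis using 0(1)[OF x] by (intro integrable_dom[of M w "%z. k z x"]) (auto intro!: AE_I2 order_trans[OF _ abs_ge_self])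
  qed
  moreover have "continuous_on \<Omega> (%x. \<integral>z. k z x \<partial>M)"
   using 0(3)[of "[]"] 0(2) by (intro continuous_on_integral_dom assms(1) 0(1)) simp_all
  ultimately show ?case by simp
 next
  case (Suc N)
  have int: "integrable M (%z. k z x)" if x: "x : \<Omega>" for x
  proof -
   obtain U w where "x : U" "integrable M w" "!!z x. z : space M ==> x : U ==> norm (k z x) <= w z"
    using Suc.prems(3)[of "[]" x] x by auto
   thus ?thesis using Suc.prems(1)[OF x] by (intro integrable_dom[of M w "%z. k z x"]) (auto intro!: AE_I2 order_trans[OF _ abs_ge_self])
  qed
  have cont: "continuous_on \<Omega> (%x. \<integral>z. k z x \<partial>M)"
   using Suc.prems(3)[of "[]"] Suc.prems(2)
   by (intro continuous_on_integral_dom assms(1) Suc.prems(1)) (simp_all add: Ck_on_Suc)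
  have step: "has_partial i (%x. \<integral>z. k z x \<partial>M) x (\<integral>z. partial i (k z) x \<partial>M) & integrable M (%z. partial i (k z) x)"
   if i: "i : Basis" and x: "x : \<Omega>" for i x
  proof -
   obtain U w where U: "open U" "x : U" "U <= \<Omega>" "integrable M w" "!!z x. z : space M ==> x : U ==> norm (partial i (k z) x) <= w z"
    using Suc.prems(3)[of "[i]" x] x i by auto
   have "has_partial i (k z) y (partial i (k z) y)" if "z : space M" "y : U" for z y
    using Suc.prems(2)[OF that(1)] that(2) U(3) i by (auto simp: Ck_on_Suc)
   thus ?thesis using has_partial_integral[of U x i M k "%z. partial i (k z)" w] U i int by blast
  qed
  have IH: "Ck_on N \<Omega> (%x. \<integral>z. partial i (k z) x \<partial>M) & (ALL is x. set is <= Basis --> length is <= N --> x : \<Omega> -->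
    integrable M (%z. dpart is (partial i (k z)) x) & dpart is (%x. \<integral>z. partial i (k z) x \<partial>M) x = (\<integral>z. dpart is (partial i (k z)) x \<partial>M))"
   if i: "i : Basis" for i
  proof (rule Suc.IH)
   show "(%z. partial i (k z) x) : borel_measurable M" if "x : \<Omega>" for x
    using step[OF i that] by auto
   show "Ck_on N \<Omega> (partial i (k z))" if "z : space M" for z
    using Suc.prems(2)[OF that] i by (simp add: Ck_on_Suc)
   show "EX U w. open U & x0 : U & U <= \<Omega> & integrable M w & (ALL z:space M. ALL x:U. norm (dpart is (partial i (k z)) x) <= w z)"
    if "set is <= Basis" "length is <= N" "x0 : \<Omega>" for "is" x0
    using Suc.prems(3)[of "is @ [i]" x0] that i by (simp add: dpart_append)
  qed
  show ?case
  proof (intro conjI allI impI)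
   show "Ck_on (Suc N) \<Omega> (%x. \<integral>z. k z x \<partial>M)"
   proof (intro Ck_on_SucI assms(1) cont)
    fix i :: 'a assume "i : Basis"
    thus "EX f'. (ALL x:\<Omega>. has_partial i (%x. \<integral>z. k z x \<partial>M) x (f' x)) & Ck_on N \<Omega> f'"
     using step IH by (intro exI[of _ "%x. \<integral>z. partial i (k z) x \<partial>M"]) auto
   qed
  next
   fix "is" :: "'a list" and x assume h: "set is <= Basis" "length is <= Suc N" "x : \<Omega>"
   have "integrable M (%z. dpart is (k z) x) & dpart is (%x. \<integral>z. k z x \<partial>M) x = (\<integral>z. dpart is (k z) x \<partial>M)"
   proof (cases "is" rule: rev_cases)
    case Nil thus ?thesis using int h by simp
   next
    case (snoc js i)
    have i: "i : Basis" "set js <= Basis" "length js <= N" using h snoc by auto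
    have "dpart is (%x. \<integral>z. k z x \<partial>M) x = dpart js (partial i (%x. \<integral>z. k z x \<partial>M)) x"
     by (simp add: snoc dpart_append)
    also have "\<dots> = dpart js (%x. \<integral>z. partial i (k z) x \<partial>M) x"
     by (rule dpart_cong[OF assms(1) _ h(3)]) (use step[OF i(1)] has_partial_imp in blast)
    finally show ?thesis using IH[OF i(1)] i h(3) by (simp add: snoc dpart_append)
   qed
   thus "integrable M (%z. dpart is (k z) x)" "dpart is (%x. \<integral>z. k z x \<partial>M) x = (\<integral>z. dpart is (k z) x \<partial>M)"
    by auto
  qed
 qed
 thus "Ck_on N \<Omega> (%x. \<integral>z. k z x \<partial>M)"
  and "set is <= Basis ==> length is <= N ==> x : \<Omega> ==>
    integrable M (%z. dpart is (k z) x) & dpart is (%x. \<integral>z. k z x \<partial>M) x = (\<integral>z. dpart is (k z) x \<partial>M)"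
  by blast+
qed

section \<open>Gaussian integrals and the heat kernel\<close>

lemma nn_integral_lborel_affine:
 fixes f :: "'a::euclidean_space => ennreal"
 assumes [measurable]: "f : bmeas" and c: "c ~= 0"
 shows "(\<integral>\<^sup>+x. f x \<partial>lborel) = ennreal (\<bar>c\<bar> ^ DIM('a)) * (\<integral>\<^sup>+x. f (t + c *\<^sub>R x) \<partial>lborel)"
 by (subst lborel_affine[OF c, of t])
   (simp add: nn_integral_density nn_integral_distr nn_integral_cmult ennreal_power)

lemma integrable_lborel_affine:
 fixes f :: "'a::euclidean_space => 'b :: {banach, second_countable_topology}"
 assumes f: "Lint f" and c: "c ~= 0"
 shows "Lint (%x. f (t + c *\<^sub>R x))"
proof -
 have [measurable]: "f : bmeas" using f by auto
 have "(\<integral>\<^sup>+x. norm (f x) \<partial>lborel) = ennreal (\<bar>c\<bar> ^ DIM('a)) * (\<integral>\<^sup>+x. norm (f (t + c *\<^sub>R x)) \<partial>lborel)"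
  by (rule nn_integral_lborel_affine[OF _ c]) measurable
 thus ?thesis using f c unfolding integrable_iff_bounded
  by (auto simp: ennreal_mult_less_top)
qed

lemma integral_lborel_affine:
 fixes f :: "'a::euclidean_space => 'b :: {banach, second_countable_topology}"
 assumes f: "Lint f" and c: "c ~= 0"
 shows "(LBINT x. f x) = \<bar>c\<bar> ^ DIM('a) *\<^sub>R (LBINT x. f (t + c *\<^sub>R x))"
 using c f f[THEN borel_measurable_integrable] integrable_lborel_affine[OF f c, of t]
 by (subst lborel_affine[OF c, of t])
   (simp add: integral_density integral_distr)

lemma integrable_lborel_translate:
 fixes f :: "'a::euclidean_space => 'b :: {banach, second_countable_topology}"
 assumes "Lint f"
 shows "Lint (%x. f (x - a))" "Lint (%x. f (a - x))"
 using integrable_lborel_affine[OF assms, of 1 "- a"] integrable_lborel_affine[OF assms, of "- 1" a] by simp_all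

lemma integral_lborel_translate:
 fixes f :: "'a::euclidean_space => 'b :: {banach, second_countable_topology}"
 assumes "Lint f"
 shows "(LBINT x. f (x - a)) = (LBINT x. f x)" "(LBINT x. f (a - x)) = (LBINT x. f x)"
 using integral_lborel_affine[OF assms, of 1 "- a"] integral_lborel_affine[OF assms, of "- 1" a] by simp_all

text \<open>\<open>lborel\<close> on a Euclidean space is the image of a product of one-dimensional
  measures under the coordinate map, so Fubini for finite products applies.\<close>

lemma
 fixes f :: "'a::euclidean_space => real => 'b::{real_normed_field, banach, second_countable_topology}"
 assumes f: "!!b. b : Basis ==> Lint (f b)"
 shows integrable_lborel_prod: "Lint (%x. \<Prod>b\<in>Basis. f b (x \<bullet> b))"
  and integral_lborel_prod: "(LBINT x. (\<Prod>b\<in>Basis. f b (x \<bullet> b))) = (\<Prod>b\<in>Basis. LBINT y. f b y)"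
proof -
 interpret product_sigma_finite "%_::'a. lborel :: real measure"
  by standard
 have m[measurable]: "f b : bmeas" if "b : Basis" for b using f[OF that] by auto
 have mp: "(%x. \<Prod>b\<in>Basis. f b (x \<bullet> b)) : bmeas"
  by (intro borel_measurable_prod measurable_compose[OF _ m]) simp_all
 have mm: "(%g. \<Sum>b\<in>Basis. g b *\<^sub>R b) : measurable (\<Pi>\<^sub>M b\<in>Basis. lborel) (borel :: 'a measure)"
  by measurable
 have e: "(\<Prod>b\<in>Basis. f b ((\<Sum>b\<in>Basis. g b *\<^sub>R b) \<bullet> b)) = (\<Prod>b\<in>Basis. f b (g b))" for g
  by (intro prod.cong) auto
 have "integrable (distr (\<Pi>\<^sub>M b\<in>Basis. lborel) borel (%g. \<Sum>b\<in>Basis. g b *\<^sub>R b)) (%x::'a. \<Prod>b\<in>Basis. f b (x \<bullet> b))"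
  unfolding integrable_distr_eq[OF mm mp] e by (rule product_integrable_prod) (use f in auto)
 thus "Lint (%x. \<Prod>b\<in>Basis. f b (x \<bullet> b))"
  unfolding lborel_eq[where 'a='a] .
 have "(\<integral>x. (\<Prod>b\<in>Basis. f b (x \<bullet> b)) \<partial>distr (\<Pi>\<^sub>M b\<in>Basis. lborel) borel (%g. \<Sum>b\<in>Basis. g b *\<^sub>R b)) = (\<Prod>b\<in>(Basis::'a set). LBINT y. f b y)"
  unfolding integral_distr[OF mm mp] e by (rule product_integral_prod) (use f in auto)
 thus "(LBINT x. (\<Prod>b\<in>Basis. f b (x \<bullet> b))) = (\<Prod>b\<in>Basis. LBINT y. f b y)"
  unfolding lborel_eq[where 'a='a] .
qed

lemma integrable_inverse_one_plus_square: "Lint (%y::real. 1 / (1 + y\<^sup>2))"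
 using integrable_inverse_1_plus_square unfolding set_integrable_def
 by (simp add: inverse_eq_divide)

text \<open>Each factor 1 + x_b^2 is at most 1 + |x|^2, so the radial decay is dominated by a
  product of one-dimensional functions 1 / (1 + y^2), and polar coordinates are avoided. The
  exponent \<open>DIM('a)\<close> counts the factors.\<close>

lemma integrable_one_plus_norm_power:
 assumes "N >= DIM('a::euclidean_space)"
 shows "Lint (%x::'a. 1 / (1 + sq x) ^ N)"
proof (rule integrable_dom)
 show "Lint (%x::'a. \<Prod>b\<in>Basis. 1 / (1 + (x \<bullet> b)\<^sup>2))"
  by (rule integrable_lborel_prod[of "%_ y. 1 / (1 + y\<^sup>2)"]) (rule integrable_inverse_one_plus_square)
 show "AE x::'a in lborel. norm (1 / (1 + sq x) ^ N) <= norm (\<Prod>b\<in>Basis. 1 / (1 + (x \<bullet> b)\<^sup>2))"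
 proof (intro AE_I2)
  fix x :: 'a
  have "(\<Prod>b\<in>Basis. 1 + (x \<bullet> b)\<^sup>2) <= (\<Prod>b\<in>(Basis::'a set). 1 + sq x)"
  proof (intro prod_mono conjI)
   fix b :: 'a assume b: "b : Basis"
   have "(x \<bullet> b)\<^sup>2 <= (norm x)\<^sup>2" using Basis_le_norm[OF b, of x] by (simp add: abs_le_square_iff[symmetric])
   thus "1 + (x \<bullet> b)\<^sup>2 <= 1 + sq x" by (simp add: power2_norm_eq_inner)
  qed (simp add: add_nonneg_nonneg)
  also have "\<dots> = (1 + sq x) ^ DIM('a)" by simp
  also have "\<dots> <= (1 + sq x) ^ N" using assms by (intro power_increasing) auto
  finally have "(\<Prod>b\<in>Basis. 1 + (x \<bullet> b)\<^sup>2) <= (1 + sq x) ^ N" .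
  moreover have "0 < (\<Prod>b\<in>Basis. 1 + (x \<bullet> b)\<^sup>2)" by (intro prod_pos) (auto intro: add_pos_nonneg)
  ultimately have "1 / (1 + sq x) ^ N <= (\<Prod>b\<in>Basis. 1 / (1 + (x \<bullet> b)\<^sup>2))"
   by (simp add: prod_dividef frac_le)
  thus "norm (1 / (1 + sq x) ^ N) <= norm (\<Prod>b\<in>Basis. 1 / (1 + (x \<bullet> b)\<^sup>2))"
   by (simp add: abs_prod[symmetric]) 
 qed
qed simp

text \<open>A rescaled form of the characteristic function of the standard normal distribution; the
  scale s with s^2 = 2 t turns y^2 / 2 into t y^2.\<close>

lemma gauss_fourier_1:
 assumes "t > 0"
 shows "Lint (%y::real. exp (\<i> * cor (a * y) - cor (t * y\<^sup>2)))"
  and "(LBINT y. exp (\<i> * cor (a * y) - cor (t * y\<^sup>2))) =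
    cor (sqrt (pi / t) * exp (- a\<^sup>2 / (4 * t)))"
proof -
 define s where "s = sqrt (2 * t)"
 have s: "s > 0" "s\<^sup>2 = 2 * t" using assms by (simp_all add: s_def)
 define f where "f y = cor (exp (- y\<^sup>2 / 2)) * exp (\<i> * cor (a / s * y))" for y
 have sd: "std_normal_density y *\<^sub>R exp (\<i> * cor (b * y)) = (1 / sqrt (2 * pi)) *\<^sub>R (cor (exp (- y\<^sup>2 / 2)) * exp (\<i> * cor (b * y)))" for b y
  by (simp add: std_normal_density_def scaleR_conv_of_real)
 have int0: "Lint (%y. std_normal_density y *\<^sub>R exp (\<i> * cor (b * y)))" for b
 proof (rule integrable_dom)
  show "Lint std_normal_density" by simp
  show "AE y in lborel. norm (std_normal_density y *\<^sub>R exp (\<i> * cor (b * y))) <= norm (std_normal_density y)"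
   by (intro AE_I2) simp
 qed simp
 have "Lint (%y. sqrt (2 * pi) *\<^sub>R (std_normal_density y *\<^sub>R exp (\<i> * cor (a / s * y))))"
  using int0[of "a / s"] by (intro integrable_scaleR_right) auto
 hence intf: "Lint f" unfolding sd f_def by simp
 have "(LBINT y. std_normal_density y *\<^sub>R exp (\<i> * cor (a / s * y))) = cor (exp (- (a / s)\<^sup>2 / 2))"
  using fun_cong[OF char_std_normal_distribution, of "a / s"] unfolding char_def
  by (subst (asm) integral_density) simp_all
 hence "sqrt (2 * pi) *\<^sub>R (1 / sqrt (2 * pi)) *\<^sub>R (LBINT y. f y) = sqrt (2 * pi) *\<^sub>R cor (exp (- (a / s)\<^sup>2 / 2))"
  unfolding sd f_def[symmetric] by simp
 hence If: "(LBINT y. f y) = sqrt (2 * pi) *\<^sub>R cor (exp (- (a / s)\<^sup>2 / 2))" by simp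
 have e: "f (0 + s *\<^sub>R y) = exp (\<i> * cor (a * y) - cor (t * y\<^sup>2))" for y
  using s by (simp add: f_def exp_diff power_mult_distrib exp_of_real[symmetric] exp_minus field_simps)
 show "Lint (%y::real. exp (\<i> * cor (a * y) - cor (t * y\<^sup>2)))"
  using integrable_lborel_affine[OF intf, of s 0] s unfolding e by simp
 have "(LBINT y. f y) = s *\<^sub>R (LBINT y. exp (\<i> * cor (a * y) - cor (t * y\<^sup>2)))"
  using integral_lborel_affine[OF intf, of s 0] s unfolding e by simp
 hence "(LBINT y. exp (\<i> * cor (a * y) - cor (t * y\<^sup>2))) = (1 / s) *\<^sub>R sqrt (2 * pi) *\<^sub>R cor (exp (- (a / s)\<^sup>2 / 2))"
  using If s by (simp add: field_simps)
 also have "\<dots> = cor ((sqrt (2 * pi) / s) * exp (- (a / s)\<^sup>2 / 2))" by (simp add: scaleR_conv_of_real)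
 also have "sqrt (2 * pi) / s = sqrt (pi / t)" unfolding s_def by (simp add: real_sqrt_divide[symmetric])
 also have "- (a / s)\<^sup>2 / 2 = - a\<^sup>2 / (4 * t)" using s by (simp add: power_divide)
 finally show "(LBINT y. exp (\<i> * cor (a * y) - cor (t * y\<^sup>2))) =
    cor (sqrt (pi / t) * exp (- a\<^sup>2 / (4 * t)))" .
qed

lemma gauss_fourier:
 fixes x :: "'a::euclidean_space"
 assumes "t > 0"
 shows "Lint (%\<xi>. cis (x \<bullet> \<xi>) * cor (exp (- t * (sq \<xi>))))"
  and "(LBINT \<xi>. cis (x \<bullet> \<xi>) * cor (exp (- t * (sq \<xi>)))) =
    cor (sqrt (pi / t) ^ DIM('a) * exp (- (sq x) / (4 * t)))"
proof -
 have e: "cis (x \<bullet> \<xi>) * cor (exp (- t * (sq \<xi>))) =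
   (\<Prod>b\<in>Basis. exp (\<i> * cor ((x \<bullet> b) * (\<xi> \<bullet> b)) - cor (t * (\<xi> \<bullet> b)\<^sup>2)))" for \<xi>
 proof -
  have "x \<bullet> \<xi> = (\<Sum>b\<in>Basis. (x \<bullet> b) * (\<xi> \<bullet> b))" by (rule euclidean_inner)
  moreover have "sq \<xi> = (\<Sum>b\<in>Basis. (\<xi> \<bullet> b)\<^sup>2)" by (subst euclidean_inner) (simp add: power2_eq_square)
  ultimately show ?thesis
   unfolding cis_conv_exp exp_of_real[symmetric] exp_add[symmetric] exp_sum[OF finite_Basis, symmetric]
   by (simp add: sum_subtractf sum_distrib_left sum_negf)
 qed
 show "Lint (%\<xi>. cis (x \<bullet> \<xi>) * cor (exp (- t * (sq \<xi>))))"
  unfolding e by (rule integrable_lborel_prod) (rule gauss_fourier_1[OF assms])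
 have "(LBINT \<xi>. cis (x \<bullet> \<xi>) * cor (exp (- t * (sq \<xi>)))) =
  (\<Prod>b\<in>(Basis::'a set). cor (sqrt (pi / t) * exp (- (x \<bullet> b)\<^sup>2 / (4 * t))))"
  unfolding e by (subst integral_lborel_prod) (simp_all only: gauss_fourier_1[OF assms])
 also have "\<dots> = cor (sqrt (pi / t) ^ DIM('a) * exp (\<Sum>b\<in>Basis. - (x \<bullet> b)\<^sup>2 / (4 * t)))"
  by (simp add: prod.distrib exp_sum)
 also have "(\<Sum>b\<in>Basis. - (x \<bullet> b)\<^sup>2 / (4 * t)) = - (sq x) / (4 * t)"
 proof -
  have "sq x = (\<Sum>b\<in>Basis. (x \<bullet> b)\<^sup>2)" by (subst euclidean_inner) (simp add: power2_eq_square)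
  thus ?thesis by (simp add: sum_negf sum_divide_distrib)
 qed
 finally show "(LBINT \<xi>. cis (x \<bullet> \<xi>) * cor (exp (- t * (sq \<xi>)))) =
    cor (sqrt (pi / t) ^ DIM('a) * exp (- (sq x) / (4 * t)))" .
qed

text \<open>The elementary bound (1 + x/N)^N <= e^x at x = z/4; N = 0 is separate because of the
  division by N.\<close>

lemma exp_one_plus_power_bounded: "EX C. ALL z>=0. exp (- z / 4) * (1 + z) ^ N <= (C::real)"
proof (cases "N = 0")
 case True thus ?thesis by (intro exI[of _ 1]) auto
next
 case False
 show ?thesis
 proof (intro exI allI impI)
  fix z :: real assume z: "z >= 0"
  have "(1 + z) ^ N <= (4 * real N * (1 + (z / 4) / real N)) ^ N"
   using False z by (intro power_mono) (auto simp: field_simps)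
  also have "\<dots> = (4 * real N) ^ N * (1 + (z / 4) / real N) ^ N" by (rule power_mult_distrib)
  also have "\<dots> <= (4 * real N) ^ N * exp (z / 4)"
   using False z by (intro mult_left_mono exp_ge_one_plus_x_over_n_power_n) auto
  finally show "exp (- z / 4) * (1 + z) ^ N <= (4 * real N) ^ N"
   by (simp add: exp_minus field_simps)
 qed
qed

section \<open>Polynomials times a Gaussian\<close>

text \<open>The class is described by generators so that closure under partial derivatives and rapid
  decay follow by rule induction, with no normal form for the polynomial factor. The constant 1/4 is
  that of the heat kernel at time 1.\<close>

inductive PG :: "('a::euclidean_space => real) => bool" where
 base: "PG (%x. exp (- (sq x) / 4))"
| inner: "i : Basis ==> PG h ==> PG (%x. (x \<bullet> i) * h x)"
| add: "PG h ==> PG h' ==> PG (%x. h x + h' x)"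
| cmult: "PG h ==> PG (%x. c * h x)"

lemma PG_partial: "PG h ==> i : Basis ==> PG (partial i h) & (ALL x. has_partial i h x (partial i h x))"
proof -
 assume "PG h" and i: "i : Basis"
 from \<open>PG h\<close> have "EX h'. PG h' & (ALL x. has_partial i h x (h' x))"
 proof induction
  case base
  have q: "has_partial i (%x. - (sq x) / 4) x (- (x \<bullet> i) / 2)" for x :: 'a
   unfolding has_partial_def has_vector_derivative_def
   by (auto intro!: derivative_eq_intros simp: inner_commute algebra_simps)
  have e: "(- 1 / 2) * (c * exp a) = exp a * (- c / 2)" for a c :: real by simp
  have "has_partial i (%x. exp (- (sq x) / 4)) x ((- 1 / 2) * ((x \<bullet> i) * exp (- (sq x) / 4)))" for x :: 'a
   unfolding e by (rule has_partial_compose[OF q]) (rule DERIV_exp)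
  thus ?case
   by (intro exI[of _ "%x. (- 1 / 2) * ((x \<bullet> i) * exp (- (sq x) / 4))"] conjI allI PG.cmult PG.inner[OF i] PG.base)
 next
  case (inner j h)
  then obtain h' where h': "PG h'" "!!x. has_partial i h x (h' x)" by blast
  have "has_partial i (%x. (x \<bullet> j) * h x) x ((x \<bullet> j) * h' x + (i \<bullet> j) * h x)" for x
   by (intro has_partial_mult has_partial_inner h')
  thus ?case using inner h' by (intro exI[of _ "%x. (x \<bullet> j) * h' x + (i \<bullet> j) * h x"]) (auto intro!: PG.intros)
 next
  case (add h1 h2)
  then obtain h1' h2' where h': "PG h1'" "!!x. has_partial i h1 x (h1' x)" "PG h2'" "!!x. has_partial i h2 x (h2' x)" by blast
  thus ?case by (intro exI[of _ "%x. h1' x + h2' x"]) (auto intro!: PG.intros has_partial_add)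
 next
  case (cmult h c)
  then obtain h' where h': "PG h'" "!!x. has_partial i h x (h' x)" by blast
  thus ?case by (intro exI[of _ "%x. c * h' x"]) (auto intro!: PG.intros has_partial_linear[OF bounded_linear_mult_right])
 qed
 then obtain h' where h': "PG h'" "!!x. has_partial i h x (h' x)" by blast
 hence "partial i h = h'" using has_partial_imp by blast
 thus ?thesis using h' by auto
qed

lemma PG_dpart: "PG h ==> set is <= Basis ==> PG (dpart is h)"
 by (induction "is") (auto simp: PG_partial)

lemma PG_continuous: "PG h ==> continuous_on UNIV h"
 by (induction rule: PG.induct) (auto intro!: continuous_intros)

lemma PG_Ck: "PG h ==> Ck_on k UNIV h"
 by (induction k arbitrary: h) (auto simp: Ck_on_Suc PG_continuous PG_partial)

lemma PG_bound: "PG h ==> EX C>=0. ALL x. \<bar>h x\<bar> * (1 + sq x) ^ N <= C"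
proof (induction arbitrary: N rule: PG.induct)
 case base
 obtain C where "ALL z>=0. exp (- z / 4 :: real) * (1 + z) ^ N <= C" using exp_one_plus_power_bounded[of N] by (elim exE)
 hence C: "exp (- z / 4) * (1 + z) ^ N <= C" if "z >= 0" for z using that by simp
 have "0 <= C" using C[of 0] by simp
 moreover have "\<bar>exp (- (sq x) / 4)\<bar> * (1 + sq x) ^ N <= C" for x :: 'a using C[of "sq x"] by simp
 ultimately show ?case by (intro exI[of _ C] conjI allI)
next
 case (inner i h)
 \<comment> \<open>Multiplication by a coordinate costs one power of 1 + |x|^2, so the induction
   hypothesis is taken at \<open>Suc N\<close>.\<close>
 obtain C where C: "C >= 0" "!!x. \<bar>h x\<bar> * (1 + sq x) ^ Suc N <= C" using inner.IH by blast
 have "\<bar>(x \<bullet> i) * h x\<bar> * (1 + sq x) ^ N <= C" for x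
 proof -
  have "\<bar>x \<bullet> i\<bar> <= norm x" using Basis_le_norm[OF inner.hyps(1)] by simp
  also have "\<dots> <= 1 + sq x" unfolding power2_norm_eq_inner[symmetric]
   using sum_power2_ge_zero[of "norm x - 1/2" 0] by (simp add: power2_eq_square algebra_simps)
  finally have "\<bar>x \<bullet> i\<bar> * (\<bar>h x\<bar> * (1 + sq x) ^ N) <= (1 + sq x) * (\<bar>h x\<bar> * (1 + sq x) ^ N)"
   by (intro mult_right_mono) auto
  thus ?thesis using C(2)[of x] by (simp add: abs_mult algebra_simps)
 qed
 thus ?case using C(1) by blast
next
 case (add h1 h2)
 obtain C1 where C1: "C1 >= 0" "!!x. \<bar>h1 x\<bar> * (1 + sq x) ^ N <= C1" using add.IH(1) by blast
 obtain C2 where C2: "C2 >= 0" "!!x. \<bar>h2 x\<bar> * (1 + sq x) ^ N <= C2" using add.IH(2) by blast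
 have "\<bar>h1 x + h2 x\<bar> * (1 + sq x) ^ N <= C1 + C2" for x
 proof -
  have "\<bar>h1 x + h2 x\<bar> * (1 + sq x) ^ N <= (\<bar>h1 x\<bar> + \<bar>h2 x\<bar>) * (1 + sq x) ^ N"
   by (intro mult_right_mono) auto
  thus ?thesis using C1(2)[of x] C2(2)[of x] by (simp add: algebra_simps)
 qed
 thus ?case using C1 C2 by (intro exI[of _ "C1 + C2"]) auto
next
 case (cmult h c)
 obtain C where C: "C >= 0" "!!x. \<bar>h x\<bar> * (1 + sq x) ^ N <= C" using cmult.IH by blast
 have "\<bar>c * h x\<bar> * (1 + sq x) ^ N <= \<bar>c\<bar> * C" for x
  using mult_left_mono[OF C(2)[of x], of "\<bar>c\<bar>"] by (simp add: abs_mult mult.assoc)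
 thus ?case using C by (intro exI[of _ "\<bar>c\<bar> * C"]) auto
qed

lemma PG_bound': "PG h ==> EX C>=0. ALL x. \<bar>h x\<bar> <= C / (1 + sq x) ^ N"
 using PG_bound[of h N] by (simp add: pos_le_divide_eq add_pos_nonneg)

lemma PG_measurable: "PG h ==> h : bmeas"
 using PG_continuous borel_measurable_continuous_onI by blast

lemma integrable_decay_bound:
 fixes f :: "'a::euclidean_space => 'b::{banach, second_countable_topology}"
 assumes "f : bmeas" "!!x. norm (f x) <= C / (1 + sq x) ^ N" "N >= DIM('a)"
 shows "Lint f"
proof (rule integrable_dom)
 show "Lint (%x::'a. C * (1 / (1 + sq x) ^ N))"
  by (intro integrable_mult_right integrable_one_plus_norm_power assms)
 show "AE x in lborel. norm (f x) <= norm (C * (1 / (1 + sq x) ^ N))"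
 proof (intro AE_I2)
  fix x :: 'a
  have "C / (1 + sq x) ^ N <= \<bar>C / (1 + sq x) ^ N\<bar>" by (rule abs_ge_self)
  thus "norm (f x) <= norm (C * (1 / (1 + sq x) ^ N))" using assms(2)[of x] by simp
 qed
qed (use assms in simp)

lemma PG_integrable:
 assumes "PG (h :: 'a::euclidean_space => real)"
 shows "Lint h"
proof -
 obtain C where "!!x. \<bar>h x\<bar> <= C / (1 + sq x) ^ DIM('a)" using PG_bound'[OF assms] by blast
 thus ?thesis by (intro integrable_decay_bound[OF PG_measurable[OF assms]]) auto
qed

section \<open>The heat kernel: scaling, decay, cancellation\<close>

text \<open>The factor (4 pi t)^(-n/2) is written as a natural power of 1 / sqrt, so that parabolic
  scaling is a ring identity.\<close>

definition hk :: "real => 'a::euclidean_space => real" where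
 "hk t x = (1 / sqrt (4 * pi * t)) ^ DIM('a) * exp (- (sq x) / (4 * t))"

lemma inner_scale_sqrt: "t > 0 ==> ((1 / sqrt t) *\<^sub>R x) \<bullet> ((1 / sqrt t) *\<^sub>R x) = (sq x) / t"
 by (simp add: real_sqrt_mult_self[of t] abs_of_pos)

lemma hk_measurable [measurable (raw)]:
 assumes [measurable]: "f : borel_measurable M" "g : borel_measurable M"
 shows "(%z. hk (f z) (g z)) : borel_measurable M"
 unfolding hk_def by measurable

lemma hk_nonneg: "t > 0 ==> 0 <= hk t x" and hk_pos: "t > 0 ==> 0 < hk t x"
 unfolding hk_def by simp_all

lemma hk_minus [simp]: "hk t (- x) = hk t x"
 unfolding hk_def by simp

lemma PG_hk1: "PG (hk 1)"
 unfolding hk_def using PG.cmult[OF PG.base] by simp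

lemma hk_scale:
 fixes x :: "'a::euclidean_space"
 assumes "t > 0"
 shows "hk t x = (1 / sqrt t) ^ DIM('a) * hk 1 ((1 / sqrt t) *\<^sub>R x)"
proof -
 have "(1 / sqrt (4 * pi * t)) ^ DIM('a) = (1 / sqrt t) ^ DIM('a) * (1 / sqrt (4 * pi)) ^ DIM('a)"
  by (simp add: power_mult_distrib[symmetric] real_sqrt_mult mult.commute)
 thus ?thesis unfolding hk_def inner_scale_sqrt[OF assms] by simp
qed

lemma hk_Ck: "Ck_on k UNIV (hk t)"
proof -
 have "Ck_on k UNIV (%x::'a. \<Sum>b\<in>Basis. (x \<bullet> b) * (x \<bullet> b))"
  by (intro Ck_on_sum Ck_on_mult Ck_on_inner) auto
 hence "Ck_on k UNIV (%x::'a. sq x)" by (subst euclidean_inner)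
 hence q: "Ck_on k UNIV (%x::'a. (- 1 / (4 * t)) * (sq x))" by (intro Ck_on_mult) auto
 have "Ck_on k UNIV (%x::'a. (1 / sqrt (4 * pi * t)) ^ DIM('a) * exp ((- 1 / (4 * t)) * (sq x)))"
  by (intro Ck_on_mult Ck_on_const Ck_on_compose[OF _ _ Ck_on_exp q]) auto
 thus ?thesis unfolding hk_def by simp
qed

text \<open>Parabolic scaling reduces every time to t = 1, where the derivatives lie in
  \<open>PG\<close>; each derivative costs t^(-1/2).\<close>

lemma hk_dpart:
 fixes x :: "'a::euclidean_space"
 assumes "t > 0" "set is <= Basis"
 shows "dpart is (hk t) x = (1 / sqrt t) ^ (DIM('a) + length is) * dpart is (hk 1) ((1 / sqrt t) *\<^sub>R x)"
proof -
 have e: "(hk t :: 'a => real) = (%x. (1 / sqrt t) ^ DIM('a) *\<^sub>R hk 1 ((1 / sqrt t) *\<^sub>R x + 0))"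
  by (rule ext) (simp add: hk_scale[OF assms(1)])
 have "Ck_on (length is) ((%x. (1 / sqrt t) *\<^sub>R x + 0) -` UNIV) (%x::'a. hk 1 ((1 / sqrt t) *\<^sub>R x + 0))"
  by (rule Ck_on_affine[OF _ hk_Ck]) simp
 hence c: "Ck_on (length is) UNIV (%x::'a. hk 1 ((1 / sqrt t) *\<^sub>R x + 0))" by simp
 show ?thesis
  unfolding e dpart_linear[OF bounded_linear_scaleR_right open_UNIV c assms(2) UNIV_I] dpart_affine[OF hk_Ck assms(2)]
  by (simp add: power_add)
qed

lemma hk_dpart_bound:
 assumes "set is <= (Basis :: 'a::euclidean_space set)"
 shows "EX C>=0. ALL t>0. ALL x. \<bar>dpart is (hk t) x\<bar> <= C * (1 / sqrt t) ^ (DIM('a) + length is) / (1 + (sq x) / t) ^ N"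
proof -
 obtain C where C: "C >= 0" "!!x::'a. \<bar>dpart is (hk 1) x\<bar> <= C / (1 + sq x) ^ N"
  using PG_bound'[OF PG_dpart[OF PG_hk1 assms], of N] by blast
 have "\<bar>dpart is (hk t) x\<bar> <= C * (1 / sqrt t) ^ (DIM('a) + length is) / (1 + (sq x) / t) ^ N" if t: "t > 0" for t and x :: 'a
 proof -
  have "\<bar>dpart is (hk 1) ((1 / sqrt t) *\<^sub>R x)\<bar> <= C / (1 + (sq x) / t) ^ N"
   using C(2)[of "(1 / sqrt t) *\<^sub>R x"] unfolding inner_scale_sqrt[OF t] .
  hence "(1 / sqrt t) ^ (DIM('a) + length is) * \<bar>dpart is (hk 1) ((1 / sqrt t) *\<^sub>R x)\<bar> <= (1 / sqrt t) ^ (DIM('a) + length is) * (C / (1 + (sq x) / t) ^ N)"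
   using t by (intro mult_left_mono) auto
  thus ?thesis unfolding hk_dpart[OF t assms] using t by (simp add: abs_mult mult.commute)
 qed
 thus ?thesis using C(1) by blast
qed

lemma hk_dpart_L1:
 assumes "set is <= (Basis :: 'a::euclidean_space set)"
 shows "EX C>=0. ALL t>0. Lint (dpart is (hk t :: 'a => real)) &
   (LBINT x. \<bar>dpart is (hk t) (x::'a)\<bar>) <= C * (1 / sqrt t) ^ length is"
proof -
 let ?h = "dpart is (hk 1 :: 'a => real)"
 have i1: "Lint ?h" using PG_integrable[OF PG_dpart[OF PG_hk1 assms]] .
 have "Lint (dpart is (hk t :: 'a => real)) &
   (LBINT x. \<bar>dpart is (hk t) (x::'a)\<bar>) <= (LBINT x. \<bar>?h x\<bar>) * (1 / sqrt t) ^ length is" if t: "t > 0" for t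
 proof
  have s: "1 / sqrt t ~= 0" using t by simp
  have e: "dpart is (hk t) = (%x. (1 / sqrt t) ^ (DIM('a) + length is) * ?h (0 + (1 / sqrt t) *\<^sub>R x))"
   using hk_dpart[OF t assms] by auto
  show "Lint (dpart is (hk t :: 'a => real))"
   unfolding e by (intro integrable_mult_right integrable_lborel_affine i1 s)
  have "(LBINT x. \<bar>?h x\<bar>) = (1 / sqrt t) ^ DIM('a) * (LBINT x. \<bar>?h (0 + (1 / sqrt t) *\<^sub>R x)\<bar>)"
   using integral_lborel_affine[OF integrable_abs[OF i1] s, of 0] t by simp
  moreover have "(LBINT x. \<bar>dpart is (hk t) (x::'a)\<bar>) = (1 / sqrt t) ^ (DIM('a) + length is) * (LBINT x. \<bar>?h (0 + (1 / sqrt t) *\<^sub>R x)\<bar>)"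
   unfolding e using t by (simp add: abs_mult)
  ultimately show "(LBINT x. \<bar>dpart is (hk t) (x::'a)\<bar>) <= (LBINT x. \<bar>?h x\<bar>) * (1 / sqrt t) ^ length is"
   by (simp add: power_add algebra_simps)
 qed
 thus ?thesis by (intro exI[of _ "(LBINT x. \<bar>?h x\<bar>)"]) auto
qed

lemma hk_integrable: "t > 0 ==> Lint (hk t)"
 using hk_dpart_L1[of "[]"] by auto

lemma hk_integral: "t > 0 ==> (LBINT x. hk t (x::'a::euclidean_space)) = 1"
proof -
 assume t: "t > 0"
 have "cor (LBINT x. exp (- (1 / (4 * t)) * ((x::'a) \<bullet> x))) = cor (sqrt (4 * pi * t) ^ DIM('a))"
  using gauss_fourier(2)[of "1 / (4 * t)" "0::'a"] t by (simp add: mult.commute mult.left_commute)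
 hence "(LBINT x. exp (- (1 / (4 * t)) * ((x::'a) \<bullet> x))) = sqrt (4 * pi * t) ^ DIM('a)"
  by (simp only: of_real_eq_iff)
 thus ?thesis unfolding hk_def using t by (simp add: power_one_over)
qed

text \<open>An inequality of Peetre type, from |z|^2 <= 2 |z + y|^2 + 2 |y|^2, which is the
  nonnegativity of |z + 2 y|^2. Decay bounds thereby survive a bounded translation.\<close>

lemma one_plus_inner_shift:
 fixes z y :: "'a::real_inner"
 shows "1 + sq z <= 3 * (1 + sq y) * (1 + (z + y) \<bullet> (z + y))"
proof -
 have "0 <= (z + 2 *\<^sub>R y) \<bullet> (z + 2 *\<^sub>R y)" by simp
 hence "sq z <= 2 * ((z + y) \<bullet> (z + y)) + 2 * (sq y)"
  by (simp add: inner_simps inner_commute algebra_simps)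
 moreover have "0 <= (sq y) * ((z + y) \<bullet> (z + y))" by simp
 moreover have "0 <= sq y" "0 <= (z + y) \<bullet> (z + y)" by simp_all
 moreover have "3 * (1 + sq y) * (1 + (z + y) \<bullet> (z + y)) = 3 + 3 * (sq y) + 3 * ((z + y) \<bullet> (z + y)) + 3 * ((sq y) * ((z + y) \<bullet> (z + y)))"
  by (simp add: algebra_simps)
 ultimately show ?thesis by linarith
qed

lemma decay_shift:
 fixes z y :: "'a::real_inner"
 assumes "norm y <= r" "0 <= C"
 shows "C / (1 + (z + y) \<bullet> (z + y)) ^ N <= (C * (3 * (1 + r\<^sup>2)) ^ N) / (1 + sq z) ^ N"
proof -
 have p: "0 < 1 + sq v" for v :: 'a by (simp add: add_pos_nonneg)
 have yr: "sq y <= r\<^sup>2" using assms(1) by (simp add: power2_norm_eq_inner[symmetric] power_mono)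
 have "1 + sq z <= 3 * (1 + sq y) * (1 + (z + y) \<bullet> (z + y))" by (rule one_plus_inner_shift)
 also have "\<dots> <= 3 * (1 + r\<^sup>2) * (1 + (z + y) \<bullet> (z + y))"
  using yr p[of "z + y"] by (intro mult_right_mono) auto
 finally have "(1 + sq z) ^ N <= (3 * (1 + r\<^sup>2)) ^ N * (1 + (z + y) \<bullet> (z + y)) ^ N"
  using p[of z] by (simp add: power_mult_distrib[symmetric] power_mono)
 hence "C * (1 + sq z) ^ N <= C * ((3 * (1 + r\<^sup>2)) ^ N * (1 + (z + y) \<bullet> (z + y)) ^ N)"
  using assms(2) by (rule mult_left_mono)
 thus ?thesis using p[of z] p[of "z + y"] by (simp add: field_simps)
qed

text \<open>The integral of f (z + y) over z does not depend on y; differentiating this constant in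
  y under the integral sign gives the claim. It takes the place of integration by parts.\<close>

lemma integral_partial_zero:
 fixes f :: "'a::euclidean_space => 'b::{banach, second_countable_topology}"
 assumes i: "i : Basis" and f: "f : bmeas"
  and d: "!!x. has_partial i f x (f' x)"
  and b: "!!x. norm (f x) <= C / (1 + sq x) ^ N" "!!x. norm (f' x) <= C / (1 + sq x) ^ N" "N >= DIM('a)"
 shows "(LBINT x. f' x) = 0"
proof -
 have C: "0 <= C" using order_trans[OF norm_ge_zero b(1)[of 0]] by simp
 have fi: "Lint f" by (rule integrable_decay_bound[OF f b(1,3)])
 have c: "(LBINT z. f (z + y)) = (LBINT z. f z)" for y
  using integral_lborel_translate(1)[OF fi, of "- y"] by simp
 have "has_partial i (%y. LBINT z. f (z + y)) 0 (LBINT z. f' (z + 0))"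
 proof (rule has_partial_integral(1)[where U="ball 0 1" and w="%z. C * (3 * (1 + 1\<^sup>2)) ^ N / (1 + sq z) ^ N"])
  show "Lint (%z. f (z + y))" for y
   using integrable_lborel_translate(1)[OF fi, of "- y"] by simp
  show "has_partial i (%y. f (z + y)) y (f' (z + y))" for z y
   using has_partial_affine[of i f 1 y z "f' (z + y)"] d by (simp add: add.commute)
  show "norm (f' (z + y)) <= C * (3 * (1 + 1\<^sup>2)) ^ N / (1 + sq z) ^ N" if "y : ball 0 1" for z y
  proof -
   have "norm y <= 1" using that by simp
   thus ?thesis using order_trans[OF b(2)[of "z + y"] decay_shift[of y 1 C z N]] C by simp
  qed
  show "Lint (%z::'a. C * (3 * (1 + 1\<^sup>2)) ^ N / (1 + sq z) ^ N)"
   using integrable_mult_right[OF integrable_one_plus_norm_power[OF b(3)], of "C * (3 * (1 + 1\<^sup>2)) ^ N"] by simp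
 qed (use i in auto)
 hence "has_partial i (%y::'a. LBINT z. f z) 0 (LBINT z. f' z)" unfolding c by simp
 thus ?thesis using has_partial_imp[OF has_partial_const[of i "(LBINT z. f z)" "0::'a"]]
  has_partial_imp[of i "%y::'a. LBINT z. f z" 0 "(LBINT z. f' z)"] by simp
qed

lemma PG_integral_partial: "PG h ==> i : Basis ==> (LBINT x. partial i h (x::'a::euclidean_space)) = 0"
proof -
 assume h: "PG h" and i: "i : Basis"
 obtain C1 where C1: "C1 >= 0" "!!x. \<bar>h x\<bar> <= C1 / (1 + sq x) ^ DIM('a)" using PG_bound'[OF h] by blast
 obtain C2 where C2: "C2 >= 0" "!!x. \<bar>partial i h x\<bar> <= C2 / (1 + sq x) ^ DIM('a)"
  using PG_bound'[of "partial i h"] PG_partial[OF h i] by blast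
 have p: "0 < (1 + sq v) ^ DIM('a)" for v :: 'a by (simp add: add_pos_nonneg)
 have "C1 / (1 + sq x) ^ DIM('a) <= max C1 C2 / (1 + sq x) ^ DIM('a)" "C2 / (1 + sq x) ^ DIM('a) <= max C1 C2 / (1 + sq x) ^ DIM('a)" for x :: 'a
  using p[of x] by (auto intro!: divide_right_mono)
 hence "\<bar>h x\<bar> <= max C1 C2 / (1 + sq x) ^ DIM('a)" "\<bar>partial i h x\<bar> <= max C1 C2 / (1 + sq x) ^ DIM('a)" for x :: 'a
  using C1(2) C2(2) order_trans by blast+
 thus ?thesis using PG_partial[OF h i] PG_measurable[OF h]
  by (intro integral_partial_zero[OF i, of h _ "max C1 C2" "DIM('a)"]) auto
qed

text \<open>The cancellation that lets a density be replaced by its increments in the Hoelder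
  estimate for the heat flow.\<close>

lemma hk_dpart_integral_zero:
 assumes "set is <= (Basis :: 'a::euclidean_space set)" "is ~= []" "t > 0"
 shows "(LBINT x. dpart is (hk t) (x::'a)) = 0"
proof -
 obtain i js where s: "is = i # js" using assms(2) by (cases "is") auto
 have h: "PG (dpart js (hk 1))" "i : Basis" using assms s PG_dpart[OF PG_hk1] by auto
 have i1: "Lint (dpart is (hk 1))" using PG_integrable PG_dpart[OF PG_hk1] assms by blast
 have t: "1 / sqrt t ~= 0" using assms by simp
 have "(LBINT x. dpart is (hk 1) (x::'a)) = 0" using PG_integral_partial[OF h] by (simp add: s)
 hence "(LBINT x. dpart is (hk 1) (0 + (1 / sqrt t) *\<^sub>R (x::'a))) = 0"
  using integral_lborel_affine[OF i1 t, of 0] assms by simp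
 thus ?thesis unfolding hk_dpart[OF assms(3,1)] by simp
qed

text \<open>All derivatives fall on K, so bounds on K and integrability of F are enough.\<close>

lemma Ck_on_convolution:
 fixes K F :: "'a::euclidean_space => real"
 assumes K: "Ck_on N UNIV K" and bd: "!!is. set is <= Basis ==> length is <= N ==> EX B. ALL x. \<bar>dpart is K x\<bar> <= B"
  and F: "Lint F"
 shows "Ck_on N UNIV (%x. LBINT y. K (x - y) * F y)"
  and "set is <= Basis ==> length is <= N ==> Lint (%y. dpart is K (x - y) * F y) &
    dpart is (%x. LBINT y. K (x - y) * F y) x = (LBINT y. dpart is K (x - y) * F y)"
proof -
 have [measurable]: "F : bmeas" using F by auto
 have [measurable]: "K : bmeas"
  using Ck_on_continuous[OF K] borel_measurable_continuous_onI by blast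
 have c: "Ck_on N UNIV (%x. K (x - y))" for y
  using Ck_on_affine[OF open_UNIV K, of 1 "- y"] by simp
 have cF: "Ck_on N UNIV (%x. K (x - y) * F y)" for y
  by (intro Ck_on_mult c) auto
 have d: "dpart is (%x. K (x - y) * F y) x = dpart is K (x - y) * F y" if h: "set is <= Basis" "length is <= N" for "is" x y
 proof -
  have k: "Ck_on (length is) UNIV K" "Ck_on (length is) UNIV (%x. K (x - y))" using K c Ck_on_mono h(2) by blast+
  show ?thesis
   using dpart_linear[OF bounded_linear_mult_left open_UNIV k(2) h(1) UNIV_I, of "F y" x] dpart_affine[OF k(1) h(1), of 1 "- y" x] by simp
 qed
 have m: "(%y. K (x - y) * F y) : borel_measurable lborel" for x by simp
 have dom: "EX U w. open U & x0 : U & U <= UNIV & Lint w &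
   (ALL z:space lborel. ALL x:U. norm (dpart is (%x. K (x - z) * F z) x) <= w z)"
  if h: "set is <= Basis" "length is <= N" for "is" x0
 proof -
  obtain B where B: "!!x. \<bar>dpart is K x\<bar> <= B" using bd[OF h] by blast
  show ?thesis
   using F B by (intro exI[of _ UNIV] exI[of _ "%y. B * \<bar>F y\<bar>"]) (auto simp: d[OF h] abs_mult intro: mult_right_mono)
 qed
 show "Ck_on N UNIV (%x. LBINT y. K (x - y) * F y)"
  by (rule Ck_on_integral(1)[OF open_UNIV m cF dom])
 show "set is <= Basis ==> length is <= N ==> Lint (%y. dpart is K (x - y) * F y) &
    dpart is (%x. LBINT y. K (x - y) * F y) x = (LBINT y. dpart is K (x - y) * F y)"
  using Ck_on_integral(2)[OF open_UNIV m cF dom, of "is" x] d by simp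
qed

section \<open>Potentials built from the heat kernel\<close>

lemma norm_integral_le:
 fixes f :: "'z => 'b::{banach, second_countable_topology}"
 assumes "integrable M f" "integrable M g" "!!x. x : space M ==> norm (f x) <= g x"
 shows "norm (\<integral>x. f x \<partial>M) <= (\<integral>x. g x \<partial>M)"
 by (rule order_trans[OF integral_norm_bound]) (use assms in \<open>auto intro!: integral_mono\<close>)

lemma integrable_lborel_of_HK:
 fixes f :: "real => real"
 assumes "f : bmeas" "S : sets borel" "!!x. x : S ==> 0 <= f x" "f integrable_on S"
 shows "Lint (%x. ind S x * f x)"
proof -
 have "f absolutely_integrable_on S" by (rule nonnegative_absolutely_integrable_1) (use assms in auto)
 hence "integrable lebesgue (%x. ind S x * f x)" unfolding set_integrable_def by simp
 moreover have "(%x. ind S x * f x) : borel_measurable lborel" using assms(1,2) by simp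
 ultimately show ?thesis using integrable_completion by blast
qed

lemma integrable_powr_unit: "a > -1 ==> Lint (%t::real. ind {0<..<1} t * t powr a)"
proof -
 assume "a > -1"
 hence "(%x. x powr a) integrable_on {0<..1}" by (rule integrable_on_powr_from_0') simp
 hence "Lint (%x::real. ind {0<..1} x * x powr a)"
  by (intro integrable_lborel_of_HK) auto
 thus ?thesis by (rule integrable_dom) (auto simp: indicator_def)
qed

lemma integrable_powr_tail: "a < -1 ==> Lint (%t::real. ind {1..} t * t powr a)"
proof -
 assume "a < -1"
 hence "(%x. x powr a) integrable_on {1..}" using has_integral_powr_to_inf[of a 1] by (auto simp: integrable_on_def)
 thus ?thesis by (intro integrable_lborel_of_HK) auto
qed

lemma inverse_sqrt_power: "t > 0 ==> (1 / sqrt t) ^ m = t powr (- real m / 2)"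
proof -
 assume t: "t > 0"
 have "1 / sqrt t = t powr (- 1 / 2)" using t powr_minus[of t "1 / 2"] powr_half_sqrt[of t] by (simp add: inverse_eq_divide)
 thus ?thesis using t by (simp add: powr_power)
qed

text \<open>Formally, the integral of t^(n/2 - 1) exp(-t |xi|^2) over t > 0 is a multiple of
  |xi|^(-n), the symbol of a fundamental solution. Stopping at t = 1 keeps the singularity and makes
  the kernel integrable.\<close>

definition hw :: "nat => real => real" where
 "hw n t = ind {0<..<1} t * t powr (real n / 2 - 1)"

lemma hw_nonneg [simp]: "0 <= hw n t"
 unfolding hw_def by simp

lemma hw_measurable [measurable]: "hw n : bmeas"
 unfolding hw_def by measurable

lemma hw_powr: "hw n t * (C * t powr p) = C * (ind {0<..<1} t * t powr (real n / 2 - 1 + p))"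
 unfolding hw_def by (simp add: powr_add)

lemma integrable_hw_powr: "real n / 2 + p > 0 ==> Lint (%t. hw n t * (C * t powr p))"
 unfolding hw_powr by (intro integrable_mult_right integrable_powr_unit) simp

lemma integrable_hw: "n > 0 ==> Lint (%t. hw n t * C)"
proof -
 assume "n > 0"
 hence "Lint (%t. hw n t * (C * t powr 0))" by (intro integrable_hw_powr) simp
 moreover have e: "hw n t * (C * t powr 0) = hw n t * C" for t by (auto simp: hw_def indicator_def)
 ultimately show ?thesis unfolding e by -
qed

definition hc :: "real => ('a::euclidean_space => real) => 'a => real" where
 "hc t F x = (LBINT y. hk t (x - y) * F y)"

text \<open>The potential with the time integral outermost: each slice is a heat evolution of F,
  whose derivatives are estimated for fixed t. \<open>VT_eq\<close> identifies it with convolution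
  by \<open>Phi\<close>.\<close>

definition VT :: "('a::euclidean_space => real) => 'a => real" where
 "VT F x = (LBINT t. hw DIM('a) t * hc t F x)"

lemma hk_dpart_bounded:
 assumes "t > 0" "set is <= (Basis :: 'a::euclidean_space set)"
 shows "EX B. ALL x::'a. \<bar>dpart is (hk t) x\<bar> <= B"
proof -
 obtain C where "!!t x. t > 0 ==> \<bar>dpart is (hk t) (x::'a)\<bar> <= C * (1 / sqrt t) ^ (DIM('a) + length is) / (1 + (sq x) / t) ^ 0"
  using hk_dpart_bound[OF assms(2), of 0] by blast
 thus ?thesis using assms(1) by (intro exI[of _ "C * (1 / sqrt t) ^ (DIM('a) + length is)"]) simp
qed

lemma hc_Ck:
 fixes F :: "'a::euclidean_space => real"
 assumes "Lint F" "t > 0"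
 shows "Ck_on N UNIV (hc t F)"
  and "set is <= Basis ==> Lint (%y. dpart is (hk t) (x - y) * F y) &
    dpart is (hc t F) x = (LBINT y. dpart is (hk t) (x - y) * F y)"
proof -
 show "Ck_on N UNIV (hc t F)"
  unfolding hc_def[abs_def] by (rule Ck_on_convolution(1)[OF hk_Ck hk_dpart_bounded[OF assms(2)] assms(1)])
 show "Lint (%y. dpart is (hk t) (x - y) * F y) &
    dpart is (hc t F) x = (LBINT y. dpart is (hk t) (x - y) * F y)" if "set is <= Basis"
  unfolding hc_def[abs_def]
  by (rule Ck_on_convolution(2)[OF hk_Ck hk_dpart_bounded[OF assms(2)] assms(1) that order_refl])
qed

lemma hc_measurable [measurable]:
 assumes [measurable]: "F : bmeas"
 shows "(%t. hc t F x) : bmeas"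
 unfolding hc_def by measurable

lemma VT_Ck:
 fixes F :: "'a::euclidean_space => real"
 assumes F: "Lint F"
  and dom: "!!is. set is <= Basis ==> length is <= N ==>
   EX b. Lint (%t. hw DIM('a) t * b t) & (ALL t:{0<..<1}. ALL x. \<bar>dpart is (hc t F) x\<bar> <= b t)"
 shows "Ck_on N UNIV (VT F)"
  and "set is <= Basis ==> length is <= N ==> Lint (%t. hw DIM('a) t * dpart is (hc t F) x) &
    dpart is (VT F) x = (LBINT t. hw DIM('a) t * dpart is (hc t F) x)"
proof -
 have [measurable]: "F : bmeas" using F by auto
 have z: "hw DIM('a) t = 0" if "t ~: {0<..<1}" for t using that by (auto simp: hw_def)
 have c: "Ck_on N UNIV (%x. hw DIM('a) t * hc t F x)" for t
  using z[of t] hc_Ck(1)[OF F, of t N] by (cases "t : {0<..<1}") (auto intro!: Ck_on_mult)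
 have d: "dpart is (%x. hw DIM('a) t * hc t F x) x = hw DIM('a) t * dpart is (hc t F) x"
  if "set is <= Basis" for "is" t x
 proof (cases "t : {0<..<1}")
  case True thus ?thesis
   using dpart_linear[OF bounded_linear_mult_right open_UNIV hc_Ck(1)[OF F] that UNIV_I, of t "hw DIM('a) t" x] by simp
 next
  case False
  have "dpart is (%x. 0) = (%x::'a. 0::real)" for "is"
  proof (induction "is")
   case (Cons i "is")
   show ?case by (rule ext) (simp add: Cons has_partial_imp[OF has_partial_const])
  qed simp
  thus ?thesis using z[OF False] by simp
 qed
 have m: "(%t. hw DIM('a) t * hc t F x) : borel_measurable lborel" for x by measurable
 have dd: "EX U w. open U & x0 : U & U <= UNIV & Lint w &
   (ALL t:space lborel. ALL x:U. norm (dpart is (%x. hw DIM('a) t * hc t F x) x) <= w t)"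
  if h: "set is <= Basis" "length is <= N" for "is" x0
 proof -
  obtain b where b: "Lint (%t. hw DIM('a) t * b t)" "ALL t:{0<..<1}. ALL x. \<bar>dpart is (hc t F) x\<bar> <= b t"
   using dom[OF h] by blast
  have "norm (dpart is (%x. hw DIM('a) t * hc t F x) x) <= hw DIM('a) t * b t" for t x
   unfolding d[OF h(1)] using b(2) z[of t] by (cases "t : {0<..<1}") (auto simp: abs_mult intro!: mult_left_mono)
  thus ?thesis using b(1) by (intro exI[of _ UNIV] exI[of _ "%t. hw DIM('a) t * b t"]) auto
 qed
 show "Ck_on N UNIV (VT F)"
  using Ck_on_integral(1)[OF open_UNIV m c dd] unfolding VT_def[abs_def] .
 show "set is <= Basis ==> length is <= N ==> Lint (%t. hw DIM('a) t * dpart is (hc t F) x) &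
    dpart is (VT F) x = (LBINT t. hw DIM('a) t * dpart is (hc t F) x)"
  using Ck_on_integral(2)[OF open_UNIV m c dd, of "is" x] d[of "is"] unfolding VT_def[abs_def] by simp
qed

text \<open>At the origin the integrand is a multiple of 1 / t on (0, 1), so the Bochner integral
  takes its default value and \<open>Phi 0 = 0\<close>. Comparisons with \<open>Phi\<close>
  therefore exclude the origin.\<close>

definition Phi :: "'a::euclidean_space => real" where
 "Phi x = (LBINT t. hw DIM('a) t * hk t x)"

lemma Phi_measurable [measurable]: "Phi : bmeas"
 unfolding Phi_def[abs_def] by measurable

text \<open>Fubini. Absolute integrability on the product is supplied by a bound b on the heat
  evolution of |F| that is integrable against the weight.\<close>

lemma VT_eq:
 fixes F :: "'a::euclidean_space => real"
 assumes F: "Lint F"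
  and b: "Lint (%t. hw DIM('a) t * b t)" "!!t. t : {0<..<1} ==> hc t (%y. \<bar>F y\<bar>) x <= b t"
 shows "Lint (%y. Phi (x - y) * F y)" "(LBINT y. Phi (x - y) * F y) = VT F x"
proof -
 have [measurable]: "F : bmeas" using F by auto
 define f where "f = (%(t, y). hw DIM('a) t * (hk t (x - y) * F y))"
 have m[measurable]: "f : borel_measurable (lborel \<Otimes>\<^sub>M lborel)" unfolding f_def by measurable
 have z: "hw DIM('a) t = 0" if "t ~: {0<..<1}" for t using that by (auto simp: hw_def)
 have i1: "Lint (%y. hk t (x - y) * F y)" if "t > 0" for t
  using hc_Ck(2)[OF F that, of "[]" x] by simp
 have int: "integrable (lborel \<Otimes>\<^sub>M lborel) f"
 proof (rule lborel_pair.Fubini_integrable[OF m])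
  have e: "(LBINT y. norm (f (t, y))) = hw DIM('a) t * hc t (%y. \<bar>F y\<bar>) x" for t
   by (cases "t : {0<..<1}") (auto simp: f_def hc_def z abs_mult hk_nonneg)
  have p: "0 <= hc t (%y. \<bar>F y\<bar>) x" if "t > 0" for t
   unfolding hc_def using that by (intro integral_nonneg_AE) (auto simp: hk_nonneg)
  show "Lint (%t. LBINT y. norm (f (t, y)))"
   unfolding e
  proof (rule integrable_dom[OF b(1)])
   show "AE t in lborel. norm (hw DIM('a) t * hc t (%y. \<bar>F y\<bar>) x) <= norm (hw DIM('a) t * b t)"
   proof (intro AE_I2)
    fix t
    show "norm (hw DIM('a) t * hc t (%y. \<bar>F y\<bar>) x) <= norm (hw DIM('a) t * b t)"
     using z[of t] p[of t] b(2)[of t]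
     by (cases "t : {0<..<1}") (auto simp: abs_mult intro!: mult_left_mono)
   qed
  qed measurable
  show "AE t in lborel. Lint (%y. f (t, y))"
  proof (intro AE_I2)
   fix t show "Lint (%y. f (t, y))"
    using z[of t] i1[of t] by (cases "t : {0<..<1}") (auto simp: f_def)
  qed
 qed
 have e1: "(LBINT t. f (t, y)) = Phi (x - y) * F y" for y
  unfolding f_def Phi_def by (simp add: mult.assoc[symmetric])
 have e2: "(LBINT y. f (t, y)) = hw DIM('a) t * hc t F x" for t
  unfolding f_def hc_def by simp
 show "Lint (%y. Phi (x - y) * F y)"
  using lborel_pair.integrable_snd[of "%t y. f (t, y)"] int unfolding e1 by simp
 show "(LBINT y. Phi (x - y) * F y) = VT F x"
  using lborel_pair.Fubini_integral[of "%t y. f (t, y)"] int unfolding e1 e2 VT_def by simp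
qed

section \<open>Hoelder and Schauder estimates for heat potentials\<close>

text \<open>For t below |x - y|^2 the size bound A is the better one, above it the Lipschitz bound
  B. The substitution t = |x - y|^2 s turns the minimum of both into |x - y|^gamma times a fixed
  integral, which converges for 0 < gamma < 1.\<close>

lemma VT_holder:
 fixes G :: "real => 'a::euclidean_space => real"
 assumes \<gamma>: "0 < \<gamma>" "\<gamma> < 1"
  and int: "!!x. Lint (%t. hw n t * G t x)"
  and A: "!!t x. t : {0<..<1} ==> \<bar>G t x\<bar> <= A * t powr ((\<gamma> - real n) / 2)"
  and B: "!!t x y. t : {0<..<1} ==> \<bar>G t x - G t y\<bar> <= B * t powr ((\<gamma> - real n - 1) / 2) * dist x y"
 shows "EX C. ALL x y. \<bar>(LBINT t. hw n t * G t x) - (LBINT t. hw n t * G t y)\<bar> <= C * dist x y powr \<gamma>"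
proof -
 \<comment> \<open>The two powers meet at s = 1; the first is integrable at 0, the second at
   infinity.\<close>
 define m where "m s = ind {0<..} s * min (s powr (\<gamma> / 2 - 1)) (s powr (\<gamma> / 2 - 3 / 2))" for s :: real
 have [measurable]: "m : bmeas" unfolding m_def by measurable
 have im: "Lint m"
 proof (rule integrable_dom)
  show "Lint (%s::real. ind {0<..<1} s * s powr (\<gamma> / 2 - 1) + ind {1..} s * s powr (\<gamma> / 2 - 3 / 2))"
   using \<gamma> by (intro Bochner_Integration.integrable_add integrable_powr_unit integrable_powr_tail) auto
 qed (auto simp: m_def indicator_def)
 define M where "M = max (2 * A) B"
 have A0: "0 <= A"
 proof -
  have "0 <= A * (1/2) powr ((\<gamma> - real n) / 2)" using order_trans[OF abs_ge_zero A[of "1/2"]] by auto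
  thus ?thesis by (simp add: zero_le_mult_iff)
 qed
 hence M0: "0 <= M" by (auto simp: M_def)
 have "\<bar>(LBINT t. hw n t * G t x) - (LBINT t. hw n t * G t y)\<bar> <= (M * (LBINT s. m s)) * dist x y powr \<gamma>" for x y
 proof (cases "x = y")
  case False
  define \<delta> where "\<delta> = dist x y"
  have \<delta>: "\<delta> > 0" using False by (simp add: \<delta>_def)
  have b: "\<bar>hw n t * G t x - hw n t * G t y\<bar> <= M * \<delta> powr (\<gamma> - 2) * m (0 + (1 / \<delta>\<^sup>2) *\<^sub>R t)" for t
  proof (cases "t : {0<..<1}")
   case True
   have hwt: "hw n t = t powr (real n / 2 - 1)" using True by (simp add: hw_def)
   have td: "(t / \<delta>\<^sup>2) powr a = t powr a / \<delta> powr (2 * a)" for a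
   proof -
    have "(\<delta> powr 2) powr a = \<delta> powr (2 * a)" by (rule powr_powr)
    hence "(\<delta>\<^sup>2) powr a = \<delta> powr (2 * a)" using \<delta> by simp
    thus ?thesis using True \<delta> by (simp add: powr_divide)
   qed
   have mt: "\<delta> powr (\<gamma> - 2) * m (0 + (1 / \<delta>\<^sup>2) *\<^sub>R t) = min (t powr (\<gamma> / 2 - 1)) (\<delta> * t powr (\<gamma> / 2 - 3 / 2))"
   proof -
    have "2 * (\<gamma> / 2 - 1) = \<gamma> - 2" "2 * (\<gamma> / 2 - 3 / 2) = \<gamma> - 3" by auto
    moreover have "\<delta> powr (\<gamma> - 2) = \<delta> * \<delta> powr (\<gamma> - 3)" using \<delta> powr_add[of \<delta> 1 "\<gamma> - 3"] by simp
    ultimately have a1: "\<delta> powr (\<gamma> - 2) * (t / \<delta>\<^sup>2) powr (\<gamma> / 2 - 1) = t powr (\<gamma> / 2 - 1)"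
     and a2: "\<delta> powr (\<gamma> - 2) * (t / \<delta>\<^sup>2) powr (\<gamma> / 2 - 3 / 2) = \<delta> * t powr (\<gamma> / 2 - 3 / 2)"
     using \<delta> by (simp_all only: td) simp_all
    have "0 < t / \<delta>\<^sup>2" using True \<delta> by simp
    hence "\<delta> powr (\<gamma> - 2) * m (0 + (1 / \<delta>\<^sup>2) *\<^sub>R t) = \<delta> powr (\<gamma> - 2) * min ((t / \<delta>\<^sup>2) powr (\<gamma> / 2 - 1)) ((t / \<delta>\<^sup>2) powr (\<gamma> / 2 - 3 / 2))"
     by (simp add: m_def)
    also have "\<dots> = min (t powr (\<gamma> / 2 - 1)) (\<delta> * t powr (\<gamma> / 2 - 3 / 2))"
     unfolding a1[symmetric] a2[symmetric] using \<delta> by (simp add: min_mult_distrib_left)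
    finally show ?thesis .
   qed
   have "\<bar>G t x - G t y\<bar> <= 2 * A * t powr ((\<gamma> - real n) / 2)" using A[OF True, of x] A[OF True, of y] by linarith
   hence "hw n t * \<bar>G t x - G t y\<bar> <= hw n t * (2 * A * t powr ((\<gamma> - real n) / 2))" by (rule mult_left_mono) simp
   also have "\<dots> = 2 * A * t powr (\<gamma> / 2 - 1)"
    unfolding hwt by (simp add: powr_add[symmetric] field_simps)
   also have "\<dots> <= M * t powr (\<gamma> / 2 - 1)" by (rule mult_right_mono) (auto simp: M_def)
   finally have 1: "hw n t * \<bar>G t x - G t y\<bar> <= M * t powr (\<gamma> / 2 - 1)" .
   have "hw n t * \<bar>G t x - G t y\<bar> <= hw n t * (B * t powr ((\<gamma> - real n - 1) / 2) * \<delta>)"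
    using B[OF True] unfolding \<delta>_def by (rule mult_left_mono) simp
   also have "\<dots> = B * (\<delta> * (t powr (real n / 2 - 1) * t powr ((\<gamma> - real n - 1) / 2)))"
    unfolding hwt by simp
   also have "t powr (real n / 2 - 1) * t powr ((\<gamma> - real n - 1) / 2) = t powr (\<gamma> / 2 - 3 / 2)"
   proof -
    have "real n / 2 - 1 + (\<gamma> - real n - 1) / 2 = \<gamma> / 2 - 3 / 2" by (simp add: field_simps)
    thus ?thesis by (simp only: powr_add[symmetric])
   qed
   also have "B * (\<delta> * t powr (\<gamma> / 2 - 3 / 2)) <= M * (\<delta> * t powr (\<gamma> / 2 - 3 / 2))" using \<delta> by (intro mult_right_mono) (auto simp: M_def)
   finally have 2: "hw n t * \<bar>G t x - G t y\<bar> <= M * (\<delta> * t powr (\<gamma> / 2 - 3 / 2))" .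
   have "hw n t * \<bar>G t x - G t y\<bar> <= M * min (t powr (\<gamma> / 2 - 1)) (\<delta> * t powr (\<gamma> / 2 - 3 / 2))"
    using 1 2 by (auto simp: min_def)
   thus ?thesis unfolding mult.assoc mt
    by (simp add: abs_mult[symmetric] right_diff_distrib[symmetric] abs_mult)
  next
   case False
   hence "hw n t = 0" by (auto simp: hw_def)
   moreover have "0 <= m s" for s by (simp add: m_def)
   ultimately show ?thesis using M0 by simp
  qed
  have c: "1 / \<delta>\<^sup>2 ~= 0" using \<delta> by simp
  have "(LBINT s. m s) = (1 / \<delta>\<^sup>2) * (LBINT t. m (0 + (1 / \<delta>\<^sup>2) *\<^sub>R t))"
   using integral_lborel_affine[OF im c, of 0] by simp
  hence mi: "(LBINT t. m (0 + (1 / \<delta>\<^sup>2) *\<^sub>R t)) = \<delta> powr 2 * (LBINT s. m s)"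
   using \<delta> by (simp add: field_simps)
  have "\<bar>(LBINT t. hw n t * G t x) - (LBINT t. hw n t * G t y)\<bar> = \<bar>(LBINT t. hw n t * G t x - hw n t * G t y)\<bar>"
   using int by simp
  also have "\<dots> <= (LBINT t. M * \<delta> powr (\<gamma> - 2) * m (0 + (1 / \<delta>\<^sup>2) *\<^sub>R t))"
   using norm_integral_le[of lborel "%t. hw n t * G t x - hw n t * G t y" "%t. M * \<delta> powr (\<gamma> - 2) * m (0 + (1 / \<delta>\<^sup>2) *\<^sub>R t)"]
    b int integrable_lborel_affine[OF im c, of 0] by simp
  also have "\<dots> = M * \<delta> powr (\<gamma> - 2) * (LBINT t. m (0 + (1 / \<delta>\<^sup>2) *\<^sub>R t))" by simp
  also have "\<dots> = M * (\<delta> powr (\<gamma> - 2) * \<delta> powr 2) * (LBINT s. m s)" unfolding mi by (simp only: mult_ac)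
  also have "\<delta> powr (\<gamma> - 2) * \<delta> powr 2 = \<delta> powr \<gamma>" by (simp add: powr_add[symmetric])
  finally show ?thesis unfolding \<delta>_def by (simp add: mult_ac)
 qed simp
 thus ?thesis by blast
qed

text \<open>\<sigma> is the regularity of the density, possibly negative: derivatives of the heat
  evolution stay bounded up to order sigma and grow like t^((sigma - order)/2) beyond it.
  Integration against t^(n/2 - 1) gains n derivatives, so n + sigma is split into N and a
  fraction.\<close>

lemma VT_regular:
 fixes F :: "'a::euclidean_space => real"
 assumes F: "Lint F"
  and b: "!!is. set is <= Basis ==>
    EX C. ALL t:{0<..<1}. ALL x. \<bar>dpart is (hc t F) x\<bar> <= C * t powr (min (\<sigma> - real (length is)) 0 / 2)"
  and N: "real DIM('a) + \<sigma> = real N + \<gamma>" "0 < \<gamma>" "\<gamma> < 1"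
 shows "Ck_on N UNIV (VT F)"
  and "set is <= Basis ==> length is = N ==> EX C. ALL x y. \<bar>dpart is (VT F) x - dpart is (VT F) y\<bar> <= C * dist x y powr \<gamma>"
proof -
 have dom: "EX b. Lint (%t. hw DIM('a) t * b t) & (ALL t:{0<..<1}. ALL x. \<bar>dpart is (hc t F) x\<bar> <= b t)"
  if h: "set is <= Basis" "length is <= N" for "is"
 proof -
  obtain C where C: "ALL t:{0<..<1}. ALL x. \<bar>dpart is (hc t F) x\<bar> <= C * t powr (min (\<sigma> - real (length is)) 0 / 2)" using b[OF h(1)] by blast
  have "Lint (%t. hw DIM('a) t * (C * t powr (min (\<sigma> - real (length is)) 0 / 2)))"
   using N h(2) by (intro integrable_hw_powr) (auto simp: min_def field_simps)
  thus ?thesis using C by (intro exI[of _ "%t. C * t powr (min (\<sigma> - real (length is)) 0 / 2)"]) simp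
 qed
 show "Ck_on N UNIV (VT F)" by (rule VT_Ck(1)[OF F dom])
 assume h: "set is <= Basis" "length is = N"
 \<comment> \<open>Since gamma < 1 <= n forces sigma < N, the minimum with 0 is inactive at the
   orders N and N + 1, the ones that enter \<open>VT_holder\<close>.\<close>
 have "1 <= real DIM('a)" using DIM_positive[where 'a='a] by linarith
 hence "\<sigma> < real N" using N by linarith
 hence e: "min (\<sigma> - real N) 0 / 2 = (\<gamma> - real DIM('a)) / 2" "min (\<sigma> - real (Suc N)) 0 / 2 = (\<gamma> - real DIM('a) - 1) / 2"
  using N by (auto simp: min_def)
 have "EX A. ALL t:{0<..<1}. ALL x. \<bar>dpart is (hc t F) x\<bar> <= A * t powr ((\<gamma> - real DIM('a)) / 2)"
  using b[OF h(1)] unfolding h(2) e(1) .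
 then obtain A where A: "!!t x. t : {0<..<1} ==> \<bar>dpart is (hc t F) x\<bar> <= A * t powr ((\<gamma> - real DIM('a)) / 2)" by blast
 have "ALL i:Basis. EX C. ALL t:{0<..<1}. ALL x. \<bar>dpart (i # is) (hc t F) x\<bar> <= C * t powr ((\<gamma> - real DIM('a) - 1) / 2)"
 proof
  fix i :: 'a assume i: "i : Basis"
  have "set (i # is) <= Basis" "length (i # is) = Suc N" using h i by auto
  thus "EX C. ALL t:{0<..<1}. ALL x. \<bar>dpart (i # is) (hc t F) x\<bar> <= C * t powr ((\<gamma> - real DIM('a) - 1) / 2)"
   using b[of "i # is"] e(2) by (simp only:)
 qed
 then obtain Ci where Ci: "ALL i:Basis. ALL t:{0<..<1}. ALL x. \<bar>dpart (i # is) (hc t F) x\<bar> <= Ci i * t powr ((\<gamma> - real DIM('a) - 1) / 2)"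
  by (auto dest!: bchoice)
 define D where "D = (\<Sum>i\<in>(Basis::'a set). \<bar>Ci i\<bar>)"
 have D: "\<bar>dpart (i # is) (hc t F) x\<bar> <= D * t powr ((\<gamma> - real DIM('a) - 1) / 2)" if "i : Basis" "t : {0<..<1}" for i t x
 proof -
  have "Ci i <= \<bar>Ci i\<bar>" by simp
  also have "\<dots> <= D" unfolding D_def using that(1) by (intro member_le_sum) auto
  finally have "Ci i * t powr ((\<gamma> - real DIM('a) - 1) / 2) <= D * t powr ((\<gamma> - real DIM('a) - 1) / 2)" by (rule mult_right_mono) simp
  thus ?thesis using Ci that by (meson order_trans)
 qed
 have "\<bar>dpart is (hc t F) x - dpart is (hc t F) y\<bar> <= (D * real DIM('a)) * t powr ((\<gamma> - real DIM('a) - 1) / 2) * dist x y"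
  if t: "t : {0<..<1}" for t x y
 proof -
  have "norm (dpart is (hc t F) x - dpart is (hc t F) y) <= (D * t powr ((\<gamma> - real DIM('a) - 1) / 2)) * real DIM('a) * dist x y"
  proof (rule lipschitz_partial_UNIV[where D="%i. dpart (i # is) (hc t F)"])
   fix z i :: 'a assume i: "i : Basis"
   show "has_partial i (dpart is (hc t F)) z (dpart (i # is) (hc t F) z)"
    by (rule Ck_on_dpart_has_partial[OF hc_Ck(1)[OF F, of t "Suc N"]]) (use t h i in auto)
   show "norm (dpart (i # is) (hc t F) z) <= D * t powr ((\<gamma> - real DIM('a) - 1) / 2)"
    using D[OF i t] by simp
  qed
  thus ?thesis by (simp add: mult_ac)
 qed
 moreover have "Lint (%t. hw DIM('a) t * dpart is (hc t F) x)" for x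
  using VT_Ck(2)[OF F dom h(1)] h(2) by simp
 ultimately have "EX C. ALL x y. \<bar>(LBINT t. hw DIM('a) t * dpart is (hc t F) x) - (LBINT t. hw DIM('a) t * dpart is (hc t F) y)\<bar> <= C * dist x y powr \<gamma>"
  by (intro VT_holder[OF N(2,3) _ A]) auto
 thus "EX C. ALL x y. \<bar>dpart is (VT F) x - dpart is (VT F) y\<bar> <= C * dist x y powr \<gamma>"
  using VT_Ck(2)[OF F dom h(1)] h(2) by simp
qed

lemma dpart_zero [simp]: "dpart is (%x. 0) = (%x::'a::euclidean_space. 0::'b::real_normed_vector)"
proof (induction "is")
 case (Cons i "is")
 show ?case by (rule ext) (simp add: Cons has_partial_imp[OF has_partial_const])
qed simp

lemma dpart_support:
 assumes "!!x. norm x > R ==> F x = 0" "norm x > R"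
 shows "dpart is F x = 0"
proof -
 have "dpart is F x = dpart is (%x. 0) x"
  by (rule dpart_cong[of "- cball 0 R"]) (use assms in auto)
 thus ?thesis by simp
qed

lemma support_bounded:
 fixes F :: "'a::euclidean_space => 'b::real_normed_vector"
 assumes "!!x. norm x > R ==> F x = 0" "continuous_on UNIV F"
 shows "EX B>=0. ALL x. norm (F x) <= B"
proof -
 have "bounded (F ` cball 0 R)"
  by (intro compact_imp_bounded compact_continuous_image continuous_on_subset[OF assms(2)]) auto
 then obtain B where B: "B > 0" "!!x. x : cball 0 R ==> norm (F x) <= B" unfolding bounded_pos by auto
 have "norm (F x) <= B" for x using B assms(1)[of x] by (cases "norm x <= R") auto
 thus ?thesis using B by (intro exI[of _ B]) auto
qed

lemma support_integrable:
 fixes F :: "'a::euclidean_space => 'b::{banach, second_countable_topology}"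
 assumes "!!x. norm x > R ==> F x = 0" "F : bmeas" "!!x. norm (F x) <= B"
 shows "Lint F"
proof (rule integrable_dom)
 show "Lint (%x::'a. ind (cball 0 R) x * B)"
  using emeasure_lborel_cball_finite[of "0::'a" R]
  by (intro integrable_mult_left integrable_real_indicator) auto
 show "AE x in lborel. norm (F x) <= norm (ind (cball 0 R) x * B)"
  using assms(1,3) by (intro AE_I2) (auto simp: indicator_def intro: order_trans[OF _ abs_ge_self])
qed (use assms in auto)

text \<open>The weight 1 + |z|^2 / t is scale invariant and dominates (|z| / sqrt t)^theta for 0 <
  theta < 1; it absorbs the Hoelder modulus of a density.\<close>

lemma hk_dpart_L1_weighted:
 assumes "set is <= (Basis :: 'a::euclidean_space set)"
 shows "EX C>=0. ALL t>0. Lint (%z::'a. \<bar>dpart is (hk t) z\<bar> * (1 + (sq z) / t)) &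
   (LBINT z. \<bar>dpart is (hk t) (z::'a)\<bar> * (1 + (sq z) / t)) <= C * (1 / sqrt t) ^ length is"
proof -
 define h where "h z = \<bar>dpart is (hk 1 :: 'a => real) z\<bar> * (1 + sq z)" for z
 have PGh: "PG (dpart is (hk 1 :: 'a => real))" using PG_dpart[OF PG_hk1 assms] .
 obtain C where C: "!!z. \<bar>dpart is (hk 1 :: 'a => real) z\<bar> * (1 + sq z) ^ Suc DIM('a) <= C"
  using PG_bound[OF PGh, of "Suc DIM('a)"] by blast
 have p: "0 < 1 + sq v" for v :: 'a by (simp add: add_pos_nonneg)
 have [measurable]: "dpart is (hk 1 :: 'a => real) : bmeas" using PG_measurable[OF PGh] .
 have i1: "Lint h"
 proof (rule integrable_decay_bound[where N="DIM('a)" and C=C])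
  show "norm (h x) <= C / (1 + sq x) ^ DIM('a)" for x
  proof -
   have "\<bar>h x\<bar> = h x" using p[of x] by (simp add: h_def)
   moreover have "h x * (1 + sq x) ^ DIM('a) <= C" using C[of x] by (simp add: h_def mult_ac)
   ultimately show ?thesis using p[of x] by (simp add: pos_le_divide_eq)
  qed
  show "h : bmeas" unfolding h_def by measurable
 qed simp
 have "Lint (%z::'a. \<bar>dpart is (hk t) z\<bar> * (1 + (sq z) / t)) &
   (LBINT z. \<bar>dpart is (hk t) (z::'a)\<bar> * (1 + (sq z) / t)) <= (LBINT x. h x) * (1 / sqrt t) ^ length is" if t: "t > 0" for t
 proof
  have s: "1 / sqrt t ~= 0" using t by simp
  have e: "\<bar>dpart is (hk t) z\<bar> * (1 + (sq z) / t) = (1 / sqrt t) ^ (DIM('a) + length is) * h (0 + (1 / sqrt t) *\<^sub>R z)" for z :: 'a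
   unfolding hk_dpart[OF t assms] h_def using t inner_scale_sqrt[OF t, of z] by (simp add: abs_mult)
  show "Lint (%z::'a. \<bar>dpart is (hk t) z\<bar> * (1 + (sq z) / t))"
   unfolding e by (intro integrable_mult_right integrable_lborel_affine i1 s)
  have "(LBINT x. h x) = (1 / sqrt t) ^ DIM('a) * (LBINT x. h (0 + (1 / sqrt t) *\<^sub>R x))"
   using integral_lborel_affine[OF i1 s, of 0] t by simp
  thus "(LBINT z. \<bar>dpart is (hk t) (z::'a)\<bar> * (1 + (sq z) / t)) <= (LBINT x. h x) * (1 / sqrt t) ^ length is"
   unfolding e by (simp add: power_add algebra_simps)
 qed
 moreover have "0 <= (LBINT x. h x)" using p by (intro integral_nonneg_AE AE_I2) (simp add: h_def less_imp_le)
 ultimately show ?thesis by blast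
qed

text \<open>Sup norm of F times the L1 norm of the differentiated kernel; this is regularity sigma =
  0.\<close>

lemma hc_dpart_bounded:
 fixes F :: "'a::euclidean_space => real"
 assumes "set is <= Basis" "Lint F" "!!y. \<bar>F y\<bar> <= B"
 shows "EX C. ALL t>0. ALL x. \<bar>dpart is (hc t F) x\<bar> <= C * t powr (- real (length is) / 2)"
proof -
 obtain C where C: "C >= 0" "!!t. t > 0 ==> Lint (dpart is (hk t :: 'a => real))"
  "!!t. t > 0 ==> (LBINT x. \<bar>dpart is (hk t) (x::'a)\<bar>) <= C * (1 / sqrt t) ^ length is"
  using hk_dpart_L1[OF assms(1)] by blast
 note F = assms(2,3)
 have "\<bar>dpart is (hc t F) x\<bar> <= B * C * t powr (- real (length is) / 2)" if t: "t > 0" for t x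
 proof -
  have B0: "0 <= B" using order_trans[OF abs_ge_zero F(2)] .
  have i: "Lint (%y. \<bar>dpart is (hk t) (x - y)\<bar>)"
   using integrable_lborel_translate(2)[OF integrable_abs[OF C(2)[OF t]]] .
  have "norm (LBINT y. dpart is (hk t) (x - y) * F y) <= (LBINT y. B * \<bar>dpart is (hk t) (x - y)\<bar>)"
  proof (rule norm_integral_le)
   show "Lint (%y. dpart is (hk t) (x - y) * F y)" using hc_Ck(2)[OF F(1) t assms(1)] by blast
   show "Lint (%y. B * \<bar>dpart is (hk t) (x - y)\<bar>)" by (rule integrable_mult_right[OF i])
   show "norm (dpart is (hk t) (x - y) * F y) <= B * \<bar>dpart is (hk t) (x - y)\<bar>" for y
    using mult_right_mono[OF F(2)[of y], of "\<bar>dpart is (hk t) (x - y)\<bar>"] by (simp add: abs_mult mult.commute)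
  qed
  hence "norm (dpart is (hc t F) x) <= (LBINT y. B * \<bar>dpart is (hk t) (x - y)\<bar>)"
   using hc_Ck(2)[OF F(1) t assms(1)] by simp
  also have "\<dots> = B * (LBINT y. \<bar>dpart is (hk t) (y::'a)\<bar>)"
   using integral_lborel_translate(2)[OF integrable_abs[OF C(2)[OF t]], of x] by simp
  also have "\<dots> <= B * (C * (1 / sqrt t) ^ length is)" using C(3)[OF t] B0 by (rule mult_left_mono)
  finally show ?thesis unfolding inverse_sqrt_power[OF t] by (simp add: mult.assoc)
 qed
 thus ?thesis by blast
qed

text \<open>By symmetry of convolution the derivatives may fall on F instead of the kernel, where
  they cost no power of t.\<close>

lemma hc_dpart_transfer:
 fixes F :: "'a::euclidean_space => real"
 assumes "Ck_on N UNIV F" "!!x. norm x > R ==> F x = 0" "t > 0" "set is <= Basis" "length is <= N"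
 shows "dpart is (hc t F) = hc t (dpart is F)"
proof -
 have bd: "EX B. ALL x. \<bar>dpart js F x\<bar> <= B" and int: "Lint (dpart js F)"
  if "set js <= Basis" "length js <= N" for js
 proof -
  have c: "continuous_on UNIV (dpart js F)" using Ck_on_dpart_continuous[OF assms(1)] that by blast
  obtain B where B: "!!x. norm (dpart js F x) <= B"
   using support_bounded[of R "dpart js F"] dpart_support[of R F] assms(2) c by blast
  thus "EX B. ALL x. \<bar>dpart js F x\<bar> <= B" by (auto simp: real_norm_def[symmetric] simp del: real_norm_def)
  show "Lint (dpart js F)"
   by (rule support_integrable[of R _ B]) (use B assms(2) dpart_support c borel_measurable_continuous_onI in blast)+
 qed
 have F: "Lint F" using int[of "[]"] by simp
 have e: "hc t G x = (LBINT z. G (x - z) * hk t z)" if "Lint G" for G and x :: 'a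
  using integral_lborel_translate(2)[of "%y. hk t (x - y) * G y" x] hc_Ck(2)[OF that assms(3), of "[]" x]
  by (simp add: hc_def mult.commute)
 have "dpart is (%x. LBINT z. F (x - z) * hk t z) x = (LBINT z. dpart is F (x - z) * hk t z)" for x
  using Ck_on_convolution(2)[OF assms(1) bd hk_integrable[OF assms(3)] assms(4,5)] by blast
 moreover have "hc t F = (%x. LBINT z. F (x - z) * hk t z)" using e[OF F] by blast
 ultimately show ?thesis using e[OF int[OF assms(4,5)]] by auto
qed

text \<open>One derivative of the heat evolution of a bounded function costs t^(-1/2), and t^(n/2 -
  3/2) is integrable at 0 exactly when n >= 2.\<close>

lemma VT_C1:
 fixes F :: "'a::euclidean_space => real"
 assumes "DIM('a) >= 2" "Lint F" "!!y. \<bar>F y\<bar> <= B"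
 shows "Ck_on 1 UNIV (VT F)"
proof (rule VT_Ck(1)[OF assms(2)])
 fix "is" :: "'a list" assume h: "set is <= Basis" "length is <= 1"
 obtain C where C: "!!t x. t > 0 ==> \<bar>dpart is (hc t F) x\<bar> <= C * t powr (- real (length is) / 2)"
  using hc_dpart_bounded[OF h(1) assms(2,3)] by blast
 have "Lint (%t. hw DIM('a) t * (C * t powr (- real (length is) / 2)))"
  using h(2) assms(1) by (intro integrable_hw_powr) auto
 thus "EX b. Lint (%t. hw DIM('a) t * b t) & (ALL t:{0<..<1}. ALL x. \<bar>dpart is (hc t F) x\<bar> <= b t)"
  using C by (intro exI[of _ "%t. C * t powr (- real (length is) / 2)"]) auto
qed

lemma dpart_support_bounded:
 fixes F :: "'a::euclidean_space => real"
 assumes "Ck_on k UNIV F" "!!x. norm x > R ==> F x = 0" "set is <= Basis" "length is <= k"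
 shows "EX B. ALL x. \<bar>dpart is F x\<bar> <= B" "Lint (dpart is F)"
proof -
 have c: "continuous_on UNIV (dpart is F)" using Ck_on_dpart_continuous assms by blast
 obtain B where B: "!!x. norm (dpart is F x) <= B"
  using support_bounded[of R "dpart is F"] dpart_support[of R F] assms(2) c by blast
 thus "EX B. ALL x. \<bar>dpart is F x\<bar> <= B" by (auto simp: real_norm_def[symmetric] simp del: real_norm_def)
 show "Lint (dpart is F)"
  by (rule support_integrable[of R _ B]) (use B assms(2) dpart_support c borel_measurable_continuous_onI in blast)+
qed

text \<open>Of k + 1 derivatives, k are put on F and at most one on the kernel, where its cost
  t^(-1/2) is integrable against the weight. This weak gain is enough to bootstrap to
  smoothness.\<close>

lemma VT_gain_one:
 fixes F :: "'a::euclidean_space => real"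
 assumes n: "DIM('a) >= 2" and F: "Ck_on k UNIV F" "!!x. norm x > R ==> F x = 0"
 shows "Ck_on (Suc k) UNIV (VT F)"
proof (rule VT_Ck(1))
 have "Lint (dpart [] F)" by (rule dpart_support_bounded(2)[OF F]) auto
 hence Fi: "Lint F" by simp
 show "Lint F" by (rule Fi)
 fix "is" :: "'a list" assume h: "set is <= Basis" "length is <= Suc k"
 obtain ks js where kj: "is = ks @ js" "length ks <= 1" "length js <= k"
 proof (cases "is")
  case Nil thus ?thesis using that[of "[]" "[]"] by simp
 next
  case (Cons i js) thus ?thesis using that[of "[i]" js] h by simp
 qed
 have s: "set ks <= Basis" "set js <= Basis" using kj h by auto
 obtain B where B: "!!x. \<bar>dpart js F x\<bar> <= B" using dpart_support_bounded(1)[OF F s(2) kj(3)] by blast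
 have i: "Lint (dpart js F)" using dpart_support_bounded(2)[OF F s(2) kj(3)] by blast
 obtain C where C: "!!t x. t > 0 ==> \<bar>dpart ks (hc t (dpart js F)) x\<bar> <= C * t powr (- real (length ks) / 2)"
  using hc_dpart_bounded[OF s(1) i B] by blast
 have "\<bar>dpart is (hc t F) x\<bar> <= C * t powr (- real (length ks) / 2)" if "t > 0" for t x
 proof -
  have "dpart js (hc t F) = hc t (dpart js F)" by (rule hc_dpart_transfer[OF F that s(2) kj(3)])
  thus ?thesis using C[OF that] unfolding kj(1) dpart_append by simp
 qed
 moreover have "Lint (%t. hw DIM('a) t * (C * t powr (- real (length ks) / 2)))"
  using kj(2) n by (intro integrable_hw_powr) auto
 ultimately show "EX b. Lint (%t. hw DIM('a) t * b t) & (ALL t:{0<..<1}. ALL x. \<bar>dpart is (hc t F) x\<bar> <= b t)"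
  by (intro exI[of _ "%t. C * t powr (- real (length ks) / 2)"]) auto
qed

text \<open>The differentiated kernel has integral zero, so F may be replaced by its increment,
  which is O(|z|^theta); on the scale |z| ~ sqrt t this wins a factor t^(theta/2).\<close>

lemma hc_dpart_holder:
 fixes F :: "'a::euclidean_space => real"
 assumes h: "set is <= Basis" "is ~= []" and \<theta>: "0 < \<theta>" "\<theta> < 1"
  and F: "Lint F" "!!x y. \<bar>F x - F y\<bar> <= H * dist x y powr \<theta>"
 shows "EX C. ALL t>0. ALL x. \<bar>dpart is (hc t F) x\<bar> <= C * t powr ((\<theta> - real (length is)) / 2)"
proof -
 obtain C where C: "C >= 0" "!!t. t > 0 ==> Lint (%z::'a. \<bar>dpart is (hk t) z\<bar> * (1 + (sq z) / t))"
  "!!t. t > 0 ==> (LBINT z. \<bar>dpart is (hk t) (z::'a)\<bar> * (1 + (sq z) / t)) <= C * (1 / sqrt t) ^ length is"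
  using hk_dpart_L1_weighted[OF h(1)] by blast
 obtain b :: 'a where b: "b : Basis" using nonempty_Basis by blast
 have "0 <= H * dist b 0 powr \<theta>" using order_trans[OF abs_ge_zero F(2)] .
 hence H0: "0 <= H" using b by (simp add: zero_le_mult_iff)
 have "\<bar>dpart is (hc t F) x\<bar> <= (H * C) * t powr ((\<theta> - real (length is)) / 2)" if t: "t > 0" for t x
 proof -
  have i1: "Lint (dpart is (hk t :: 'a => real))" using hk_dpart_L1[OF h(1)] t by blast
  have i2: "Lint (%z. dpart is (hk t) z * F (x - z))"
   using integrable_lborel_translate(2)[of "%y. dpart is (hk t) (x - y) * F y" x] hc_Ck(2)[OF F(1) t h(1), of x] by simp
  have "dpart is (hc t F) x = (LBINT z. dpart is (hk t) z * F (x - z))"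
   using integral_lborel_translate(2)[of "%y. dpart is (hk t) (x - y) * F y" x] hc_Ck(2)[OF F(1) t h(1), of x] by simp
  also have "\<dots> = (LBINT z. dpart is (hk t) z * F (x - z)) - (LBINT z. dpart is (hk t) z * F x)"
   using hk_dpart_integral_zero[OF h t] by simp
  also have "\<dots> = (LBINT z. dpart is (hk t) z * F (x - z) - dpart is (hk t) z * F x)"
   by (rule Bochner_Integration.integral_diff[symmetric]) (use i1 i2 in auto)
  finally have e: "dpart is (hc t F) x = (LBINT z. dpart is (hk t) z * F (x - z) - dpart is (hk t) z * F x)" .
  have pt: "norm (dpart is (hk t) z * F (x - z) - dpart is (hk t) z * F x) <= H * t powr (\<theta> / 2) * (\<bar>dpart is (hk t) z\<bar> * (1 + (sq z) / t))" for z
  proof -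
   define r where "r = (sq z) / t"
   have r: "0 <= r" using t by (simp add: r_def)
   have "norm z = sqrt t * sqrt r" unfolding r_def norm_eq_sqrt_inner using t by (simp add: real_sqrt_mult[symmetric])
   hence "norm z powr \<theta> = t powr (\<theta> / 2) * r powr (\<theta> / 2)"
    using t r by (simp add: powr_mult powr_half_sqrt[symmetric] powr_powr)
   \<comment> \<open>With r = |z|^2 / t, the crude majorant 1 + r is precisely the weight of
     \<open>hk_dpart_L1_weighted\<close>.\<close>
   moreover have "r powr (\<theta> / 2) <= 1 + r"
   proof (cases "r <= 1")
    case True
    have "r powr (\<theta> / 2) <= 1 powr (\<theta> / 2)" using True r \<theta> by (intro powr_mono2) auto
    thus ?thesis using r by simp
   next
    case False
    have "r powr (\<theta> / 2) <= r powr 1" using False \<theta> by (intro powr_mono) auto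
    thus ?thesis using False by simp
   qed
   ultimately have "norm z powr \<theta> <= t powr (\<theta> / 2) * (1 + r)" by (simp add: mult_left_mono)
   hence "\<bar>F (x - z) - F x\<bar> <= H * (t powr (\<theta> / 2) * (1 + r))"
    using F(2)[of "x - z" x] H0 by (auto simp: dist_norm intro: order_trans mult_left_mono)
   hence "\<bar>dpart is (hk t) z\<bar> * \<bar>F (x - z) - F x\<bar> <= \<bar>dpart is (hk t) z\<bar> * (H * (t powr (\<theta> / 2) * (1 + r)))"
    by (rule mult_left_mono) simp
   moreover have "dpart is (hk t) z * F (x - z) - dpart is (hk t) z * F x = dpart is (hk t) z * (F (x - z) - F x)"
    by (simp add: right_diff_distrib)
   ultimately show ?thesis by (simp add: r_def abs_mult mult_ac)
  qed
  have "\<bar>dpart is (hc t F) x\<bar> <= (LBINT z. H * t powr (\<theta> / 2) * (\<bar>dpart is (hk t) z\<bar> * (1 + (sq z) / t)))"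
   unfolding e real_norm_def[symmetric]
   by (rule norm_integral_le) (use i1 i2 C(2)[OF t] pt in auto)
  also have "\<dots> = H * t powr (\<theta> / 2) * (LBINT z. \<bar>dpart is (hk t) (z::'a)\<bar> * (1 + (sq z) / t))" by simp
  also have "\<dots> <= H * t powr (\<theta> / 2) * (C * (1 / sqrt t) ^ length is)"
   using H0 C(3)[OF t] by (intro mult_left_mono) auto
  also have "\<dots> = H * C * (t powr (\<theta> / 2) * t powr (- real (length is) / 2))"
   unfolding inverse_sqrt_power[OF t] by (simp add: mult_ac)
  also have "t powr (\<theta> / 2) * t powr (- real (length is) / 2) = t powr ((\<theta> - real (length is)) / 2)"
   by (simp add: powr_add[symmetric] diff_divide_distrib)
  finally show ?thesis .
 qed
 thus ?thesis by blast
qed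

text \<open>\<open>VT_regular\<close> with sigma = k + theta: up to k derivatives are moved to F,
  and any further ones act on the heat evolution of a Hoelder function.\<close>

lemma VT_schauder:
 fixes F :: "'a::euclidean_space => real"
 assumes F: "Ck_on k UNIV F" "!!x. norm x > R ==> F x = 0" and \<theta>: "0 < \<theta>" "\<theta> < 1"
  and H: "!!is. set is <= Basis ==> length is = k ==> EX H. ALL x y. \<bar>dpart is F x - dpart is F y\<bar> <= H * dist x y powr \<theta>"
 shows "Ck_on (DIM('a) + k) UNIV (VT F)"
  and "set is <= Basis ==> length is = DIM('a) + k ==> EX C. ALL x y. \<bar>dpart is (VT F) x - dpart is (VT F) y\<bar> <= C * dist x y powr \<theta>"
proof -
 have "Lint (dpart [] F)" by (rule dpart_support_bounded(2)[OF F]) auto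
 hence Fi: "Lint F" by simp
 have b: "EX C. ALL t:{0<..<1}. ALL x. \<bar>dpart is (hc t F) x\<bar> <= C * t powr (min (real k + \<theta> - real (length is)) 0 / 2)"
  if h: "set is <= Basis" for "is"
 proof (cases "length is <= k")
  case True
  obtain B where B: "!!x. \<bar>dpart is F x\<bar> <= B" using dpart_support_bounded(1)[OF F h True] by blast
  have i: "Lint (dpart is F)" using dpart_support_bounded(2)[OF F h True] by blast
  obtain C where C: "!!t x. t > 0 ==> \<bar>hc t (dpart is F) x\<bar> <= C"
   using hc_dpart_bounded[of "[]", OF _ i B] by auto
  have "\<bar>dpart is (hc t F) x\<bar> <= C * t powr (min (real k + \<theta> - real (length is)) 0 / 2)" if "t : {0<..<1}" for t x
  proof -
   have "dpart is (hc t F) = hc t (dpart is F)" by (rule hc_dpart_transfer[OF F _ h True]) (use that in auto)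
   thus ?thesis using C[of t x] that True \<theta> by (auto simp: min_def)
  qed
  thus ?thesis by blast
 next
  case False
  \<comment> \<open>The tail of the list holds the derivatives applied first: k of them go to F, the
    remaining \<open>ks\<close> stay on the kernel.\<close>
  define js where "js = drop (length is - k) is"
  define ks where "ks = take (length is - k) is"
  have kj: "is = ks @ js" "length js = k" "length ks = length is - k" "ks ~= []" using False by (auto simp: js_def ks_def)
  have s: "set ks <= Basis" "set js <= Basis" using kj(1) h by auto
  obtain H where H': "!!x y. \<bar>dpart js F x - dpart js F y\<bar> <= H * dist x y powr \<theta>" using H[OF s(2) kj(2)] by blast
  have i: "Lint (dpart js F)" using dpart_support_bounded(2)[OF F s(2)] kj by blast
  obtain C where C: "!!t x. t > 0 ==> \<bar>dpart ks (hc t (dpart js F)) x\<bar> <= C * t powr ((\<theta> - real (length ks)) / 2)"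
   using hc_dpart_holder[OF s(1) kj(4) \<theta> i H'] by blast
  have "min (real k + \<theta> - real (length is)) 0 / 2 = (\<theta> - real (length ks)) / 2" using kj(3) False \<theta> by (auto simp: min_def of_nat_diff)
  moreover have "dpart is (hc t F) = dpart ks (hc t (dpart js F))" if "t > 0" for t
   unfolding kj(1) dpart_append using hc_dpart_transfer[OF F that s(2)] kj(2) by simp
  ultimately show ?thesis using C by (intro exI[of _ C]) auto
 qed
 have N: "real DIM('a) + (real k + \<theta>) = real (DIM('a) + k) + \<theta>" by simp
 show "Ck_on (DIM('a) + k) UNIV (VT F)"
  by (rule VT_regular(1)[OF Fi b N \<theta>])
 show "set is <= Basis ==> length is = DIM('a) + k ==> EX C. ALL x y. \<bar>dpart is (VT F) x - dpart is (VT F) y\<bar> <= C * dist x y powr \<theta>"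
  by (rule VT_regular(2)[OF Fi b N \<theta>])
qed

section \<open>Densities with a power singularity at the origin\<close>

text \<open>Since p <= 0 and |y_b| <= |y|, the factor |y|^(p/n) is at most |y_b|^(p/n) for every
  coordinate b; the product of these is integrable because p/n > -1. The coordinate hyperplanes,
  where the comparison breaks down, are null sets.\<close>

lemma integrable_norm_powr_ball:
 assumes p: "- real DIM('a::euclidean_space) < p" "p <= 0"
 shows "Lint (%y::'a. ind (cball 0 1) y * norm y powr p)"
proof (rule integrable_dom)
 define q where "q = p / real DIM('a)"
 have q: "-1 < q" "q <= 0" using p by (simp_all add: q_def field_simps)
 have i1: "Lint (%s::real. ind {-1..1} s * \<bar>s\<bar> powr q)"
 proof -
  have "(%x. x powr q) integrable_on {0<..1}" using q by (intro integrable_on_powr_from_0') auto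
  hence a: "Lint (%x::real. ind {0<..1} x * x powr q)" by (intro integrable_lborel_of_HK) auto
  have "Lint (%s::real. ind {0<..1} s * s powr q + ind {0<..1} (- s) * (- s) powr q)"
   using a integrable_lborel_affine[OF a, of "-1" 0] by (intro Bochner_Integration.integrable_add) simp_all
  thus ?thesis
   by (rule integrable_dom) (auto simp: indicator_def)
 qed
 show "Lint (%y::'a. \<Prod>b\<in>Basis. ind {-1..1} (y \<bullet> b) * \<bar>y \<bullet> b\<bar> powr q)"
  by (rule integrable_lborel_prod[of "%_ s. ind {-1..1} s * \<bar>s\<bar> powr q"]) (rule i1)
 have "AE y in lborel. ALL b:Basis. (y::'a) \<bullet> b ~= 0"
  by (subst AE_finite_all[OF finite_Basis]) (auto intro: AE_lborel_inner_neq)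
 thus "AE y::'a in lborel. norm (ind (cball 0 1) y * norm y powr p) <= norm (\<Prod>b\<in>Basis. ind {-1..1} (y \<bullet> b) * \<bar>y \<bullet> b\<bar> powr q :: real)"
 proof eventually_elim
  case (elim y)
  show ?case
  proof (cases "norm y <= 1")
   case True
   have "norm y powr p = (\<Prod>b\<in>(Basis::'a set). norm y powr q)"
   proof -
    obtain b :: 'a where "b : Basis" using nonempty_Basis by blast
    hence "0 < norm y" using elim by force
    hence "(norm y powr q) ^ DIM('a) = norm y powr (q * real DIM('a))"
     by (simp add: powr_realpow[symmetric] powr_powr)
    thus ?thesis by (simp add: q_def)
   qed
   also have "\<dots> <= (\<Prod>b\<in>Basis. ind {-1..1} (y \<bullet> b) * \<bar>y \<bullet> b\<bar> powr q)"
   proof (intro prod_mono conjI)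
    fix b :: 'a assume b: "b : Basis"
    have "\<bar>y \<bullet> b\<bar> <= norm y" by (rule Basis_le_norm[OF b])
    moreover have "0 < \<bar>y \<bullet> b\<bar>" using elim b by simp
    ultimately have "norm y powr q <= \<bar>y \<bullet> b\<bar> powr q" using q by (intro powr_mono2') auto
    moreover have "y \<bullet> b : {-1..1}" using \<open>\<bar>y \<bullet> b\<bar> <= norm y\<close> True by auto
    ultimately show "norm y powr q <= ind {-1..1} (y \<bullet> b) * \<bar>y \<bullet> b\<bar> powr q" by simp
   qed simp
   finally show ?thesis using True by (simp add: abs_prod)
  qed simp
 qed
 show "(%y::'a. ind (cball 0 1) y * norm y powr p) : borel_measurable lborel"
 proof -
  have [measurable]: "cball (0::'a) 1 : sets borel" by simp
  have "(%y::'a. ind (cball 0 1) y * norm y powr p) : bmeas" by measurable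
  thus ?thesis by simp
 qed
qed

text \<open>After scaling it remains to bound the integral of (1 + |x - y|^2)^(-n) |y|^p uniformly
  in x. A majorant homogeneous of degree p thus acts like regularity sigma = p.\<close>

lemma hc_dpart_singular:
 fixes F :: "'a::euclidean_space => real"
 assumes h: "set is <= Basis" and p: "- real DIM('a) < p" "p <= 0"
  and F: "Lint F" "AE y in lborel. \<bar>F y\<bar> <= B * norm y powr p" and B: "0 <= B"
 shows "EX C. ALL t>0. ALL x. \<bar>dpart is (hc t F) x\<bar> <= C * t powr ((p - real (length is)) / 2)"
proof -
 let ?n = "DIM('a)"
 obtain C where C: "C >= 0" "!!t x. t > 0 ==> \<bar>dpart is (hk t) (x::'a)\<bar> <= C * (1 / sqrt t) ^ (?n + length is) / (1 + (sq x) / t) ^ ?n"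
  using hk_dpart_bound[OF h, of ?n] by blast
 have pos: "0 < 1 + sq v" for v :: 'a by (simp add: add_pos_nonneg)
 have i1: "Lint (%y::'a. ind (cball 0 1) y * norm y powr p)" by (rule integrable_norm_powr_ball[OF p])
 have i2: "Lint (%y::'a. 1 / (1 + sq y) ^ ?n)" by (rule integrable_one_plus_norm_power) simp
 define K where "K = (LBINT y. ind (cball 0 1) (y::'a) * norm y powr p) + (LBINT y. 1 / (1 + (y::'a) \<bullet> y) ^ ?n)"
 define g where "g x y = 1 / (1 + (x - y) \<bullet> (x - y)) ^ ?n * norm y powr p" for x y :: 'a
 have [measurable]: "g x : bmeas" for x unfolding g_def by measurable
 have g0: "0 <= g x y" for x y unfolding g_def using pos[of "x - y"] by simp
 \<comment> \<open>In the unit ball the decaying factor is at most 1, outside it |y|^p is at most 1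
   because p <= 0; both majorants have integrals independent of x.\<close>
 have gb: "g x y <= ind (cball 0 1) y * norm y powr p + 1 / (1 + (x - y) \<bullet> (x - y)) ^ ?n" for x y
 proof (cases "norm y <= 1")
  case True
  have "1 <= (1 + (x - y) \<bullet> (x - y)) ^ ?n" by (intro one_le_power) simp
  hence "1 / (1 + (x - y) \<bullet> (x - y)) ^ ?n <= 1" using frac_le[of "1::real" 1 1 "(1 + (x - y) \<bullet> (x - y)) ^ ?n"] by simp
  hence "g x y <= 1 * norm y powr p" unfolding g_def by (rule mult_right_mono) simp
  thus ?thesis using True pos[of "x - y"] by (simp add: add_increasing2)
 next
  case False
  have "norm y powr p <= norm y powr 0" using False p by (intro powr_mono) auto
  hence "norm y powr p <= 1" using False by (auto split: if_splits)
  hence "g x y <= 1 / (1 + (x - y) \<bullet> (x - y)) ^ ?n * 1" unfolding g_def using pos[of "x - y"] by (intro mult_left_mono) auto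
  thus ?thesis using False by simp
 qed
 have i3: "Lint (%y. ind (cball 0 1) y * norm y powr p + 1 / (1 + (x - y) \<bullet> (x - y)) ^ ?n)" for x :: 'a
  using i1 integrable_lborel_translate(2)[OF i2, of x] by (rule Bochner_Integration.integrable_add)
 have gi: "Lint (g x)" for x
  by (rule integrable_dom[OF i3[of x]]) (use gb g0 in \<open>auto intro: order_trans[OF _ abs_ge_self]\<close>)
 have gK: "(LBINT y. g x y) <= K" for x
 proof -
  have "(LBINT y. g x y) <= (LBINT y. ind (cball 0 1) y * norm y powr p + 1 / (1 + (x - y) \<bullet> (x - y)) ^ ?n)"
   by (rule integral_mono[OF gi i3 gb])
  also have "\<dots> = K" unfolding K_def
   using i1 integrable_lborel_translate(2)[OF i2, of x] integral_lborel_translate(2)[OF i2, of x] by simp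
  finally show ?thesis .
 qed
 have "\<bar>dpart is (hc t F) x\<bar> <= (B * C * K) * t powr ((p - real (length is)) / 2)" if t: "t > 0" for t x
 proof -
  have s: "1 / sqrt t ~= 0" using t by simp
  define c where "c = 1 / sqrt t"
  have c: "c > 0" using t by (simp add: c_def)
  have ge: "(1 / (1 + ((x - y) \<bullet> (x - y)) / t) ^ ?n) * norm y powr p = c powr (- p) * g (c *\<^sub>R x) (0 + c *\<^sub>R y)" for y
  proof -
   have "(c *\<^sub>R x - c *\<^sub>R y) \<bullet> (c *\<^sub>R x - c *\<^sub>R y) = ((x - y) \<bullet> (x - y)) / t"
    using inner_scale_sqrt[OF t, of "x - y"] by (simp add: c_def scaleR_diff_right[symmetric])
   moreover have "norm y powr p = c powr (- p) * norm (c *\<^sub>R y) powr p"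
    using c by (simp add: powr_mult powr_minus)
   ultimately show ?thesis unfolding g_def by simp
  qed
  have ig: "Lint (%y. g (c *\<^sub>R x) (0 + c *\<^sub>R y))" using integrable_lborel_affine[OF gi[of "c *\<^sub>R x"], of c 0] c by simp
  have Ig: "c ^ ?n * (LBINT y. g (c *\<^sub>R x) (0 + c *\<^sub>R y)) <= K"
   using integral_lborel_affine[OF gi[of "c *\<^sub>R x"], of c 0] gK[of "c *\<^sub>R x"] c by simp
  have i4: "Lint (%y. dpart is (hk t) (x - y) * F y)" using hc_Ck(2)[OF F(1) t h] by blast
  have "\<bar>dpart is (hc t F) x\<bar> = \<bar>(LBINT y. dpart is (hk t) (x - y) * F y)\<bar>" using hc_Ck(2)[OF F(1) t h] by simp
  also have "\<dots> <= (LBINT y. \<bar>dpart is (hk t) (x - y) * F y\<bar>)" by (rule integral_abs_bound)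
  also have "\<dots> <= (LBINT y. (C * c ^ (?n + length is)) * (B * (c powr (- p) * g (c *\<^sub>R x) (0 + c *\<^sub>R y))))"
  proof (rule integral_mono_AE)
   show "AE y in lborel. \<bar>dpart is (hk t) (x - y) * F y\<bar> <= (C * c ^ (?n + length is)) * (B * (c powr (- p) * g (c *\<^sub>R x) (0 + c *\<^sub>R y)))"
    using F(2)
   proof eventually_elim
    case (elim y)
    have "\<bar>dpart is (hk t) (x - y)\<bar> * \<bar>F y\<bar> <= (C * c ^ (?n + length is) / (1 + ((x - y) \<bullet> (x - y)) / t) ^ ?n) * (B * norm y powr p)"
     using C(2)[OF t, of "x - y"] elim B by (intro mult_mono) (auto simp: c_def intro: order_trans[OF abs_ge_zero])
    thus ?case unfolding ge[symmetric] by (simp add: abs_mult mult_ac)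
   qed
  qed (use i4 ig in auto)
  also have "\<dots> = (C * c ^ length is) * (B * (c powr (- p) * (c ^ ?n * (LBINT y. g (c *\<^sub>R x) (0 + c *\<^sub>R y)))))"
   by (simp add: power_add mult_ac)
  also have "\<dots> <= (C * c ^ length is) * (B * (c powr (- p) * K))"
   using Ig C(1) c B by (intro mult_left_mono) auto
  also have "\<dots> = (B * C * K) * (t powr (- real (length is) / 2) * c powr (- p))"
   using inverse_sqrt_power[OF t, of "length is"] by (simp add: c_def mult_ac)
  also have "c powr (- p) = t powr (p / 2)"
  proof -
   have "c = t powr (- 1 / 2)" using inverse_sqrt_power[OF t, of 1] by (simp add: c_def)
   thus ?thesis by (simp add: powr_powr)
  qed
  also have "t powr (- real (length is) / 2) * t powr (p / 2) = t powr ((p - real (length is)) / 2)"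
   by (simp add: powr_add[symmetric] diff_divide_distrib)
  finally show ?thesis .
 qed
 thus ?thesis by blast
qed

section \<open>Smooth cutoff functions\<close>

text \<open>The flat functions s^(-m) exp(-1/s). Carrying the power m makes the family closed under
  differentiation, so smoothness is a single induction for all m.\<close>

definition eflat :: "nat => real => real" where
 "eflat m s = (if s > 0 then (1 / s) ^ m * exp (- 1 / s) else 0)"

text \<open>A bound of order s^2 forces the difference quotient at the origin to tend to 0.\<close>

lemma eflat_bound: "EX C. ALL s. \<bar>eflat m s\<bar> <= C * s\<^sup>2"
proof -
 obtain C where C: "ALL z>=0. exp (- z / 4 :: real) * (1 + z) ^ (m + 2) <= C"
  using exp_one_plus_power_bounded[of "m + 2"] by (elim exE)
 have C0: "0 <= C" using C[rule_format, of 0] by simp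
 have "\<bar>eflat m s\<bar> <= C * s\<^sup>2" for s
 proof (cases "s > 0")
  case True
  have "exp (- 1 / s) * (1 / s) ^ (m + 2) <= exp (- 1 / s) * (1 + 4 / s) ^ (m + 2)"
  proof (intro mult_left_mono power_mono)
   show "1 / s <= 1 + 4 / s" using True by (simp add: field_simps)
  qed (use True in auto)
  also have "\<dots> <= C" using C[rule_format, of "4 / s"] True by simp
  finally have "(exp (- 1 / s) * (1 / s) ^ (m + 2)) * s\<^sup>2 <= C * s\<^sup>2" by (rule mult_right_mono) simp
  moreover have "(exp (- 1 / s) * (1 / s) ^ (m + 2)) * s\<^sup>2 = eflat m s"
  proof -
   have "(1 / s) ^ (m + 2) * s\<^sup>2 = (1 / s) ^ m"
    using True by (simp only: power_add mult.assoc power_mult_distrib[symmetric]) simp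
   thus ?thesis using True by (simp only: eflat_def if_True mult.assoc) (simp only: mult.commute)
  qed
  moreover have "0 <= eflat m s" by (simp add: eflat_def)
  ultimately show ?thesis by simp
 next
  case False thus ?thesis using C0 by (simp add: eflat_def)
 qed
 thus ?thesis by blast
qed

lemma eflat_deriv: "(eflat m has_real_derivative (eflat (m + 2) s - real m * eflat (m + 1) s)) (at s)"
proof -
 consider "s < 0" | "s = 0" | "s > 0" by linarith
 thus ?thesis
 proof cases
  case 1
  have "((%s. 0::real) has_real_derivative 0) (at s)" by simp
  hence "(eflat m has_real_derivative 0) (at s)"
   by (rule has_field_derivative_transform_within_open[of _ _ _ "{..<0}"]) (use 1 in \<open>auto simp: eflat_def\<close>)
  thus ?thesis using 1 by (simp add: eflat_def)
 next
  case 2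
  obtain C where C: "!!s. \<bar>eflat m s\<bar> <= C * s\<^sup>2" using eflat_bound by blast
  have "((%h. (eflat m (0 + h) - eflat m 0) / h) \<longlongrightarrow> 0) (at 0)"
  proof (rule Lim_null_comparison)
   have "norm ((eflat m (0 + h) - eflat m 0) / h) <= C * \<bar>h\<bar>" for h
   proof (cases "h = 0")
    case False
    thus ?thesis using C[of h] by (simp add: eflat_def[of m 0] abs_divide divide_le_eq power2_eq_square mult.assoc abs_mult[symmetric])
   qed simp
   thus "\<forall>\<^sub>F h in at 0. norm ((eflat m (0 + h) - eflat m 0) / h) <= C * \<bar>h\<bar>" by simp
   show "((%h. C * \<bar>h\<bar>) \<longlongrightarrow> 0) (at 0)" by (auto intro!: tendsto_eq_intros)
  qed
  thus ?thesis using 2 by (simp add: DERIV_def eflat_def)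
 next
  case 3
  have "((%s. (1 / s) ^ m * exp (- 1 / s)) has_real_derivative (eflat (m + 2) s - real m * eflat (m + 1) s)) (at s)"
  proof (cases m)
   case 0
   show ?thesis using 3 by (auto intro!: derivative_eq_intros simp: eflat_def 0 power2_eq_square field_simps)
  next
   case (Suc k)
   have "((%s. (1 / s) ^ m * exp (- 1 / s)) has_real_derivative
     (1 / s) ^ m * (exp (- 1 / s) * (1 / s\<^sup>2)) + real m * ((1 / s) ^ (m - 1) * (- (1 / s\<^sup>2))) * exp (- 1 / s)) (at s)"
    using 3 by (auto intro!: derivative_eq_intros simp: power2_eq_square)
   thus ?thesis using 3 by (simp add: eflat_def Suc power2_eq_square algebra_simps)
  qed
  thus ?thesis
   by (rule has_field_derivative_transform_within_open[of _ _ _ "{0<..}"]) (use 3 in \<open>auto simp: eflat_def\<close>)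
 qed
qed

lemma eflat_Ck: "Ck_on k UNIV (eflat m)"
proof (induction k arbitrary: m)
 case 0
 show ?case using eflat_deriv by (auto intro!: continuous_at_imp_continuous_on intro: DERIV_isCont)
next
 case (Suc k)
 show ?case
  by (rule Ck_on_real_SucI[OF open_UNIV eflat_deriv])
   (use Ck_on_add[OF open_UNIV Suc[of "m + 2"] Ck_on_mult[OF open_UNIV Ck_on_const[of k UNIV "- real m"] Suc[of "m + 1"]]] in simp)
qed

text \<open>A smooth transition from 1 for s <= 1/4 to 0 for s >= 1. The thresholds are squares:
  evaluated at |x|^2 / r^2 they become the radii r/2 and r, and squaring the norm avoids its
  singularity at 0.\<close>

definition step :: "real => real" where
 "step s = eflat 0 (1 - s) * inverse (eflat 0 (1 - s) + eflat 0 (s - 1 / 4))"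

lemma step_pos: "0 < eflat 0 (1 - s) + eflat 0 (s - 1 / 4)"
 by (auto simp: eflat_def add_pos_nonneg add_nonneg_pos)

lemma step_Ck: "Ck_on k UNIV step"
proof -
 have a: "Ck_on k UNIV (%s. eflat 0 (1 - s))"
  using Ck_on_affine[OF open_UNIV eflat_Ck[of k 0], of "- 1" 1] by simp
 have b: "Ck_on k UNIV (%s. eflat 0 (s - 1 / 4))"
  using Ck_on_affine[OF open_UNIV eflat_Ck[of k 0], of 1 "- 1 / 4"] by simp
 have "Ck_on k UNIV (%s. inverse (eflat 0 (1 - s) + eflat 0 (s - 1 / 4)))"
  by (rule Ck_on_compose[OF open_UNIV _ Ck_on_inverse Ck_on_add[OF open_UNIV a b]]) (use step_pos in auto)
 thus ?thesis unfolding step_def[abs_def] by (intro Ck_on_mult a) auto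
qed

lemma step_eq_1: "s <= 1 / 4 ==> step s = 1" and step_eq_0: "1 <= s ==> step s = 0"
 and step_bounds: "0 <= step s" "step s <= 1"
proof -
 show "s <= 1 / 4 ==> step s = 1" by (simp add: step_def eflat_def)
 show "1 <= s ==> step s = 0" by (simp add: step_def eflat_def)
 have "0 <= eflat 0 (1 - s)" "0 <= eflat 0 (s - 1 / 4)" by (auto simp: eflat_def)
 thus "0 <= step s" "step s <= 1" using step_pos[of s]
  by (auto simp: step_def divide_inverse[symmetric] divide_le_eq)
qed

definition cutoff :: "real => 'a::euclidean_space => real" where
 "cutoff r x = step ((1 / r\<^sup>2) * (sq x))"

lemma Ck_on_inner_self: "Ck_on k UNIV (%x::'a::euclidean_space. sq x)"
proof -
 have "Ck_on k UNIV (%x::'a. \<Sum>b\<in>Basis. (x \<bullet> b) * (x \<bullet> b))"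
  by (intro Ck_on_sum Ck_on_mult Ck_on_inner) auto
 thus ?thesis by (subst euclidean_inner)
qed

lemma cutoff_Ck: "Ck_on k UNIV (cutoff r)"
 unfolding cutoff_def[abs_def]
 by (rule Ck_on_compose[OF open_UNIV open_UNIV step_Ck]; (intro Ck_on_mult Ck_on_const Ck_on_inner_self open_UNIV)?) auto

lemma cutoff_eq_1: "r > 0 ==> norm x <= r / 2 ==> cutoff r x = 1"
proof -
 assume "r > 0" "norm x <= r / 2"
 hence "(norm x)\<^sup>2 <= (r / 2)\<^sup>2" by (intro power_mono) auto
 hence "(1 / r\<^sup>2) * (sq x) <= 1 / 4" using \<open>r > 0\<close> by (simp add: power2_norm_eq_inner power_divide field_simps)
 thus ?thesis unfolding cutoff_def by (rule step_eq_1)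
qed

lemma cutoff_eq_0: "r > 0 ==> norm x >= r ==> cutoff r x = 0"
proof -
 assume "r > 0" "norm x >= r"
 hence "r\<^sup>2 <= (norm x)\<^sup>2" by (intro power_mono) auto
 hence "1 <= (1 / r\<^sup>2) * (sq x)" using \<open>r > 0\<close> by (simp add: power2_norm_eq_inner field_simps)
 thus ?thesis unfolding cutoff_def by (rule step_eq_0)
qed

lemma cutoff_bounds: "0 <= cutoff r x" "cutoff r x <= 1"
 unfolding cutoff_def using step_bounds by auto

lemma cutoff_measurable [measurable]: "cutoff r : bmeas"
 using Ck_on_continuous[OF cutoff_Ck] borel_measurable_continuous_onI by blast

section \<open>Bounded smooth functions and the kernel away from its singularity\<close>

definition bsmooth :: "('a::euclidean_space => real) => bool" where
 "bsmooth \<eta> \<longleftrightarrow> smooth_on UNIV \<eta> & (ALL is. set is <= Basis --> (EX B. ALL x. \<bar>dpart is \<eta> x\<bar> <= B))"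

lemma bsmooth_Ck: "bsmooth \<eta> ==> Ck_on k UNIV \<eta>"
 unfolding bsmooth_def smooth_on_def by blast

lemma bsmooth_partial: "bsmooth \<eta> ==> i : Basis ==> bsmooth (partial i \<eta>)"
proof -
 assume b: "bsmooth \<eta>" and i: "i : Basis"
 have "Ck_on k UNIV (partial i \<eta>)" for k using bsmooth_Ck[OF b, of "Suc k"] i by (simp add: Ck_on_Suc)
 moreover have "EX B. ALL x. \<bar>dpart is (partial i \<eta>) x\<bar> <= B" if "set is <= Basis" for "is"
 proof -
  have "ALL is. set is <= Basis --> (EX B. ALL x. \<bar>dpart is \<eta> x\<bar> <= B)" using b unfolding bsmooth_def by blast
  hence "set (is @ [i]) <= Basis --> (EX B. ALL x. \<bar>dpart (is @ [i]) \<eta> x\<bar> <= B)" by (rule spec)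
  thus ?thesis using i that by (simp add: dpart_append)
 qed
 ultimately show ?thesis unfolding bsmooth_def smooth_on_def by blast
qed

lemma bsmooth_support:
 fixes \<eta> :: "'a::euclidean_space => real"
 assumes "!!k. Ck_on k UNIV \<eta>" "!!x. norm x > R ==> \<eta> x = 0"
 shows "bsmooth \<eta>"
 unfolding bsmooth_def smooth_on_def
proof (intro conjI allI impI assms(1))
 fix "is" :: "'a list" assume "set is <= Basis"
 thus "EX B. ALL x. \<bar>dpart is \<eta> x\<bar> <= B"
  by (intro dpart_support_bounded(1)[where k="length is" and R=R and F=\<eta>]) (use assms in auto)
qed

lemma dpart_const_bounded: "EX B. ALL x::'a::euclidean_space. \<bar>dpart is (%x. c::real) x\<bar> <= B"
proof (cases "is" rule: rev_cases)
 case (snoc js i)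
 have "partial i (%x::'a. c) = (%x. 0)" using has_partial_imp[OF has_partial_const] by blast
 thus ?thesis unfolding snoc dpart_append by auto
qed auto

lemma bsmooth_one_minus: "bsmooth \<eta> ==> bsmooth (%x. 1 - \<eta> x)"
proof -
 assume b: "bsmooth \<eta>"
 have e: "(%x. 1 - \<eta> x) = (%x. 1 + (- 1) * \<eta> x)" by auto
 have c: "Ck_on k UNIV (%x. (- 1) * \<eta> x)" for k by (intro Ck_on_mult bsmooth_Ck[OF b]) auto
 have "EX B. ALL x. \<bar>dpart is (%x. 1 + (- 1) * \<eta> x) x\<bar> <= B" if h: "set is <= Basis" for "is"
 proof -
  obtain B1 where B1: "!!x::'a. \<bar>dpart is (%x. 1::real) x\<bar> <= B1" using dpart_const_bounded by blast
  obtain B2 where B2: "!!x. \<bar>dpart is \<eta> x\<bar> <= B2" using b h unfolding bsmooth_def by blast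
  have "dpart is (%x. 1 + (- 1) * \<eta> x) x = dpart is (%x. 1) x + (- 1) * dpart is \<eta> x" for x
   using dpart_add[OF open_UNIV Ck_on_const c h UNIV_I] dpart_linear[OF bounded_linear_mult_right open_UNIV bsmooth_Ck[OF b] h UNIV_I, of "-1"] by simp
  hence "\<bar>dpart is (%x. 1 + (- 1) * \<eta> x) x\<bar> <= B1 + B2" for x
   using B1[of x] B2[of x] by simp
  thus ?thesis by blast
 qed
 thus ?thesis unfolding e bsmooth_def smooth_on_def using Ck_on_add[OF open_UNIV Ck_on_const c] by blast
qed

lemma bsmooth_cutoff: "r > 0 ==> bsmooth (cutoff r)"
 by (rule bsmooth_support[OF cutoff_Ck, of r]) (simp add: cutoff_eq_0)

text \<open>For |x| >= r the factor (1 + |x|^2 / t)^(-N) is at most (t / r^2)^N, which more than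
  compensates t^(-N/2); N is chosen as the number of factors 1 / sqrt t.\<close>

lemma hk_dpart_away_bounded:
 assumes h: "set js <= (Basis :: 'a::euclidean_space set)" and r: "r > 0"
 shows "EX B. ALL t:{0<..1}. ALL x::'a. norm x >= r --> \<bar>dpart js (hk t) x\<bar> <= B"
proof -
 let ?N = "DIM('a) + length js"
 obtain C where C: "C >= 0" "!!t x. t > 0 ==> \<bar>dpart js (hk t) (x::'a)\<bar> <= C * (1 / sqrt t) ^ ?N / (1 + (sq x) / t) ^ ?N"
  using hk_dpart_bound[OF h, of ?N] by blast
 have "\<bar>dpart js (hk t) x\<bar> <= C * (1 / r\<^sup>2) ^ ?N" if t: "t : {0<..1}" and x: "norm x >= r" for t x
 proof -
  have "r\<^sup>2 <= sq x" using x r by (simp add: power2_norm_eq_inner[symmetric] power_mono)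
  hence xt: "r\<^sup>2 / t <= 1 + (sq x) / t" using t by (simp add: field_simps)
  have rt: "0 < r\<^sup>2 / t" using r t by simp
  have st: "sqrt t * sqrt t = t" "0 < sqrt t" "sqrt t <= 1" using t by auto
  have "(1 / sqrt t) / (1 + (sq x) / t) <= (1 / sqrt t) / (r\<^sup>2 / t)"
   using xt rt st by (intro divide_left_mono mult_pos_pos) auto
  also have "\<dots> = sqrt t / r\<^sup>2" using st r by (simp add: field_simps)
  also have "\<dots> <= 1 / r\<^sup>2" using st r by (intro divide_right_mono) auto
  finally have "((1 / sqrt t) / (1 + (sq x) / t)) ^ ?N <= (1 / r\<^sup>2) ^ ?N"
   using st xt rt by (intro power_mono) auto
  hence "C * ((1 / sqrt t) / (1 + (sq x) / t)) ^ ?N <= C * (1 / r\<^sup>2) ^ ?N" using C(1) by (rule mult_left_mono)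
  moreover have "C * (1 / sqrt t) ^ ?N / (1 + (sq x) / t) ^ ?N = C * ((1 / sqrt t) / (1 + (sq x) / t)) ^ ?N"
   by (simp only: power_divide times_divide_eq_right)
  ultimately show ?thesis using C(2)[of t x] t by (metis greaterThanAtMost_iff order_trans)
 qed
 thus ?thesis by blast
qed

text \<open>The Leibniz rule as an induction that peels off the derivative applied first. It falls
  either on \<eta>, whose partial derivative again vanishes near 0, or on the kernel; hence the
  generality in \<eta> and \<open>js\<close>.\<close>

lemma cut_hk_dpart_bounded:
 assumes r: "r > 0"
 shows "set is <= Basis ==> set js <= Basis ==> bsmooth \<eta> ==> (!!x::'a::euclidean_space. norm x < r ==> \<eta> x = 0) ==>
  EX B. ALL t:{0<..1}. ALL x. \<bar>dpart is (%x. \<eta> x * dpart js (hk t) x) x\<bar> <= B"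
proof (induction "is" arbitrary: js \<eta> rule: rev_induct)
 case Nil
 obtain B1 where B1: "!!x. \<bar>dpart [] \<eta> x\<bar> <= B1" using Nil.prems(3) unfolding bsmooth_def by (metis empty_subsetI list.set(1))
 obtain B2 where B2: "!!t x. t : {0<..1} ==> norm x >= r ==> \<bar>dpart js (hk t) x\<bar> <= B2"
  using hk_dpart_away_bounded[OF Nil.prems(2) r] by blast
 have "\<bar>\<eta> x * dpart js (hk t) x\<bar> <= max (B1 * B2) 0" if "t : {0<..1}" for t x
 proof (cases "norm x < r")
  case True thus ?thesis using Nil.prems(4) by simp
 next
  case False
  have "\<bar>\<eta> x\<bar> * \<bar>dpart js (hk t) x\<bar> <= B1 * B2"
   using B1[of x] B2[OF that, of x] False by (intro mult_mono) (auto intro: order_trans[OF abs_ge_zero])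
  thus ?thesis by (simp add: abs_mult)
 qed
 thus ?case by (intro exI[of _ "max (B1 * B2) 0"]) auto
next
 case (snoc i "is")
 have i: "i : Basis" and s: "set is <= Basis" using snoc.prems by auto
 have z: "partial i \<eta> x = 0" if "norm x < r" for x
 proof -
  have "partial i \<eta> x = partial i (%x. 0) x"
   by (rule partial_cong[of "ball 0 r"]) (use that snoc.prems(4) in auto)
  thus ?thesis using has_partial_imp[OF has_partial_const] by metis
 qed
 obtain B1 where B1: "ALL t:{0<..1}. ALL x. \<bar>dpart is (%x. partial i \<eta> x * dpart js (hk t) x) x\<bar> <= B1"
  using snoc.IH[OF s snoc.prems(2) bsmooth_partial[OF snoc.prems(3) i] z] by blast
 obtain B2 where B2: "ALL t:{0<..1}. ALL x. \<bar>dpart is (%x. \<eta> x * dpart (i # js) (hk t) x) x\<bar> <= B2"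
  using snoc.IH[OF s _ snoc.prems(3,4), of "i # js"] i snoc.prems(2) by auto
 have "\<bar>dpart (is @ [i]) (%x. \<eta> x * dpart js (hk t) x) x\<bar> <= B1 + B2" if t: "t : {0<..1}" for t x
 proof -
  have d: "Ck_on k UNIV (dpart ks (hk t :: 'a => real))" if "set ks <= Basis" for k ks
   using Ck_on_dpart[OF hk_Ck that] .
  have "has_partial i (%x. \<eta> x * dpart js (hk t) x) x (\<eta> x * dpart (i # js) (hk t) x + partial i \<eta> x * dpart js (hk t) x)" for x
  proof (rule has_partial_mult)
   show "has_partial i \<eta> x (partial i \<eta> x)" using bsmooth_Ck[OF snoc.prems(3), of 1] i by (simp add: Ck_on_Suc)
   show "has_partial i (dpart js (hk t)) x (dpart (i # js) (hk t) x)"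
    using d[OF snoc.prems(2), of 1] i by (simp add: Ck_on_Suc)
  qed
  hence e: "partial i (%x. \<eta> x * dpart js (hk t) x) = (%x. \<eta> x * dpart (i # js) (hk t) x + partial i \<eta> x * dpart js (hk t) x)"
   using has_partial_imp by blast
  have c1: "Ck_on (length is) UNIV (%x. \<eta> x * dpart (i # js) (hk t) x)"
   using i snoc.prems(2) by (intro Ck_on_mult bsmooth_Ck[OF snoc.prems(3)] d) auto
  have c2: "Ck_on (length is) UNIV (%x. partial i \<eta> x * dpart js (hk t) x)"
   using i snoc.prems(2) by (intro Ck_on_mult bsmooth_Ck[OF bsmooth_partial[OF snoc.prems(3)]] d) auto
  have "dpart (is @ [i]) (%x. \<eta> x * dpart js (hk t) x) x =
    dpart is (%x. \<eta> x * dpart (i # js) (hk t) x) x + dpart is (%x. partial i \<eta> x * dpart js (hk t) x) x"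
   unfolding dpart_append using e dpart_add[OF open_UNIV c1 c2 s UNIV_I] by simp
  moreover have "\<bar>dpart is (%x. partial i \<eta> x * dpart js (hk t) x) x\<bar> <= B1" using B1 t by blast
  moreover have "\<bar>dpart is (%x. \<eta> x * dpart (i # js) (hk t) x) x\<bar> <= B2" using B2 t by blast
  ultimately show ?thesis by linarith
 qed
 thus ?case by blast
qed

text \<open>Stated for every weight \<omega> below \<open>hw\<close>, so that it serves the full
  kernel and all its truncations at once.\<close>

lemma
 fixes \<eta> :: "'a::euclidean_space => real"
 assumes r: "r > 0" and \<eta>: "bsmooth \<eta>" "!!x. norm x < r ==> \<eta> x = 0"
  and \<omega>: "\<omega> : bmeas" "!!t. 0 <= \<omega> t" "!!t. \<omega> t <= hw DIM('a) t"
 shows cut_weighted: "smooth_on UNIV (%x. \<eta> x * (LBINT t. \<omega> t * hk t x))" (is "smooth_on UNIV ?F")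
   "set js <= Basis ==> Lint (%t. \<omega> t * dpart js (%x. \<eta> x * hk t x) x) &
    dpart js (%x. \<eta> x * (LBINT t. \<omega> t * hk t x)) x = (LBINT t. \<omega> t * dpart js (%x. \<eta> x * hk t x) x)"
    (is "_ ==> ?D js x")
proof -
 note [measurable] = \<omega>(1)
 have wi: "Lint \<omega>"
  by (rule integrable_dom[OF integrable_hw[OF DIM_positive[where 'a='a], of 1]])
   (use \<omega> order_trans[OF \<omega>(2,3)] in auto)
 have w0: "\<omega> t = 0" if "t ~: {0<..<1}" for t using \<omega>(2,3)[of t] that by (auto simp: hw_def)
 have m: "(%t. \<omega> t * (\<eta> x * hk t x)) : borel_measurable lborel" for x by measurable
 have c1: "Ck_on k UNIV (%x. \<eta> x * hk t x)" for t k by (intro Ck_on_mult bsmooth_Ck \<eta> hk_Ck) auto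
 have c: "Ck_on k UNIV (%x. \<omega> t * (\<eta> x * hk t x))" for t k by (intro Ck_on_mult c1) auto
 have d: "dpart js (%x. \<omega> t * (\<eta> x * hk t x)) x = \<omega> t * dpart js (%x. \<eta> x * hk t x) x" if "set js <= Basis" for js t x
  using dpart_linear[OF bounded_linear_mult_right open_UNIV c1 that UNIV_I] by blast
 have dom: "EX U w. open U & x0 : U & U <= UNIV & Lint w &
   (ALL t:space lborel. ALL x:U. norm (dpart js (%x. \<omega> t * (\<eta> x * hk t x)) x) <= w t)"
  if h: "set js <= Basis" "length js <= N" for js N x0
 proof -
  have "EX B. ALL t:{0<..1}. ALL x. \<bar>dpart js (%x. \<eta> x * dpart [] (hk t) x) x\<bar> <= B"
   by (rule cut_hk_dpart_bounded[OF r h(1) _ \<eta>]) auto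
  then obtain B where B: "ALL t:{0<..1}. ALL x. \<bar>dpart js (%x. \<eta> x * hk t x) x\<bar> <= B" by auto
  have "norm (dpart js (%x. \<omega> t * (\<eta> x * hk t x)) x) <= \<omega> t * B" for t x
   using B \<omega>(2)[of t] w0[of t] unfolding d[OF h(1)] by (cases "t : {0<..<1}") (auto simp: abs_mult intro!: mult_left_mono)
  thus ?thesis using wi by (intro exI[of _ UNIV] exI[of _ "%t. \<omega> t * B"]) auto
 qed
 have e: "?F = (%x. LBINT t. \<omega> t * (\<eta> x * hk t x))"
 proof
  show "?F x = (LBINT t. \<omega> t * (\<eta> x * hk t x))" for x
   unfolding mult.left_commute[of "\<omega> _" "\<eta> x"] by simp
 qed
 show "smooth_on UNIV ?F" unfolding e smooth_on_def by (intro allI) (rule Ck_on_integral(1)[OF open_UNIV m c dom])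
 assume h: "set js <= Basis"
 show "?D js x" using Ck_on_integral(2)[OF open_UNIV m c dom h order_refl UNIV_I] unfolding e d[OF h] by simp
qed

text \<open>B is chosen before \<omega>: this uniformity controls the truncated kernels as the
  truncation parameter tends to 0.\<close>

lemma cut_weighted_bound:
 fixes \<eta> :: "'a::euclidean_space => real"
 assumes r: "r > 0" and js: "set js <= Basis" and \<eta>: "bsmooth \<eta>" "!!x. norm x < r ==> \<eta> x = 0"
 shows "EX B. ALL \<omega> x. \<omega> : bmeas --> (ALL t. 0 <= \<omega> t & \<omega> t <= hw DIM('a) t) -->
  \<bar>dpart js (%x. \<eta> x * (LBINT t. \<omega> t * hk t x)) x\<bar> <= B"
proof -
 have "EX B. ALL t:{0<..1}. ALL x. \<bar>dpart js (%x. \<eta> x * dpart [] (hk t) x) x\<bar> <= B"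
  by (rule cut_hk_dpart_bounded[OF r js _ \<eta>]) auto
 then obtain B where B: "ALL t:{0<..1}. ALL x. \<bar>dpart js (%x. \<eta> x * hk t x) x\<bar> <= B" by auto
 hence B0: "0 <= B" using order_trans[OF abs_ge_zero, of "dpart js (%x. \<eta> x * hk 1 x) 0" B] by simp
 have "\<bar>dpart js (%x. \<eta> x * (LBINT t. \<omega> t * hk t x)) x\<bar> <= (LBINT t. hw DIM('a) t * B)"
  if \<omega>: "\<omega> : bmeas" "ALL t. 0 <= \<omega> t & \<omega> t <= hw DIM('a) t" for \<omega> x
 proof -
  have "norm (\<omega> t * dpart js (%x. \<eta> x * hk t x) x) <= hw DIM('a) t * B" for t
  proof (cases "t : {0<..<1}")
   case True
   hence "\<omega> t * \<bar>dpart js (%x. \<eta> x * hk t x) x\<bar> <= hw DIM('a) t * B" using B \<omega>(2) by (intro mult_mono) auto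
   thus ?thesis using \<omega>(2) by (simp add: abs_mult)
  next
   case False
   hence "hw DIM('a) t = 0" by (auto simp: hw_def)
   moreover have "\<omega> t = 0" using \<omega>(2)[rule_format, of t] calculation by simp
   ultimately show ?thesis by simp
  qed
  thus ?thesis using cut_weighted(2)[OF r \<eta> \<omega>(1) _ _ js, of x] \<omega>(2)
    norm_integral_le[OF _ integrable_hw[OF DIM_positive[where 'a='a], of B], of "%t. \<omega> t * dpart js (%x. \<eta> x * hk t x) x"] by simp
 qed
 thus ?thesis by blast
qed

lemma cut_Phi:
 assumes r: "r > 0" and \<eta>: "bsmooth \<eta>" "!!x::'a::euclidean_space. norm x < r ==> \<eta> x = 0"
 shows "bsmooth (%x. \<eta> x * Phi x)"
 unfolding bsmooth_def Phi_def
proof (intro conjI allI impI)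
 show "smooth_on UNIV (%x. \<eta> x * (LBINT t. hw DIM('a) t * hk t x))" by (rule cut_weighted(1)[OF r \<eta>]) auto
 show "EX B. ALL x. \<bar>dpart js (%x. \<eta> x * (LBINT t. hw DIM('a) t * hk t x)) x\<bar> <= B" if "set js <= Basis" for js
  using cut_weighted_bound[OF r that \<eta>] hw_measurable hw_nonneg by blast
qed

lemma bsmooth_convolution:
 assumes "bsmooth K" "Lint F"
 shows "Ck_on k UNIV (%x. LBINT y. K (x - y) * F y)" "Lint (%y. K (x - y) * F y)"
proof -
 have bd: "EX B. ALL x. \<bar>dpart is K x\<bar> <= B" if "set is <= Basis" "length is <= N" for "is" N
  using assms(1) that unfolding bsmooth_def by blast
 show "Ck_on k UNIV (%x. LBINT y. K (x - y) * F y)"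
  by (rule Ck_on_convolution(1)[OF bsmooth_Ck[OF assms(1)] bd assms(2)])
 have "Lint (%y. dpart [] K (x - y) * F y)"
  by (rule conjunct1[OF Ck_on_convolution(2)[OF bsmooth_Ck[OF assms(1)] bd assms(2)]]) auto
 thus "Lint (%y. K (x - y) * F y)" by simp
qed

text \<open>For a within r/4 of x0, the part of f outside radius r/2 meets the kernel only at |a -
  y| >= r/4, where it agrees with a smooth kernel \<open>K\<close> all of whose derivatives are
  bounded. The conclusion is an implication because a product that is not integrable has Bochner
  integral 0, which would spoil the splitting.\<close>

lemma Phi_conv_local:
 fixes f :: "'a::euclidean_space => real"
 assumes f: "Lint f" and r: "r > 0"
 shows "EX S. (ALL k. Ck_on k UNIV S) & (ALL a:ball x0 (r / 4). Lint (%y. Phi (a - y) * (cutoff r (y - x0) * f y)) -->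
   Lint (%y. Phi (a - y) * f y) &
   (LBINT y. Phi (a - y) * f y) = (LBINT y. Phi (a - y) * (cutoff r (y - x0) * f y)) + S a)"
proof -
 have [measurable]: "f : bmeas" using f by auto
 define K where "K x = (1 - cutoff (r / 4) x) * Phi x" for x :: 'a
 have K: "bsmooth K" unfolding K_def
 proof (rule cut_Phi[of "r / 8"])
  show "bsmooth (%x::'a. 1 - cutoff (r / 4) x)" using r by (intro bsmooth_one_minus bsmooth_cutoff) auto
  show "1 - cutoff (r / 4) x = 0" if "norm x < r / 8" for x :: 'a using that r by (simp add: cutoff_eq_1)
 qed (use r in simp)
 define F where "F y = (1 - cutoff r (y - x0)) * f y" for y
 have F: "Lint F"
 proof (rule integrable_dom[OF f])
  show "F : borel_measurable lborel" unfolding F_def by measurable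
 qed (auto simp: F_def abs_mult cutoff_bounds intro!: mult_left_le_one_le)
 have "Lint (%y. Phi (a - y) * f y) &
   (LBINT y. Phi (a - y) * f y) = (LBINT y. Phi (a - y) * (cutoff r (y - x0) * f y)) + (LBINT y. K (a - y) * F y)"
  if a: "a : ball x0 (r / 4)" and i: "Lint (%y. Phi (a - y) * (cutoff r (y - x0) * f y))" for a
 proof -
  have e: "Phi (a - y) * f y = Phi (a - y) * (cutoff r (y - x0) * f y) + K (a - y) * F y" for y
  proof (cases "norm (y - x0) <= r / 2")
   case True thus ?thesis using r by (simp add: F_def cutoff_eq_1)
  next
   case False
   have "norm (y - x0) <= norm (a - y) + norm (a - x0)"
    using norm_triangle_ineq4[of "a - x0" "a - y"] by (simp add: algebra_simps)
   hence "r / 4 <= norm (a - y)" using False a by (simp add: dist_norm norm_minus_commute)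
   hence "K (a - y) = Phi (a - y)" using r by (simp add: K_def cutoff_eq_0)
   thus ?thesis by (simp add: F_def algebra_simps)
  qed
  show ?thesis unfolding e using i bsmooth_convolution(2)[OF K F, of a] by simp
 qed
 thus ?thesis using bsmooth_convolution(1)[OF K F]
  by (intro exI[of _ "%a. LBINT y. K (a - y) * F y"]) auto
qed

section \<open>Hoelder spaces\<close>

text \<open>Balls about the origin exhaust the bounded sets, so testing on them captures local
  Hoelder continuity.\<close>

definition lhol :: "real => ('a::euclidean_space => real) => bool" where
 "lhol \<theta> f \<longleftrightarrow> (ALL R. EX H>=0. ALL x:cball 0 R. ALL y:cball 0 R. \<bar>f x - f y\<bar> <= H * dist x y powr \<theta>)"

text \<open>The local space C^(k, theta) with order and exponent kept apart. \<open>Cs_loc\<close>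
  encodes both in one real number; the translation is postponed, so that theta = 1 is meaningful
  here.\<close>

definition HC :: "nat => real => ('a::euclidean_space => real) => bool" where
 "HC k \<theta> f \<longleftrightarrow> Ck_on k UNIV f & (ALL is. set is <= Basis & length is = k --> lhol \<theta> (dpart is f))"

lemma dist_powr_le:
 assumes "0 <= \<gamma>" "\<gamma> <= \<gamma>'" "dist x y <= D"
 shows "dist x y powr \<gamma>' <= D powr (\<gamma>' - \<gamma>) * dist x y powr \<gamma>"
proof (cases "x = y")
 case False
 have "dist x y powr \<gamma>' = dist x y powr (\<gamma>' - \<gamma>) * dist x y powr \<gamma>" by (simp add: powr_add[symmetric])
 also have "\<dots> <= D powr (\<gamma>' - \<gamma>) * dist x y powr \<gamma>"
  using assms by (intro mult_right_mono powr_mono2) auto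
 finally show ?thesis .
qed simp

lemma lhol_mono: "lhol \<theta> f ==> 0 <= \<theta>' ==> \<theta>' <= \<theta> ==> lhol \<theta>' f"
 unfolding lhol_def
proof
 fix R assume a: "ALL R. EX H>=0. ALL x:cball 0 R. ALL y:cball 0 R. \<bar>f x - f y\<bar> <= H * dist x y powr \<theta>" "0 <= \<theta>'" "\<theta>' <= \<theta>"
 obtain H where H: "H >= 0" "!!x y. x : cball 0 R ==> y : cball 0 R ==> \<bar>f x - f y\<bar> <= H * dist x y powr \<theta>" using a(1) by blast
 have "\<bar>f x - f y\<bar> <= (H * (2 * R) powr (\<theta> - \<theta>')) * dist x y powr \<theta>'" if xy: "x : cball 0 R" "y : cball 0 R" for x y
 proof -
  have "dist x y <= 2 * R" using xy norm_triangle_ineq4[of x y] by (simp add: dist_norm)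
  hence "dist x y powr \<theta> <= (2 * R) powr (\<theta> - \<theta>') * dist x y powr \<theta>'" by (rule dist_powr_le[OF a(2,3)])
  hence "H * dist x y powr \<theta> <= H * ((2 * R) powr (\<theta> - \<theta>') * dist x y powr \<theta>')" using H(1) by (rule mult_left_mono)
  thus ?thesis using H(2)[OF xy] by (simp add: mult.assoc)
 qed
 thus "EX H>=0. ALL x:cball 0 R. ALL y:cball 0 R. \<bar>f x - f y\<bar> <= H * dist x y powr \<theta>'"
  using H(1) by (intro exI[of _ "H * (2 * R) powr (\<theta> - \<theta>')"]) auto
qed

lemma continuous_bounded_cball:
 fixes f :: "'a::euclidean_space => 'b::real_normed_vector"
 assumes "continuous_on UNIV f"
 shows "EX B>=0. ALL x:cball x0 R. norm (f x) <= B"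
proof -
 have "bounded (f ` cball x0 R)"
  by (intro compact_imp_bounded compact_continuous_image continuous_on_subset[OF assms]) auto
 then obtain B where "B > 0" "!!x. x : cball x0 R ==> norm (f x) <= B" unfolding bounded_pos by auto
 thus ?thesis by (intro exI[of _ B]) auto
qed

lemma C1_lhol:
 fixes f :: "'a::euclidean_space => real"
 assumes "Ck_on 1 UNIV f" "0 <= \<theta>" "\<theta> <= 1"
 shows "lhol \<theta> f"
proof -
 have "lhol 1 f" unfolding lhol_def
 proof
  fix R
  have b: "bounded (cball (0::'a) R)" by simp
  obtain c where c: "cball 0 R <= cbox (- c) (c::'a)" using bounded_subset_cbox_symmetric[OF b] .
  have "ALL i:Basis. EX B>=0. ALL z:cbox (- c) c. \<bar>partial i f z\<bar> <= B"
  proof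
   fix i :: 'a assume i: "i : Basis"
   have "continuous_on UNIV (partial i f)" using assms(1) i by (simp add: Ck_on_Suc)
   hence "continuous_on (cbox (- c) c) (partial i f)" by (rule continuous_on_subset) simp
   hence "bounded (partial i f ` cbox (- c) c)"
    by (rule compact_imp_bounded[OF compact_continuous_image[OF _ compact_cbox]])
   then obtain B where "B > 0" "!!x. x : cbox (- c) c ==> norm (partial i f x) <= B" unfolding bounded_pos by auto
   thus "EX B>=0. ALL z:cbox (- c) c. \<bar>partial i f z\<bar> <= B" by (intro exI[of _ B]) auto
  qed
  from bchoice[OF this] obtain B where B: "ALL i:Basis. 0 <= B i & (ALL z:cbox (- c) c. \<bar>partial i f z\<bar> <= B i)" by blast
  define M where "M = (\<Sum>i\<in>(Basis::'a set). B i)"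
  have M: "\<bar>partial i f z\<bar> <= M" if "i : Basis" "z : cbox (- c) c" for i z
  proof -
   have "B i <= M" unfolding M_def using B that(1) by (intro member_le_sum) auto
   thus ?thesis using B that by force
  qed
  have M0: "0 <= M" unfolding M_def using B by (intro sum_nonneg) auto
  have "\<bar>f x - f y\<bar> <= (M * real DIM('a)) * dist x y powr 1" if "x : cball 0 R" "y : cball 0 R" for x y
  proof -
   have "norm (f x - f y) <= M * real DIM('a) * dist x y"
    by (rule lipschitz_partial[where D="%i. partial i f" and a="- c" and b=c])
     (use assms(1) M that c in \<open>auto simp: Ck_on_Suc\<close>)
   thus ?thesis by simp
  qed
  thus "EX H>=0. ALL x:cball 0 R. ALL y:cball 0 R. \<bar>f x - f y\<bar> <= H * dist x y powr 1"
   using M0 by (intro exI[of _ "M * real DIM('a)"]) auto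
 qed
 thus ?thesis by (rule lhol_mono[OF _ assms(2,3)])
qed

lemma HC_0 [simp]: "HC 0 \<theta> f \<longleftrightarrow> continuous_on UNIV f & lhol \<theta> f"
 unfolding HC_def by auto

lemma HC_Suc:
 "HC (Suc k) \<theta> f \<longleftrightarrow> continuous_on UNIV f & (ALL i:Basis. (ALL x. has_partial i f x (partial i f x)) & HC k \<theta> (partial i f))"
proof -
 have "(ALL is. set is <= Basis & length is = Suc k --> lhol \<theta> (dpart is f)) \<longleftrightarrow>
   (ALL i:Basis. ALL is. set is <= Basis & length is = k --> lhol \<theta> (dpart is (partial i f)))" (is "?l \<longleftrightarrow> ?r")
 proof
  assume l: ?l
  show ?r
  proof (intro ballI allI impI)
   fix i :: 'a and "is" :: "'a list" assume "i : Basis" "set is <= Basis & length is = k"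
   thus "lhol \<theta> (dpart is (partial i f))" using l[rule_format, of "is @ [i]"] by (simp add: dpart_append)
  qed
 next
  assume r: ?r
  show ?l
  proof (intro allI impI)
   fix "is" :: "'a list" assume h: "set is <= Basis & length is = Suc k"
   then obtain js i where "is = js @ [i]" by (cases "is" rule: rev_cases) auto
   thus "lhol \<theta> (dpart is f)" using r h by (simp add: dpart_append)
  qed
 qed
 thus ?thesis unfolding HC_def Ck_on_Suc by auto
qed

lemma HC_Ck: "HC k \<theta> f ==> Ck_on k UNIV f"
 unfolding HC_def by blast

text \<open>One more continuous derivative gives a local Lipschitz bound, hence every Hoelder
  exponent up to 1.\<close>

lemma HC_of_Ck:
 assumes "Ck_on (Suc k) UNIV f" "0 <= \<theta>" "\<theta> <= 1"
 shows "HC k \<theta> f"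
 unfolding HC_def
proof (intro conjI allI impI)
 show "Ck_on k UNIV f" using assms(1) Ck_on_mono by (metis le_SucI order_refl)
 fix "is" :: "'a list" assume h: "set is <= Basis & length is = k"
 have "Ck_on 1 UNIV (dpart is f)" by (rule Ck_on_dpart) (use h assms(1) in auto)
 thus "lhol \<theta> (dpart is f)" by (rule C1_lhol[OF _ assms(2,3)])
qed

lemma HC_SucD: "HC (Suc k) \<theta> f ==> 0 <= \<theta> ==> \<theta> <= 1 ==> HC k \<theta> f"
 using HC_of_Ck HC_Ck by blast

lemma HC_SucI:
 assumes "continuous_on UNIV f"
  and "!!i. i : Basis ==> EX f'. (ALL x. has_partial i f x (f' x)) & HC k \<theta> f'"
 shows "HC (Suc k) \<theta> f"
 unfolding HC_Suc
proof (intro conjI ballI assms(1))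
 fix i :: 'a assume "i : Basis"
 then obtain f' where f': "!!x. has_partial i f x (f' x)" "HC k \<theta> f'" using assms(2) by blast
 have "partial i f = f'" using f' has_partial_imp by blast
 thus "ALL x. has_partial i f x (partial i f x)" "HC k \<theta> (partial i f)" using f' by auto
qed

lemma lhol_add: "lhol \<theta> f ==> lhol \<theta> g ==> lhol \<theta> (%x. f x + g x)"
 unfolding lhol_def
proof
 fix R assume a: "ALL R. EX H>=0. ALL x:cball 0 R. ALL y:cball 0 R. \<bar>f x - f y\<bar> <= H * dist x y powr \<theta>"
  "ALL R. EX H>=0. ALL x:cball 0 R. ALL y:cball 0 R. \<bar>g x - g y\<bar> <= H * dist x y powr \<theta>"
 obtain H where H: "H >= 0" "!!x y. x : cball 0 R ==> y : cball 0 R ==> \<bar>f x - f y\<bar> <= H * dist x y powr \<theta>" using a(1) by blast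
 obtain K where K: "K >= 0" "!!x y. x : cball 0 R ==> y : cball 0 R ==> \<bar>g x - g y\<bar> <= K * dist x y powr \<theta>" using a(2) by blast
 have "\<bar>f x + g x - (f y + g y)\<bar> <= (H + K) * dist x y powr \<theta>" if "x : cball 0 R" "y : cball 0 R" for x y
  using H(2)[OF that] K(2)[OF that] by (simp add: algebra_simps)
 thus "EX H>=0. ALL x:cball 0 R. ALL y:cball 0 R. \<bar>f x + g x - (f y + g y)\<bar> <= H * dist x y powr \<theta>"
  using H(1) K(1) by (intro exI[of _ "H + K"]) auto
qed

lemma lhol_mult:
 assumes "lhol \<theta> f" "lhol \<theta> g" "continuous_on UNIV f" "continuous_on UNIV g"
 shows "lhol \<theta> (%x. f x * g x)"
 unfolding lhol_def
proof
 fix R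
 obtain H where H: "H >= 0" "!!x y. x : cball 0 R ==> y : cball 0 R ==> \<bar>f x - f y\<bar> <= H * dist x y powr \<theta>" using assms(1) unfolding lhol_def by blast
 obtain K where K: "K >= 0" "!!x y. x : cball 0 R ==> y : cball 0 R ==> \<bar>g x - g y\<bar> <= K * dist x y powr \<theta>" using assms(2) unfolding lhol_def by blast
 obtain A where A: "A >= 0" "!!x. x : cball 0 R ==> norm (f x) <= A" using continuous_bounded_cball[OF assms(3)] by blast
 obtain B where B: "B >= 0" "!!x. x : cball 0 R ==> norm (g x) <= B" using continuous_bounded_cball[OF assms(4)] by blast
 have "\<bar>f x * g x - f y * g y\<bar> <= (A * K + H * B) * dist x y powr \<theta>" if xy: "x : cball 0 R" "y : cball 0 R" for x y
 proof -
  have "f x * g x - f y * g y = f x * (g x - g y) + (f x - f y) * g y" by (simp add: algebra_simps)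
  hence "\<bar>f x * g x - f y * g y\<bar> <= \<bar>f x\<bar> * \<bar>g x - g y\<bar> + \<bar>f x - f y\<bar> * \<bar>g y\<bar>"
   by (metis abs_mult abs_triangle_ineq)
  also have "\<dots> <= A * (K * dist x y powr \<theta>) + (H * dist x y powr \<theta>) * B"
   using A(1) A(2)[of x] B(1) B(2)[of y] xy H K by (intro add_mono mult_mono) auto
  finally show ?thesis by (simp add: algebra_simps)
 qed
 thus "EX H>=0. ALL x:cball 0 R. ALL y:cball 0 R. \<bar>f x * g x - f y * g y\<bar> <= H * dist x y powr \<theta>"
  using A B H K by (intro exI[of _ "A * K + H * B"]) auto
qed

lemma HC_add: "HC k \<theta> f ==> HC k \<theta> g ==> HC k \<theta> (%x. f x + g x)"
proof (induction k arbitrary: f g)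
 case 0 thus ?case by (auto intro: continuous_on_add lhol_add)
next
 case (Suc k)
 show ?case
 proof (rule HC_SucI)
  show "continuous_on UNIV (%x. f x + g x)" using Suc.prems by (auto simp: HC_Suc intro: continuous_on_add)
  fix i :: 'a assume "i : Basis"
  thus "EX f'. (ALL x. has_partial i (%x. f x + g x) x (f' x)) & HC k \<theta> f'"
   using Suc by (intro exI[of _ "%x. partial i f x + partial i g x"]) (auto simp: HC_Suc intro: has_partial_add)
 qed
qed

lemma HC_mult: "0 <= \<theta> ==> \<theta> <= 1 ==> HC k \<theta> f ==> HC k \<theta> g ==> HC k \<theta> (%x. f x * g x)"
proof (induction k arbitrary: f g)
 case 0 thus ?case by (auto intro: continuous_on_mult lhol_mult)
next
 case (Suc k)
 have m: "HC k \<theta> f" "HC k \<theta> g" using Suc.prems HC_SucD by blast+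
 show ?case
 proof (rule HC_SucI)
  show "continuous_on UNIV (%x. f x * g x)" using Suc.prems by (auto simp: HC_Suc intro: continuous_on_mult)
  fix i :: 'a assume "i : Basis"
  thus "EX f'. (ALL x. has_partial i (%x. f x * g x) x (f' x)) & HC k \<theta> f'"
   using Suc m by (intro exI[of _ "%x. f x * partial i g x + partial i f x * g x"])
    (auto simp: HC_Suc intro!: has_partial_mult HC_add)
 qed
qed

section \<open>Homogeneous functions\<close>

text \<open>Contains |x|^d, and differentiation lowers the degree by one, so the regularity of |x|^p
  is found by descending to a degree in (0, 1]. The value 0 at the origin agrees with
  \<open>0 powr d = 0\<close>.\<close>

definition HG :: "real => ('a::euclidean_space => real) => bool" where
 "HG d \<phi> \<longleftrightarrow> \<phi> 0 = 0 & (ALL k. Ck_on k (UNIV - {0}) \<phi>) & (ALL s>0. ALL x. \<phi> (s *\<^sub>R x) = s powr d * \<phi> x)"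

lemma HG_Ck: "HG d \<phi> ==> Ck_on k (UNIV - {0}) \<phi>"
 unfolding HG_def by blast

lemma HG_bound:
 assumes "HG d \<phi>"
 shows "EX M>=0. ALL x. \<bar>\<phi> x\<bar> <= M * norm x powr d"
proof -
 have c: "continuous_on (sphere 0 1) \<phi>"
  using Ck_on_continuous[OF HG_Ck[OF assms]] by (rule continuous_on_subset) auto
 have "bounded (\<phi> ` sphere 0 1)" by (intro compact_imp_bounded compact_continuous_image c) auto
 then obtain M where M: "M > 0" "!!x. x : sphere 0 1 ==> norm (\<phi> x) <= M" unfolding bounded_pos by auto
 have "\<bar>\<phi> x\<bar> <= M * norm x powr d" for x
 proof (cases "x = 0")
  case True thus ?thesis using assms by (simp add: HG_def)
 next
  case False
  define w where "w = (1 / norm x) *\<^sub>R x"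
  have "x = norm x *\<^sub>R w" "w : sphere 0 1" using False by (simp_all add: w_def)
  hence "\<phi> x = norm x powr d * \<phi> w" using assms False unfolding HG_def by (metis zero_less_norm_iff)
  thus ?thesis using M(2)[OF \<open>w : sphere 0 1\<close>] by (simp add: abs_mult mult.commute mult_right_mono)
 qed
 thus ?thesis using M(1) by (intro exI[of _ M]) auto
qed

lemma HG_continuous:
 assumes "HG d \<phi>" "d > 0"
 shows "continuous_on UNIV \<phi>"
proof (rule continuous_at_imp_continuous_on, intro ballI)
 fix x :: 'a
 show "isCont \<phi> x"
 proof (cases "x = 0")
  case False
  have "continuous_on (UNIV - {0}) \<phi>" using Ck_on_continuous[OF HG_Ck[OF assms(1)]] .
  thus ?thesis using False by (subst (asm) continuous_on_eq_continuous_at) (auto simp: open_delete)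
 next
  case True
  obtain M where M: "!!x. \<bar>\<phi> x\<bar> <= M * norm x powr d" using HG_bound[OF assms(1)] by blast
  have n: "((%x::'a. norm x) \<longlongrightarrow> 0) (at 0)" by (rule tendsto_norm_zero) simp
  have "((%x::'a. norm x powr d) \<longlongrightarrow> 0) (at 0)"
  proof (rule tendsto_zero_powrI[OF n tendsto_const _ assms(2)])
   show "\<forall>\<^sub>F x::'a in at 0. 0 <= norm x" by simp
  qed
  hence "((%x::'a. M * norm x powr d) \<longlongrightarrow> 0) (at 0)" by (rule tendsto_mult_right_zero)
  hence "(\<phi> \<longlongrightarrow> 0) (at 0)" by (rule Lim_null_comparison[rotated]) (use M in auto)
  thus ?thesis using True assms(1) by (simp add: isCont_def HG_def)
 qed
qed

text \<open>Degree above 1 makes the difference quotients at the origin O(|t|^(d - 1)), so the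
  partial derivative exists there and is 0. Homogeneity of the derivative comes from differentiating
  the scaling relation.\<close>

lemma HG_partial:
 assumes "HG d \<phi>" "d > 1" "i : Basis"
 shows "HG (d - 1) (partial i \<phi>)" "has_partial i \<phi> x (partial i \<phi> x)"
proof -
 obtain M where M: "M >= 0" "!!x. \<bar>\<phi> x\<bar> <= M * norm x powr d" using HG_bound[OF assms(1)] by blast
 have p0: "has_partial i \<phi> 0 0"
  unfolding has_partial_tendsto
 proof (rule Lim_null_comparison)
  have "norm ((1 / t) *\<^sub>R (\<phi> (0 + t *\<^sub>R i) - \<phi> 0)) <= M * \<bar>t\<bar> powr (d - 1)" for t
  proof (cases "t = 0")
   case False
   have "\<bar>\<phi> (t *\<^sub>R i)\<bar> <= M * \<bar>t\<bar> powr d" using M(2)[of "t *\<^sub>R i"] assms(3) by simp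
   also have "\<bar>t\<bar> powr d = \<bar>t\<bar> * \<bar>t\<bar> powr (d - 1)" using False powr_add[of "\<bar>t\<bar>" 1 "d - 1"] by simp
   finally have "\<bar>\<phi> (t *\<^sub>R i)\<bar> / \<bar>t\<bar> <= M * \<bar>t\<bar> powr (d - 1)" using False by (simp add: divide_le_eq mult_ac)
   thus ?thesis using assms(1) by (simp add: HG_def)
  qed simp
  thus "\<forall>\<^sub>F t in at 0. norm ((1 / t) *\<^sub>R (\<phi> (0 + t *\<^sub>R i) - \<phi> 0)) <= M * \<bar>t\<bar> powr (d - 1)" by simp
  have n: "((%t::real. \<bar>t\<bar>) \<longlongrightarrow> 0) (at 0)" by (rule tendsto_rabs_zero) simp
  have "((%t::real. \<bar>t\<bar> powr (d - 1)) \<longlongrightarrow> 0) (at 0)"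
   by (rule tendsto_zero_powrI[OF n tendsto_const]) (use assms(2) in auto)
  thus "((%t. M * \<bar>t\<bar> powr (d - 1)) \<longlongrightarrow> 0) (at 0)" by (rule tendsto_mult_right_zero)
 qed
 have pp: "has_partial i \<phi> x (partial i \<phi> x)" for x
 proof (cases "x = 0")
  case True thus ?thesis using p0 has_partial_imp by metis
 next
  case False thus ?thesis using HG_Ck[OF assms(1), of 1] assms(3) by (simp add: Ck_on_Suc)
 qed
 thus "has_partial i \<phi> x (partial i \<phi> x)" .
 have "partial i \<phi> (s *\<^sub>R x) = s powr (d - 1) * partial i \<phi> x" if s: "s > 0" for s x
 proof -
  have a: "has_partial i (%x. \<phi> (s *\<^sub>R x + 0)) x (s *\<^sub>R partial i \<phi> (s *\<^sub>R x + 0))"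
   by (rule has_partial_affine) (rule pp)
  have e: "(%x. \<phi> (s *\<^sub>R x + 0)) = (%x. s powr d * \<phi> x)" using assms(1) s by (simp add: HG_def)
  have b: "has_partial i (%x. s powr d * \<phi> x) x (s powr d * partial i \<phi> x)"
   by (rule has_partial_linear[OF bounded_linear_mult_right pp])
  have "s * partial i \<phi> (s *\<^sub>R x) = s powr d * partial i \<phi> x"
   using has_partial_imp[OF a] has_partial_imp[OF b] unfolding e by simp
  moreover have "s powr d = s * s powr (d - 1)" using s powr_add[of s 1 "d - 1"] by simp
  ultimately show ?thesis using s by simp
 qed
 moreover have "Ck_on k (UNIV - {0}) (partial i \<phi>)" for k using HG_Ck[OF assms(1), of "Suc k"] assms(3) by (simp add: Ck_on_Suc)
 moreover have "partial i \<phi> 0 = 0" using p0 has_partial_imp by blast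
 ultimately show "HG (d - 1) (partial i \<phi>)" unfolding HG_def by blast
qed

text \<open>If |x| <= 2 |x - y|, the size bound |x|^d suffices. Otherwise the larger point is
  rescaled to the unit sphere: both points then have norm between 1/2 and 1, where the function is
  Lipschitz, and |a - b| <= |a - b|^d.\<close>

lemma HG_lhol:
 assumes "HG d \<phi>" "0 < d" "d <= 1"
 shows "lhol d \<phi>"
proof -
 obtain M where M: "M >= 0" "!!x. \<bar>\<phi> x\<bar> <= M * norm x powr d" using HG_bound[OF assms(1)] by blast
 \<comment> \<open>Cutting out the origin gives a C^1 function on the whole space that equals \<phi>
   wherever the norm is at least 1/2.\<close>
 define \<psi> where "\<psi> x = (1 - cutoff (1/2) x) * \<phi> x" for x
 have "Ck_on 1 UNIV \<psi>"
 proof (rule Ck_on_local)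
  fix x :: 'a
  show "EX U. open U & x : U & Ck_on 1 U \<psi>"
  proof (cases "x = 0")
   case True
   have "Ck_on 1 (ball 0 (1/4)) \<psi> \<longleftrightarrow> Ck_on 1 (ball 0 (1/4)) (%x::'a. 0::real)"
    by (rule Ck_on_cong) (auto simp: \<psi>_def cutoff_eq_1)
   thus ?thesis using True by (intro exI[of _ "ball 0 (1/4)"]) auto
  next
   case False
   have "Ck_on 1 (UNIV - {0}) \<psi>" unfolding \<psi>_def
    by (intro Ck_on_mult HG_Ck[OF assms(1)] Ck_on_mono[OF bsmooth_Ck[OF bsmooth_one_minus[OF bsmooth_cutoff]]]) (auto simp: open_delete)
   thus ?thesis using False by (intro exI[of _ "UNIV - {0}"]) (auto simp: open_delete)
  qed
 qed
 then obtain L where L: "L >= 0" "!!x y. x : cball 0 1 ==> y : cball 0 1 ==> \<bar>\<psi> x - \<psi> y\<bar> <= L * dist x y powr 1"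
  using C1_lhol[of \<psi> 1] unfolding lhol_def by (meson order_refl zero_le_one)
 have main: "\<bar>\<phi> x - \<phi> y\<bar> <= (2 * M * 2 powr d + L) * dist x y powr d" if xy: "norm y <= norm x" for x y
 proof (cases "norm x <= 2 * dist x y")
  case True
  have a: "norm z powr d <= 2 powr d * dist x y powr d" if "norm z <= norm x" for z :: 'a
  proof -
   have "norm z powr d <= (2 * dist x y) powr d" using that True assms by (intro powr_mono2) auto
   thus ?thesis by (simp add: powr_mult)
  qed
  have "\<bar>\<phi> x - \<phi> y\<bar> <= M * norm x powr d + M * norm y powr d" using M(2)[of x] M(2)[of y] by linarith
  also have "\<dots> <= M * (2 powr d * dist x y powr d) + M * (2 powr d * dist x y powr d)"
   using a[of x] a[OF xy] M(1) by (intro add_mono mult_left_mono) auto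
  also have "\<dots> <= (2 * M * 2 powr d + L) * dist x y powr d" using L(1) by (simp add: algebra_simps)
  finally show ?thesis .
 next
  case False
  hence x0: "norm x > 0" by (metis dist_not_less_zero mult_nonneg_nonneg norm_ge_zero not_less order_trans zero_le_dist zero_le_numeral linorder_not_le)
  define r where "r = norm x"
  define a where "a = (1 / r) *\<^sub>R x"
  define b where "b = (1 / r) *\<^sub>R y"
  have r: "r > 0" using x0 by (simp add: r_def)
  have ab: "x = r *\<^sub>R a" "y = r *\<^sub>R b" using r by (simp_all add: a_def b_def)
  have na: "norm a = 1" using r by (simp add: a_def r_def)
  have nb: "norm b <= 1" using xy r by (simp add: b_def r_def)
  have dab: "dist x y = r * dist a b" unfolding ab dist_norm using r by (simp add: scaleR_diff_right[symmetric])
  have "dist a b < 1 / 2" using False dab r by (simp add: r_def[symmetric])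
  hence nb': "1 / 2 <= norm b" using na norm_triangle_ineq2[of a b] by (simp add: dist_norm)
  have "\<bar>\<psi> a - \<psi> b\<bar> <= L * dist a b" using L(2)[of a b] na nb by simp
  moreover have "\<psi> a = \<phi> a" "\<psi> b = \<phi> b" using na nb' by (simp_all add: \<psi>_def cutoff_eq_0)
  ultimately have "\<bar>\<phi> a - \<phi> b\<bar> <= L * dist a b" by simp
  also have "\<dots> <= L * dist a b powr d"
  proof (cases "a = b")
   case False
   have "dist a b powr 1 <= dist a b powr d" using False assms \<open>dist a b < 1 / 2\<close> by (intro powr_mono') auto
   thus ?thesis using L(1) False by (simp add: mult_left_mono)
  qed simp
  finally have "r powr d * \<bar>\<phi> a - \<phi> b\<bar> <= r powr d * (L * dist a b powr d)" by (rule mult_left_mono) simp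
  moreover have "\<phi> x - \<phi> y = r powr d * (\<phi> a - \<phi> b)"
   unfolding ab using assms(1) r by (simp add: HG_def algebra_simps)
  ultimately have "\<bar>\<phi> x - \<phi> y\<bar> <= L * dist x y powr d"
   unfolding dab using r by (simp add: abs_mult powr_mult mult_ac)
  also have "\<dots> <= (2 * M * 2 powr d + L) * dist x y powr d" using M(1) by (intro mult_right_mono) auto
  finally show ?thesis .
 qed
 have "\<bar>\<phi> x - \<phi> y\<bar> <= (2 * M * 2 powr d + L) * dist x y powr d" for x y
  using main[of y x] main[of x y] by (cases "norm y <= norm x") (auto simp: dist_commute abs_minus_commute)
 thus ?thesis unfolding lhol_def using M(1) L(1) by (intro allI exI[of _ "2 * M * 2 powr d + L"]) auto
qed

lemma HG_HC:
 assumes "0 < d" "d <= 1" "0 <= \<theta>" "\<theta> <= d"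
 shows "HG (real k + d) \<phi> ==> HC k \<theta> \<phi>"
proof (induction k arbitrary: \<phi>)
 case 0
 thus ?case using HG_continuous[of d \<phi>] HG_lhol[of d \<phi>] lhol_mono[of d \<phi> \<theta>] assms by auto
next
 case (Suc k)
 show ?case unfolding HC_Suc
 proof (intro conjI ballI allI)
  show "continuous_on UNIV \<phi>" using HG_continuous[OF Suc.prems] assms by simp
  fix i :: 'a assume i: "i : Basis"
  have d1: "1 < real (Suc k) + d" using assms by simp
  show "has_partial i \<phi> x (partial i \<phi> x)" for x by (rule HG_partial(2)[OF Suc.prems d1 i])
  show "HC k \<theta> (partial i \<phi>)" using HG_partial(1)[OF Suc.prems d1 i] by (intro Suc.IH) simp
 qed
qed

lemma norm_powr_Ck: "Ck_on k (UNIV - {0}) (%x::'a::euclidean_space. norm x powr p)"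
proof -
 have "Ck_on k (UNIV - {0}) (%x::'a. (sq x) powr (p / 2))"
  by (rule Ck_on_compose[OF _ _ Ck_on_powr Ck_on_mono[OF Ck_on_inner_self]]) (auto simp: open_delete)
 moreover have "(sq x) powr (p / 2) = norm x powr p" for x :: 'a
 proof -
  have "(norm x)\<^sup>2 powr (p / 2) = norm x powr p"
   by (cases "x = 0") (simp_all add: powr_powr[of "norm x" 2 "p / 2", simplified])
  thus ?thesis by (simp add: power2_norm_eq_inner)
 qed
 ultimately show ?thesis by simp
qed

lemma HG_norm_powr: "HG p (%x::'a::euclidean_space. norm x powr p)"
 unfolding HG_def using norm_powr_Ck by (auto simp: powr_mult)

lemma norm_powr_HC: "0 < d ==> d <= 1 ==> 0 <= \<theta> ==> \<theta> <= d ==> HC k \<theta> (%x::'a::euclidean_space. norm x powr (real k + d))"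
 by (rule HG_HC[OF _ _ _ _ HG_norm_powr])

section \<open>Passage to the spaces of the statement\<close>

lemma HC_imp_Cs_on:
 assumes "HC N \<gamma> v" "0 <= \<gamma>" "\<gamma> < 1" "bounded \<Omega>"
 shows "Cs_on (real N + \<gamma>) \<Omega> v"
proof -
 have ip: "ipart (real N + \<gamma>) = N"
 proof -
  have "\<lfloor>real N + \<gamma>\<rfloor> = int N" using assms by (intro floor_unique) auto
  thus ?thesis by (simp add: ipart_def)
 qed
 obtain R where R: "\<Omega> <= cball 0 R" using assms(4) unfolding bounded_iff by (auto simp: subset_iff)
 have "holder_on \<gamma> \<Omega> (dpart is v)" if h: "set is <= Basis" "length is = N" for "is"
 proof -
  have "lhol \<gamma> (dpart is v)" using assms(1) h unfolding HC_def by blast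
  then obtain H where "ALL x:cball 0 R. ALL y:cball 0 R. \<bar>dpart is v x - dpart is v y\<bar> <= H * dist x y powr \<gamma>" unfolding lhol_def by blast
  moreover have "continuous_on \<Omega> (dpart is v)"
   using Ck_on_dpart_continuous[OF HC_Ck[OF assms(1)] h(1)] h(2) by (auto intro: continuous_on_subset)
  ultimately show ?thesis unfolding holder_on_def using R by (auto intro!: exI[of _ H])
 qed
 thus ?thesis unfolding Cs_on_def ip using Ck_on_mono[OF HC_Ck[OF assms(1)]] by auto
qed

lemma HC_imp_Cs_loc:
 assumes "HC N \<gamma> v" "0 <= \<gamma>" "\<gamma> < 1"
 shows "Cs_loc (real N + \<gamma>) v"
 unfolding Cs_loc_def using Ck_on_continuous[OF HC_Ck[OF assms(1)]] HC_imp_Cs_on[OF assms] by blast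

text \<open>With equal integer parts the exponents are compared; with a smaller integer part of s,
  an extra derivative beats any Hoelder exponent.\<close>

lemma HC_imp_Cs_loc_le:
 assumes "HC N \<gamma> v" "0 <= \<gamma>" "\<gamma> < 1" "0 < s" "s <= real N + \<gamma>"
 shows "Cs_loc s v"
proof -
 define m where "m = nat \<lfloor>s\<rfloor>"
 define \<delta> where "\<delta> = s - real m"
 have m: "real m = of_int \<lfloor>s\<rfloor>" using assms(4) by (simp add: m_def)
 have d: "0 <= \<delta>" "\<delta> < 1" "s = real m + \<delta>" unfolding \<delta>_def m by (simp_all) linarith
 have "m <= N"
 proof (rule ccontr)
  assume "~ m <= N"
  hence "real N + 1 <= real m" by simp
  thus False using d assms by linarith
 qed
 have "HC m \<delta> v"
 proof (cases "m = N")
  case True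
  hence "\<delta> <= \<gamma>" using d assms by simp
  thus ?thesis using assms(1) d(1) True unfolding HC_def by (auto intro: lhol_mono)
 next
  case False
  hence "Suc m <= N" using \<open>m <= N\<close> by simp
  thus ?thesis using Ck_on_mono[OF HC_Ck[OF assms(1)]] d by (intro HC_of_Ck) auto
 qed
 thus ?thesis using HC_imp_Cs_loc d by metis
qed

section \<open>Regularity of potential representations\<close>

text \<open>The formula is imposed at every point, with Bochner integrals that may take their
  default value; genuine integrability is recovered locally from bounds on the density. Modifying g
  on a null set leaves v unchanged.\<close>

definition pot_repr :: "real => ('a::euclidean_space => real) => ('a => real) => ('a => real) => bool" where
 "pot_repr c h g v \<longleftrightarrow> Lint g & (ALL k. Ck_on k UNIV h) &
   (ALL a. v a = c * (LBINT y. Phi (a - y) * g y) + h a)"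

lemma pot_repr_measurable:
 assumes "pot_repr c h g v"
 shows "v : bmeas"
proof -
 have [measurable]: "g : bmeas" using assms unfolding pot_repr_def by auto
 have "continuous_on UNIV h" using assms Ck_on_continuous unfolding pot_repr_def by blast
 hence [measurable]: "h : bmeas" by (rule borel_measurable_continuous_onI)
 have "(%a. c * (LBINT y. Phi (a - y) * g y) + h a) : bmeas" by measurable
 moreover have "v = (%a. c * (LBINT y. Phi (a - y) * g y) + h a)" using assms unfolding pot_repr_def by blast
 ultimately show ?thesis by simp
qed

lemma pot_repr_cong:
 assumes "pot_repr c h g v" "AE y in lborel. g y = g' y" "g' : bmeas"
 shows "pot_repr c h g' v"
proof -
 have [measurable]: "g : bmeas" using assms(1) unfolding pot_repr_def by auto
 note [measurable] = assms(3)
 have "Lint g'" using assms(1) integrable_cong_AE[of g lborel g'] assms(2) unfolding pot_repr_def by auto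
 moreover have "(LBINT y. Phi (a - y) * g y) = (LBINT y. Phi (a - y) * g' y)" for a
 proof (rule integral_cong_AE)
  show "AE y in lborel. Phi (a - y) * g y = Phi (a - y) * g' y" using assms(2) by eventually_elim simp
 qed measurable
 ultimately show ?thesis using assms(1) unfolding pot_repr_def by simp
qed

lemma cut_integrable:
 assumes "Lint g"
 shows "Lint (%y. cutoff r (y - x0) * g y)"
proof (rule integrable_dom[OF assms])
 have [measurable]: "g : bmeas" using assms by auto
 show "(%y. cutoff r (y - x0) * g y) : borel_measurable lborel" by measurable
qed (auto simp: abs_mult cutoff_bounds intro!: mult_left_le_one_le)

text \<open>The condition on b makes the cut potential genuinely integrable, so that the splitting
  of \<open>Phi_conv_local\<close> becomes available.\<close>

lemma pot_repr_local:
 assumes "pot_repr c h g v" "r > 0"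
  and b: "Lint (%t. hw DIM('a) t * b t)" "!!t x. t : {0<..<1} ==> hc t (%y. \<bar>cutoff r (y - x0) * g y\<bar>) x <= b t"
 shows "EX S. (ALL k. Ck_on k UNIV S) & (ALL a:ball x0 (r / 4). v (a::'a::euclidean_space) = c * VT (%y. cutoff r (y - x0) * g y) a + S a)"
proof -
 have g: "Lint g" and h: "!!k. Ck_on k UNIV h" and v: "!!a. v a = c * (LBINT y. Phi (a - y) * g y) + h a"
  using assms(1) unfolding pot_repr_def by auto
 obtain S where S: "!!k. Ck_on k UNIV S" "!!a. a : ball x0 (r / 4) ==> Lint (%y. Phi (a - y) * (cutoff r (y - x0) * g y)) ==>
   (LBINT y. Phi (a - y) * g y) = (LBINT y. Phi (a - y) * (cutoff r (y - x0) * g y)) + S a"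
  using Phi_conv_local[OF g assms(2), of x0] by blast
 have "v a = c * VT (%y. cutoff r (y - x0) * g y) a + (c * S a + h a)" if a: "a : ball x0 (r / 4)" for a
 proof -
  have i: "Lint (%y. Phi (a - y) * (cutoff r (y - x0) * g y))"
   by (rule VT_eq(1)[OF cut_integrable[OF g] b])
  have e: "(LBINT y. Phi (a - y) * (cutoff r (y - x0) * g y)) = VT (%y. cutoff r (y - x0) * g y) a"
   by (rule VT_eq(2)[OF cut_integrable[OF g] b])
  show ?thesis using S(2)[OF a i] v[of a] unfolding e by (simp add: algebra_simps)
 qed
 moreover have "Ck_on k UNIV (%a. c * S a + h a)" for k by (intro Ck_on_add Ck_on_mult S h) auto
 ultimately show ?thesis by (intro exI[of _ "%a. c * S a + h a"]) auto
qed

lemma pot_repr_local_bounded: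
 assumes "pot_repr c h g v" "r > 0" "!!y. \<bar>cutoff r (y - x0) * g y\<bar> <= B"
 shows "EX S. (ALL k. Ck_on k UNIV S) & (ALL a:ball x0 (r / 4). v (a::'a::euclidean_space) = c * VT (%y. cutoff r (y - x0) * g y) a + S a)"
proof -
 have g: "Lint g" using assms(1) unfolding pot_repr_def by auto
 have i: "Lint (%y. \<bar>cutoff r (y - x0) * g y\<bar>)" using cut_integrable[OF g] by (rule integrable_abs)
 have bb: "\<bar>\<bar>cutoff r (y - x0) * g y\<bar>\<bar> <= B" for y using assms(3)[of y] by simp
 obtain C where C: "!!t x. t > 0 ==> \<bar>dpart [] (hc t (%y. \<bar>cutoff r (y - x0) * g y\<bar>)) x\<bar> <= C * t powr (- real (length []) / 2)"
  using hc_dpart_bounded[of "[]", OF _ i bb] by auto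
 show ?thesis
 proof (rule pot_repr_local[OF assms(1,2), where b="%t. C"])
  show "Lint (%t. hw DIM('a) t * C)" by (rule integrable_hw) simp
  show "hc t (%y. \<bar>cutoff r (y - x0) * g y\<bar>) x <= C" if "t : {0<..<1}" for t x
   using C[of t x] that by auto
 qed
qed

lemma Ck_on_ball_from:
 fixes v w S :: "'a::euclidean_space => real"
 assumes "!!a. a : ball x0 \<rho> ==> v a = c * w a + S a" "Ck_on k UNIV w" "Ck_on k UNIV S"
 shows "Ck_on k (ball x0 \<rho>) v"
proof -
 have "Ck_on k UNIV (%a. c * w a + S a)"
  by (rule Ck_on_add[OF open_UNIV Ck_on_mult[OF open_UNIV Ck_on_const assms(2)] assms(3)])
 hence "Ck_on k (ball x0 \<rho>) (%a. c * w a + S a)" by (rule Ck_on_mono) auto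
 thus ?thesis using Ck_on_cong[of "ball x0 \<rho>" v "%a. c * w a + S a" k] assms(1) by simp
qed

lemma cut_eq_0_away: "r > 0 ==> norm y > norm x0 + r ==> cutoff r (y - x0) = 0"
 using norm_triangle_ineq2[of y x0] by (intro cutoff_eq_0) auto

text \<open>Start of the bootstrap: from here on, regularity of v feeds back into the
  density.\<close>

lemma boot_0:
 fixes v :: "'a::euclidean_space => real"
 assumes n: "DIM('a) >= 2" and R: "pot_repr c h g v"
  and b: "!!x0. x0 : \<Omega> ==> EX r>0. EX B. ALL y:ball x0 r. \<bar>g y\<bar> <= B"
 shows "Ck_on 1 \<Omega> v"
proof (rule Ck_on_local)
 fix x0 assume "x0 : \<Omega>"
 then obtain r B where r: "r > 0" "!!y. y : ball x0 r ==> \<bar>g y\<bar> <= B" using b by blast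
 have g: "Lint g" using R unfolding pot_repr_def by auto
 have B0: "0 <= B" using r(2)[of x0] r(1) by (smt (verit) centre_in_ball)
 have bd: "\<bar>cutoff r (y - x0) * g y\<bar> <= B" for y
 proof (cases "y : ball x0 r")
  case True
  have "\<bar>cutoff r (y - x0)\<bar> * \<bar>g y\<bar> <= 1 * B" using r(2)[OF True] cutoff_bounds[of r "y - x0"] by (intro mult_mono) auto
  thus ?thesis by (simp add: abs_mult)
 next
  case False
  hence "cutoff r (y - x0) = 0" using r(1) by (intro cutoff_eq_0) (auto simp: dist_norm norm_minus_commute)
  thus ?thesis using B0 by simp
 qed
 obtain S where S: "!!k. Ck_on k UNIV S" "!!a. a : ball x0 (r / 4) ==> v a = c * VT (%y. cutoff r (y - x0) * g y) a + S a"
  using pot_repr_local_bounded[OF R r(1) bd] by blast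
 have "Ck_on 1 UNIV (VT (%y. cutoff r (y - x0) * g y))" by (rule VT_C1[OF n cut_integrable[OF g] bd])
 hence "Ck_on 1 (ball x0 (r / 4)) v"
  by (intro Ck_on_ball_from[where w="VT (%y. cutoff r (y - x0) * g y)" and S=S and c=c] S)
 thus "EX U. open U & x0 : U & Ck_on 1 U v" using r(1) by (intro exI[of _ "ball x0 (r / 4)"]) auto
qed

lemma cut_Ck: "Ck_on k UNIV (%y. cutoff r (y - x0))"
 using Ck_on_affine[OF open_UNIV cutoff_Ck[of k r], of 1 "- x0"] by simp

lemma cut_mult_Ck:
 assumes "open \<Omega>" "Ck_on k \<Omega> g" "cball x0 r <= \<Omega>" "r > 0"
 shows "Ck_on k UNIV (%y. cutoff r (y - x0) * g y)"
proof (rule Ck_on_local)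
 fix x :: 'a
 show "EX U. open U & x : U & Ck_on k U (%y. cutoff r (y - x0) * g y)"
 proof (cases "x : \<Omega>")
  case True
  have "Ck_on k \<Omega> (%y. cutoff r (y - x0) * g y)"
   by (intro Ck_on_mult assms(1,2) Ck_on_mono[OF cut_Ck]) auto
  thus ?thesis using True assms(1) by blast
 next
  case False
  have "Ck_on k (- cball x0 r) (%y. cutoff r (y - x0) * g y) \<longleftrightarrow> Ck_on k (- cball x0 r) (%y. 0::real)"
   using assms(4) by (intro Ck_on_cong) (auto simp: cutoff_eq_0 dist_norm norm_minus_commute)
  thus ?thesis using False assms(3) by (intro exI[of _ "- cball x0 r"]) auto
 qed
qed

text \<open>Cutting off inside \<Omega> makes the density globally C^k with compact support, to
  which \<open>VT_gain_one\<close> applies; the rest of the potential is smooth near x0.\<close>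

lemma boot_step:
 fixes v :: "'a::euclidean_space => real"
 assumes n: "DIM('a) >= 2" and R: "pot_repr c h g v" and \<Omega>: "open \<Omega>" and gk: "Ck_on k \<Omega> g"
 shows "Ck_on (Suc k) \<Omega> v"
proof (rule Ck_on_local)
 fix x0 assume "x0 : \<Omega>"
 then obtain r where r: "r > 0" "cball x0 r <= \<Omega>" using \<Omega> open_contains_cball by blast
 let ?F = "%y. cutoff r (y - x0) * g y"
 have F: "Ck_on k UNIV ?F" by (rule cut_mult_Ck[OF \<Omega> gk r(2,1)])
 have z: "?F y = 0" if "norm y > norm x0 + r" for y using cut_eq_0_away[OF r(1) that] by simp
 obtain B where B: "!!y. norm (?F y) <= B" using support_bounded[OF z Ck_on_continuous[OF F]] by blast
 hence bd: "\<bar>?F y\<bar> <= B" for y by (metis real_norm_def)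
 obtain S where S: "!!k. Ck_on k UNIV S" "!!a. a : ball x0 (r / 4) ==> v a = c * VT ?F a + S a"
  using pot_repr_local_bounded[OF R r(1) bd] by blast
 have "Ck_on (Suc k) UNIV (VT ?F)" by (rule VT_gain_one[OF n F z])
 hence "Ck_on (Suc k) (ball x0 (r / 4)) v"
  by (intro Ck_on_ball_from[where w="VT ?F" and S=S and c=c] S)
 thus "EX U. open U & x0 : U & Ck_on (Suc k) U v" using r(1) by (intro exI[of _ "ball x0 (r / 4)"]) auto
qed

lemma HC_local:
 assumes "!!R. R > 0 ==> EX w. HC N \<gamma> w & (ALL a:ball 0 R. v a = w a)"
 shows "HC N \<gamma> v"
 unfolding HC_def
proof (intro conjI allI impI)
 show "Ck_on N UNIV v"
 proof (rule Ck_on_local)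
  fix x :: 'a
  obtain w where w: "HC N \<gamma> w" "!!a. a : ball 0 (norm x + 1) ==> v a = w a"
   using assms[of "norm x + 1"] by (auto simp: add_nonneg_pos)
  have "Ck_on N (ball 0 (norm x + 1)) v"
   using Ck_on_cong[of "ball 0 (norm x + 1)" v w N] w(2) Ck_on_mono[OF HC_Ck[OF w(1)], of N "ball 0 (norm x + 1)"] by simp
  thus "EX U. open U & x : U & Ck_on N U v" by (intro exI[of _ "ball 0 (norm x + 1)"]) auto
 qed
 fix "is" :: "'a list" assume h: "set is <= Basis & length is = N"
 show "lhol \<gamma> (dpart is v)" unfolding lhol_def
 proof
  fix R :: real
  have "0 < \<bar>R\<bar> + 1" by simp
  then obtain w where w: "HC N \<gamma> w" "!!a. a : ball 0 (\<bar>R\<bar> + 1) ==> v a = w a"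
   using assms by blast
  have e: "dpart is v x = dpart is w x" if "x : cball 0 R" for x
   by (rule dpart_cong[of "ball 0 (\<bar>R\<bar> + 1)"]) (use w(2) that in auto)
  have "lhol \<gamma> (dpart is w)" using w(1) h unfolding HC_def by blast
  thus "EX H>=0. ALL x:cball 0 R. ALL y:cball 0 R. \<bar>dpart is v x - dpart is v y\<bar> <= H * dist x y powr \<gamma>"
   unfolding lhol_def using e by (metis (no_types, lifting))
 qed
qed

text \<open>If one point lies outside the ball of radius |r| + 1 and the other inside radius r,
  their distance is at least 1 and the sup bound takes over.\<close>

lemma lhol_support_global:
 assumes "lhol \<theta> G" "0 <= \<theta>" "!!x. norm x > r ==> G x = 0" "continuous_on UNIV G"
 shows "EX H. ALL x y. \<bar>G x - G y\<bar> <= H * dist x y powr \<theta>"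
proof -
 obtain H where H: "H >= 0" "!!x y. x : cball 0 (\<bar>r\<bar> + 1) ==> y : cball 0 (\<bar>r\<bar> + 1) ==> \<bar>G x - G y\<bar> <= H * dist x y powr \<theta>"
  using assms(1) unfolding lhol_def by blast
 obtain B where B: "B >= 0" "!!x. norm (G x) <= B" using support_bounded[OF assms(3,4)] by blast
 have far: "\<bar>G x - G y\<bar> <= (H + B) * dist x y powr \<theta>" if x: "x ~: cball 0 (\<bar>r\<bar> + 1)" for x y
 proof (cases "norm y > r")
  case True
  hence "G x = 0" "G y = 0" using assms(3) x by auto
  thus ?thesis using H B by simp
 next
  case False
  have "norm x <= norm y + dist x y" using norm_triangle_ineq2[of x y] by (simp add: dist_norm)
  hence "1 <= dist x y" using x False by auto
  hence "1 <= dist x y powr \<theta>" using assms(2) by (simp add: ge_one_powr_ge_zero)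
  hence "B * 1 <= (H + B) * dist x y powr \<theta>" using H B by (intro mult_mono) auto
  moreover have "G x = 0" using assms(3) x by auto
  ultimately show ?thesis using B(2)[of y] by simp
 qed
 have "\<bar>G x - G y\<bar> <= (H + B) * dist x y powr \<theta>" for x y
 proof (cases "x : cball 0 (\<bar>r\<bar> + 1) & y : cball 0 (\<bar>r\<bar> + 1)")
  case True
  hence "\<bar>G x - G y\<bar> <= H * dist x y powr \<theta>" using H(2) by blast
  also have "\<dots> <= (H + B) * dist x y powr \<theta>" using B(1) by (intro mult_right_mono) auto
  finally show ?thesis .
 next
  case False
  thus ?thesis using far[of x y] far[of y x] by (auto simp: dist_commute abs_minus_commute)
 qed
 thus ?thesis by blast
qed

lemma global_holder_HC:
 assumes "Ck_on N UNIV w" "!!is. set is <= Basis ==> length is = N ==> EX C. ALL x y. \<bar>dpart is w x - dpart is w y\<bar> <= C * dist x y powr \<gamma>"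
 shows "HC N \<gamma> w"
 unfolding HC_def
proof (intro conjI allI impI assms(1))
 fix "is" :: "'a list" assume h: "set is <= Basis & length is = N"
 then obtain C where C: "!!x y. \<bar>dpart is w x - dpart is w y\<bar> <= C * dist x y powr \<gamma>" using assms(2) by blast
 have "\<bar>dpart is w x - dpart is w y\<bar> <= \<bar>C\<bar> * dist x y powr \<gamma>" for x y
  using C[of x y] by (rule order_trans) (simp add: mult_right_mono)
 thus "lhol \<gamma> (dpart is w)" unfolding lhol_def by (intro allI exI[of _ "\<bar>C\<bar>"]) auto
qed

lemma HC_affine_comb:
 assumes "HC N \<gamma> w" "!!k. Ck_on k UNIV S" "0 <= \<gamma>" "\<gamma> <= 1"
 shows "HC N \<gamma> (%a. c * w a + S a)"
 by (intro HC_add HC_mult assms HC_of_Ck) auto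

lemma local_bounded_cball:
 fixes v :: "'a::euclidean_space => real"
 assumes "!!x0. EX r>0. EX M. ALL y:ball x0 r. \<bar>v y\<bar> <= M"
 shows "EX M>=0. ALL y:cball 0 R. \<bar>v y\<bar> <= M"
proof -
 have "ALL x. EX p. fst p > 0 & (ALL y:ball x (fst p). \<bar>v y\<bar> <= snd p)" using assms by auto
 then obtain p where p: "!!x. fst (p x) > 0 & (ALL y:ball x (fst (p x)). \<bar>v y\<bar> <= snd (p x))" by metis
 have "!!D. cball 0 R <= \<Union>((%x. ball x (fst (p x))) ` cball 0 R)" using p by force
 then obtain D where D: "D <= cball 0 R" "finite D" "cball 0 R <= (\<Union>x\<in>D. ball x (fst (p x)))"
  using compactE_image[OF compact_cball, of "cball 0 R" "%x. ball x (fst (p x))" 0 R] by auto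
 define M where "M = (\<Sum>x\<in>D. \<bar>snd (p x)\<bar>)"
 have "\<bar>v y\<bar> <= M" if y: "y : cball 0 R" for y
 proof -
  obtain x where x: "x : D" "y : ball x (fst (p x))" using D(3) y by blast
  hence "\<bar>v y\<bar> <= snd (p x)" using p by blast
  also have "\<dots> <= \<bar>snd (p x)\<bar>" by simp
  also have "\<dots> <= M" unfolding M_def using x D by (intro member_le_sum) auto
  finally show ?thesis .
 qed
 moreover have "0 <= M" unfolding M_def by (intro sum_nonneg) auto
 ultimately show ?thesis by blast
qed

section \<open>Feedback: densities |y|^p exp (m v) with v their own potential\<close>

context
 fixes v h :: "'a::euclidean_space => real" and p c m :: real and g
 assumes n: "DIM('a) >= 2" and m: "m >= 0"
  and g_def: "g \<equiv> %y. norm y powr p * exp (m * v y)"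
  and R: "pot_repr c h g v"
  and lb: "!!x0. EX r>0. EX M. ALL y:ball x0 r. \<bar>v y\<bar> <= M"
begin

lemma exp_v_bound: "EX r>0. EX M. ALL y:ball x0 r. exp (m * v y) <= M"
proof -
 obtain r M where r: "r > 0" "!!y. y : ball x0 r ==> \<bar>v y\<bar> <= M" using lb by blast
 have "exp (m * v y) <= exp (m * M)" if "y : ball x0 r" for y
  using r(2)[OF that] m by (simp add: mult_left_mono)
 thus ?thesis using r(1) by blast
qed

lemma exp_v_Ck:
 assumes "open \<Omega>" "Ck_on k \<Omega> v"
 shows "Ck_on k \<Omega> (%y. exp (m * v y))"
 by (rule Ck_on_compose[OF assms(1) open_UNIV Ck_on_exp Ck_on_mult[OF assms(1) Ck_on_const assms(2)]]) auto

text \<open>Off the origin the weight is smooth, so v in C^k gives a density in C^k, and then v in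
  C^(k+1).\<close>

lemma smooth_away: "Ck_on k (UNIV - {0}) v"
proof (induction k)
 have o: "open (UNIV - {0::'a})" by (simp add: open_delete)
 have c1: "Ck_on 1 (UNIV - {0}) v"
 proof (rule boot_0[OF n R])
  fix x0 :: 'a assume "x0 : UNIV - {0}"
  hence x0: "norm x0 > 0" by simp
  obtain r M where r: "r > 0" "!!y. y : ball x0 r ==> exp (m * v y) <= M" using exp_v_bound by blast
  define \<rho> where "\<rho> = min r (norm x0 / 2)"
  define B where "B = (norm x0 / 2) powr p + (2 * norm x0) powr p"
  have "\<bar>g y\<bar> <= B * M" if y: "y : ball x0 \<rho>" for y
  proof -
   have d: "dist x0 y < norm x0 / 2" "y : ball x0 r" using y by (auto simp: \<rho>_def)
   have ny: "norm x0 / 2 <= norm y" "norm y <= 2 * norm x0"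
    using d(1) norm_triangle_ineq2[of x0 y] norm_triangle_ineq2[of y x0] by (auto simp: dist_norm norm_minus_commute)
   have "norm y powr p <= B"
   proof (cases "p >= 0")
    case True
    hence "norm y powr p <= (2 * norm x0) powr p" using ny by (intro powr_mono2) auto
    thus ?thesis by (simp add: B_def add_increasing)
   next
    case False
    hence "norm y powr p <= (norm x0 / 2) powr p" using ny x0 by (intro powr_mono2') auto
    thus ?thesis by (simp add: B_def add_increasing2)
   qed
   hence "norm y powr p * exp (m * v y) <= B * M" using r(2)[OF d(2)] by (intro mult_mono) (auto simp: B_def)
   thus ?thesis by (simp add: g_def)
  qed
  moreover have "\<rho> > 0" using r(1) x0 by (simp add: \<rho>_def)
  ultimately show "EX r>0. EX B. ALL y:ball x0 r. \<bar>g y\<bar> <= B" by blast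
 qed
 {
  case 0
  thus ?case using Ck_on_continuous[OF c1] by simp
 next
  case (Suc k)
  have "Ck_on k (UNIV - {0}) g" unfolding g_def
   by (intro Ck_on_mult norm_powr_Ck exp_v_Ck o Suc)
  thus ?case by (rule boot_step[OF n R o])
 }
qed

lemma g_local_bound:
 assumes "p >= 0"
 shows "EX r>0. EX B. ALL y:ball x0 r. \<bar>g y\<bar> <= B"
proof -
 obtain r M where r: "r > 0" "!!y. y : ball x0 r ==> exp (m * v y) <= M" using exp_v_bound by blast
 have "\<bar>g y\<bar> <= (norm x0 + r) powr p * M" if "y : ball x0 r" for y
 proof -
  have "norm y <= norm x0 + r" using that norm_triangle_ineq2[of y x0] by (auto simp: dist_norm norm_minus_commute)
  hence "norm y powr p <= (norm x0 + r) powr p" using assms by (intro powr_mono2) auto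
  hence "norm y powr p * exp (m * v y) <= (norm x0 + r) powr p * M" using r(2)[OF that] by (intro mult_mono) auto
  thus ?thesis by (simp add: g_def)
 qed
 thus ?thesis using r(1) by blast
qed

text \<open>For an even integer exponent the weight is the polynomial (y . y)^j, so the bootstrap
  meets no obstacle at the origin.\<close>

lemma smooth_everywhere:
 assumes "p = 2 * real j"
 shows "Ck_on k UNIV v"
proof -
 \<comment> \<open>The two densities can differ at the origin: for j = 0,
   \<open>0 powr 0 = 0\<close> while \<open>0 ^ 0 = 1\<close>. The change takes place on a null
   set.\<close>
 define g' where "g' y = (sq y) ^ j * exp (m * v y)" for y
 have [measurable]: "v : bmeas" by (rule pot_repr_measurable[OF R])
 have gm: "g' : bmeas" unfolding g'_def by measurable
 have "AE y in lborel. y ~= (0::'a)" by (rule AE_lborel_singleton)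
 hence ae: "AE y in lborel. g y = g' y"
 proof eventually_elim
  case (elim y)
  have "norm y powr p = norm y ^ (2 * j)" using elim assms powr_realpow[of "norm y" "2 * j"] by simp
  thus ?case by (simp add: g_def g'_def power_mult power2_norm_eq_inner)
 qed
 have R': "pot_repr c h g' v" by (rule pot_repr_cong[OF R ae gm])
 show ?thesis
 proof (induction k)
  case 0
  have "Ck_on 1 UNIV v" by (rule boot_0[OF n R g_local_bound]) (use assms in auto)
  thus ?case using Ck_on_continuous by auto
 next
  case (Suc k)
  have "Ck_on k UNIV (%y::'a. (sq y) ^ i)" for i
   by (induction i) (auto intro!: Ck_on_mult Ck_on_inner_self)
  hence "Ck_on k UNIV g'" unfolding g'_def by (intro Ck_on_mult exp_v_Ck Suc) auto
  thus ?case by (rule boot_step[OF n R' open_UNIV])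
 qed
qed

text \<open>The weight limits the density to C^(k, theta), and \<open>VT_schauder\<close> adds n
  derivatives. Allowing d = 1 covers the integer exponent p = k + 1, at the price of theta < 1; this
  is the loss in the odd case.\<close>

lemma HC_positive:
 assumes p: "p = real k + d" and d: "0 < d" "d <= 1" and \<theta>: "0 < \<theta>" "\<theta> <= d" "\<theta> < 1"
 shows "HC (DIM('a) + k) \<theta> v"
proof -
 have w: "HC k \<theta> (%x::'a. norm x powr p)" unfolding p by (rule norm_powr_HC) (use d \<theta> in auto)
 \<comment> \<open>Order k + 1 is reached so that exp (m v) belongs to \<open>HC k \<theta>\<close>
   and the weight alone limits the density.\<close>
 have "Ck_on j UNIV v" if "j <= Suc k" for j
  using that
 proof (induction j)
  case 0
  have "Ck_on 1 UNIV v" by (rule boot_0[OF n R g_local_bound]) (use p d in auto)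
  thus ?case using Ck_on_continuous by auto
 next
  case (Suc j)
  have "Ck_on j UNIV g" unfolding g_def
   using Suc by (intro Ck_on_mult exp_v_Ck Ck_on_mono[OF HC_Ck[OF w]]) auto
  thus ?case by (rule boot_step[OF n R open_UNIV])
 qed
 hence "HC k \<theta> (%y. exp (m * v y))" using \<theta> by (intro HC_of_Ck exp_v_Ck) auto
 hence gH: "HC k \<theta> g" unfolding g_def using w \<theta> by (intro HC_mult) auto
 show ?thesis
 proof (rule HC_local)
  fix \<rho> :: real assume \<rho>: "\<rho> > 0"
  define r where "r = 4 * \<rho>"
  have r: "r > 0" using \<rho> by (simp add: r_def)
  let ?F = "%y. cutoff r (y - 0) * g y"
  have F: "HC k \<theta> ?F" by (rule HC_mult[OF _ _ HC_of_Ck[OF cut_Ck] gH]) (use \<theta> in auto)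
  have z: "?F y = 0" if "norm y > norm (0::'a) + r" for y using cut_eq_0_away[OF r that] by simp
  obtain B where B: "!!y. norm (?F y) <= B" using support_bounded[OF z Ck_on_continuous[OF HC_Ck[OF F]]] by blast
  hence bd: "\<bar>?F y\<bar> <= B" for y by (metis real_norm_def)
  obtain S where S: "!!k. Ck_on k UNIV S" "!!a. a : ball 0 (r / 4) ==> v a = c * VT ?F a + S a"
   using pot_repr_local_bounded[OF R r bd] by blast
  have H: "EX H. ALL x y. \<bar>dpart is ?F x - dpart is ?F y\<bar> <= H * dist x y powr \<theta>" if h: "set is <= Basis" "length is = k" for "is"
  proof (rule lhol_support_global[where r=r])
   show "lhol \<theta> (dpart is ?F)" using F h unfolding HC_def by blast
   show "dpart is ?F x = 0" if "norm x > r" for x by (rule dpart_support[of r]) (use z that in auto)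
   show "continuous_on UNIV (dpart is ?F)" using Ck_on_dpart_continuous[OF HC_Ck[OF F]] h by auto
  qed (use \<theta> in auto)
  have "HC (DIM('a) + k) \<theta> (VT ?F)"
   by (rule global_holder_HC[OF VT_schauder(1)[OF HC_Ck[OF F] z \<theta>(1,3) H] VT_schauder(2)[OF HC_Ck[OF F] z \<theta>(1,3) H]])
  hence "HC (DIM('a) + k) \<theta> (%a. c * VT ?F a + S a)" using S(1) \<theta> by (intro HC_affine_comb) auto
  thus "EX w. HC (DIM('a) + k) \<theta> w & (ALL a:ball 0 \<rho>. v a = w a)"
   using S(2) by (intro exI[of _ "%a. c * VT ?F a + S a"]) (auto simp: r_def)
 qed
qed

text \<open>The density is known only through a bound by a multiple of |y|^p, which acts like the
  negative regularity p; every splitting N + gamma <= n + p is then within reach of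
  \<open>VT_regular\<close>.\<close>

lemma HC_negative:
 assumes p: "- real DIM('a) < p" "p < 0" and \<gamma>: "0 < \<gamma>" "\<gamma> < 1" and N: "real N + \<gamma> <= real DIM('a) + p"
 shows "HC N \<gamma> v"
proof (rule HC_local)
 fix \<rho> :: real assume \<rho>: "\<rho> > 0"
 define r where "r = 4 * \<rho>"
 have r: "r > 0" using \<rho> by (simp add: r_def)
 have g: "Lint g" using R unfolding pot_repr_def by auto
 \<comment> \<open>The regularity claimed for the density, lowered from p if necessary so that n +
   sigma is N plus a fraction in (0, 1).\<close>
 define \<sigma> where "\<sigma> = real N + \<gamma> - real DIM('a)"
 have \<sigma>: "real DIM('a) + \<sigma> = real N + \<gamma>" "\<sigma> <= p" using N by (auto simp: \<sigma>_def)
 let ?F = "%y. cutoff r (y - 0) * g y"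
 have Fi: "Lint ?F" by (rule cut_integrable[OF g])
 obtain M where M: "M >= 0" "!!y. y : cball 0 r ==> \<bar>v y\<bar> <= M" using local_bounded_cball[OF lb] by blast
 have Fb: "\<bar>?F y\<bar> <= exp (m * M) * norm y powr p" for y
 proof (cases "y : cball 0 r")
  case True
  have "exp (m * v y) <= exp (m * M)" using M(2)[OF True] m by (simp add: mult_left_mono)
  hence "cutoff r y * (norm y powr p * exp (m * v y)) <= 1 * (norm y powr p * exp (m * M))"
   using cutoff_bounds[of r y] by (intro mult_mono mult_left_mono) auto
  thus ?thesis using cutoff_bounds[of r y] by (simp add: g_def mult.commute)
 next
  case False thus ?thesis using r by (simp add: cutoff_eq_0)
 qed
 have sing: "EX C. ALL t>0. ALL x. \<bar>dpart is (hc t G) x\<bar> <= C * t powr ((p - real (length is)) / 2)"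
  if "set is <= Basis" "Lint G" "!!y. \<bar>G y\<bar> <= exp (m * M) * norm y powr p" for "is" and G :: "'a => real"
  by (rule hc_dpart_singular[OF that(1) p(1) less_imp_le[OF p(2)] that(2)]) (use that(3) in auto)
 obtain C0 where C0: "!!t x. t > 0 ==> \<bar>dpart [] (hc t (%y. \<bar>?F y\<bar>)) x\<bar> <= C0 * t powr ((p - real (length [])) / 2)"
  using sing[of "[]" "%y. \<bar>?F y\<bar>"] integrable_abs[OF Fi] Fb by auto
 have "EX S. (ALL k. Ck_on k UNIV S) & (ALL a:ball 0 (r / 4). v a = c * VT ?F a + S a)"
 proof (rule pot_repr_local[OF R r, where b="%t. C0 * t powr (p / 2)"])
  show "Lint (%t. hw DIM('a) t * (C0 * t powr (p / 2)))"
   using p by (intro integrable_hw_powr) auto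
  show "hc t (%y. \<bar>?F y\<bar>) x <= C0 * t powr (p / 2)" if "t : {0<..<1}" for t x
   using C0[of t x] that by auto
 qed
 then obtain S where S: "!!k. Ck_on k UNIV S" "!!a. a : ball 0 (r / 4) ==> v a = c * VT ?F a + S a" by blast
 have b: "EX C. ALL t:{0<..<1}. ALL x. \<bar>dpart is (hc t ?F) x\<bar> <= C * t powr (min (\<sigma> - real (length is)) 0 / 2)"
  if h: "set is <= Basis" for "is"
 proof -
  obtain C where C: "!!t x. t > 0 ==> \<bar>dpart is (hc t ?F) x\<bar> <= C * t powr ((p - real (length is)) / 2)"
   using sing[OF h Fi Fb] by blast
  have "\<bar>dpart is (hc t ?F) x\<bar> <= \<bar>C\<bar> * t powr (min (\<sigma> - real (length is)) 0 / 2)" if t: "t : {0<..<1}" for t x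
  proof -
   have "\<bar>dpart is (hc t ?F) x\<bar> <= C * t powr ((p - real (length is)) / 2)" using C t by auto
   also have "\<dots> <= \<bar>C\<bar> * t powr (min (\<sigma> - real (length is)) 0 / 2)"
    using t \<sigma>(2) p by (intro mult_mono powr_mono') auto
   finally show ?thesis .
  qed
  thus ?thesis by blast
 qed
 have "HC N \<gamma> (VT ?F)"
  by (rule global_holder_HC[OF VT_regular(1)[OF Fi b \<sigma>(1) \<gamma>] VT_regular(2)[OF Fi b \<sigma>(1) \<gamma>]])
 hence "HC N \<gamma> (%a. c * VT ?F a + S a)" using S(1) \<gamma> by (intro HC_affine_comb) auto
 thus "EX w. HC N \<gamma> w & (ALL a:ball 0 \<rho>. v a = w a)"
  using S(2) by (intro exI[of _ "%a. c * VT ?F a + S a"]) (auto simp: r_def)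
qed

lemma Cs_negative:
 assumes p: "- real DIM('a) < p" "p < 0" and s: "0 < s" "s < real DIM('a) + p"
 shows "Cs_loc s v"
proof -
 define N where "N = nat \<lfloor>s\<rfloor>"
 have N: "real N <= s" "s < real N + 1" using s(1) by (auto simp: N_def)
 \<comment> \<open>For an integer s the fraction would be 0, which \<open>VT_regular\<close>
   excludes; a positive one is taken instead, at most half of the gap n + p - s.\<close>
 define \<gamma> where "\<gamma> = (if real N = s then min (1/2) ((real DIM('a) + p - s) / 2) else s - real N)"
 have \<gamma>: "0 < \<gamma>" "\<gamma> < 1" "real N + \<gamma> <= real DIM('a) + p" "s <= real N + \<gamma>"
  using N s by (auto simp: \<gamma>_def min_def field_simps)
 have "HC N \<gamma> v" by (rule HC_negative[OF p \<gamma>(1,2,3)])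
 thus ?thesis using \<gamma> s by (intro HC_imp_Cs_loc_le) auto
qed

lemma regularity_conclusion:
 assumes p: "p = real DIM('a) * \<alpha>" and \<alpha>: "\<alpha> > -1"
 shows "smooth_on (UNIV - {0}) v"
  and "(\<alpha> : {-1<..<0} | (EX k::nat. real DIM('a) * \<alpha> - 1 = 2 * real k)) ==> 0 < s ==> s < real DIM('a) * (1 + \<alpha>) ==> Cs_loc s v"
  and "\<alpha> > 0 ==> real DIM('a) * \<alpha> ~: \<nat> ==> Cs_loc (real DIM('a) * (1 + \<alpha>)) v"
  and "(EX k::nat. real DIM('a) * \<alpha> = 2 * real k) ==> smooth_on UNIV v"
proof -
 have D: "real DIM('a) * (1 + \<alpha>) = real DIM('a) + p" by (simp add: p algebra_simps)
 have Dp: "0 < real DIM('a)" by simp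
 show "smooth_on (UNIV - {0}) v" unfolding smooth_on_def using smooth_away by blast
 show "(EX k::nat. real DIM('a) * \<alpha> = 2 * real k) ==> smooth_on UNIV v"
  unfolding smooth_on_def using smooth_everywhere p by blast
 show "Cs_loc s v" if a: "\<alpha> : {-1<..<0} | (EX k::nat. real DIM('a) * \<alpha> - 1 = 2 * real k)" and s: "0 < s" "s < real DIM('a) * (1 + \<alpha>)"
  using a
 proof
  assume "\<alpha> : {-1<..<0}"
  hence "- real DIM('a) < p" "p < 0" unfolding p
   using mult_strict_left_mono[of "-1" \<alpha> "real DIM('a)"] by (auto simp: mult_pos_neg)
  thus ?thesis using s unfolding D by (intro Cs_negative) auto
 next
  assume "EX k::nat. real DIM('a) * \<alpha> - 1 = 2 * real k"
  then obtain k :: nat where "real DIM('a) * \<alpha> - 1 = 2 * real k" by blast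
  hence k: "p = real (2 * k) + 1" unfolding p by simp
  \<comment> \<open>An exponent large enough to reach s; it stays below 1 because s < n + 2 k +
    1.\<close>
  define \<theta> where "\<theta> = max (1/2) (s - real (DIM('a) + 2 * k))"
  have \<theta>: "0 < \<theta>" "\<theta> <= 1" "\<theta> < 1" "s <= real (DIM('a) + 2 * k) + \<theta>" using s unfolding D k by (auto simp: \<theta>_def)
  have "HC (DIM('a) + 2 * k) \<theta> v" by (rule HC_positive[OF k _ _ \<theta>(1,2,3)]) auto
  thus ?thesis using \<theta> s by (intro HC_imp_Cs_loc_le) auto
 qed
 show "Cs_loc (real DIM('a) * (1 + \<alpha>)) v" if a: "\<alpha> > 0" "real DIM('a) * \<alpha> ~: \<nat>"
 proof -
  have p0: "p > 0" using a Dp by (simp add: p)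
  \<comment> \<open>Since p is not an integer, its fractional part d lies strictly between 0 and 1,
    and the full exponent n + p is attained.\<close>
  define k where "k = nat \<lfloor>p\<rfloor>"
  define d where "d = p - real k"
  have k: "real k <= p" "p < real k + 1" using p0 by (auto simp: k_def)
  have "real k ~= p" using a(2) unfolding p by (metis of_nat_in_Nats)
  hence d: "0 < d" "d < 1" "p = real k + d" using k by (auto simp: d_def)
  have "HC (DIM('a) + k) d v" by (rule HC_positive[OF d(3)]) (use d in auto)
  hence "Cs_loc (real (DIM('a) + k) + d) v" using d by (intro HC_imp_Cs_loc) auto
  moreover have "real (DIM('a) + k) + d = real DIM('a) * (1 + \<alpha>)" unfolding D using d(3) by simp
  ultimately show ?thesis by simp
 qed
qed

end

section \<open>Local boundedness of exponentially integrable potentials\<close>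

lemma Phi_nonneg: "0 <= Phi x"
 unfolding Phi_def
proof (rule integral_nonneg_AE, rule AE_I2)
 fix t :: real
 show "0 <= hw DIM('a) t * hk t (x::'a)"
  by (cases "t > 0") (auto simp: hk_nonneg hw_def)
qed

text \<open>The constant (4 pi)^(-n/2). Near 0 the kernel is at most -2 \<open>kap\<close> log |x|
  up to a constant, so this number decides which exponentials of \<open>Phi\<close> are
  integrable.\<close>

definition kap :: "'a::euclidean_space itself => real" where
 "kap _ = (1 / sqrt (4 * pi)) ^ DIM('a)"

lemma kap_pos: "kap TYPE('a::euclidean_space) > 0"
 unfolding kap_def by simp

text \<open>The powers of t cancel to 1 / t, which is the source of the logarithm.\<close>

lemma hw_hk:
 assumes "t : {0<..<1}"
 shows "hw DIM('a) t * hk t (x::'a::euclidean_space) = kap TYPE('a) * (exp (- (sq x) / (4 * t)) / t)"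
proof -
 have t: "t > 0" using assms by simp
 have "(1 / sqrt (4 * pi * t)) ^ DIM('a) = (1 / sqrt t) ^ DIM('a) * kap TYPE('a)"
  by (simp add: kap_def power_mult_distrib[symmetric] real_sqrt_mult mult.commute)
 also have "(1 / sqrt t) ^ DIM('a) = t powr (- real DIM('a) / 2)" by (rule inverse_sqrt_power[OF t])
 finally have "hw DIM('a) t * hk t x = (t powr (real DIM('a) / 2 - 1) * t powr (- real DIM('a) / 2)) * kap TYPE('a) * exp (- (sq x) / (4 * t))"
  using assms by (simp add: hw_def hk_def)
 also have "t powr (real DIM('a) / 2 - 1) * t powr (- real DIM('a) / 2) = 1 / t"
 proof -
  have "real DIM('a) / 2 - 1 + - real DIM('a) / 2 = - 1" by simp
  hence "t powr (real DIM('a) / 2 - 1) * t powr (- real DIM('a) / 2) = t powr (- 1)" by (simp only: powr_add[symmetric])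
  thus ?thesis using t by (simp add: powr_minus_divide)
 qed
 finally show ?thesis by (simp add: field_simps)
qed

lemma Phi_integrable_t:
 assumes "x ~= 0"
 shows "Lint (%t. hw DIM('a) t * hk t (x::'a::euclidean_space))"
proof -
 obtain B where B: "ALL t:{0<..1}. ALL y::'a. norm y >= norm x --> \<bar>hk t y\<bar> <= B"
  using hk_dpart_away_bounded[of "[]" "norm x"] assms by auto
 show ?thesis
 proof (rule integrable_dom[OF integrable_hw[OF DIM_positive, of B]])
  show "AE t in lborel. norm (hw DIM('a) t * hk t x) <= norm (hw DIM('a) t * B)"
  proof (intro AE_I2)
   fix t
   show "norm (hw DIM('a) t * hk t x) <= norm (hw DIM('a) t * B)"
   proof (cases "t : {0<..<1}")
    case True
    hence "\<bar>hk t x\<bar> <= B" using B by auto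
    thus ?thesis by (simp add: abs_mult mult_left_mono)
   qed (auto simp: hw_def)
  qed
 qed measurable
qed

lemma Phi_away_bounded:
 assumes "r > 0"
 shows "EX B>=0. ALL x::'a::euclidean_space. norm x >= r --> Phi x <= B"
proof -
 obtain B where B: "ALL t:{0<..1}. ALL y::'a. norm y >= r --> \<bar>hk t y\<bar> <= B"
  using hk_dpart_away_bounded[of "[]" r] assms by auto
 have "Phi x <= (LBINT t. hw DIM('a) t * \<bar>B\<bar>)" if x: "norm x >= r" for x :: 'a
  unfolding Phi_def
 proof (rule integral_mono)
  show "Lint (%t. hw DIM('a) t * hk t x)" using x assms by (intro Phi_integrable_t) auto
  show "Lint (%t. hw DIM('a) t * \<bar>B\<bar>)" by (rule integrable_hw) simp
  show "hw DIM('a) t * hk t x <= hw DIM('a) t * \<bar>B\<bar>" for t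
  proof (cases "t : {0<..<1}")
   case True
   hence "\<bar>hk t x\<bar> <= B" using B x by auto
   thus ?thesis by (intro mult_left_mono) auto
  qed (auto simp: hw_def)
 qed
 moreover have "0 <= (LBINT t. hw DIM('a) t * \<bar>B\<bar>)" by (rule integral_nonneg_AE) auto
 ultimately show ?thesis by blast
qed

lemma exp_minus_le: "z > 0 ==> exp (- z) <= 1 / (z::real)"
proof -
 assume z: "z > 0"
 have "z <= exp z" using exp_ge_add_one_self[of z] by linarith
 thus ?thesis using z by (simp add: exp_minus field_simps)
qed

text \<open>Split the time integral at t = |x|^2. Below, exp(-z) <= 1/z bounds the integrand by 4 /
  |x|^2 and contributes 4; above, 1 / t contributes -2 log |x|.\<close>

lemma Phi_log_bound:
 assumes "x ~= 0" "norm x <= 1"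
 shows "Phi (x::'a::euclidean_space) <= kap TYPE('a) * (4 - 2 * ln (norm x))"
proof -
 define r where "r = norm x"
 have r: "0 < r" "r <= 1" using assms by (simp_all add: r_def)
 have r2: "0 < r\<^sup>2" "r\<^sup>2 <= 1" using r by (auto simp: power_le_one)
 have lnI: "has_bochner_integral lborel (%t. 1 / t * ind {r\<^sup>2 .. 1} t) (ln 1 - ln (r\<^sup>2))"
 proof (rule has_bochner_integral_FTC_Icc_real[where F=ln])
  show "DERIV ln t :> 1 / t" if "r\<^sup>2 <= t" "t <= 1" for t
   using that r2 by (intro DERIV_ln_divide) linarith
  show "isCont (%t. 1 / t) t" if "r\<^sup>2 <= t" "t <= 1" for t
   using that r2 by (intro continuous_intros) auto
 qed (use r2 in auto)
 have cI: "has_bochner_integral lborel (%t. ind {0<..<r\<^sup>2} t * (4 / r\<^sup>2)) (measure lborel {0<..<r\<^sup>2} * (4 / r\<^sup>2))"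
  by (intro has_bochner_integral_mult_left has_bochner_integral_real_indicator) (use r2 in auto)
 have tot: "has_bochner_integral lborel (%t. ind {0<..<r\<^sup>2} t * (4 / r\<^sup>2) + 1 / t * ind {r\<^sup>2 .. 1} t) (4 - 2 * ln r)"
  using has_bochner_integral_add[OF cI lnI] r r2 by (simp add: ln_realpow)
 have "Phi x <= (LBINT t. kap TYPE('a) * (ind {0<..<r\<^sup>2} t * (4 / r\<^sup>2) + 1 / t * ind {r\<^sup>2 .. 1} t))"
  unfolding Phi_def
 proof (rule integral_mono[OF Phi_integrable_t[OF assms(1)]])
  show "Lint (%t. kap TYPE('a) * (ind {0<..<r\<^sup>2} t * (4 / r\<^sup>2) + 1 / t * ind {r\<^sup>2 .. 1} t))"
   using tot by (intro integrable_mult_right) (auto simp: has_bochner_integral_iff)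
  show "hw DIM('a) t * hk t x <= kap TYPE('a) * (ind {0<..<r\<^sup>2} t * (4 / r\<^sup>2) + 1 / t * ind {r\<^sup>2 .. 1} t)" for t
  proof (cases "t : {0<..<1}")
   case True
   have xx: "sq x = r\<^sup>2" by (simp add: r_def power2_norm_eq_inner)
   have "exp (- (sq x) / (4 * t)) / t <= ind {0<..<r\<^sup>2} t * (4 / r\<^sup>2) + 1 / t * ind {r\<^sup>2 .. 1} t"
   proof (cases "t < r\<^sup>2")
    case True
    have "exp (- (r\<^sup>2 / (4 * t))) <= 1 / (r\<^sup>2 / (4 * t))" using \<open>t : {0<..<1}\<close> r2 by (intro exp_minus_le) auto
    hence "exp (- (r\<^sup>2 / (4 * t))) / t <= (1 / (r\<^sup>2 / (4 * t))) / t" using \<open>t : {0<..<1}\<close> by (intro divide_right_mono) auto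
    thus ?thesis using True \<open>t : {0<..<1}\<close> by (simp add: xx)
   next
    case False
    have "exp (- (r\<^sup>2 / (4 * t))) <= 1" using \<open>t : {0<..<1}\<close> by simp
    thus ?thesis using False \<open>t : {0<..<1}\<close> by (simp add: xx divide_right_mono)
   qed
   thus ?thesis unfolding hw_hk[OF True] using kap_pos[where 'a='a] by (intro mult_left_mono) auto
  next
   case False
   have "0 <= ind {0<..<r\<^sup>2} t * (4 / r\<^sup>2) + 1 / t * ind {r\<^sup>2 .. 1} t"
   proof (cases "r\<^sup>2 <= t")
    case True
    hence "0 < t" using r2 by linarith
    thus ?thesis by simp
   qed simp
   moreover have "hw DIM('a) t = 0" using False by (auto simp: hw_def)
   ultimately show ?thesis using kap_pos[where 'a='a] by (simp add: less_imp_le)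
  qed
 qed
 also have "\<dots> = kap TYPE('a) * (4 - 2 * ln r)" using tot by (simp add: has_bochner_integral_iff)
 finally show ?thesis by (simp add: r_def)
qed

text \<open>By the logarithmic bound the exponential is at most a constant times |z| to the power -2
  kappa \<open>kap\<close>, which is integrable near 0 when that exponent exceeds -n.\<close>

lemma exp_Phi_integrable:
 assumes \<kappa>: "0 <= \<kappa>" "\<kappa> * (2 * kap TYPE('a)) < real DIM('a::euclidean_space)"
 shows "Lint (%z::'a. ind (cball 0 1) z * exp (\<kappa> * Phi z))"
proof (rule integrable_dom)
 let ?q = "- (\<kappa> * (2 * kap TYPE('a)))"
 show "Lint (%y::'a. exp (\<kappa> * (kap TYPE('a) * 4)) * (ind (cball 0 1) y * norm y powr ?q))"
  using \<kappa> kap_pos[where 'a='a] by (intro integrable_mult_right integrable_norm_powr_ball) auto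
 have [measurable]: "cball (0::'a) 1 : sets borel" by simp
 have "(%z::'a. ind (cball 0 1) z * exp (\<kappa> * Phi z)) : bmeas" by measurable
 thus "(%z::'a. ind (cball 0 1) z * exp (\<kappa> * Phi z)) : borel_measurable lborel" by simp
 have "AE z::'a in lborel. z ~= 0" by (rule AE_lborel_singleton)
 thus "AE z::'a in lborel. norm (ind (cball 0 1) z * exp (\<kappa> * Phi z)) <= norm (exp (\<kappa> * (kap TYPE('a) * 4)) * (ind (cball 0 1) z * norm z powr ?q))"
 proof eventually_elim
  case (elim z)
  show ?case
  proof (cases "norm z <= 1")
   case True
   have "\<kappa> * Phi z <= \<kappa> * (kap TYPE('a) * (4 - 2 * ln (norm z)))"
    using Phi_log_bound[OF elim True] \<kappa>(1) by (rule mult_left_mono)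
   also have "\<dots> = \<kappa> * (kap TYPE('a) * 4) + ?q * ln (norm z)" by (simp add: algebra_simps)
   finally have "exp (\<kappa> * Phi z) <= exp (\<kappa> * (kap TYPE('a) * 4)) * norm z powr ?q"
    using elim by (simp add: powr_def exp_add[symmetric])
   thus ?thesis using True by simp
  qed simp
 qed
qed

section \<open>Inequalities of Young and Jensen type\<close>

lemma young_elementary:
 fixes a b \<delta> :: real
 assumes "0 <= a" "0 <= b" "\<delta> > 0"
 shows "a * b <= a powr (1 + \<delta>) + b powr ((1 + \<delta>) / \<delta>)"
proof (cases "a = 0 | b = 0")
 case False
 hence p: "a > 0" "b > 0" using assms by auto
 show ?thesis
 proof (cases "b <= a powr \<delta>")
  case True
  hence "a * b <= a * a powr \<delta>" using p by simp
  also have "\<dots> = a powr (1 + \<delta>)" using p by (simp add: powr_add)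
  finally show ?thesis by (simp add: add_increasing2)
 next
  case False
  hence "(a powr \<delta>) powr (1 / \<delta>) <= b powr (1 / \<delta>)" using p assms by (intro powr_mono2) auto
  hence "a <= b powr (1 / \<delta>)" using p assms by (simp add: powr_powr)
  hence "a * b <= b powr (1 / \<delta>) * b" using p by simp
  also have "\<dots> = b powr (1 / \<delta> + 1)" using p by (simp add: powr_add)
  also have "1 / \<delta> + 1 = (1 + \<delta>) / \<delta>" using assms by (simp add: field_simps)
  finally show ?thesis by (simp add: add_increasing)
 qed
qed auto

text \<open>If b <= exp (X / 2), the exponential absorbs the product; otherwise X < 2 log b, and log
  b is at most b^delta / delta. This serves as a pointwise duality between exponential and power
  integrability, without L^p spaces.\<close>

lemma young_exp:
 fixes X b \<delta> :: real
 assumes "0 <= X" "0 <= b" "\<delta> > 0"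
 shows "X * b <= 2 * exp X + (2 / \<delta>) * b powr (1 + \<delta>)"
proof (cases "b <= exp (X / 2)")
 case True
 have "X <= 2 * exp (X / 2)" using exp_ge_add_one_self[of "X / 2"] by linarith
 hence "X * b <= 2 * exp (X / 2) * exp (X / 2)" using assms True by (intro mult_mono) auto
 also have "\<dots> = 2 * exp X" by (simp add: exp_add[symmetric])
 finally show ?thesis using assms by (simp add: add_increasing2)
next
 case False
 hence b: "b > 0" using exp_gt_zero[of "X / 2"] by linarith
 have "X / 2 < ln b" using ln_less_cancel_iff[of "exp (X / 2)" b] False b by simp
 moreover have "ln b <= b powr \<delta> / \<delta>"
 proof -
  have "b powr \<delta> = exp (\<delta> * ln b)" using b by (simp add: powr_def)
  hence "\<delta> * ln b <= b powr \<delta>" using exp_ge_add_one_self[of "\<delta> * ln b"] by linarith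
  thus ?thesis using assms by (simp add: field_simps)
 qed
 ultimately have "X <= (2 / \<delta>) * b powr \<delta>" by simp
 hence "X * b <= (2 / \<delta>) * b powr \<delta> * b" using b by (intro mult_right_mono) auto
 also have "\<dots> = (2 / \<delta>) * b powr (1 + \<delta>)" using b by (simp add: powr_add)
 finally show ?thesis by (simp add: add_increasing)
qed

lemma integral_le_nn_integral:
 fixes f :: "'z => real"
 assumes "integrable M f" "!!x. x : space M ==> ennreal (f x) <= k x"
 shows "ennreal (\<integral>x. f x \<partial>M) <= (\<integral>\<^sup>+x. k x \<partial>M)"
proof -
 have i: "integrable M (%x. max (f x) 0)" using assms(1) by simp
 have "(\<integral>x. f x \<partial>M) <= (\<integral>x. max (f x) 0 \<partial>M)" by (rule integral_mono[OF assms(1) i]) simp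
 hence "ennreal (\<integral>x. f x \<partial>M) <= ennreal (\<integral>x. max (f x) 0 \<partial>M)" by (rule ennreal_leI)
 also have "\<dots> = (\<integral>\<^sup>+x. ennreal (max (f x) 0) \<partial>M)" by (rule nn_integral_eq_integral[symmetric, OF i]) simp
 also have "\<dots> <= (\<integral>\<^sup>+x. k x \<partial>M)" by (rule nn_integral_mono) (use assms(2) in \<open>auto simp: max_def ennreal_neg\<close>)
 finally show ?thesis .
qed

text \<open>Jensen's inequality for a measure of mass A at most m, through the tangent of exp at z:
  exp (m phi) >= e^z (1 + m phi - z). The missing mass m - A costs at most m because e^z (1 - z) <=
  1. The right side is a nonnegative integral since it may be infinite.\<close>

lemma exp_jensen:
 fixes F \<phi> :: "'z => real"
 assumes F: "integrable M F" "!!y. 0 <= F y" and P: "integrable M (%y. \<phi> y * F y)"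
  and m: "(\<integral>y. F y \<partial>M) <= m" "m > 0"
 shows "ennreal (m * exp (\<integral>y. \<phi> y * F y \<partial>M)) <= (\<integral>\<^sup>+y. ennreal (exp (m * \<phi> y) * F y) \<partial>M) + ennreal m"
proof -
 define z where "z = (\<integral>y. \<phi> y * F y \<partial>M)"
 define A where "A = (\<integral>y. F y \<partial>M)"
 have A: "0 <= A" "A <= m" using m(1) F(2) by (auto simp: A_def intro!: integral_nonneg_AE)
 have I: "(\<integral>y. exp z * ((1 - z) * F y + m * (\<phi> y * F y)) \<partial>M) = exp z * ((1 - z) * A + m * z)"
  unfolding z_def A_def using F(1) P by simp
 have "ennreal (\<integral>y. exp z * ((1 - z) * F y + m * (\<phi> y * F y)) \<partial>M) <= (\<integral>\<^sup>+y. ennreal (exp (m * \<phi> y) * F y) \<partial>M)"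
 proof (rule integral_le_nn_integral)
  show "integrable M (%y. exp z * ((1 - z) * F y + m * (\<phi> y * F y)))" using F P by auto
  show "ennreal (exp z * ((1 - z) * F y + m * (\<phi> y * F y))) <= ennreal (exp (m * \<phi> y) * F y)" for y
  proof (rule ennreal_leI)
   have "exp z * (1 + (m * \<phi> y - z)) <= exp z * exp (m * \<phi> y - z)"
    by (intro mult_left_mono exp_ge_add_one_self) auto
   hence "exp z * (1 + (m * \<phi> y - z)) <= exp (m * \<phi> y)" by (simp add: exp_diff)
   hence "exp z * (1 + (m * \<phi> y - z)) * F y <= exp (m * \<phi> y) * F y" using F(2) by (rule mult_right_mono)
   thus "exp z * ((1 - z) * F y + m * (\<phi> y * F y)) <= exp (m * \<phi> y) * F y" by (simp add: algebra_simps)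
  qed
 qed
 hence 1: "ennreal (exp z * ((1 - z) * A + m * z)) <= (\<integral>\<^sup>+y. ennreal (exp (m * \<phi> y) * F y) \<partial>M)" unfolding I .
 have "exp z * (1 - z) <= 1"
 proof -
  have "exp z * (1 + - z) <= exp z * exp (- z)" by (intro mult_left_mono exp_ge_add_one_self) auto
  thus ?thesis by (simp add: exp_minus)
 qed
 hence "(m - A) * (exp z * (1 - z)) <= (m - A) * 1" using A by (intro mult_left_mono) auto
 hence "(m - A) * (exp z * (1 - z)) <= m - A" by simp
 moreover have "m * exp z = exp z * ((1 - z) * A + m * z) + (m - A) * (exp z * (1 - z))" by (simp add: algebra_simps)
 ultimately have "m * exp z <= exp z * ((1 - z) * A + m * z) + m" using A by linarith
 hence "ennreal (m * exp z) <= ennreal (exp z * ((1 - z) * A + m * z) + m)" by (rule ennreal_leI)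
 also have "\<dots> <= ennreal (exp z * ((1 - z) * A + m * z)) + ennreal m"
  using m(2) by (cases "0 <= exp z * ((1 - z) * A + m * z)") (auto simp: ennreal_plus ennreal_neg intro: ennreal_leI)
 also have "\<dots> <= (\<integral>\<^sup>+y. ennreal (exp (m * \<phi> y) * F y) \<partial>M) + ennreal m" using 1 by (rule add_right_mono)
 finally show ?thesis by (simp add: z_def)
qed

text \<open>A point carries no mass, so dominated convergence applies to shrinking balls. The cap
  1/4 keeps differences between points of the balls of radii r and 2r inside the unit ball.\<close>

lemma small_mass:
 fixes g :: "'a::euclidean_space => real"
 assumes g: "Lint g" "!!y. 0 <= g y" and "\<eta> > 0"
 shows "EX r>0. r <= 1 / 4 & (LBINT y. ind (ball x0 (2 * r)) y * g y) <= \<eta>"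
proof -
 have [measurable]: "g : bmeas" using g by auto
 have "(%k. LBINT y. ind (ball x0 (1 / real (Suc k))) y * g y) \<longlonglongrightarrow> (\<integral>y. 0 \<partial>(lborel :: 'a measure))"
 proof (rule integral_dominated_convergence[OF _ _ g(1)])
  have "AE y in lborel. y ~= x0" by (rule AE_lborel_singleton)
  thus "AE y in lborel. (%k. ind (ball x0 (1 / real (Suc k))) y * g y) \<longlonglongrightarrow> 0"
  proof eventually_elim
   case (elim y)
   hence "dist x0 y > 0" by auto
   then obtain K where K: "1 / real (Suc K) < dist x0 y" by (meson nat_approx_posE)
   show ?case
   proof (rule tendsto_eventually, rule eventually_sequentiallyI[of K])
    fix k assume "K <= k"
    hence "1 / real (Suc k) <= 1 / real (Suc K)" by (simp add: frac_le)
    thus "ind (ball x0 (1 / real (Suc k))) y * g y = 0" using K by (simp add: indicator_def)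
   qed
  qed
  show "AE y in lborel. norm (ind (ball x0 (1 / real (Suc k))) y * g y) <= g y" for k
   using g(2) by (intro AE_I2) (auto simp: indicator_def)
  show "(%y. ind (ball x0 (1 / real (Suc k))) y * g y) : borel_measurable lborel" for k
  proof -
   have [measurable]: "ball x0 (1 / real (Suc k)) : sets borel" by simp
   have "(%y. ind (ball x0 (1 / real (Suc k))) y * g y) : bmeas" by measurable
   thus ?thesis by simp
  qed
 qed simp
 hence "\<forall>\<^sub>F k in sequentially. (LBINT y. ind (ball x0 (1 / real (Suc k))) y * g y) < \<eta>"
  using assms(3) by (intro order_tendstoD(2)[of _ 0]) auto
 then obtain K where K: "!!k. k >= K ==> (LBINT y. ind (ball x0 (1 / real (Suc k))) y * g y) < \<eta>"
  unfolding eventually_sequentially by blast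
 define k where "k = K + 1"
 have "1 / real (Suc k) / 2 <= 1 / 4" by (simp add: k_def field_simps)
 moreover have "0 < 1 / real (Suc k) / 2" by simp
 moreover have "2 * (1 / real (Suc k) / 2) = 1 / real (Suc k)" by (simp add: field_simps)
 moreover have "(LBINT y. ind (ball x0 (1 / real (Suc k))) y * g y) <= \<eta>" using K[of k] by (simp add: k_def less_imp_le)
 ultimately show ?thesis by metis
qed

lemma indicator_mult_measurable:
 fixes f :: "'a::euclidean_space => real"
 assumes "f : bmeas" "S : sets borel"
 shows "(%x. ind S x * f x) : bmeas"
proof -
 note [measurable] = assms
 show ?thesis by measurable
qed

section \<open>Exponential integrability and local boundedness\<close>

text \<open>An argument of Brezis-Merle type. The density near x0 has mass at most eta; Jensen turns
  the exponential of its potential into an average of exp (eta Q Phi (a - y)), which is integrable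
  in a once 2 eta Q \<open>kap\<close> < n. The far part of the density has a bounded
  potential.\<close>

lemma exp_potential_integrable:
 fixes g :: "'a::euclidean_space => real"
 assumes g: "Lint g" "!!y. 0 <= g y" and Q: "Q > 0"
 shows "EX r>0. r <= 1 / 4 & Lint (%a. ind (ball x0 r) a * exp (Q * (LBINT y. Phi (a - y) * g y)))"
proof -
 have gm[measurable]: "g : bmeas" using g by auto
 \<comment> \<open>Gives 2 eta Q \<open>kap\<close> = n / 2, half of the threshold in
   \<open>exp_Phi_integrable\<close>.\<close>
 define \<eta> where "\<eta> = real DIM('a) / (4 * kap TYPE('a) * Q)"
 have kp: "kap TYPE('a) > 0" by (rule kap_pos)
 have \<eta>: "\<eta> > 0" "\<eta> * Q * (2 * kap TYPE('a)) < real DIM('a)"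
  using kp Q by (simp_all add: \<eta>_def field_simps)
 obtain r where r: "r > 0" "r <= 1 / 4" "(LBINT y. ind (ball x0 (2 * r)) y * g y) <= \<eta>"
  using small_mass[OF g \<eta>(1), of x0] by blast
 define F where "F y = ind (ball x0 (2 * r)) y * g y" for y
 define G where "G y = ind (- ball x0 (2 * r)) y * g y" for y
 have [measurable]: "F : bmeas" "G : bmeas"
  unfolding F_def[abs_def] G_def[abs_def] by (intro indicator_mult_measurable gm; simp)+
 have F: "Lint F" "!!y. 0 <= F y" "!!y. F y <= g y"
  using g(2) by (auto simp: F_def indicator_def intro: integrable_dom[OF g(1)])
 have fg: "g y = F y + G y" for y by (simp add: F_def G_def indicator_def)
 have G: "0 <= G y" "G y <= g y" for y using g(2)[of y] by (simp_all add: G_def indicator_def)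
 obtain B where B: "B >= 0" "!!x::'a. norm x >= r ==> Phi x <= B" using Phi_away_bounded[OF r(1)] by blast
 define V where "V a = (LBINT y. Phi (a - y) * g y)" for a
 have [measurable]: "V : bmeas" unfolding V_def[abs_def] by measurable
 define I where "I = (LBINT y. g y)"
 have I0: "0 <= I" unfolding I_def using g(2) by (intro integral_nonneg_AE) auto
 define C0 where "C0 = exp (Q * (B * I))"
 have C0: "C0 >= 1" unfolding C0_def using Q B I0 by simp
 define J where "J a = (\<integral>\<^sup>+y. ennreal (exp (\<eta> * (Q * Phi (a - y))) * F y) \<partial>lborel)" for a
 have key: "ennreal (\<eta> * exp (Q * V a)) <= ennreal C0 * (J a + ennreal \<eta>)" if a: "a : ball x0 r" for a
 proof (cases "Lint (%y. Phi (a - y) * g y)")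
  case True
  have iF: "Lint (%y. Phi (a - y) * F y)"
   by (rule integrable_dom[OF True])
    (use F Phi_nonneg g(2) in \<open>auto simp: abs_mult intro!: mult_left_mono\<close>)
  have iG: "Lint (%y. Phi (a - y) * G y)"
   by (rule integrable_dom[OF True])
    (use G Phi_nonneg g(2) in \<open>auto simp: abs_mult intro!: mult_left_mono\<close>)
  have "Phi (a - y) * G y <= B * g y" for y
  proof (cases "y : ball x0 (2 * r)")
   case False
   have "dist x0 y <= dist x0 a + dist a y" by (rule dist_triangle)
   hence "norm (a - y) >= r" using False a by (simp add: dist_norm)
   thus ?thesis using B G[of y] by (intro mult_mono) auto
  qed (use B g(2) in \<open>auto simp: G_def\<close>)
  hence GB: "(LBINT y. Phi (a - y) * G y) <= B * I"
   unfolding I_def using integral_mono[OF iG integrable_mult_right[OF g(1)], of B] by simp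
  have "V a = (LBINT y. Phi (a - y) * F y) + (LBINT y. Phi (a - y) * G y)"
   unfolding V_def fg using iF iG by (simp add: distrib_left)
  hence "Q * V a <= (LBINT y. (Q * Phi (a - y)) * F y) + Q * (B * I)"
   using GB Q by (simp add: mult.assoc distrib_left[symmetric])
  hence "exp (Q * V a) <= C0 * exp (LBINT y. (Q * Phi (a - y)) * F y)"
   unfolding C0_def exp_add[symmetric] by (simp add: add.commute)
  hence "\<eta> * exp (Q * V a) <= C0 * (\<eta> * exp (LBINT y. (Q * Phi (a - y)) * F y))"
   using \<eta>(1) by (simp add: mult.left_commute)
  hence "ennreal (\<eta> * exp (Q * V a)) <= ennreal C0 * ennreal (\<eta> * exp (LBINT y. (Q * Phi (a - y)) * F y))"
   using C0 \<eta>(1) by (simp add: ennreal_mult[symmetric] ennreal_leI)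
  also have "\<dots> <= ennreal C0 * (J a + ennreal \<eta>)"
   unfolding J_def
  proof (intro mult_left_mono exp_jensen)
   show "Lint (%y. Q * Phi (a - y) * F y)" using integrable_mult_right[OF iF, of Q] by (simp add: mult.assoc)
   show "(LBINT y. F y) <= \<eta>" using r(3) by (simp add: F_def)
  qed (use F \<eta> in auto)
  finally show ?thesis .
 next
  \<comment> \<open>Where the potential is not integrable, V takes the default value 0 and the bound
    is trivial.\<close>
  case False
  hence "V a = 0" unfolding V_def by (rule not_integrable_integral_eq)
  hence "ennreal (\<eta> * exp (Q * V a)) = 1 * ennreal \<eta>" by simp
  also have "\<dots> <= ennreal C0 * (J a + ennreal \<eta>)" using C0 by (intro mult_mono) (auto simp: one_ennreal_def[symmetric] ennreal_leI add_increasing)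
  finally show ?thesis .
 qed
 define E where "E z = ind (cball 0 1) z * exp (\<eta> * Q * Phi z)" for z :: 'a
 have Ei: "Lint E" unfolding E_def[abs_def] by (rule exp_Phi_integrable) (use \<eta> Q in auto)
 have [measurable]: "E : bmeas" using Ei by auto
 have E0: "0 <= E z" for z by (simp add: E_def)
 have JE: "ind (ball x0 r) a * J a <= (\<integral>\<^sup>+y. ennreal (E (a - y) * F y) \<partial>lborel)" for a
 proof (cases "a : ball x0 r")
  case True
  have "exp (\<eta> * (Q * Phi (a - y))) * F y <= E (a - y) * F y" for y
  proof (cases "y : ball x0 (2 * r)")
   case yb: True
   have "dist a y <= dist a x0 + dist x0 y" by (rule dist_triangle)
   hence "norm (a - y) <= 1" using True yb r by (simp add: dist_norm norm_minus_commute)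
   thus ?thesis by (simp add: E_def mult.assoc)
  qed (simp add: F_def)
  thus ?thesis using True unfolding J_def by (auto intro!: nn_integral_mono ennreal_leI)
 qed simp
 have Etr: "(\<integral>\<^sup>+a. ennreal (E (a - y)) \<partial>lborel) = ennreal (LBINT z. E z)" for y
  using nn_integral_eq_integral[OF integrable_lborel_translate(1)[OF Ei, of y]] E0 integral_lborel_translate(1)[OF Ei, of y] by simp
 have JJ: "(\<integral>\<^sup>+a. ind (ball x0 r) a * J a \<partial>lborel) < \<infinity>"
 proof -
  have "(\<integral>\<^sup>+a. ind (ball x0 r) a * J a \<partial>lborel) <= (\<integral>\<^sup>+a. (\<integral>\<^sup>+y. ennreal (E (a - y) * F y) \<partial>lborel) \<partial>lborel)"
   by (rule nn_integral_mono) (rule JE)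
  also have "\<dots> = (\<integral>\<^sup>+y. (\<integral>\<^sup>+a. ennreal (E (a - y) * F y) \<partial>lborel) \<partial>lborel)"
   by (rule lborel_pair.Fubini') measurable
  also have "\<dots> = (\<integral>\<^sup>+y. ennreal (LBINT z. E z) * ennreal (F y) \<partial>lborel)"
   using E0 F(2) by (simp add: ennreal_mult nn_integral_multc Etr)
  also have "\<dots> = ennreal (LBINT z. E z) * ennreal (LBINT y. F y)"
   using nn_integral_eq_integral[OF F(1)] F(2) by (simp add: nn_integral_cmult)
  also have "\<dots> < \<infinity>" by (simp add: ennreal_mult_less_top)
  finally show ?thesis .
 qed
 have "Lint (%a. \<eta> * (ind (ball x0 r) a * exp (Q * V a)))"
  unfolding integrable_iff_bounded
 proof
  have m: "(%a. ind (ball x0 r) a * exp (Q * V a)) : bmeas"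
   by (rule indicator_mult_measurable[OF _ borel_open[OF open_ball]]) measurable
  thus "(%a. \<eta> * (ind (ball x0 r) a * exp (Q * V a))) : borel_measurable lborel" by simp
  have "(\<integral>\<^sup>+a. ennreal (norm (\<eta> * (ind (ball x0 r) a * exp (Q * V a)))) \<partial>lborel) <=
    (\<integral>\<^sup>+a. ennreal C0 * (ind (ball x0 r) a * J a + ennreal \<eta> * ind (ball x0 r) a) \<partial>lborel)"
  proof (rule nn_integral_mono)
   fix a :: 'a
   show "ennreal (norm (\<eta> * (ind (ball x0 r) a * exp (Q * V a)))) <= ennreal C0 * (ind (ball x0 r) a * J a + ennreal \<eta> * ind (ball x0 r) a)"
    using key[of a] \<eta>(1) by (cases "a : ball x0 r") auto
  qed
  also have "\<dots> = ennreal C0 * ((\<integral>\<^sup>+a. ind (ball x0 r) a * J a \<partial>lborel) + ennreal \<eta> * emeasure lborel (ball x0 r))"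
  proof -
   have "J : bmeas" unfolding J_def[abs_def] by measurable
   hence 1: "(%a. ind (ball x0 r) a * J a) : borel_measurable lborel"
    by (intro borel_measurable_times_ennreal borel_measurable_indicator) auto
   have 2: "(%a. ennreal \<eta> * ind (ball x0 r) a) : borel_measurable lborel"
    by (intro borel_measurable_times_ennreal borel_measurable_indicator borel_measurable_const) auto
   have "(\<integral>\<^sup>+a. ennreal C0 * (ind (ball x0 r) a * J a + ennreal \<eta> * ind (ball x0 r) a) \<partial>lborel) =
     ennreal C0 * (\<integral>\<^sup>+a. ind (ball x0 r) a * J a + ennreal \<eta> * ind (ball x0 r) a \<partial>lborel)"
    by (rule nn_integral_cmult) (intro borel_measurable_add 1 2)
   also have "(\<integral>\<^sup>+a. ind (ball x0 r) a * J a + ennreal \<eta> * ind (ball x0 r) a \<partial>lborel) =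
     (\<integral>\<^sup>+a. ind (ball x0 r) a * J a \<partial>lborel) + (\<integral>\<^sup>+a. ennreal \<eta> * ind (ball x0 r) a \<partial>lborel)"
    by (rule nn_integral_add[OF 1 2])
   also have "(\<integral>\<^sup>+a. ennreal \<eta> * ind (ball x0 r) a \<partial>lborel) = ennreal \<eta> * emeasure lborel (ball x0 r)"
    by (rule nn_integral_cmult_indicator) simp
   finally show ?thesis .
  qed
  also have "\<dots> < \<infinity>"
   using JJ emeasure_lborel_ball_finite[of x0 r] by (simp add: ennreal_mult_less_top)
  finally show "(\<integral>\<^sup>+a. ennreal (norm (\<eta> * (ind (ball x0 r) a * exp (Q * V a)))) \<partial>lborel) < \<infinity>" .
 qed
 hence "Lint (%a. (1 / \<eta>) * (\<eta> * (ind (ball x0 r) a * exp (Q * V a))))" by (rule integrable_mult_right)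
 hence "Lint (%a. ind (ball x0 r) a * exp (Q * V a))" using \<eta>(1) by simp
 thus ?thesis using r unfolding V_def by blast
qed

lemma integrable_norm_powr_local:
 assumes p: "- real DIM('a::euclidean_space) < p"
 shows "Lint (%y::'a. ind (ball x0 r) y * norm y powr p)"
proof (rule integrable_dom)
 let ?q = "min p 0"
 have "Lint (%y. ind (ball x0 r) y * (norm x0 + r) powr p :: real)"
  using emeasure_lborel_ball_finite[of x0 r] by (intro integrable_mult_left integrable_real_indicator) auto
 moreover have "Lint (%y. ind (ball x0 r) y :: real)"
  using emeasure_lborel_ball_finite[of x0 r] by (intro integrable_real_indicator) auto
 ultimately show "Lint (%y::'a. ind (cball 0 1) y * norm y powr ?q + (ind (ball x0 r) y * (norm x0 + r) powr p + ind (ball x0 r) y))"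
  using p by (intro Bochner_Integration.integrable_add integrable_norm_powr_ball) auto
 have "(%y::'a. ind (ball x0 r) y * norm y powr p) : bmeas"
  by (rule indicator_mult_measurable[OF _ borel_open[OF open_ball]]) measurable
 thus "(%y::'a. ind (ball x0 r) y * norm y powr p) : borel_measurable lborel" by simp
 show "AE y::'a in lborel. norm (ind (ball x0 r) y * norm y powr p) <= norm (ind (cball 0 1) y * norm y powr ?q + (ind (ball x0 r) y * (norm x0 + r) powr p + ind (ball x0 r) y) :: real)"
 proof (intro AE_I2)
  fix y :: 'a
  have "ind (ball x0 r) y * norm y powr p <= ind (cball 0 1) y * norm y powr ?q + (ind (ball x0 r) y * (norm x0 + r) powr p + ind (ball x0 r) y)"
  proof (cases "y : ball x0 r")
   case True
   show ?thesis
   proof (cases "p >= 0")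
    case p0: True
    have "norm y <= norm x0 + r" using True norm_triangle_ineq2[of y x0] by (auto simp: dist_norm norm_minus_commute)
    hence "norm y powr p <= (norm x0 + r) powr p" using p0 by (intro powr_mono2) auto
    thus ?thesis using True by (simp add: add_increasing)
   next
    case p0: False
    show ?thesis
    proof (cases "norm y <= 1")
     case True
     thus ?thesis using p0 \<open>y : ball x0 r\<close> by (simp add: min_def)
    next
     case False
     have "norm y powr p <= norm y powr 0" using False p0 by (intro powr_mono) auto
     hence "norm y powr p <= 1" using False by (auto split: if_splits)
     thus ?thesis using \<open>y : ball x0 r\<close> by (simp add: add_increasing)
    qed
   qed
  qed simp
  thus "norm (ind (ball x0 r) y * norm y powr p) <= norm (ind (cball 0 1) y * norm y powr ?q + (ind (ball x0 r) y * (norm x0 + r) powr p + ind (ball x0 r) y) :: real)"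
   by simp
 qed
qed

text \<open>Exponential integrability of the potential V at a high exponent Q makes g^(1 + delta)
  integrable near x0. Then \<open>young_exp\<close> bounds Phi (a - y) g y by exp (kappa Phi (a -
  y)) plus a multiple of g^(1 + delta), whose integrals near x0 are bounded uniformly in a.\<close>

lemma potential_locally_bounded:
 fixes v :: "'a::euclidean_space => real"
 assumes R: "pot_repr c h g v" and c: "c >= 0" and m: "m >= 0" and p: "- real DIM('a) < p"
  and g_def: "g = (%y. norm y powr p * exp (m * v y))"
 shows "EX r>0. EX M. ALL a:ball x0 r. \<bar>v a\<bar> <= M"
proof -
 have g: "Lint g" and h: "!!k. Ck_on k UNIV h" and v: "!!a. v a = c * (LBINT y. Phi (a - y) * g y) + h a"
  using R unfolding pot_repr_def by auto
 have [measurable]: "v : bmeas" by (rule pot_repr_measurable[OF R])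
 have gm[measurable]: "g : bmeas" using g by auto
 have g0: "0 <= g y" for y by (simp add: g_def)
 define V where "V a = (LBINT y. Phi (a - y) * g y)" for a
 have V0: "0 <= V a" for a unfolding V_def using Phi_nonneg g0 by (intro integral_nonneg_AE AE_I2 mult_nonneg_nonneg)
 \<comment> \<open>The exponent 1 + delta enters twice, as the power of g and as the Young exponent
   separating the weight from the exponential. The weight then carries p (1 + delta)^2, which must
   remain above -n.\<close>
 obtain \<delta> where \<delta>: "\<delta> > 0" "- real DIM('a) < p * (1 + \<delta>)\<^sup>2"
 proof (cases "p >= 0")
  case True
  have "0 < real DIM('a)" by simp
  moreover have "0 <= p * (1 + 1)\<^sup>2" using True by simp
  ultimately have "- real DIM('a) < p * (1 + 1)\<^sup>2" by linarith
  thus ?thesis using that[of 1] by simp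
 next
  case False
  define e where "e = real DIM('a) / (- p) - 1"
  have e: "e > 0" using False p by (simp add: e_def field_simps)
  define \<delta> where "\<delta> = min 1 (e / 4)"
  have d: "\<delta> > 0" "\<delta> <= 1" "\<delta> <= e / 4" using e by (auto simp: \<delta>_def)
  have "\<delta>\<^sup>2 <= \<delta>" using d by (simp add: power2_eq_square mult_left_le)
  moreover have "(1 + \<delta>)\<^sup>2 = 1 + 2 * \<delta> + \<delta>\<^sup>2" by (simp add: power2_eq_square algebra_simps)
  ultimately have "(1 + \<delta>)\<^sup>2 < 1 + e" using d e by linarith
  hence "(- p) * (1 + \<delta>)\<^sup>2 < (- p) * (1 + e)" using False by (intro mult_strict_left_mono) auto
  also have "(- p) * (1 + e) = real DIM('a)" using False by (simp add: e_def)
  finally show ?thesis using d(1) that[of \<delta>] by simp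
 qed
 \<comment> \<open>The conjugate Young exponent (1 + delta) / delta times the power 1 +
   delta.\<close>
 define q where "q = (1 + \<delta>)\<^sup>2 / \<delta>"
 have q: "q > 0" using \<delta>(1) by (simp add: q_def)
 \<comment> \<open>The summand 1 keeps Q positive when m or c vanishes; since V >= 0, enlarging the
   exponent only weakens the bound.\<close>
 define Q where "Q = m * q * c + 1"
 have Q: "Q > 0" using m q c by (simp add: Q_def add_nonneg_pos)
 obtain r where r: "r > 0" "r <= 1 / 4" and eV: "Lint (%a. ind (ball x0 r) a * exp (Q * V a))"
  using exp_potential_integrable[OF g g0 Q, of x0] unfolding V_def by blast
 obtain H where H: "H >= 0" "!!a. a : cball x0 r ==> norm (h a) <= H"
  using continuous_bounded_cball[OF Ck_on_continuous[OF h[of 0]], of x0 r] by blast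
 define g1 where "g1 y = ind (ball x0 r) y * g y powr (1 + \<delta>)" for y
 have g1i: "Lint g1"
 proof (rule integrable_dom)
  show "Lint (%y. ind (ball x0 r) y * norm y powr (p * (1 + \<delta>)\<^sup>2) + exp (m * q * H) * (ind (ball x0 r) y * exp (Q * V y)))"
   by (intro Bochner_Integration.integrable_add integrable_norm_powr_local \<delta>(2) integrable_mult_right eV)
  have "g1 : bmeas" unfolding g1_def[abs_def] by (rule indicator_mult_measurable[OF _ borel_open[OF open_ball]]) measurable
  thus "g1 : borel_measurable lborel" by simp
  show "AE y in lborel. norm (g1 y) <= norm (ind (ball x0 r) y * norm y powr (p * (1 + \<delta>)\<^sup>2) + exp (m * q * H) * (ind (ball x0 r) y * exp (Q * V y)))"
  proof (intro AE_I2)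
   fix y :: 'a
   have "g1 y <= ind (ball x0 r) y * norm y powr (p * (1 + \<delta>)\<^sup>2) + exp (m * q * H) * (ind (ball x0 r) y * exp (Q * V y))"
   proof (cases "y : ball x0 r")
    case True
    have "g y powr (1 + \<delta>) = norm y powr (p * (1 + \<delta>)) * exp (m * (1 + \<delta>) * v y)"
     unfolding g_def by (simp add: powr_mult powr_powr exp_powr_real mult_ac)
    also have "\<dots> <= (norm y powr (p * (1 + \<delta>))) powr (1 + \<delta>) + exp (m * (1 + \<delta>) * v y) powr ((1 + \<delta>) / \<delta>)"
     by (rule young_elementary) (use \<delta> in auto)
    also have "(norm y powr (p * (1 + \<delta>))) powr (1 + \<delta>) = norm y powr (p * (1 + \<delta>)\<^sup>2)"
     by (simp add: powr_powr power2_eq_square mult.assoc)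
    also have "exp (m * (1 + \<delta>) * v y) powr ((1 + \<delta>) / \<delta>) = exp (m * q * v y)"
     by (simp add: exp_powr_real q_def power2_eq_square mult_ac)
    also have "\<dots> <= exp (m * q * H) * exp (Q * V y)"
    proof -
     have "h y <= H" using H(2)[of y] True by auto
     hence "m * q * v y <= m * q * (c * V y + H)" using m q by (intro mult_left_mono) (auto simp: v V_def)
     also have "\<dots> <= m * q * H + Q * V y" using V0[of y] by (simp add: Q_def algebra_simps)
     finally show ?thesis by (simp add: exp_add[symmetric])
    qed
    finally show ?thesis using True by (simp add: g1_def)
   qed (simp add: g1_def)
   moreover have "0 <= g1 y" by (simp add: g1_def)
   ultimately show "norm (g1 y) <= norm (ind (ball x0 r) y * norm y powr (p * (1 + \<delta>)\<^sup>2) + exp (m * q * H) * (ind (ball x0 r) y * exp (Q * V y)))"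
    by simp
  qed
 qed
 \<comment> \<open>Gives 2 kappa \<open>kap\<close> = n / 2, again half of the threshold.\<close>
 define \<kappa> where "\<kappa> = real DIM('a) / (4 * kap TYPE('a))"
 have kp: "kap TYPE('a) > 0" by (rule kap_pos)
 have \<kappa>: "\<kappa> > 0" "\<kappa> * (2 * kap TYPE('a)) < real DIM('a)" using kp by (simp_all add: \<kappa>_def field_simps)
 define E where "E z = ind (cball 0 1) z * exp (\<kappa> * Phi z)" for z :: 'a
 have Ei: "Lint E" unfolding E_def[abs_def] by (rule exp_Phi_integrable) (use \<kappa> in auto)
 obtain B where B: "B >= 0" "!!x::'a. norm x >= r / 2 ==> Phi x <= B" using Phi_away_bounded[of "r / 2"] r by auto
 define K where "K = (2 / \<delta>) * (1 / \<kappa>) powr (1 + \<delta>)"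
 have K: "0 <= K" using \<delta> by (simp add: K_def)
 define M0 where "M0 = 2 * (LBINT z. E z) + K * (LBINT y. g1 y) + B * (LBINT y. g y)"
 have VM: "V a <= M0" if a: "a : ball x0 (r / 2)" for a
 proof -
  let ?D = "%y. 2 * E (a - y) + K * g1 y + B * g y"
  have Di: "Lint ?D"
   using integrable_lborel_translate(2)[OF Ei, of a] g1i g by auto
  have D0: "0 <= ?D y" for y using K B g0[of y] by (simp add: E_def g1_def)
  have le: "Phi (a - y) * g y <= ?D y" for y
  proof (cases "y : ball x0 r")
   case True
   have "dist a y <= dist a x0 + dist x0 y" by (rule dist_triangle)
   hence "norm (a - y) <= 1" using a True r by (simp add: dist_norm norm_minus_commute)
   hence E: "E (a - y) = exp (\<kappa> * Phi (a - y))" by (simp add: E_def)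
   have "Phi (a - y) * g y = (\<kappa> * Phi (a - y)) * (g y / \<kappa>)" using \<kappa> by simp
   also have "\<dots> <= 2 * exp (\<kappa> * Phi (a - y)) + (2 / \<delta>) * (g y / \<kappa>) powr (1 + \<delta>)"
    by (rule young_exp) (use \<kappa> \<delta> mult_nonneg_nonneg[OF less_imp_le[OF \<kappa>(1)] Phi_nonneg] g0 in auto)
   also have "(g y / \<kappa>) powr (1 + \<delta>) = (1 / \<kappa>) powr (1 + \<delta>) * g y powr (1 + \<delta>)"
    using powr_mult[of "1 / \<kappa>" "g y" "1 + \<delta>"] \<kappa> g0 by (simp add: mult.commute)
   finally have "Phi (a - y) * g y <= 2 * E (a - y) + K * g1 y" using True by (simp add: E K_def g1_def mult.assoc)
   thus ?thesis using B g0[of y] by (simp add: add_increasing2)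
  next
   case False
   have "dist x0 y <= dist x0 a + dist a y" by (rule dist_triangle)
   hence "norm (a - y) >= r / 2" using False a by (simp add: dist_norm)
   hence "Phi (a - y) * g y <= B * g y" using B g0[of y] by (intro mult_right_mono) auto
   moreover have "0 <= 2 * E (a - y) + K * g1 y" using K by (simp add: E_def g1_def)
   ultimately show ?thesis by linarith
  qed
  have "V a <= (LBINT y. ?D y)"
  proof (cases "Lint (%y. Phi (a - y) * g y)")
   case True thus ?thesis unfolding V_def by (rule integral_mono[OF _ Di le])
  next
   case False
   hence "V a = 0" unfolding V_def by (rule not_integrable_integral_eq)
   thus ?thesis using D0 by (simp add: integral_nonneg_AE)
  qed
  also have "\<dots> = M0" unfolding M0_def
   using integrable_lborel_translate(2)[OF Ei, of a] integral_lborel_translate(2)[OF Ei, of a] g1i g by simp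
  finally show ?thesis .
 qed
 have "\<bar>v a\<bar> <= c * M0 + H" if a: "a : ball x0 (r / 2)" for a
 proof -
  have "\<bar>h a\<bar> <= H" using H(2)[of a] a r by auto
  moreover have "c * V a <= c * M0" "0 <= c * V a" using VM[OF a] V0[of a] c by (auto intro: mult_left_mono)
  ultimately show ?thesis unfolding v V_def[symmetric] by linarith
 qed
 moreover have "r / 2 > 0" using r(1) by simp
 ultimately show ?thesis by blast
qed

section \<open>Fourier multipliers\<close>

lemma cis_measurable [measurable (raw)]:
 assumes "f : borel_measurable M"
 shows "(%x. cis (f x)) : borel_measurable M"
proof -
 have "continuous_on UNIV cis" by (intro continuous_intros)
 hence "cis : bmeas" by (rule borel_measurable_continuous_onI)
 thus ?thesis using assms by (rule measurable_compose[rotated])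
qed

text \<open>Rapid decrease without smoothness: enough for the transform to be smooth, and stable
  under multiplication by measurable symbols of polynomial growth.\<close>

definition rdec :: "('a::euclidean_space => complex) => bool" where
 "rdec m \<longleftrightarrow> m : bmeas & (ALL N. EX C. ALL \<xi>. norm (m \<xi>) <= C / (1 + sq \<xi>) ^ N)"

text \<open>The inverse Fourier integral without its factor (2 pi)^(-n), which
  \<open>inv_fourier_Ex\<close> restores.\<close>

definition Ex :: "('a::euclidean_space => complex) => 'a => complex" where
 "Ex m x = (LINT \<xi>|lborel. cis (x \<bullet> \<xi>) * m \<xi>)"

lemma rdec_integrable: "rdec m ==> Lint m"
proof -
 assume m: "rdec (m :: 'a => complex)"
 then obtain C where "!!\<xi>. norm (m \<xi>) <= C / (1 + sq \<xi>) ^ DIM('a)" unfolding rdec_def by blast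
 thus ?thesis using m unfolding rdec_def by (intro integrable_decay_bound[of m C "DIM('a)"]) auto
qed

lemma rdec_mult:
 assumes "rdec m" "g : bmeas" "!!\<xi>. norm (g \<xi>) <= B * (1 + sq \<xi>) ^ d"
 shows "rdec (%\<xi>. g \<xi> * m \<xi>)"
 unfolding rdec_def
proof (intro conjI allI)
 note [measurable] = assms(2)
 have [measurable]: "m : bmeas" using assms(1) by (simp add: rdec_def)
 show "(%\<xi>. g \<xi> * m \<xi>) : bmeas" by measurable
 fix N
 obtain C where C: "!!\<xi>. norm (m \<xi>) <= C / (1 + sq \<xi>) ^ (N + d)" using assms(1) unfolding rdec_def by blast
 have "norm (g \<xi> * m \<xi>) <= (B * C) / (1 + sq \<xi>) ^ N" for \<xi>
 proof -
  have p: "0 < 1 + sq \<xi>" by (simp add: add_pos_nonneg)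
  have "norm (g \<xi> * m \<xi>) <= (B * (1 + sq \<xi>) ^ d) * (C / (1 + sq \<xi>) ^ (N + d))"
   unfolding norm_mult using assms(3)[of \<xi>] C[of \<xi>] by (intro mult_mono) (auto intro: order_trans[OF norm_ge_zero])
  also have "\<dots> = (B * C) / (1 + sq \<xi>) ^ N" using p by (simp add: power_add)
  finally show ?thesis .
 qed
 thus "EX C. ALL \<xi>. norm (g \<xi> * m \<xi>) <= C / (1 + sq \<xi>) ^ N" by blast
qed

lemma norm_le_one_plus_inner: "norm x <= 1 + sq x"
 unfolding power2_norm_eq_inner[symmetric]
 using sum_power2_ge_zero[of "norm x - 1/2" 0] by (simp add: power2_eq_square algebra_simps)

lemma rdec_inner: "rdec m ==> i : Basis ==> rdec (%\<xi>. (\<i> * cor (i \<bullet> \<xi>)) * m \<xi>)"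
proof (rule rdec_mult[of m _ 1 1])
 fix \<xi> :: 'a assume "i : Basis"
 hence "\<bar>i \<bullet> \<xi>\<bar> <= norm \<xi>" using Basis_le_norm[of i \<xi>] by (simp add: inner_commute)
 also have "\<dots> <= 1 + sq \<xi>" by (rule norm_le_one_plus_inner)
 finally show "norm (\<i> * cor (i \<bullet> \<xi>)) <= 1 * (1 + sq \<xi>) ^ 1" by (simp add: norm_mult)
qed auto

lemma has_partial_cis: "has_partial i (%x. cis (x \<bullet> \<xi>)) x (\<i> * cor (i \<bullet> \<xi>) * cis (x \<bullet> \<xi>))"
proof -
 have "((%t. \<i> * cor (x \<bullet> \<xi> + t * (i \<bullet> \<xi>))) has_vector_derivative \<i> * cor (i \<bullet> \<xi>)) (at 0)"
  by (auto intro!: derivative_eq_intros simp: has_vector_derivative_def scaleR_conv_of_real)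
 hence "(exp \<circ> (%t. \<i> * cor (x \<bullet> \<xi> + t * (i \<bullet> \<xi>))) has_vector_derivative
   \<i> * cor (i \<bullet> \<xi>) * exp (\<i> * cor (x \<bullet> \<xi> + 0 * (i \<bullet> \<xi>)))) (at 0)"
  by (rule field_vector_diff_chain_at) (rule DERIV_exp)
 thus ?thesis unfolding has_partial_def by (simp add: o_def cis_conv_exp inner_add_left)
qed

lemma Ex_has_partial:
 assumes "rdec m" "i : Basis"
 shows "has_partial i (Ex m) x (Ex (%\<xi>. (\<i> * cor (i \<bullet> \<xi>)) * m \<xi>) x)"
proof -
 have [measurable]: "m : bmeas" using assms(1) by (simp add: rdec_def)
 have "has_partial i (%x. LINT \<xi>|lborel. cis (x \<bullet> \<xi>) * m \<xi>) x (LINT \<xi>|lborel. cis (x \<bullet> \<xi>) * ((\<i> * cor (i \<bullet> \<xi>)) * m \<xi>))"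
 proof (rule has_partial_integral(1)[where U=UNIV and w="%\<xi>. norm ((\<i> * cor (i \<bullet> \<xi>)) * m \<xi>)"])
  show "Lint (%\<xi>. cis (y \<bullet> \<xi>) * m \<xi>)" for y
   by (rule integrable_dom[OF rdec_integrable[OF assms(1)]]) (auto simp: norm_mult)
  show "has_partial i (%x. cis (x \<bullet> \<xi>) * m \<xi>) y (cis (y \<bullet> \<xi>) * ((\<i> * cor (i \<bullet> \<xi>)) * m \<xi>))" for \<xi> y
   using has_partial_linear[OF bounded_linear_mult_left[of "m \<xi>"] has_partial_cis[of i \<xi> y]] by (simp add: mult_ac)
  show "Lint (%\<xi>. norm ((\<i> * cor (i \<bullet> \<xi>)) * m \<xi>))"
   using rdec_integrable[OF rdec_inner[OF assms]] by (rule integrable_norm)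
 qed (auto simp: norm_mult assms)
 thus ?thesis unfolding Ex_def[abs_def] .
qed

lemma Ex_partial: "rdec m ==> i : Basis ==> partial i (Ex m) = Ex (%\<xi>. (\<i> * cor (i \<bullet> \<xi>)) * m \<xi>)"
 using Ex_has_partial has_partial_imp by blast

lemma Ex_continuous:
 assumes "rdec m" shows "continuous_on UNIV (Ex m)"
 unfolding Ex_def[abs_def]
proof (rule continuous_on_integral_dom)
 have [measurable]: "m : bmeas" using assms(1) by (simp add: rdec_def)
 show "(%\<xi>. cis (x \<bullet> \<xi>) * m \<xi>) : borel_measurable lborel" for x by measurable
 show "continuous_on UNIV (%x. cis (x \<bullet> \<xi>) * m \<xi>)" for \<xi> by (intro continuous_intros)
 show "EX U w. open U & x0 : U & U <= UNIV & Lint w & (ALL z:space lborel. ALL x:U. norm (cis (x \<bullet> z) * m z) <= w z)" for x0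
  using rdec_integrable[OF assms] by (intro exI[of _ UNIV] exI[of _ "%\<xi>. norm (m \<xi>)"]) (auto simp: norm_mult)
qed simp

lemma Ex_Ck: "rdec m ==> Ck_on k UNIV (Ex m)"
 by (induction k arbitrary: m) (auto simp: Ck_on_Suc Ex_continuous Ex_has_partial Ex_partial rdec_inner)

text \<open>The negative Laplacian, whose symbol |xi|^2 has powers without alternating
  signs.\<close>

definition nlap :: "('a::euclidean_space => 'b::real_normed_vector) => 'a => 'b" where
 "nlap f x = - (\<Sum>i\<in>Basis. partial i (partial i f) x)"

lemma Ex_add:
 assumes "rdec m" "rdec m'"
 shows "Ex (%\<xi>. m \<xi> + m' \<xi>) x = Ex m x + Ex m' x"
proof -
 have [measurable]: "m : bmeas" "m' : bmeas" using assms by (simp_all add: rdec_def)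
 have "Lint (%\<xi>. cis (x \<bullet> \<xi>) * m \<xi>)"
  by (rule integrable_dom[OF rdec_integrable[OF assms(1)]]) (auto simp: norm_mult)
 moreover have "Lint (%\<xi>. cis (x \<bullet> \<xi>) * m' \<xi>)"
  by (rule integrable_dom[OF rdec_integrable[OF assms(2)]]) (auto simp: norm_mult)
 ultimately show ?thesis unfolding Ex_def by (simp add: distrib_left)
qed

lemma rdec_add: "rdec m ==> rdec m' ==> rdec (%\<xi>. m \<xi> + m' \<xi>)"
 unfolding rdec_def
proof (intro conjI allI)
 assume a: "m : bmeas & (ALL N. EX C. ALL \<xi>. norm (m \<xi>) <= C / (1 + sq \<xi>) ^ N)"
  "m' : bmeas & (ALL N. EX C. ALL \<xi>. norm (m' \<xi>) <= C / (1 + sq \<xi>) ^ N)"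
 thus "(%\<xi>. m \<xi> + m' \<xi>) : bmeas" by auto
 fix N
 obtain C where C: "!!\<xi>. norm (m \<xi>) <= C / (1 + sq \<xi>) ^ N" using a(1) by blast
 obtain C' where C': "!!\<xi>. norm (m' \<xi>) <= C' / (1 + sq \<xi>) ^ N" using a(2) by blast
 have "norm (m \<xi> + m' \<xi>) <= (C + C') / (1 + sq \<xi>) ^ N" for \<xi>
  using order_trans[OF norm_triangle_ineq add_mono[OF C C']] by (simp add: add_divide_distrib)
 thus "EX C. ALL \<xi>. norm (m \<xi> + m' \<xi>) <= C / (1 + sq \<xi>) ^ N" by blast
qed

lemma rdec_zero: "rdec (%\<xi>. 0)"
 unfolding rdec_def by (auto intro!: exI[of _ 0])

lemma rdec_sum: "finite J ==> (!!j. j : J ==> rdec (m j)) ==> rdec (%\<xi>. \<Sum>j\<in>J. m j \<xi>)"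
 by (induction J rule: finite_induct) (auto intro: rdec_add rdec_zero)

lemma Ex_sum: "finite J ==> (!!j. j : J ==> rdec (m j)) ==> Ex (%\<xi>. \<Sum>j\<in>J. m j \<xi>) x = (\<Sum>j\<in>J. Ex (m j) x)"
 by (induction J rule: finite_induct) (auto simp: Ex_add rdec_sum Ex_def[of "%\<xi>. 0"])

lemma Ex_cmult: "Ex (%\<xi>. c * m \<xi>) x = c * Ex m x"
 unfolding Ex_def by (simp add: mult.left_commute)

lemma rdec_cmult: "rdec m ==> rdec (%\<xi>. c * m \<xi>)"
 by (rule rdec_mult[of m _ "norm c" 0]) auto

lemma rdec_norm2: "rdec m ==> rdec (%\<xi>. cor (sq \<xi>) * m \<xi>)"
 by (rule rdec_mult[of m _ 1 1]) auto

lemma Ex_nlap: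
 assumes "rdec m"
 shows "nlap (Ex m) = Ex (%\<xi>. cor (sq \<xi>) * m \<xi>)"
proof
 fix x :: 'a
 let ?m = "%i \<xi>. (\<i> * cor (i \<bullet> \<xi>)) * ((\<i> * cor (i \<bullet> \<xi>)) * m \<xi>)"
 have r: "rdec (?m i)" if "i : Basis" for i using rdec_inner[OF rdec_inner[OF assms that] that] .
 have "nlap (Ex m) x = - (\<Sum>i\<in>Basis. Ex (?m i) x)"
  unfolding nlap_def using Ex_partial[OF assms] Ex_partial[OF rdec_inner[OF assms]] by (intro arg_cong[of _ _ uminus] sum.cong) auto
 also have "\<dots> = - Ex (%\<xi>. \<Sum>i\<in>Basis. ?m i \<xi>) x" using r by (subst Ex_sum) auto
 also have "\<dots> = Ex (%\<xi>. - 1 * (\<Sum>i\<in>Basis. ?m i \<xi>)) x" by (subst Ex_cmult) simp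
 also have "(%\<xi>. - 1 * (\<Sum>i\<in>Basis. ?m i \<xi>)) = (%\<xi>. cor (sq \<xi>) * m \<xi>)"
 proof
  fix \<xi> :: 'a
  have "?m i \<xi> = - (cor ((\<xi> \<bullet> i) * (\<xi> \<bullet> i)) * m \<xi>)" for i
   by (simp add: inner_commute mult_ac)
  hence "- 1 * (\<Sum>i\<in>Basis. ?m i \<xi>) = cor (\<Sum>i\<in>Basis. (\<xi> \<bullet> i) * (\<xi> \<bullet> i)) * m \<xi>"
   by (simp add: sum_negf sum_distrib_right)
  thus "- 1 * (\<Sum>i\<in>Basis. ?m i \<xi>) = cor (sq \<xi>) * m \<xi>" by (simp add: euclidean_inner[symmetric])
 qed
 finally show "nlap (Ex m) x = Ex (%\<xi>. cor (sq \<xi>) * m \<xi>) x" .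
qed

lemma Ex_nlap_pow: "rdec m ==> (nlap ^^ j) (Ex m) = Ex (%\<xi>. cor ((sq \<xi>) ^ j) * m \<xi>) & rdec (%\<xi>. cor ((sq \<xi>) ^ j) * m \<xi>)"
proof (induction j)
 case (Suc j)
 thus ?case using Ex_nlap rdec_norm2 by (fastforce simp: mult.assoc[symmetric])
qed auto

lemma rdec_gauss: "t > 0 ==> rdec (%\<xi>::'a::euclidean_space. cor (exp (- t * (sq \<xi>))))"
 unfolding rdec_def
proof (intro conjI allI)
 show "(%\<xi>::'a. cor (exp (- t * (sq \<xi>)))) : bmeas" by measurable
 fix N assume t: "t > 0"
 obtain C where C: "ALL z>=0. exp (- z / 4 :: real) * (1 + z) ^ N <= C" using exp_one_plus_power_bounded[of N] by (elim exE)
 define L where "L = max 1 (1 / (4 * t))"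
 have L: "1 <= L" "1 / (4 * t) <= L" by (auto simp: L_def)
 have "norm (cor (exp (- t * (sq \<xi>)))) <= (C * L ^ N) / (1 + sq \<xi>) ^ N" for \<xi> :: 'a
 proof -
  define s where "s = sq \<xi>"
  have s: "0 <= s" by (simp add: s_def)
  have "s = (1 / (4 * t)) * (4 * t * s)" using t by simp
  also have "\<dots> <= L * (4 * t * s)" using L(2) t s by (intro mult_right_mono) auto
  finally have "1 + s <= L * (1 + 4 * t * s)" using L(1) by (simp add: distrib_left)
  hence "(1 + s) ^ N <= (L * (1 + 4 * t * s)) ^ N" using s by (intro power_mono) auto
  hence "exp (- t * s) * (1 + s) ^ N <= exp (- t * s) * (L * (1 + 4 * t * s)) ^ N" by (intro mult_left_mono) auto
  also have "\<dots> = L ^ N * (exp (- (4 * t * s) / 4) * (1 + 4 * t * s) ^ N)" by (simp add: power_mult_distrib mult_ac)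
  also have "\<dots> <= L ^ N * C"
   using C[rule_format, of "4 * t * s"] t s L by (intro mult_left_mono) simp_all
  finally show ?thesis using s by (simp add: s_def[symmetric] pos_le_divide_eq add_pos_nonneg mult.commute)
 qed
 thus "EX C. ALL \<xi>::'a. norm (cor (exp (- t * (sq \<xi>)))) <= C / (1 + sq \<xi>) ^ N" by blast
qed

lemma Ex_gauss: "t > 0 ==> Ex (%\<xi>::'a::euclidean_space. cor (exp (- t * (sq \<xi>)))) x = cor ((2 * pi) ^ DIM('a) * hk t x)"
proof -
 assume t: "t > 0"
 have "sqrt (pi / t) = (2 * pi) * (1 / sqrt (4 * pi * t))"
 proof -
  have "pi = sqrt pi * sqrt pi" by simp
  thus ?thesis using t by (simp add: real_sqrt_divide real_sqrt_mult field_simps)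
 qed
 hence "sqrt (pi / t) ^ DIM('a) = (2 * pi) ^ DIM('a) * (1 / sqrt (4 * pi * t)) ^ DIM('a)"
  by (simp only: power_mult_distrib)
 thus ?thesis unfolding Ex_def gauss_fourier(2)[OF t] hk_def by simp
qed

lemma fourier_hk: "t > 0 ==> fourier (%x. cor (hk t x)) \<xi> = cor (exp (- t * (sq \<xi>)))"
 for \<xi> :: "'a::euclidean_space"
proof -
 assume t: "t > 0"
 have t4: "1 / (4 * t) > 0" using t by simp
 define c where "c = (1 / sqrt (4 * pi * t)) ^ DIM('a)"
 have "cis (- (x \<bullet> \<xi>)) * cor (hk t x) = cor c * (cis (- \<xi> \<bullet> x) * cor (exp (- (1 / (4 * t)) * (sq x))))" for x
  unfolding hk_def c_def[symmetric] by (simp add: inner_commute)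
 hence "fourier (%x. cor (hk t x)) \<xi> = cor c *
   (LINT x|lborel. cis (- \<xi> \<bullet> x) * cor (exp (- (1 / (4 * t)) * (sq x))))"
  unfolding fourier_def by simp
 also have "\<dots> = cor (c * sqrt (pi / (1 / (4 * t))) ^ DIM('a) * exp (- (- \<xi> \<bullet> - \<xi>) / (4 * (1 / (4 * t)))))"
  unfolding gauss_fourier(2)[OF t4] by simp
 also have "c * sqrt (pi / (1 / (4 * t))) ^ DIM('a) = 1"
 proof -
  have "pi / (1 / (4 * t)) = 4 * pi * t" by simp
  thus ?thesis unfolding c_def power_mult_distrib[symmetric] by (simp only:) (use t in simp)
 qed
 finally show ?thesis using t by (simp add: mult.commute)
qed

lemma partial_of_real:
 assumes "Ck_on 1 UNIV f" "i : Basis"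
 shows "partial i (%x. cor (f x)) = (%x. cor (partial i f x))"
proof
 fix x
 have "has_partial i f x (partial i f x)" using assms by (simp add: Ck_on_Suc)
 hence "has_partial i (%x. cor (f x)) x (cor (partial i f x))"
  by (rule has_partial_linear[OF bounded_linear_of_real])
 thus "partial i (%x. cor (f x)) x = cor (partial i f x)" by (rule has_partial_imp)
qed

lemma nlap_of_real:
 assumes "Ck_on 2 UNIV f"
 shows "nlap (%x. cor (f x)) = (%x. cor (nlap f x))"
proof
 fix x
 have 1: "Ck_on 1 UNIV f" using assms Ck_on_mono[of 2 UNIV f 1] by simp
 have "Ck_on 1 UNIV (partial i f)" if "i : Basis" for i using assms that by (simp add: numeral_2_eq_2 Ck_on_Suc)
 thus "nlap (%x. cor (f x)) x = cor (nlap f x)"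
  unfolding nlap_def by (simp add: partial_of_real[OF 1] partial_of_real)
qed

lemma PG_sum: "finite J ==> (!!j. j : J ==> PG (h j)) ==> PG (%x. \<Sum>j\<in>J. h j x)"
proof (induction J rule: finite_induct)
 case empty
 show ?case using PG.cmult[OF PG.base, of 0] by simp
next
 case (insert j J) thus ?case by (simp add: PG.add)
qed

lemma PG_nlap: "PG h ==> PG (nlap h)"
proof -
 assume "PG h"
 hence "PG (%x. (- 1) * (\<Sum>i\<in>Basis. partial i (partial i h) x))"
  by (intro PG.cmult PG_sum) (auto simp: PG_partial)
 thus ?thesis unfolding nlap_def[abs_def] by simp
qed

lemma nlap_cmult:
 assumes "PG h"
 shows "nlap (%x. c * h x) = (%x. c * nlap h x)"
proof -
 have p: "partial i (%x. c * h x) = (%x. c * partial i h x)" if "PG h" "i : Basis" for h i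
  using has_partial_imp[OF has_partial_linear[OF bounded_linear_mult_right]] PG_partial[OF that] by blast
 have "partial i (partial i (%x. c * h x)) = (%x. c * partial i (partial i h) x)" if "i : Basis" for i
  using p[OF assms that] p[of "partial i h" i] PG_partial[OF assms that] that by simp
 thus ?thesis unfolding nlap_def by (intro ext) (simp add: sum_distrib_left cong: sum.cong)
qed

lemma PG_nlap_pow: "PG h ==> PG ((nlap ^^ j) h)"
 by (induction j) (auto intro: PG_nlap)

lemma nlap_pow_of_real: "PG h ==> (nlap ^^ j) (%x. cor (h x)) = (%x. cor ((nlap ^^ j) h x))"
 by (induction j) (auto simp: nlap_of_real PG_Ck PG_nlap_pow)

lemma PG_nlap_integral: "PG h ==> (LBINT x. nlap h (x::'a::euclidean_space)) = 0"
proof -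
 assume h: "PG h"
 have i: "Lint (partial i (partial i h))" "(LBINT x. partial i (partial i h) (x::'a)) = 0" if "i : Basis" for i
  using PG_integrable PG_integral_partial PG_partial h that by blast+
 have "(LBINT x. nlap h (x::'a)) = - (\<Sum>i\<in>Basis. LBINT x. partial i (partial i h) (x::'a))"
  unfolding nlap_def using i(1) by simp
 also have "\<dots> = 0" using i(2) by (subst sum.neutral) auto
 finally show ?thesis .
qed

section \<open>Incomplete gamma symbols and their kernels\<close>

text \<open>The upper incomplete gamma function of order k + 1, the integral of s^k e^(-s) over s >
  z, in closed form. It is the antiderivative of -z^k e^(-z) that decays at infinity, and its value
  at 0 is k!.\<close>

definition Qk :: "nat => real => real" where
 "Qk k z = exp (- z) * (\<Sum>j\<le>k. (fact k / fact j) * z ^ j)"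

lemma Qk_deriv: "(Qk k has_real_derivative (- (z ^ k * exp (- z)))) (at z)"
proof -
 have s: "((%z. \<Sum>j\<le>k. (fact k / fact j) * z ^ j) has_real_derivative ((\<Sum>j\<le>k. (fact k / fact j) * z ^ j) - z ^ k)) (at z)" for k
 proof (induction k)
  case 0 thus ?case by simp
 next
  case (Suc k)
  have e: "(\<Sum>j\<le>Suc k. (fact (Suc k) / fact j) * z ^ j) = real (Suc k) * (\<Sum>j\<le>k. (fact k / fact j) * z ^ j) + z ^ Suc k" for z :: real
  proof -
   have "(\<Sum>j\<le>k. (fact (Suc k) / fact j) * z ^ j) = real (Suc k) * (\<Sum>j\<le>k. (fact k / fact j) * z ^ j)"
    by (simp add: sum_distrib_left mult.assoc)
   moreover have "fact (Suc k) / fact (Suc k) * z ^ Suc k = z ^ Suc k" by (simp del: fact_Suc)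
   ultimately show ?thesis by (simp only: sum.atMost_Suc)
  qed
  have "((%z. real (Suc k) * (\<Sum>j\<le>k. (fact k / fact j) * z ^ j) + z ^ Suc k) has_real_derivative
    real (Suc k) * ((\<Sum>j\<le>k. (fact k / fact j) * z ^ j) - z ^ k) + real (Suc k) * z ^ k) (at z)"
   by (rule DERIV_cong[OF DERIV_add[OF DERIV_cmult[OF Suc] DERIV_pow]]) simp
  thus ?case unfolding e by (simp add: algebra_simps)
 qed
 have e: "((%z. exp (- z)) has_real_derivative (- exp (- z))) (at z)"
  by (auto intro!: derivative_eq_intros)
 show ?thesis unfolding Qk_def[abs_def]
  by (rule DERIV_cong[OF DERIV_mult[OF e s]]) (simp add: algebra_simps)
qed

text \<open>The inverse Fourier transform of \<open>Qk k\<close> at |xi|^2, term by term: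
  exp(-|xi|^2) becomes \<open>hk 1\<close>, and |xi|^(2j) becomes the j-th power of
  \<open>nlap\<close>.\<close>

definition Pk :: "nat => 'a::euclidean_space => real" where
 "Pk k x = (\<Sum>j\<le>k. (fact k / fact j) * (nlap ^^ j) (hk 1) x)"

lemma PG_Pk: "PG (Pk k)"
 unfolding Pk_def[abs_def] by (intro PG_sum PG.cmult PG_nlap_pow PG_hk1) auto

text \<open>Only the term j = 0 contributes, the others being integrals of derivatives; the value is
  \<open>Qk k 0\<close>.\<close>

lemma Pk_integral: "(LBINT x. Pk k (x::'a::euclidean_space)) = fact k"
proof -
 have i: "Lint ((nlap ^^ j) (hk 1 :: 'a => real))" for j using PG_integrable PG_nlap_pow PG_hk1 by blast
 have z: "(LBINT x. (nlap ^^ j) (hk 1) (x::'a)) = (if j = 0 then 1 else 0)" for j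
  using PG_nlap_integral[OF PG_nlap_pow[OF PG_hk1]] hk_integral[of 1, where 'a='a] by (cases j) auto
 have "(LBINT x. Pk k (x::'a)) = (\<Sum>j\<le>k. (fact k / fact j) * (LBINT x. (nlap ^^ j) (hk 1) (x::'a)))"
  unfolding Pk_def using i by simp
 also have "\<dots> = (\<Sum>j\<le>k. if j = 0 then fact k else 0)" unfolding z by (intro sum.cong) auto
 also have "\<dots> = fact k" by simp
 finally show ?thesis .
qed

lemma Qk_rdec_and_Ex:
 shows "rdec (%\<xi>::'a::euclidean_space. cor (Qk k (sq \<xi>)))"
  and "Ex (%\<xi>. cor (Qk k (sq \<xi>))) (x::'a) = cor ((2 * pi) ^ DIM('a) * Pk k x)"
proof -
 let ?g = "%\<xi>::'a. cor (exp (- 1 * (sq \<xi>)))"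
 let ?m = "%j \<xi>::'a. cor (fact k / fact j) * (cor ((sq \<xi>) ^ j) * ?g \<xi>)"
 have g: "rdec ?g" by (rule rdec_gauss) simp
 have r: "rdec (?m j)" for j using Ex_nlap_pow[OF g, of j] by (intro rdec_cmult) blast
 have e: "(%\<xi>::'a. cor (Qk k (sq \<xi>))) = (%\<xi>. \<Sum>j\<in>{..k}. ?m j \<xi>)"
  by (rule ext) (simp add: Qk_def sum_distrib_left mult_ac)
 show "rdec (%\<xi>::'a. cor (Qk k (sq \<xi>)))" unfolding e by (rule rdec_sum) (use r in auto)
 have h: "Ex ?g = (%x. cor ((2 * pi) ^ DIM('a) * hk 1 x))" using Ex_gauss[of 1] by auto
 have PGc: "PG (%x::'a. (2 * pi) ^ DIM('a) * hk 1 x)" by (intro PG.cmult PG_hk1)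
 have lin: "(nlap ^^ j) (%x::'a. c * hk 1 x) = (%x. c * (nlap ^^ j) (hk 1) x)" for j and c :: real
  by (induction j) (simp_all add: nlap_cmult PG_nlap_pow PG_hk1)
 have "Ex (%\<xi>. \<Sum>j\<in>{..k}. ?m j \<xi>) x = (\<Sum>j\<in>{..k}. Ex (?m j) x)" by (rule Ex_sum) (use r in auto)
 also have "\<dots> = (\<Sum>j\<in>{..k}. cor (fact k / fact j) * (nlap ^^ j) (Ex ?g) x)"
  using Ex_nlap_pow[OF g] by (intro sum.cong refl) (simp only: Ex_cmult)
 also have "\<dots> = (\<Sum>j\<in>{..k}. cor (fact k / fact j * ((2 * pi) ^ DIM('a) * (nlap ^^ j) (hk 1) x)))"
  unfolding h nlap_pow_of_real[OF PGc] lin by simp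
 also have "\<dots> = cor ((2 * pi) ^ DIM('a) * Pk k x)"
  unfolding Pk_def by (simp add: sum_distrib_left mult_ac)
 finally show "Ex (%\<xi>. cor (Qk k (sq \<xi>))) x = cor ((2 * pi) ^ DIM('a) * Pk k x)" unfolding e .
qed

lemma Ex_scale:
 fixes x :: "'a::euclidean_space"
 assumes "rdec m" "s > 0"
 shows "Ex (%\<xi>. m (s *\<^sub>R \<xi>)) x = cor ((1 / s) ^ DIM('a)) * Ex m ((1 / s) *\<^sub>R x)"
proof -
 have [measurable]: "m : bmeas" using assms by (simp add: rdec_def)
 have i: "Lint (%\<xi>. cis (((1 / s) *\<^sub>R x) \<bullet> \<xi>) * m \<xi>)"
  by (rule integrable_dom[OF rdec_integrable[OF assms(1)]]) (auto simp: norm_mult)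
 have s: "s ~= 0" using assms by simp
 have "Ex m ((1 / s) *\<^sub>R x) = s ^ DIM('a) *\<^sub>R Ex (%\<xi>. m (s *\<^sub>R \<xi>)) x"
  unfolding Ex_def using integral_lborel_affine[OF i s, of 0] assms(2) by simp
 thus ?thesis using assms(2) by (simp add: scaleR_conv_of_real power_one_over)
qed

lemma inv_fourier_Ex: "inv_fourier m (x::'a::euclidean_space) = cor (1 / (2 * pi) ^ DIM('a)) * Ex m x"
 unfolding inv_fourier_def Ex_def by simp

lemma inv_fourier_Qk:
 fixes x :: "'a::euclidean_space"
 assumes "t > 0"
 shows "rdec (%\<xi>::'a. cor (Qk k (t * (sq \<xi>))))"
  and "Ex (%\<xi>. cor (Qk k (t * (sq \<xi>)))) x = cor ((2 * pi) ^ DIM('a) * ((1 / sqrt t) ^ DIM('a) * Pk k ((1 / sqrt t) *\<^sub>R x)))"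
proof -
 have st: "sqrt t > 0" using assms by simp
 have e: "t * (sq \<xi>) = (sqrt t *\<^sub>R \<xi>) \<bullet> (sqrt t *\<^sub>R \<xi>)" for \<xi> :: 'a
  using assms real_sqrt_mult_self[of t] by (simp add: mult.assoc[symmetric] abs_of_pos)
 let ?m = "%\<xi>::'a. cor (Qk k (sq \<xi>))"
 have r: "rdec ?m" by (rule Qk_rdec_and_Ex(1))
 show "Ex (%\<xi>. cor (Qk k (t * (sq \<xi>)))) x = cor ((2 * pi) ^ DIM('a) * ((1 / sqrt t) ^ DIM('a) * Pk k ((1 / sqrt t) *\<^sub>R x)))"
  unfolding e using Ex_scale[OF r st, of x] by (simp add: Qk_rdec_and_Ex(2) mult_ac)
 show "rdec (%\<xi>::'a. cor (Qk k (t * (sq \<xi>))))"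
  unfolding rdec_def
 proof (intro conjI allI)
  have [measurable]: "?m : bmeas" using r by (simp add: rdec_def)
  have "(%\<xi>. ?m (sqrt t *\<^sub>R \<xi>)) : bmeas" by measurable
  thus "(%\<xi>::'a. cor (Qk k (t * (sq \<xi>)))) : bmeas" unfolding e .
  fix N
  obtain C where C: "!!\<xi>. norm (?m \<xi>) <= C / (1 + sq \<xi>) ^ N" using r unfolding rdec_def by blast
  have C0: "0 <= C" using order_trans[OF norm_ge_zero C[of 0]] by simp
  define L where "L = max 1 (1 / t)"
  have L: "1 <= L" "1 / t <= L" by (auto simp: L_def)
  have "norm (cor (Qk k (t * (sq \<xi>)))) <= (C * L ^ N) / (1 + sq \<xi>) ^ N" for \<xi> :: 'a
  proof -
   have p: "0 < 1 + sq \<xi>" "0 < 1 + t * (sq \<xi>)" using assms by (auto intro: add_pos_nonneg)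
   have "sq \<xi> = (1 / t) * (t * (sq \<xi>))" using assms by simp
   also have "\<dots> <= L * (t * (sq \<xi>))" using L(2) assms by (intro mult_right_mono) auto
   finally have "1 + sq \<xi> <= L * (1 + t * (sq \<xi>))" using L(1) by (simp add: distrib_left)
   hence "(1 + sq \<xi>) ^ N <= L ^ N * (1 + t * (sq \<xi>)) ^ N"
    using p(1) by (simp add: power_mult_distrib[symmetric] power_mono)
   hence "C * (1 + sq \<xi>) ^ N <= C * (L ^ N * (1 + t * (sq \<xi>)) ^ N)" using C0 by (rule mult_left_mono)
   hence "C / (1 + t * (sq \<xi>)) ^ N <= (C * L ^ N) / (1 + sq \<xi>) ^ N" using p by (simp add: field_simps)
   thus ?thesis using C[of "sqrt t *\<^sub>R \<xi>"] unfolding e[symmetric] by linarith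
  qed
  thus "EX C. ALL \<xi>::'a. norm (cor (Qk k (t * (sq \<xi>)))) <= C / (1 + sq \<xi>) ^ N" by blast
 qed
qed

section \<open>Passing to the limit in the weak formulation\<close>

text \<open>Boxes form an intersection-stable generator of the Borel sets. The argument runs inside
  one bounded box, where D is integrable, and countably many boxes then exhaust the space.\<close>

lemma AE_zero_if_box_integrals_zero:
 fixes D :: "'a::euclidean_space => real"
 assumes i: "!!l k. Lint (%a. ind (box l k) a * D a)"
  and z: "!!l k. (LBINT a. ind (box l k) a * D a) = 0"
 shows "AE a in lborel. D a = 0"
proof -
 have main: "AE a in lborel. ind (box (- B) B) a * D a = 0" for B :: 'a
 proof (rule sigma_finite_measure.density_zero[OF sigma_finite_lborel i])
  let ?D = "%a. ind (box (- B) B) a * D a"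
  fix A :: "'a set" assume A: "A : sets lborel"
  have si: "set_integrable lborel A ?D" if "A : sets lborel" for A
   unfolding set_integrable_def using integrable_mult_indicator[OF that i] .
  let ?E = "range (%(a, b). box a b :: 'a set)"
  have "Int_stable ?E" "?E <= Pow UNIV" by (auto simp: Int_stable_def box_Int_box)
  moreover have "A : sigma_sets UNIV ?E" using A by (simp add: borel_eq_box)
  ultimately show "(LINT a:A|lborel. ?D a) = 0"
  proof (induction rule: sigma_sets_induct_disjoint)
   case (basic A)
   then obtain l k l' k' where b: "A = box l k" "box l k \<inter> box (- B) B = box l' k'" by (auto simp: box_Int_box)
   have e: "ind A a *\<^sub>R (ind (box (- B) B) a * D a) = ind (box l' k') a * D a" for a
    unfolding b(2)[symmetric] b(1) by (simp add: indicator_def)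
   show ?case unfolding set_lebesgue_integral_def e by (rule z)
  next
   case (compl A)
   have "A : sets lborel" "UNIV - A : sets lborel" using compl by (simp_all add: borel_eq_box sigma_sets.Compl)
   hence "(LINT a:A \<union> (UNIV - A)|lborel. ?D a) = (LINT a:A|lborel. ?D a) + (LINT a:UNIV - A|lborel. ?D a)"
    by (intro set_integral_Un si) auto
   thus ?case using compl z[of "- B" B] by (simp add: set_lebesgue_integral_def)
  next
   case (union A)
   have "A j : sets lborel" for j using union(2) by (simp add: borel_eq_box image_subset_iff)
   thus ?case using union by (subst lebesgue_integral_countable_add) (auto simp: disjoint_family_on_def intro!: si)
  qed (simp add: set_lebesgue_integral_def)
 qed
 have "AE a in lborel. ALL n::nat. ind (box (- (real n *\<^sub>R One)) (real n *\<^sub>R One)) a * D a = 0"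
  unfolding AE_all_countable using main by blast
 thus ?thesis
 proof eventually_elim
  case (elim a)
  have "a : (\<Union>n::nat. box (- (real n *\<^sub>R One)) (real n *\<^sub>R One))" unfolding UN_box_eq_UNIV by simp
  then obtain n :: nat where "a : box (- (real n *\<^sub>R One)) (real n *\<^sub>R One)" by blast
  thus ?case using elim[rule_format, of n] by simp
 qed
qed

section \<open>Truncated kernels and dilations\<close>

definition ew :: "nat => real => real => real" where
 "ew n \<epsilon> t = ind {\<epsilon><..<1} t * t powr (real n / 2 - 1)"

lemma ew_measurable [measurable]: "ew n \<epsilon> : bmeas"
proof -
 have [measurable]: "{\<epsilon><..<1} : sets borel" by simp
 show ?thesis unfolding ew_def[abs_def] by measurable
qed

lemma ew_nonneg [simp]: "0 <= ew n \<epsilon> t" by (simp add: ew_def)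

lemma ew_zero: "t ~: {\<epsilon><..<1} ==> ew n \<epsilon> t = 0" by (simp add: ew_def)

lemma ew_le_hw: "0 <= \<epsilon> ==> ew n \<epsilon> t <= hw n t"
 by (auto simp: ew_def hw_def indicator_def)

lemma ew_tendsto:
 assumes "\<epsilon> \<longlonglongrightarrow> 0" "!!j. 0 < \<epsilon> j"
 shows "(%j. ew n (\<epsilon> j) t) \<longlonglongrightarrow> hw n t"
proof (cases "t > 0")
 case True
 have "\<forall>\<^sub>F j in sequentially. \<epsilon> j < t" using order_tendstoD(2)[OF assms(1) True] .
 thus ?thesis by (rule tendsto_eventually[OF eventually_mono]) (use True in \<open>auto simp: hw_def ew_def indicator_def\<close>)
next
 case False
 hence e: "ew n (\<epsilon> j) t = hw n t" for j using assms(2)[of j] by (auto simp: hw_def ew_def indicator_def)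
 show ?thesis unfolding e by (rule tendsto_const)
qed

definition phe :: "real => 'a::euclidean_space => real" where
 "phe \<epsilon> x = (LBINT t. ew DIM('a) \<epsilon> t * hk t x)"

lemma phe_measurable [measurable]: "phe \<epsilon> : bmeas"
 unfolding phe_def[abs_def] by measurable

lemma phe_integrand_le:
 assumes "0 <= \<epsilon>"
 shows "0 <= ew n \<epsilon> t * hk t x" "ew n \<epsilon> t * hk t x <= hw n t * hk t x"
 using assms hk_nonneg[of t x] ew_le_hw[OF assms, of n t]
 by (cases "t : {\<epsilon><..<1}"; auto simp: ew_zero hw_def indicator_def mult_right_mono)+

lemma phe_bounds:
 assumes "0 <= \<epsilon>"
 shows "0 <= phe \<epsilon> (x::'a::euclidean_space)" "x ~= 0 ==> phe \<epsilon> x <= Phi x"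
proof -
 show "0 <= phe \<epsilon> x" unfolding phe_def using phe_integrand_le[OF assms] by (intro integral_nonneg_AE AE_I2)
 assume x: "x ~= 0"
 have "Lint (%t. ew DIM('a) \<epsilon> t * hk t x)"
  by (rule integrable_dom[OF Phi_integrable_t[OF x]])
   (use phe_integrand_le[OF assms, of "DIM('a)" _ x] in \<open>auto simp only: real_norm_def abs_of_nonneg intro!: AE_I2 order_trans[OF _ abs_ge_self]\<close>, measurable)
 thus "phe \<epsilon> x <= Phi x" unfolding phe_def Phi_def
  using phe_integrand_le(2)[OF assms] Phi_integrable_t[OF x] by (intro integral_mono)
qed

lemma phe_tendsto:
 assumes "x ~= (0::'a::euclidean_space)" "\<epsilon> \<longlonglongrightarrow> 0" "!!j. 0 < \<epsilon> j"
 shows "(%j. phe (\<epsilon> j) x) \<longlonglongrightarrow> Phi x"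
 unfolding phe_def Phi_def
proof (rule integral_dominated_convergence[OF _ _ Phi_integrable_t[OF assms(1)]])
 show "AE t in lborel. norm (ew DIM('a) (\<epsilon> j) t * hk t x) <= hw DIM('a) t * hk t x" for j
  using phe_integrand_le[of "\<epsilon> j" _ _ x] assms(3)[of j] by (intro AE_I2) (simp only: real_norm_def abs_of_nonneg less_imp_le)
 show "AE t in lborel. (%j. ew DIM('a) (\<epsilon> j) t * hk t x) \<longlonglongrightarrow> hw DIM('a) t * hk t x"
  by (intro AE_I2 tendsto_mult tendsto_const ew_tendsto assms)
qed measurable

text \<open>Dilation by sqrt epsilon with preserved integral, so that epsilon plays the part of
  time; as epsilon tends to 0 these kernels form an approximate identity, up to the factor given by
  the integral of q.\<close>

definition dil :: "('a::euclidean_space => real) => real => 'a => real" where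
 "dil q \<epsilon> z = (1 / sqrt \<epsilon>) ^ DIM('a) * q ((1 / sqrt \<epsilon>) *\<^sub>R z)"

lemma dil_measurable [measurable]:
 assumes [measurable]: "q : bmeas"
 shows "dil q \<epsilon> : bmeas"
 unfolding dil_def[abs_def] by measurable

lemma dil_integral:
 fixes q :: "'a::euclidean_space => real"
 assumes q: "Lint q" and e: "0 < \<epsilon>"
 shows "Lint (dil q \<epsilon>)" "(LBINT z. dil q \<epsilon> z) = (LBINT z. q z)"
  "(LBINT z. \<bar>dil q \<epsilon> z\<bar>) = (LBINT z. \<bar>q z\<bar>)"
proof -
 let ?s = "1 / sqrt \<epsilon>"
 have s: "?s ~= 0" using e by simp
 show "Lint (dil q \<epsilon>)" unfolding dil_def[abs_def]
  using integrable_lborel_affine[OF q s, of 0] by (intro integrable_mult_right) simp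
 show "(LBINT z. dil q \<epsilon> z) = (LBINT z. q z)" unfolding dil_def
  using integral_lborel_affine[OF q s, of 0] e by simp
 show "(LBINT z. \<bar>dil q \<epsilon> z\<bar>) = (LBINT z. \<bar>q z\<bar>)" unfolding dil_def
  using integral_lborel_affine[OF integrable_abs[OF q] s, of 0] e by (simp add: abs_mult)
qed

lemma dil_substitution:
 fixes q g :: "'a::euclidean_space => real"
 assumes e: "0 < \<epsilon>" and i: "Lint (%z. g z * dil q \<epsilon> z)"
 shows "(LBINT z. g z * dil q \<epsilon> z) = (LBINT y. g (sqrt \<epsilon> *\<^sub>R y) * q y)"
proof -
 let ?s = "sqrt \<epsilon>"
 have s: "?s > 0" using e by simp
 have "(LBINT z. g z * dil q \<epsilon> z) = ?s ^ DIM('a) * (LBINT y. g (0 + ?s *\<^sub>R y) * dil q \<epsilon> (0 + ?s *\<^sub>R y))"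
  using integral_lborel_affine[OF i, of ?s 0] s by simp
 also have "\<dots> = (LBINT y. ?s ^ DIM('a) * (g (?s *\<^sub>R y) * dil q \<epsilon> (?s *\<^sub>R y)))" by simp
 also have "\<dots> = (LBINT y. g (?s *\<^sub>R y) * q y)"
 proof (rule Bochner_Integration.integral_cong[OF refl])
  fix y :: 'a
  have 1: "(1 / ?s) *\<^sub>R ?s *\<^sub>R y = y" using s by (metis scaleR_scaleR nonzero_eq_divide_eq order_less_irrefl scaleR_one)
  have "?s ^ DIM('a) * (1 / ?s) ^ DIM('a) = 1" using s by (simp add: power_mult_distrib[symmetric])
  moreover have "?s ^ DIM('a) * (X * ((1 / ?s) ^ DIM('a) * Z)) = (?s ^ DIM('a) * (1 / ?s) ^ DIM('a)) * (X * Z)" for X Z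
   by (simp only: mult_ac)
  ultimately show "?s ^ DIM('a) * (g (?s *\<^sub>R y) * dil q \<epsilon> (?s *\<^sub>R y)) = g (?s *\<^sub>R y) * q y" unfolding dil_def 1 by simp
 qed
 finally show ?thesis .
qed

text \<open>Each heat kernel has mass 1, and the weight is integrable on (0, 1).\<close>

lemma Phi_integrable: "Lint (Phi :: 'a::euclidean_space => real)"
proof -
 define G where "G = (%(t, z::'a). hw DIM('a) t * hk t z)"
 have [measurable]: "G : borel_measurable (lborel \<Otimes>\<^sub>M lborel)" unfolding G_def by measurable
 have z: "hw DIM('a) t = 0" if "t ~: {0<..<1}" for t using that by (auto simp: hw_def)
 have "integrable (lborel \<Otimes>\<^sub>M lborel) G"
 proof (rule lborel_pair.Fubini_integrable)
  have "(LBINT y. norm (G (t, y))) = hw DIM('a) t * 1" for t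
   using hk_integral[of t, where 'a='a] z[of t] by (cases "t : {0<..<1}") (auto simp: G_def abs_mult hk_nonneg)
  thus "Lint (%t. LBINT y. norm (G (t, y)))" using integrable_hw[OF DIM_positive, of 1] by simp
  show "AE t in lborel. Lint (%y. G (t, y))"
  proof (intro AE_I2)
   fix t show "Lint (%y. G (t, y))"
    using hk_integrable[of t] z[of t] by (cases "t : {0<..<1}") (auto simp: G_def)
  qed
 qed measurable
 hence "Lint (%z. LBINT t. G (t, z))" using lborel_pair.integrable_snd[of "%t z. G (t, z)"] by simp
 thus ?thesis unfolding G_def Phi_def[abs_def] by simp
qed

lemma L1_convolution:
 fixes k f :: "'a::euclidean_space => real"
 assumes "Lint k" "Lint f"
 shows "AE a in lborel. Lint (%x. f x * k (x - a))"
  "Lint (%a. LBINT x. f x * k (x - a))"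
proof -
 have [measurable]: "k : bmeas" "f : bmeas" using assms by auto
 define G where "G = (%(x, a). f x * k (x - a))"
 have [measurable]: "G : borel_measurable (lborel \<Otimes>\<^sub>M lborel)" unfolding G_def by measurable
 have "integrable (lborel \<Otimes>\<^sub>M lborel) G"
 proof (rule lborel_pair.Fubini_integrable)
  have "(LBINT a. norm (G (x, a))) = \<bar>f x\<bar> * (LBINT z. \<bar>k z\<bar>)" for x
   using integral_lborel_translate(2)[OF integrable_abs[OF assms(1)], of x] by (simp add: G_def abs_mult)
  thus "Lint (%x. LBINT a. norm (G (x, a)))" using assms(2) by simp
  show "AE x in lborel. Lint (%a. G (x, a))"
   using integrable_lborel_translate(2)[OF assms(1)] by (intro AE_I2) (simp add: G_def)
 qed measurable
 thus "AE a in lborel. Lint (%x. f x * k (x - a))"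
  "Lint (%a. LBINT x. f x * k (x - a))"
  using lborel_pair.AE_integrable_snd[of "%x a. f x * k (x - a)"] lborel_pair.integrable_snd[of "%x a. f x * k (x - a)"]
  unfolding G_def by simp_all
qed

text \<open>The limit argument shared by both parities. \<theta> is the cutoff of the test function
  (constantly 1 in odd dimension), r \<epsilon> the part of the transformed test function that stays
  regular. For centres in a ball, w dominates the kernels r \<epsilon>, and it dominates the
  concentrating kernels after integration over that ball. As u is only locally integrable, the
  identity is integrated over a in a box, which moves the approximate identity from u onto the
  indicator of the box.\<close>

lemma weak_limit:
 fixes u f q \<theta> r0 :: "'a::euclidean_space => real" and r :: "real => 'a => real"
 assumes u: "u : bmeas" "!!l k. Lint (%x. ind (box l k) x * u x)"
  and f: "Lint f"
  and q: "Lint q" "A = (LBINT z. q z)"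
  and \<theta>: "\<theta> : bmeas" "isCont \<theta> 0" "\<theta> 0 = 1" "!!z. \<bar>\<theta> z\<bar> <= 1"
  and r: "!!\<epsilon>. r \<epsilon> : bmeas" "r0 : bmeas"
   "!!z \<epsilon>. \<epsilon> \<longlonglongrightarrow> 0 ==> (!!j. 0 < \<epsilon> j & \<epsilon> j < 1) ==> (%j::nat. r (\<epsilon> j) z) \<longlonglongrightarrow> r0 z"
  and w: "!!R. EX w. Lint (%x. \<bar>u x\<bar> * w x) & (ALL \<epsilon>:{0<..<1}. ALL x.
    (LBINT a. ind (cball 0 R) a * \<bar>\<theta> (x - a) * dil q \<epsilon> (x - a)\<bar>) <= w x & (ALL a:cball 0 R. \<bar>r \<epsilon> (x - a)\<bar> <= w x))"
  and eq: "!!\<epsilon> a. \<epsilon> : {0<..<1} ==>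
    (LBINT x. u x * (\<theta> (x - a) * dil q \<epsilon> (x - a) - r \<epsilon> (x - a))) = A' * (LBINT x. f x * (\<theta> (x - a) * phe \<epsilon> (x - a)))"
 shows "AE a in lborel. A * u a = (LBINT x. u x * r0 (x - a)) + A' * (LBINT x. f x * (\<theta> (x - a) * Phi (x - a)))"
proof -
 note [measurable] = u(1) \<theta>(1) r(1,2)
 have [measurable]: "f : bmeas" "q : bmeas" using f q by auto
 define S where "S a = (LBINT x. u x * r0 (x - a))" for a
 define W where "W a = (LBINT x. f x * (\<theta> (x - a) * Phi (x - a)))" for a
 define W1 where "W1 a = (LBINT x. \<bar>f x\<bar> * Phi (x - a))" for a
 note W1i = L1_convolution(2)[OF Phi_integrable integrable_abs[OF f], folded W1_def]
  and W1ae = L1_convolution(1)[OF Phi_integrable integrable_abs[OF f]]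
 have [measurable]: "S : bmeas" "W : bmeas" unfolding S_def[abs_def] W_def[abs_def] by measurable
 \<comment> \<open>A null sequence strictly inside (0, 1), hence the shift by two.\<close>
 define e :: "nat => real" where "e j = inverse (real (Suc (Suc j)))" for j
 have e: "e j : {0<..<1}" "0 < e j" "e j < 1" for j by (auto simp: e_def inverse_less_1_iff)
 have e0: "e \<longlonglongrightarrow> 0" unfolding e_def[abs_def] using LIMSEQ_Suc[OF LIMSEQ_inverse_real_of_nat] by simp
 have se0: "(%j. sqrt (e j)) \<longlonglongrightarrow> 0" using tendsto_real_sqrt[OF e0] by simp
 define \<kappa> where "\<kappa> j z = \<theta> z * dil q (e j) z" for j z
 have [measurable]: "\<kappa> j : bmeas" for j unfolding \<kappa>_def[abs_def] by measurable
 have \<kappa>i: "Lint (\<kappa> j)" for j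
  by (rule integrable_dom[OF dil_integral(1)[OF q(1) e(2)[of j]]])
   (use \<theta>(4) in \<open>auto simp: \<kappa>_def abs_mult mult_left_le_one_le intro!: AE_I2\<close>)
 define H where "H j a = (LBINT x. f x * (\<theta> (x - a) * phe (e j) (x - a)))" for j a
 have [measurable]: "H j : bmeas" for j unfolding H_def[abs_def] by measurable
 \<comment> \<open>At x = a the kernel \<open>Phi\<close> has its default value 0 while the
   truncations are positive, so the comparison is claimed almost everywhere.\<close>
 have fb: "AE x in lborel. norm (f x * (\<theta> (x - a) * phe (e j) (x - a))) <= \<bar>f x\<bar> * Phi (x - a)" for j a
  using AE_lborel_singleton[of a]
 proof eventually_elim
  case (elim x)
  have "\<bar>\<theta> (x - a)\<bar> * \<bar>phe (e j) (x - a)\<bar> <= 1 * Phi (x - a)"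
   using \<theta>(4) phe_bounds[of "e j" "x - a"] e(2)[of j] elim by (intro mult_mono) auto
  thus ?case by (simp add: abs_mult mult_left_mono)
 qed
 have HW: "AE a in lborel. norm (H j a) <= W1 a" for j
  using W1ae
 proof eventually_elim
  case (elim a)
  have "Lint (%x. f x * (\<theta> (x - a) * phe (e j) (x - a)))"
   by (rule integrable_dom[OF elim]) (measurable, use fb[of a j] in \<open>auto elim!: eventually_mono intro: order_trans\<close>)
  thus ?case
   unfolding W1_def H_def by (intro order_trans[OF integral_norm_bound] integral_mono_AE[OF _ elim fb] integrable_norm)
 qed
 have box: "Lint (%a. ind (box l k) a * (A * u a - S a - A' * W a)) &
   (LBINT a. ind (box l k) a * (A * u a - S a - A' * W a)) = 0" for l k
 proof -
  let ?b = "box l k"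
  have [measurable]: "?b : sets borel" by simp
  have ib: "Lint (%a. ind ?b a :: real)"
   using emeasure_lborel_box_finite[of l k] by (intro integrable_real_indicator) auto
  obtain R where R: "?b <= cball 0 R"
   using bounded_box[of l k] unfolding bounded_iff by (auto simp: subset_iff)
  obtain w where wi: "Lint (%x. \<bar>u x\<bar> * w x)" and
   ww: "ALL \<epsilon>:{0<..<1}. ALL x. (LBINT a. ind (cball 0 R) a * \<bar>\<theta> (x - a) * dil q \<epsilon> (x - a)\<bar>) <= w x & (ALL a:cball 0 R. \<bar>r \<epsilon> (x - a)\<bar> <= w x)"
   using w[of R] by (elim exE conjE)
  have w1: "(LBINT a. ind (cball 0 R) a * \<bar>\<kappa> j (x - a)\<bar>) <= w x" for j x
   using ww[rule_format, OF e(1), THEN conjunct1] by (simp add: \<kappa>_def)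
  have w2: "\<bar>r (e j) (x - a)\<bar> <= w x" if "a : ?b" for j x a
   using ww[rule_format, OF e(1), THEN conjunct2, rule_format] that R by blast
  define K where "K j x = (LBINT a. ind ?b a * \<kappa> j (x - a))" for j x
  have [measurable]: "K j : bmeas" for j unfolding K_def[abs_def] by measurable
  have \<kappa>t: "Lint (%a. \<kappa> j (x - a))" for j x by (rule integrable_lborel_translate(2)[OF \<kappa>i])
  have \<kappa>b: "Lint (%a. ind S a * \<bar>\<kappa> j (x - a)\<bar>)" if "S : sets borel" for S j x
   by (rule integrable_dom[OF \<kappa>t[of j x]]) (use that in \<open>auto simp: indicator_def\<close>)
  have Kabs: "(LBINT a. \<bar>ind ?b a * \<kappa> j (x - a)\<bar>) <= w x" for j x
  proof -
   have "(LBINT a. \<bar>ind ?b a * \<kappa> j (x - a)\<bar>) <= (LBINT a. ind (cball 0 R) a * \<bar>\<kappa> j (x - a)\<bar>)"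
   proof (rule integral_mono)
    show "Lint (%a. \<bar>ind ?b a * \<kappa> j (x - a)\<bar>)" using \<kappa>b[of ?b j x] by (simp add: abs_mult)
    show "Lint (%a. ind (cball 0 R) a * \<bar>\<kappa> j (x - a)\<bar>)" by (rule \<kappa>b) simp
    show "\<bar>ind ?b a * \<kappa> j (x - a)\<bar> <= ind (cball 0 R) a * \<bar>\<kappa> j (x - a)\<bar>" for a
     using R by (auto simp: indicator_def)
   qed
   also note w1
   finally show ?thesis .
  qed
  have Kw: "\<bar>K j x\<bar> <= w x" for j x
   unfolding K_def using integral_abs_bound[of lborel "%a. ind ?b a * \<kappa> j (x - a)"] Kabs[of j x] by linarith
  have w0: "0 <= w x" for x using Kw[of 0 x] by linarith
  have uw: "\<bar>u x\<bar> * y <= \<bar>u x\<bar> * w x" if "y <= w x" for x y using that by (rule mult_left_mono) simp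

  define G where "G j = (%(x, a). u x * (ind ?b a * \<kappa> j (x - a)))" for j
  have Gi: "integrable (lborel \<Otimes>\<^sub>M lborel) (G j)" for j
  proof (rule lborel_pair.Fubini_integrable)
   show "G j : borel_measurable (lborel \<Otimes>\<^sub>M lborel)" unfolding G_def by measurable
   have e1: "(LBINT a. norm (G j (x, a))) = \<bar>u x\<bar> * (LBINT a. \<bar>ind ?b a * \<kappa> j (x - a)\<bar>)" for x
    by (simp add: G_def abs_mult)
   show "Lint (%x. LBINT a. norm (G j (x, a)))" unfolding e1
    by (rule integrable_dom[OF wi], measurable) (use uw[OF Kabs] w0 in \<open>auto simp: abs_mult\<close>)
   have "Lint (%a. ind ?b a * \<kappa> j (x - a))" for x
    by (rule integrable_dom[OF \<kappa>t[of j x]]) (auto simp: indicator_def)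
   thus "AE x in lborel. Lint (%a. G j (x, a))" unfolding G_def by simp
  qed
  \<comment> \<open>Fubini yields integrability in x for almost every centre a, which is enough for
    an identity integrated over a.\<close>
  have uk: "AE a in lborel. a : ?b --> Lint (%x. u x * \<kappa> j (x - a))" for j
   using lborel_pair.AE_integrable_snd[of "%x a. u x * (ind ?b a * \<kappa> j (x - a))"] Gi[of j] unfolding G_def
   by (auto elim!: eventually_mono)
  \<comment> \<open>Concentrating term: after Fubini the kernels act on the indicator of the box and
    tend to A times it.\<close>
  have T1: "(%j. LBINT a. ind ?b a * (LBINT x. u x * \<kappa> j (x - a))) \<longlonglongrightarrow> (LBINT x. u x * (A * ind ?b x))"
  proof -
   have F: "(LBINT a. ind ?b a * (LBINT x. u x * \<kappa> j (x - a))) = (LBINT x. u x * K j x)" for j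
   proof -
    have "(LBINT x. u x * (ind ?b a * \<kappa> j (x - a))) = ind ?b a * (LBINT x. u x * \<kappa> j (x - a))" for a
     by (simp add: mult.left_commute[of "u _"])
    thus ?thesis unfolding K_def
     using lborel_pair.Fubini_integral[of "%x a. u x * (ind ?b a * \<kappa> j (x - a))"] Gi[of j] unfolding G_def by simp
   qed
   \<comment> \<open>Off the boundary of the box the indicator is locally constant; the boundary is
     a null set.\<close>
   have Klim: "(%j. K j x) \<longlonglongrightarrow> A * ind ?b x" if x: "x ~: cbox l k - box l k" for x
   proof -
    have Kq: "K j x = (LBINT y. ind ?b (x - sqrt (e j) *\<^sub>R y) * \<theta> (sqrt (e j) *\<^sub>R y) * q y)" for j
    proof -
     have i1: "Lint (%z. ind ?b (x - z) * \<kappa> j z)"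
      by (rule integrable_dom[OF \<kappa>i[of j]]) (auto simp: indicator_def)
     have "K j x = (LBINT z. ind ?b (x - z) * \<kappa> j z)"
      unfolding K_def using integral_lborel_translate(2)[OF i1, of x] by simp
     thus ?thesis using dil_substitution[OF e(2)[of j], of "%z. ind ?b (x - z) * \<theta> z" q] i1 unfolding \<kappa>_def mult.assoc[symmetric] by simp
    qed
    have "(%j. LBINT y. ind ?b (x - sqrt (e j) *\<^sub>R y) * \<theta> (sqrt (e j) *\<^sub>R y) * q y) \<longlonglongrightarrow> (LBINT y. ind ?b x * 1 * q y)"
    proof (rule integral_dominated_convergence[OF _ _ integrable_abs[OF q(1)]])
     show "AE y in lborel. (%j. ind ?b (x - sqrt (e j) *\<^sub>R y) * \<theta> (sqrt (e j) *\<^sub>R y) * q y) \<longlonglongrightarrow> ind ?b x * 1 * q y"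
     proof (intro AE_I2 tendsto_mult tendsto_const)
      fix y :: 'a
      have sy: "(%j. sqrt (e j) *\<^sub>R y) \<longlonglongrightarrow> 0" using tendsto_scaleR[OF se0 tendsto_const[of y]] by simp
      hence xy: "(%j. x - sqrt (e j) *\<^sub>R y) \<longlonglongrightarrow> x" using tendsto_diff[OF tendsto_const[of x] sy] by simp
      show "(%j. \<theta> (sqrt (e j) *\<^sub>R y)) \<longlonglongrightarrow> 1" using isCont_tendsto_compose[OF \<theta>(2) sy] \<theta>(3) by simp
      show "(%j. ind ?b (x - sqrt (e j) *\<^sub>R y) :: real) \<longlonglongrightarrow> ind ?b x"
      proof (cases "x : box l k")
       case True
       have "\<forall>\<^sub>F j in sequentially. x - sqrt (e j) *\<^sub>R y : box l k" using topological_tendstoD[OF xy open_box True] .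
       thus ?thesis by (rule tendsto_eventually[OF eventually_mono]) (use True in auto)
      next
       case False
       hence "x : - cbox l k" using x by auto
       hence "\<forall>\<^sub>F j in sequentially. x - sqrt (e j) *\<^sub>R y : - cbox l k"
        using topological_tendstoD[OF xy open_Compl[OF closed_cbox]] by blast
       hence "\<forall>\<^sub>F j in sequentially. (ind ?b (x - sqrt (e j) *\<^sub>R y) :: real) = ind ?b x"
        by eventually_elim (use False box_subset_cbox[of l k] in \<open>auto simp: indicator_def\<close>)
       thus ?thesis by (rule tendsto_eventually)
      qed
     qed
     show "AE y in lborel. norm (ind ?b (x - sqrt (e j) *\<^sub>R y) * \<theta> (sqrt (e j) *\<^sub>R y) * q y) <= \<bar>q y\<bar>" for j
      using \<theta>(4) by (intro AE_I2) (auto simp: indicator_def abs_mult mult_left_le_one_le)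
    qed measurable
    thus ?thesis unfolding Kq[symmetric] using q(2) by (simp add: mult.commute)
   qed
   have "(%j. LBINT x. u x * K j x) \<longlonglongrightarrow> (LBINT x. u x * (A * ind ?b x))"
   proof (rule integral_dominated_convergence[OF _ _ wi])
    have "AE x in lborel. x ~: cbox l k - box l k" using AE_not_in[OF null_sets_cbox_Diff_box] .
    thus "AE x in lborel. (%j. u x * K j x) \<longlonglongrightarrow> u x * (A * ind ?b x)"
     by eventually_elim (intro tendsto_mult tendsto_const Klim)
    show "AE x in lborel. norm (u x * K j x) <= \<bar>u x\<bar> * w x" for j
     using uw[OF Kw] by (intro AE_I2) (simp add: abs_mult)
   qed measurable
   thus ?thesis unfolding F .
  qed

  have urw: "norm (u x * r (e j) (x - a)) <= \<bar>u x\<bar> * w x" if "a : ?b" for j a x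
   using uw[OF w2[OF that]] by (simp add: abs_mult)
  have ur: "Lint (%x. u x * r (e j) (x - a))" if "a : ?b" for j a
   by (rule integrable_dom[OF wi], measurable) (use order_trans[OF urw[OF that] abs_ge_self] in auto)
  define I where "I = (LBINT x. \<bar>u x\<bar> * w x)"
  define P where "P j a = (LBINT x. u x * r (e j) (x - a))" for j a
  have [measurable]: "P j : bmeas" for j unfolding P_def[abs_def] by measurable
  \<comment> \<open>Regular term: convergence at each centre of the box, dominated by the constant
    \<open>I\<close>.\<close>
  have T2: "(%j. LBINT a. ind ?b a * P j a) \<longlonglongrightarrow> (LBINT a. ind ?b a * S a) &
    Lint (%a. ind ?b a * S a) & (ALL j. Lint (%a. ind ?b a * P j a))"
  proof -
   have iI: "Lint (%a. ind ?b a * I)" using ib by simp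
   have "(%j. P j a) \<longlonglongrightarrow> S a" if a: "a : ?b" for a
    unfolding S_def P_def
   proof (rule integral_dominated_convergence[OF _ _ wi])
    show "AE x in lborel. (%j. u x * r (e j) (x - a)) \<longlonglongrightarrow> u x * r0 (x - a)"
     by (intro AE_I2 tendsto_mult tendsto_const r(3) e0) (use e in auto)
    show "AE x in lborel. norm (u x * r (e j) (x - a)) <= \<bar>u x\<bar> * w x" for j
     using urw[OF a] by (intro AE_I2)
   qed measurable
   hence l: "AE a in lborel. (%j. ind ?b a * P j a) \<longlonglongrightarrow> ind ?b a * S a"
    by (intro AE_I2) (auto simp: indicator_def)
   have b: "AE a in lborel. norm (ind ?b a * P j a) <= ind ?b a * I" for j
    using norm_integral_le[OF ur wi urw] unfolding P_def I_def by (intro AE_I2) (auto simp: indicator_def)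
   have m1: "(%a. ind ?b a * S a) : borel_measurable lborel" by measurable
   have m2: "(%a. ind ?b a * P j a) : borel_measurable lborel" for j by measurable
   show ?thesis using integral_dominated_convergence[OF m1 m2 iI l b] integrable_dominated_convergence[OF m1 m2 iI l b]
    integrable_dominated_convergence2[OF m1 m2 iI l b] by blast
  qed
  \<comment> \<open>Potential of f: the truncations are dominated by \<open>W1\<close>, the
    convolution of |f| with \<open>Phi\<close>, which is integrable.\<close>
  have T3: "(%j. LBINT a. ind ?b a * H j a) \<longlonglongrightarrow> (LBINT a. ind ?b a * W a) &
    Lint (%a. ind ?b a * W a) & (ALL j. Lint (%a. ind ?b a * H j a))"
  proof -
   have l: "AE a in lborel. (%j. ind ?b a * H j a) \<longlonglongrightarrow> ind ?b a * W a"
    using W1ae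
   proof eventually_elim
    case (elim a)
    have "(%j. H j a) \<longlonglongrightarrow> W a" unfolding W_def H_def
    proof (rule integral_dominated_convergence[OF _ _ elim _ fb])
     show "AE x in lborel. (%j. f x * (\<theta> (x - a) * phe (e j) (x - a))) \<longlonglongrightarrow> f x * (\<theta> (x - a) * Phi (x - a))"
      using AE_lborel_singleton[of a] by eventually_elim (intro tendsto_mult tendsto_const phe_tendsto e0 e, auto)
    qed measurable
    thus ?case by (intro tendsto_mult tendsto_const)
   qed
   have b: "AE a in lborel. norm (ind ?b a * H j a) <= W1 a" for j
    using HW[of j]
   proof eventually_elim
    case (elim a)
    thus ?case using order_trans[OF norm_ge_zero elim] by (auto simp: indicator_def)
   qed
   have m1: "(%a. ind ?b a * W a) : borel_measurable lborel" by measurable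
   have m2: "(%a. ind ?b a * H j a) : borel_measurable lborel" for j by measurable
   show ?thesis using integral_dominated_convergence[OF m1 m2 W1i l b] integrable_dominated_convergence[OF m1 m2 W1i l b]
    integrable_dominated_convergence2[OF m1 m2 W1i l b] by blast
  qed
  have id: "(LBINT a. ind ?b a * (LBINT x. u x * \<kappa> j (x - a))) =
   (LBINT a. ind ?b a * P j a) + A' * (LBINT a. ind ?b a * H j a)" for j
  proof -
   have "(LBINT a. ind ?b a * (LBINT x. u x * \<kappa> j (x - a))) = (LBINT a. ind ?b a * P j a + A' * (ind ?b a * H j a))"
   proof (rule integral_cong_AE)
    show "AE a in lborel. ind ?b a * (LBINT x. u x * \<kappa> j (x - a)) = ind ?b a * P j a + A' * (ind ?b a * H j a)"
     using uk[of j]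
    proof eventually_elim
     case (elim a)
     show ?case
     proof (cases "a : ?b")
      case True
      have "(LBINT x. u x * \<kappa> j (x - a)) - P j a = (LBINT x. u x * \<kappa> j (x - a) - u x * r (e j) (x - a))"
       unfolding P_def using elim ur True by simp
      also have "\<dots> = A' * H j a" using eq[OF e(1)[of j], of a] by (simp add: \<kappa>_def H_def right_diff_distrib)
      finally show ?thesis using True by simp
     qed simp
    qed
   qed measurable
   thus ?thesis using T2 T3 by simp
  qed
  have lim: "(%j. (LBINT a. ind ?b a * P j a) + A' * (LBINT a. ind ?b a * H j a))
   \<longlonglongrightarrow> (LBINT a. ind ?b a * S a) + A' * (LBINT a. ind ?b a * W a)"
   using T2 T3 by (intro tendsto_add tendsto_mult tendsto_const) auto
  have "(LBINT x. u x * (A * ind ?b x)) = (LBINT a. ind ?b a * S a) + A' * (LBINT a. ind ?b a * W a)"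
   using LIMSEQ_unique[OF T1[unfolded id] lim] .
  moreover have "(LBINT x. u x * (A * ind ?b x)) = A * (LBINT x. ind ?b x * u x)"
   by (simp add: mult_ac flip: integral_mult_right_zero)
  moreover have dd: "ind ?b a * (A * u a - S a - A' * W a) = A * (ind ?b a * u a) - ind ?b a * S a - A' * (ind ?b a * W a)" for a
   by (simp add: algebra_simps)
  ultimately show ?thesis unfolding dd using u(2)[of l k] T2 T3 by simp
 qed
 have "AE a in lborel. A * u a - S a - A' * W a = 0"
  by (rule AE_zero_if_box_integrals_zero) (use box in auto)
 thus ?thesis unfolding S_def W_def by eventually_elim simp
qed

text \<open>Domination by a product reduces integrability on the product space to two one-variable
  facts; the Gaussian and Fourier double integrals below fit this form.\<close>

lemma integrable_pair_dom:
 fixes G :: "'a::euclidean_space \<times> 'b::euclidean_space => 'c::{banach, second_countable_topology}"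
 assumes m: "G : borel_measurable (lborel \<Otimes>\<^sub>M lborel)" and f: "Lint f" and g: "Lint g"
  and b: "!!x y. norm (G (x, y)) <= f x * g y"
 shows "integrable (lborel \<Otimes>\<^sub>M lborel) G"
proof (rule lborel_pair.Fubini_integrable[OF m])
 note [measurable] = m
 have i: "Lint (%y. G (x, y))" for x
 proof (rule integrable_dom)
  show "Lint (%y. f x * g y)" using g by simp
  show "AE y in lborel. norm (G (x, y)) <= norm (f x * g y)"
   using order_trans[OF b abs_ge_self] by (intro AE_I2) simp
 qed measurable
 show "AE x in lborel. Lint (%y. G (x, y))" using i by simp
 show "Lint (%x. LBINT y. norm (G (x, y)))"
 proof (rule integrable_dom)
  show "Lint (%x. f x * (LBINT y. g y))" using f by simp
  have "norm (LBINT y. norm (G (x, y))) <= (LBINT y. f x * g y)" for x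
   using b[of x] g by (intro norm_integral_le integrable_norm i) auto
  thus "AE x in lborel. norm (LBINT y. norm (G (x, y))) <= norm (f x * (LBINT y. g y))"
   by (intro AE_I2) (simp add: order_trans[OF _ abs_ge_self])
 qed measurable
qed

lemma fubini_dom:
 fixes G :: "'a::euclidean_space => 'b::euclidean_space => 'c::{banach, second_countable_topology}"
 assumes m: "(%(x, y). G x y) : borel_measurable (lborel \<Otimes>\<^sub>M lborel)" and f: "Lint f" and g: "Lint g"
  and b: "!!x y. norm (G x y) <= f x * g y"
 shows "(LBINT y. (LBINT x. G x y)) = (LBINT x. (LBINT y. G x y))"
  "Lint (%y. LBINT x. G x y)"
proof -
 have i: "integrable (lborel \<Otimes>\<^sub>M lborel) (%(x, y). G x y)"
  by (rule integrable_pair_dom[OF m f g]) (use b in auto)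
 show "(LBINT y. (LBINT x. G x y)) = (LBINT x. (LBINT y. G x y))"
  by (rule lborel_pair.Fubini_integral[OF i])
 show "Lint (%y. LBINT x. G x y)" by (rule lborel_pair.integrable_snd[OF i])
qed

text \<open>Source of the smooth remainder: u integrated against a fixed smooth kernel. Derivatives
  fall on the kernel, and w dominates as long as a stays bounded.\<close>

lemma weighted_convolution_Ck:
 fixes u q :: "'a::euclidean_space => real"
 assumes u: "u : bmeas" and q: "!!k. Ck_on k UNIV q"
  and w: "!!R is. set is <= Basis ==> EX w. Lint (%x. \<bar>u x\<bar> * w x) & (ALL x. ALL a:cball 0 R. \<bar>dpart is q (x - a)\<bar> <= w x)"
 shows "Ck_on k UNIV (%a. LBINT x. u x * q (x - a))"
proof (rule Ck_on_integral(1)[OF open_UNIV])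
 note [measurable] = u
 have qm [measurable]: "q : bmeas" using Ck_on_continuous[OF q[of 0]] by (rule borel_measurable_continuous_onI)
 show "(%x. u x * q (x - a)) : borel_measurable lborel" for a by measurable
 have e: "(%a. u x * q (x - a)) = (%a. u x *\<^sub>R q ((- 1) *\<^sub>R a + x))" for x by simp
 have aff: "Ck_on k UNIV (%a. q ((- 1) *\<^sub>R a + x))" for k x
  using Ck_on_affine[OF open_UNIV q[of k], of "- 1" x] by simp
 show "Ck_on k UNIV (%a. u x * q (x - a))" for x
  unfolding e by (rule Ck_on_linear[OF bounded_linear_scaleR_right open_UNIV aff])
 fix js :: "'a list" and a0 :: 'a assume js: "set js <= Basis"
 obtain w where wi: "Lint (%x. \<bar>u x\<bar> * w x)" and wb: "!!x a. a : cball 0 (norm a0 + 1) ==> \<bar>dpart js q (x - a)\<bar> <= w x"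
  using w[OF js, of "norm a0 + 1"] by blast
 have d: "dpart js (%a. u x * q (x - a)) a = u x * ((- 1) ^ length js * dpart js q (x - a))" for x a
  unfolding e using dpart_linear[OF bounded_linear_scaleR_right open_UNIV aff js UNIV_I, of "u x" x a]
   dpart_affine[OF q js, of "- 1" x a] by simp
 show "EX U w. open U & a0 : U & U <= UNIV & Lint w &
   (ALL x:space lborel. ALL a:U. norm (dpart js (%a. u x * q (x - a)) a) <= w x)"
 proof (intro exI conjI ballI)
  show "open (ball a0 1)" "a0 : ball a0 1" "ball a0 1 <= UNIV" by auto
  show "Lint (%x. \<bar>u x\<bar> * w x)" by (rule wi)
  fix x a assume "a : ball a0 1"
  hence "norm a <= norm a0 + 1" using norm_triangle_ineq2[of a a0] by (simp add: dist_norm norm_minus_commute)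
  thus "norm (dpart js (%a. u x * q (x - a)) a) <= \<bar>u x\<bar> * w x"
   unfolding d using wb[of a x] by (simp add: abs_mult power_abs mult_left_mono)
 qed
qed

lemma ew_integrable:
 assumes "n > 0" "\<epsilon> >= 0"
 shows "Lint (ew n \<epsilon>)"
proof (rule integrable_dom)
 show "Lint (%t. hw n t * 1)" by (rule integrable_hw[OF assms(1)])
 show "AE t in lborel. norm (ew n \<epsilon> t) <= norm (hw n t * 1)"
  using assms(2) by (intro AE_I2) (auto simp: ew_def hw_def indicator_def)
qed measurable

section \<open>Fourier transforms of the truncated kernels\<close>

text \<open>The Fourier transform of \<open>phe \<epsilon>\<close>; the truncation t > epsilon gives
  it Gaussian decay.\<close>

definition ee :: "real => 'a::euclidean_space => real" where
 "ee \<epsilon> \<xi> = (LBINT t. ew DIM('a) \<epsilon> t * exp (- t * (sq \<xi>)))"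

lemma ew_exp_le: "0 < \<epsilon> ==> ew n \<epsilon> t * exp (- t * (sq \<xi>)) <= ew n \<epsilon> t * exp (- \<epsilon> * (sq \<xi>))" for \<xi> :: "'a::euclidean_space"
 by (cases "t : {\<epsilon><..<1}") (auto simp: ew_zero intro!: mult_left_mono mult_right_mono)

lemma ee_bound:
 assumes "0 < \<epsilon>"
 shows "\<bar>ee \<epsilon> (\<xi>::'a::euclidean_space)\<bar> <= (LBINT t. ew DIM('a) \<epsilon> t) * exp (- \<epsilon> * (sq \<xi>))"
proof -
 have i: "Lint (%t. ew DIM('a) \<epsilon> t * exp (- \<epsilon> * (sq \<xi>)))" using ew_integrable[of "DIM('a)" \<epsilon>] assms by simp
 have i2: "Lint (%t. ew DIM('a) \<epsilon> t * exp (- t * (sq \<xi>)))"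
  by (rule integrable_dom[OF i]) (use ew_exp_le[OF assms, of "DIM('a)" _ \<xi>] in auto)
 have "norm (ee \<epsilon> \<xi>) <= (LBINT t. ew DIM('a) \<epsilon> t * exp (- \<epsilon> * (sq \<xi>)))"
  unfolding ee_def by (rule norm_integral_le[OF i2 i]) (use ew_exp_le[OF assms, of "DIM('a)" _ \<xi>] in auto)
 thus ?thesis by simp
qed

lemma ee_measurable [measurable]: "ee \<epsilon> : bmeas"
 unfolding ee_def[abs_def] by measurable

lemma ee_rdec:
 assumes "0 < \<epsilon>"
 shows "rdec (%\<xi>::'a::euclidean_space. cor (ee \<epsilon> \<xi>))"
 unfolding rdec_def
proof (intro conjI allI)
 show "(%\<xi>::'a. cor (ee \<epsilon> \<xi>)) : bmeas" by measurable
 fix N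
 let ?I = "(LBINT t. ew DIM('a) \<epsilon> t)"
 have I: "0 <= ?I" by (intro integral_nonneg_AE AE_I2) simp
 obtain C where C: "!!\<xi>::'a. norm (cor (exp (- \<epsilon> * (sq \<xi>)))) <= C / (1 + sq \<xi>) ^ N"
  using rdec_gauss[OF assms, where 'a='a] unfolding rdec_def by blast
 have "norm (cor (ee \<epsilon> \<xi>)) <= (?I * C) / (1 + sq \<xi>) ^ N" for \<xi> :: 'a
  using order_trans[OF ee_bound[OF assms, of \<xi>] mult_left_mono[OF C[of \<xi>, unfolded norm_of_real abs_exp_cancel] I]] by simp
 thus "EX C. ALL \<xi>::'a. norm (cor (ee \<epsilon> \<xi>)) <= C / (1 + sq \<xi>) ^ N" by blast
qed

lemma Ex_ee:
 fixes x :: "'a::euclidean_space"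
 assumes e: "0 < \<epsilon>"
 shows "Ex (%\<xi>. cor (ee \<epsilon> \<xi>)) x = cor ((2 * pi) ^ DIM('a) * phe \<epsilon> x)"
proof -
 define G where "G t \<xi> = cor (ew DIM('a) \<epsilon> t) * (cis (x \<bullet> \<xi>) * cor (exp (- t * (sq \<xi>))))" for t \<xi>
 have gi: "Lint (%\<xi>::'a. exp (- \<epsilon> * (sq \<xi>)))"
  using integrable_norm[OF rdec_integrable[OF rdec_gauss[OF e, where 'a='a]]] by simp
 have F: "(LBINT \<xi>. (LBINT t. G t \<xi>)) = (LBINT t. (LBINT \<xi>. G t \<xi>))"
 proof (rule fubini_dom(1)[OF _ ew_integrable[of "DIM('a)" \<epsilon>] gi])
  show "(%(t, \<xi>). G t \<xi>) : borel_measurable (lborel \<Otimes>\<^sub>M lborel)" unfolding G_def by measurable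
  show "norm (G t \<xi>) <= ew DIM('a) \<epsilon> t * exp (- \<epsilon> * (sq \<xi>))" for t \<xi>
   using ew_exp_le[OF e, of "DIM('a)" t \<xi>] by (simp add: G_def norm_mult)
 qed (use e in auto)
 have "(LBINT t. G t \<xi>) = cis (x \<bullet> \<xi>) * cor (ee \<epsilon> \<xi>)" for \<xi>
 proof -
  have "G t \<xi> = cis (x \<bullet> \<xi>) * cor (ew DIM('a) \<epsilon> t * exp (- t * (sq \<xi>)))" for t by (simp add: G_def)
  thus ?thesis unfolding ee_def by (simp only: integral_mult_right_zero integral_complex_of_real)
 qed
 moreover have "(LBINT \<xi>. G t \<xi>) = cor ((2 * pi) ^ DIM('a) * (ew DIM('a) \<epsilon> t * hk t x))" for t
 proof (cases "t : {\<epsilon><..<1}")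
  case True
  hence "t > 0" using e by simp
  thus ?thesis using Ex_gauss[of t x] by (simp add: G_def Ex_def)
 qed (simp add: G_def ew_zero)
 ultimately have "Ex (%\<xi>. cor (ee \<epsilon> \<xi>)) x = (LBINT t. cor ((2 * pi) ^ DIM('a) * (ew DIM('a) \<epsilon> t * hk t x)))"
  using F unfolding Ex_def by simp
 thus ?thesis unfolding phe_def by (simp only: integral_complex_of_real integral_mult_right_zero)
qed

lemma fourier_phe:
 fixes \<xi> :: "'a::euclidean_space"
 assumes e: "0 < \<epsilon>"
 shows "fourier (%x. cor (phe \<epsilon> x)) \<xi> = cor (ee \<epsilon> \<xi>)"
proof -
 define C where "C = (1 / sqrt (4 * pi * \<epsilon>)) ^ DIM('a)"
 define G where "G t x = cor (ew DIM('a) \<epsilon> t) * (cis (- (x \<bullet> \<xi>)) * cor (hk t x))" for t x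
 have gi: "Lint (%x::'a. C * exp (- (sq x) / 4))"
  by (rule integrable_mult_right[OF PG_integrable[OF PG.base]])
 have F: "(LBINT x. (LBINT t. G t x)) = (LBINT t. (LBINT x. G t x))"
 proof (rule fubini_dom(1)[OF _ ew_integrable[of "DIM('a)" \<epsilon>] gi])
  show "(%(t, x). G t x) : borel_measurable (lborel \<Otimes>\<^sub>M lborel)" unfolding G_def by measurable
  show "norm (G t x) <= ew DIM('a) \<epsilon> t * (C * exp (- (sq x) / 4))" for t x
  proof (cases "t : {\<epsilon><..<1}")
   case True
   hence t: "\<epsilon> < t" "t < 1" "t > 0" using e by auto
   have "(1 / sqrt (4 * pi * t)) ^ DIM('a) <= C"
    unfolding C_def using t e by (intro power_mono divide_left_mono real_sqrt_le_mono mult_left_mono) auto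
   moreover have "exp (- (sq x) / (4 * t)) <= exp (- (sq x) / 4)"
    using t by (simp add: divide_simps mult_left_le)
   ultimately have "hk t x <= C * exp (- (sq x) / 4)" unfolding hk_def using t e by (intro mult_mono) (auto simp: C_def)
   thus ?thesis using hk_nonneg[OF t(3), of x] by (simp add: G_def norm_mult mult_left_mono)
  qed (simp add: G_def ew_zero)
 qed (use e in auto)
 have "(LBINT t. G t x) = cis (- (x \<bullet> \<xi>)) * cor (phe \<epsilon> x)" for x
 proof -
  have "G t x = cis (- (x \<bullet> \<xi>)) * cor (ew DIM('a) \<epsilon> t * hk t x)" for t by (simp add: G_def)
  thus ?thesis unfolding phe_def by (simp only: integral_mult_right_zero integral_complex_of_real)
 qed
 moreover have "(LBINT x. G t x) = cor (ew DIM('a) \<epsilon> t * exp (- t * (sq \<xi>)))" for t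
 proof (cases "t : {\<epsilon><..<1}")
  case True
  hence "t > 0" using e by simp
  thus ?thesis using fourier_hk[of t \<xi>] by (simp add: G_def fourier_def)
 qed (simp add: G_def ew_zero)
 ultimately have "fourier (%x. cor (phe \<epsilon> x)) \<xi> = (LBINT t. cor (ew DIM('a) \<epsilon> t * exp (- t * (sq \<xi>))))"
  using F unfolding fourier_def by simp
 thus ?thesis unfolding ee_def by (simp only: integral_complex_of_real)
qed

text \<open>For epsilon < t < 1 the derivatives of the heat kernel have uniform rapid decay, which
  survives integration over t. This is what makes the truncations admissible test functions.\<close>

lemma phe_smooth_decay:
 assumes e: "0 < \<epsilon>"
 shows "Ck_on k UNIV (phe \<epsilon> :: 'a::euclidean_space => real)"
  and "set is <= Basis ==> EX C>=0. ALL x::'a. \<bar>dpart is (phe \<epsilon>) x\<bar> <= C / (1 + sq x) ^ N"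
proof -
 have wi: "Lint (%t. ew DIM('a) \<epsilon> t * B)" for B using ew_integrable[of "DIM('a)" \<epsilon>] e by simp
 have d: "dpart js (%x. ew DIM('a) \<epsilon> t * hk t x) (x::'a) = ew DIM('a) \<epsilon> t * dpart js (hk t) x" if "set js <= Basis" for js t x
  using dpart_linear[OF bounded_linear_mult_right open_UNIV hk_Ck that UNIV_I] .
 have b: "EX C>=0. ALL t. ALL x::'a. norm (dpart js (%x. ew DIM('a) \<epsilon> t * hk t x) x) <= ew DIM('a) \<epsilon> t * (C / (1 + sq x) ^ N)"
  if js: "set js <= Basis" for js :: "'a list" and N
 proof -
  obtain C where C: "C >= 0" "!!t x. t > 0 ==> \<bar>dpart js (hk t) (x::'a)\<bar> <= C * (1 / sqrt t) ^ (DIM('a) + length js) / (1 + (sq x) / t) ^ N"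
   using hk_dpart_bound[OF js] by metis
  define B where "B = C * (1 / sqrt \<epsilon>) ^ (DIM('a) + length js)"
  have B: "B >= 0" using C(1) e by (simp add: B_def)
  have "norm (dpart js (%x. ew DIM('a) \<epsilon> t * hk t x) x) <= ew DIM('a) \<epsilon> t * (B / (1 + sq x) ^ N)" for t and x :: 'a
  proof (cases "t : {\<epsilon><..<1}")
   case True
   hence t: "\<epsilon> < t" "t < 1" "t > 0" using e by auto
   have "\<bar>dpart js (hk t) x\<bar> <= C * (1 / sqrt t) ^ (DIM('a) + length js) / (1 + (sq x) / t) ^ N" by (rule C(2)[OF t(3)])
   also have "\<dots> <= B / (1 + sq x) ^ N" unfolding B_def
   proof (intro frac_le mult_left_mono power_mono divide_left_mono real_sqrt_le_mono)
    have "sq x <= (sq x) / t" using t by (simp add: le_divide_eq mult_left_le)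
    thus "1 + sq x <= 1 + (sq x) / t" by simp
   qed (use t e C in \<open>auto simp: add_pos_nonneg intro!: zero_less_power\<close>)
   finally show ?thesis unfolding d[OF js] using mult_left_mono[OF _ ew_nonneg] by (simp only: real_norm_def abs_mult abs_of_nonneg[OF ew_nonneg])
  qed (simp add: d[OF js] ew_zero)
  thus ?thesis using B by blast
 qed
 have dom: "EX U w. open U & x0 : U & U <= UNIV & Lint w & (ALL t:space lborel. ALL x:U. norm (dpart js (%x. ew DIM('a) \<epsilon> t * hk t x) x) <= w t)"
  if js: "set js <= Basis" for js and x0 :: 'a
 proof -
  obtain C where C: "!!t x::'a. norm (dpart js (%x. ew DIM('a) \<epsilon> t * hk t x) x) <= ew DIM('a) \<epsilon> t * (C / (1 + sq x) ^ 0)" using b[OF js, of 0] by blast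
  show ?thesis by (intro exI[of _ UNIV] exI[of _ "%t. ew DIM('a) \<epsilon> t * C"] conjI ballI wi) (use C in auto)
 qed
 have ck: "Ck_on k UNIV (%x. ew DIM('a) \<epsilon> t * hk t (x::'a))" for t k
  by (rule Ck_on_linear[OF bounded_linear_mult_right open_UNIV hk_Ck])
 have m: "(%t. ew DIM('a) \<epsilon> t * hk t x) : borel_measurable lborel" for x :: 'a by measurable
 show "Ck_on k UNIV (phe \<epsilon> :: 'a => real)" unfolding phe_def[abs_def]
  by (rule Ck_on_integral(1)[OF open_UNIV m ck]) (use dom in auto)
 assume js: "set is <= (Basis :: 'a set)"
 obtain C where C: "C >= 0" "!!t x::'a. norm (dpart is (%x. ew DIM('a) \<epsilon> t * hk t x) x) <= ew DIM('a) \<epsilon> t * (C / (1 + sq x) ^ N)" using b[OF js] by metis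
 define I where "I = (LBINT t. ew DIM('a) \<epsilon> t)"
 have I: "0 <= I" unfolding I_def by (intro integral_nonneg_AE AE_I2) simp
 have "\<bar>dpart is (phe \<epsilon>) x\<bar> <= (I * C) / (1 + sq x) ^ N" for x :: 'a
 proof -
  have "Lint (%t. dpart is (%x. ew DIM('a) \<epsilon> t * hk t x) x) &
   dpart is (%x. LBINT t. ew DIM('a) \<epsilon> t * hk t x) x = (LBINT t. dpart is (%x. ew DIM('a) \<epsilon> t * hk t x) x)"
   by (rule Ck_on_integral(2)[OF open_UNIV m ck, where N = "length is"]) (use dom js in auto)
  thus ?thesis using norm_integral_le[OF _ wi C(2), of x] unfolding phe_def[abs_def] I_def by simp
 qed
 thus "EX C>=0. ALL x::'a. \<bar>dpart is (phe \<epsilon>) x\<bar> <= C / (1 + sq x) ^ N" using I C(1) by (intro exI[of _ "I * C"]) auto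
qed

lemma fourier_translate:
 fixes \<psi> :: "'a::euclidean_space => complex"
 assumes "Lint \<psi>"
 shows "fourier (%x. \<psi> (x - a)) \<xi> = cis (- (a \<bullet> \<xi>)) * fourier \<psi> \<xi>"
proof -
 have [measurable]: "\<psi> : bmeas" using assms by auto
 have i: "Lint (%x. cis (- (x \<bullet> \<xi>)) * \<psi> x)"
  by (rule integrable_dom[OF assms]) (auto simp: norm_mult)
 have "fourier (%x. \<psi> (x - a)) \<xi> = (LBINT x. cis (- (a \<bullet> \<xi>)) * (cis (- ((x - a) \<bullet> \<xi>)) * \<psi> (x - a)))"
  unfolding fourier_def mult.assoc[symmetric] cis_mult by (simp add: inner_diff_left)
 also have "\<dots> = cis (- (a \<bullet> \<xi>)) * fourier \<psi> \<xi>"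
  unfolding fourier_def using integral_lborel_translate(1)[OF i, of a] by simp
 finally show ?thesis .
qed

lemma Ex_translate: "Ex (%\<xi>. cis (- (a \<bullet> \<xi>)) * m \<xi>) x = Ex m (x - a)"
 unfolding Ex_def mult.assoc[symmetric] cis_mult by (simp add: inner_diff_left)

lemma schwartz_phe:
 fixes a :: "'a::euclidean_space"
 assumes e: "0 < \<epsilon>"
 shows "schwartz (%x. cor (phe \<epsilon> (x - a)))"
proof -
 have ee: "(%x. cor (phe \<epsilon> (x - a))) = (%x. cor (phe \<epsilon> (1 *\<^sub>R x + (- a))))" by simp
 have ck: "Ck_on k UNIV (%x. phe \<epsilon> (1 *\<^sub>R x + (- a)))" for k
  using Ck_on_affine[OF open_UNIV phe_smooth_decay(1)[OF e, of k], of 1 "- a"] by simp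
 have "bdd_above (range (%x. norm x ^ k * norm (dpart js (%x. cor (phe \<epsilon> (x - a))) x)))" if js: "set js <= Basis" for js k
 proof -
  obtain C where C: "C >= 0" "!!x::'a. \<bar>dpart js (phe \<epsilon>) x\<bar> <= C / (1 + sq x) ^ k" using phe_smooth_decay(2)[OF e js] by metis
  define D where "D = C * (3 * (1 + (norm a)\<^sup>2)) ^ k"
  have "norm x ^ k * norm (dpart js (%x. cor (phe \<epsilon> (x - a))) x) <= D" for x
  proof -
   have "dpart js (%x. cor (phe \<epsilon> (x - a))) x = cor (dpart js (phe \<epsilon>) (x - a))"
    unfolding ee using dpart_linear[OF bounded_linear_of_real open_UNIV ck js UNIV_I, of x]
     dpart_affine[OF phe_smooth_decay(1)[OF e] js, of 1 "- a" x] by simp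
   hence "norm (dpart js (%x. cor (phe \<epsilon> (x - a))) x) <= C / (1 + (x + - a) \<bullet> (x + - a)) ^ k"
    using C(2)[of "x - a"] by simp
   also have "\<dots> <= D / (1 + sq x) ^ k" unfolding D_def by (rule decay_shift) (use C in auto)
   finally have "norm x ^ k * norm (dpart js (%x. cor (phe \<epsilon> (x - a))) x) <= (1 + sq x) ^ k * (D / (1 + sq x) ^ k)"
    using norm_le_one_plus_inner[of x] by (intro mult_mono power_mono) auto
   moreover have "1 + sq x > 0" by (simp add: add_pos_nonneg)
   ultimately show ?thesis by simp
  qed
  thus ?thesis by (intro bdd_aboveI[of _ D]) auto
 qed
 moreover have "smooth_on UNIV (%x. cor (phe \<epsilon> (x - a)))"
  unfolding smooth_on_def ee by (intro allI Ck_on_linear[OF bounded_linear_of_real open_UNIV ck])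
 ultimately show ?thesis unfolding schwartz_def by blast
qed

text \<open>Turns an identity of symbols into one of kernels: the dilation of q corresponds to the
  symbol Q (epsilon |xi|^2). The parity of n enters only through Q and A'.\<close>

lemma kernel_pair:
 fixes q :: "'a::euclidean_space => real" and Q :: "real => real"
 assumes Q: "rdec (%\<xi>::'a. cor (Q (sq \<xi>)))"
   "!!x::'a. Ex (%\<xi>. cor (Q (sq \<xi>))) x = cor ((2 * pi) ^ DIM('a) * q x)"
  and s: "!!\<xi>::'a. A' * (norm \<xi> powr real DIM('a) * ee \<epsilon> \<xi>) = Q (\<epsilon> * (sq \<xi>)) - Q (sq \<xi>)"
  and e: "0 < \<epsilon>" and A': "A' ~= 0"
 shows "Ex (%\<xi>::'a. cor (norm \<xi> powr real DIM('a)) * cor (ee \<epsilon> \<xi>)) x =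
  cor ((2 * pi) ^ DIM('a) * ((1 / A') * (dil q \<epsilon> x - q x)))"
proof -
 have se: "sqrt \<epsilon> > 0" using e by simp
 have sc: "(%\<xi>::'a. cor (Q (\<epsilon> * (sq \<xi>)))) = (%\<xi>. cor (Q ((sqrt \<epsilon> *\<^sub>R \<xi>) \<bullet> (sqrt \<epsilon> *\<^sub>R \<xi>))))"
  using e by (simp add: mult.assoc[symmetric])
 have Ei: "Lint (%\<xi>. cis (x \<bullet> \<xi>) * m \<xi>)" if "Lint m" for m :: "'a => complex"
 proof -
  have [measurable]: "m : bmeas" using that by auto
  show ?thesis by (rule integrable_dom[OF that]) (auto simp: norm_mult)
 qed
 have Qi: "Lint (%\<xi>::'a. cor (Q (sq \<xi>)))" by (rule rdec_integrable[OF Q(1)])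
 have Qei: "Lint (%\<xi>::'a. cor (Q (\<epsilon> * (sq \<xi>))))"
  unfolding sc using integrable_lborel_affine[OF Qi, of "sqrt \<epsilon>" 0] se by simp
 have "Ex (%\<xi>. cor (Q (\<epsilon> * (sq \<xi>)))) x = cor ((2 * pi) ^ DIM('a) * (dil q \<epsilon> x))"
  unfolding sc dil_def using Ex_scale[OF Q(1) se, of x] Q(2)[of "(1 / sqrt \<epsilon>) *\<^sub>R x"] by (simp add: mult_ac)
 hence h1: "Ex (%\<xi>. cor (Q (\<epsilon> * (sq \<xi>))) - cor (Q (sq \<xi>))) x =
   cor ((2 * pi) ^ DIM('a) * (dil q \<epsilon> x - q x))"
  using Q(2)[of x] Bochner_Integration.integral_diff[OF Ei[OF Qei] Ei[OF Qi]] unfolding Ex_def by (simp add: right_diff_distrib)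
 have h2: "cor (norm \<xi> powr real DIM('a)) * cor (ee \<epsilon> \<xi>) =
   cor (1 / A') * (cor (Q (\<epsilon> * (sq \<xi>))) - cor (Q (sq \<xi>)))" for \<xi> :: 'a
  unfolding of_real_mult[symmetric] of_real_diff[symmetric] s[symmetric] using A' by simp
 show ?thesis unfolding h2 Ex_cmult h1 by simp
qed

section \<open>Odd dimension\<close>

lemma loc_integrable_measurable:
 fixes u :: "'a::euclidean_space => real"
 assumes "loc_integrable u"
 shows "u : bmeas"
proof (rule borel_measurable_LIMSEQ_real)
 show "(%x. ind (cball 0 (real n)) x *\<^sub>R u x) : bmeas" for n
 proof -
  have "set_integrable lborel (cball 0 (real n)) u" using assms by (simp add: loc_integrable_def)
  thus ?thesis unfolding set_integrable_def using borel_measurable_integrable by fastforce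
 qed
 fix x
 have "\<forall>\<^sub>F n in sequentially. ind (cball 0 (real n)) x *\<^sub>R u x = u x"
  using eventually_ge_at_top[of "nat \<lceil>norm x\<rceil>"]
 proof eventually_elim
  case (elim n)
  hence "norm x <= real n" by linarith
  thus ?case by simp
 qed
 thus "(%n. ind (cball 0 (real n)) x *\<^sub>R u x) \<longlonglongrightarrow> u x" by (rule tendsto_eventually)
qed

lemma loc_integrable_cball:
 fixes u :: "'a::euclidean_space => real"
 assumes "loc_integrable u"
 shows "Lint (%x. \<bar>u x\<bar> * (C * ind (cball 0 R) x))"
proof -
 have "Lint (%x. ind (cball 0 R) x *\<^sub>R u x)"
  using assms unfolding loc_integrable_def set_integrable_def by simp
 from integrable_mult_right[OF integrable_abs[OF this], of C] show ?thesis by (simp add: abs_mult mult_ac)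
qed

lemma loc_integrable_box:
 fixes u :: "'a::euclidean_space => real"
 assumes "loc_integrable u"
 shows "Lint (%x. ind (box l k) x * u x)"
proof -
 have "Lint (%x. ind (cbox l k) x *\<^sub>R u x)"
  using assms unfolding loc_integrable_def set_integrable_def by simp
 thus ?thesis
  by (rule integrable_dom)
   (use indicator_mult_measurable[OF loc_integrable_measurable[OF assms] borel_open[OF open_box]] box_subset_cbox[of l k] in \<open>auto simp: indicator_def\<close>)
qed

lemma integral_positive:
 fixes f :: "real => real"
 assumes "Lint f" "!!x. 0 <= f x" "!!x. 0 < x ==> 0 < f x"
 shows "0 < (LBINT x. f x)"
proof -
 have "(LBINT x. f x) ~= 0"
 proof
  assume "(LBINT x. f x) = 0"
  hence "AE x in lborel. f x = 0" using integral_nonneg_eq_0_iff_AE[OF assms(1)] assms(2) by simp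
  hence "AE x in lborel. x ~: {0<..<1::real}" by eventually_elim (use assms(3) in force)
  hence "{0<..<1::real} : null_sets lborel" by (subst AE_iff_null_sets) auto
  thus False by (auto simp: null_sets_def)
 qed
 moreover have "0 <= (LBINT x. f x)" using assms(2) by (intro integral_nonneg_AE AE_I2)
 ultimately show ?thesis by simp
qed

lemma Qk_bound: "EX C>=0. ALL z>=0. \<bar>Qk k z\<bar> <= C / (1 + z) ^ N"
proof -
 obtain C where C: "!!\<xi>::real. norm (cor (Qk k (sq \<xi>))) <= C / (1 + sq \<xi>) ^ N"
  using Qk_rdec_and_Ex(1)[of k, where 'a=real] unfolding rdec_def by blast
 have "\<bar>Qk k z\<bar> <= C / (1 + z) ^ N" if "z >= 0" for z using C[of "sqrt z"] that by simp
 moreover have "C >= 0" using C[of 0] by simp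
 ultimately show ?thesis by blast
qed

lemma Qk_measurable [measurable]: "Qk k : bmeas"
 unfolding Qk_def[abs_def] by measurable

lemma Pk_measurable [measurable]: "Pk k : bmeas"
 by (rule PG_measurable[OF PG_Pk])

section \<open>Subordination for odd dimension\<close>

text \<open>For n = 2k + 1 one has |xi|^n t^(n/2 - 1) = |xi|^(2(k+1)) t^k (t |xi|^2)^(-1/2), and the
  last factor is proportional to the integral of S^(-1/2) exp(-S t |xi|^2) over S > 0. Integrating
  t^k exp(-(1 + S) t |xi|^2) over t then produces \<open>Qk\<close> at (1 + S) |xi|^2 and a factor
  (1 + S)^(-(k+1)), whence this weight.\<close>

definition Wk :: "nat => real => real" where
 "Wk k S = ind {0<..} S * (S powr (- 1 / 2) / (1 + S) ^ (k + 1))"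

lemma Wk_measurable [measurable]: "Wk k : bmeas"
proof -
 have [measurable]: "{0::real<..} : sets borel" by simp
 show ?thesis unfolding Wk_def[abs_def] by measurable
qed

lemma Wk_nonneg [simp]: "0 <= Wk k S" and Wk_pos: "0 < S ==> 0 < Wk k S" and Wk_zero: "~ 0 < S ==> Wk k S = 0"
 by (auto simp: Wk_def indicator_def)

lemma integrable_powr_half_dominated:
 fixes f :: "real => real"
 assumes "f : bmeas" "!!S. ~ 0 < S ==> f S = 0" "!!S. 0 < S ==> \<bar>f S\<bar> <= S powr (- 1 / 2)"
  "!!S. 1 <= S ==> \<bar>f S\<bar> <= c * S powr (- 3 / 2)"
 shows "Lint f"
proof (rule integrable_dom)
 show "Lint (%S::real. ind {0<..<1} S * S powr (- 1 / 2) + c * (ind {1..} S * S powr (- 3 / 2)))"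
  using integrable_powr_unit[of "- 1 / 2"] integrable_powr_tail[of "- 3 / 2"] by (intro Bochner_Integration.integrable_add integrable_mult_right) auto
 have "\<bar>f S\<bar> <= ind {0<..<1} S * S powr (- 1 / 2) + c * (ind {1..} S * S powr (- 3 / 2))" for S
  using assms(2-4)[of S] by (cases "0 < S"; cases "S < 1") auto
 thus "AE S in lborel. norm (f S) <= norm (ind {0<..<1} S * S powr (- 1 / 2) + c * (ind {1..} S * S powr (- 3 / 2)))"
  by (intro AE_I2) (simp add: order_trans[OF _ abs_ge_self])
qed (use assms in simp)

lemma Wk_integrable: "Lint (Wk k)"
proof (rule integrable_powr_half_dominated[of _ 1])
 show "\<bar>Wk k S\<bar> <= S powr (- 1 / 2)" if "0 < S" for S
 proof -
  have "(1::real) <= (1 + S) ^ (k + 1)" using that by (intro one_le_power) auto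
  thus ?thesis using that by (simp add: Wk_def divide_le_eq mult_le_cancel_left1 del: power_Suc)
 qed
 show "\<bar>Wk k S\<bar> <= 1 * S powr (- 3 / 2)" if "1 <= S" for S
 proof -
  have "S ^ 1 <= (1 + S) ^ 1" by simp
  also have "\<dots> <= (1 + S) ^ (k + 1)" using that by (intro power_increasing) auto
  finally have "S powr (- 1 / 2) / (1 + S) ^ (k + 1) <= S powr (- 1 / 2) / S ^ 1" using that by (intro divide_left_mono mult_pos_pos) auto
  also have "\<dots> = S powr (- 3 / 2)" using that powr_diff[of S "- 1 / 2" 1] by simp
  finally show ?thesis using that by (simp add: Wk_def)
 qed
qed (auto simp: Wk_zero)

text \<open>The superposition over S of the integer-order symbols; \<open>qs\<close> and
  \<open>qo\<close> below are the kernels of a single term and of the superposition.\<close>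

definition Qo :: "nat => real => real" where
 "Qo k z = (LBINT S. Wk k S * Qk k ((1 + S) * z))"

definition qs :: "nat => real => 'a::euclidean_space => real" where
 "qs k S x = (1 / sqrt (1 + S)) ^ DIM('a) * Pk k ((1 / sqrt (1 + S)) *\<^sub>R x)"

definition qo :: "nat => 'a::euclidean_space => real" where
 "qo k x = (LBINT S. Wk k S * qs k S x)"

lemma qs_measurable [measurable]: "(%(S, x::'a::euclidean_space). qs k S x) : borel_measurable (borel \<Otimes>\<^sub>M borel)"
 unfolding qs_def by measurable

lemma Wk_Qk_bound:
 obtains C where "C >= 0" "!!z S. z >= 0 ==> \<bar>Wk k S * Qk k ((1 + S) * z)\<bar> <= Wk k S * (C / (1 + z) ^ N)"
proof -
 obtain C where C: "C >= 0" "!!z. z >= 0 ==> \<bar>Qk k z\<bar> <= C / (1 + z) ^ N" using Qk_bound by metis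
 have "\<bar>Qk k ((1 + S) * z)\<bar> <= C / (1 + z) ^ N" if "0 < S" "z >= 0" for S z
 proof -
  have "\<bar>Qk k ((1 + S) * z)\<bar> <= C / (1 + (1 + S) * z) ^ N" using that by (intro C(2)) simp
  also have "\<dots> <= C / (1 + z) ^ N"
   using that C(1) by (intro divide_left_mono power_mono mult_pos_pos zero_less_power) (auto simp: algebra_simps add_pos_nonneg)
  finally show ?thesis .
 qed
 hence "\<bar>Wk k S * Qk k ((1 + S) * z)\<bar> <= Wk k S * (C / (1 + z) ^ N)" if "z >= 0" for z S
  using that by (cases "0 < S") (auto simp: Wk_zero abs_mult simp del: times_divide_eq_right intro!: mult_left_mono)
 thus ?thesis using that C(1) by blast
qed

lemma Wk_Qk_integrable: "z >= 0 ==> Lint (%S. Wk k S * Qk k ((1 + S) * z))"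
proof -
 assume z: "z >= 0"
 obtain C where C: "!!S. \<bar>Wk k S * Qk k ((1 + S) * z)\<bar> <= Wk k S * (C / (1 + z) ^ 0)" using Wk_Qk_bound[of k 0] z by metis
 have "Lint (%S. Wk k S * (C / (1 + z) ^ 0))" by (rule integrable_mult_left[OF Wk_integrable])
 thus ?thesis
  by (rule integrable_dom) (use order_trans[OF C abs_ge_self] in auto)
qed

lemma Qo_rdec_Ex:
 shows "rdec (%\<xi>::'a::euclidean_space. cor (Qo k (sq \<xi>)))"
  and "Ex (%\<xi>. cor (Qo k (sq \<xi>))) (x::'a) = cor ((2 * pi) ^ DIM('a) * qo k x)"
proof -
 have W: "Lint (%S. Wk k S * B)" for B by (rule integrable_mult_left[OF Wk_integrable])
 show "rdec (%\<xi>::'a. cor (Qo k (sq \<xi>)))" unfolding rdec_def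
 proof (intro conjI allI)
  have "(%z. Qo k z) : bmeas" unfolding Qo_def by measurable
  thus "(%\<xi>::'a. cor (Qo k (sq \<xi>))) : bmeas" by measurable
  fix N
  obtain C where C: "!!z S. z >= 0 ==> \<bar>Wk k S * Qk k ((1 + S) * z)\<bar> <= Wk k S * (C / (1 + z) ^ N)" using Wk_Qk_bound[of k N] by metis
  have "norm (cor (Qo k (sq \<xi>))) <= ((LBINT S. Wk k S) * C) / (1 + sq \<xi>) ^ N" for \<xi> :: 'a
   using norm_integral_le[OF Wk_Qk_integrable[of "sq \<xi>" k] W, of "C / (1 + sq \<xi>) ^ N"] C[of "sq \<xi>"] by (simp add: Qo_def)
  thus "EX C. ALL \<xi>::'a. norm (cor (Qo k (sq \<xi>))) <= C / (1 + sq \<xi>) ^ N" by blast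
 qed
 obtain C where C: "C >= 0" "!!z S. z >= 0 ==> \<bar>Wk k S * Qk k ((1 + S) * z)\<bar> <= Wk k S * (C / (1 + z) ^ DIM('a))" using Wk_Qk_bound[of k "DIM('a)"] by metis
 define G where "G S \<xi> = cis (x \<bullet> \<xi>) * cor (Wk k S * Qk k ((1 + S) * (sq \<xi>)))" for S \<xi>
 have F: "(LBINT \<xi>. (LBINT S. G S \<xi>)) = (LBINT S. (LBINT \<xi>. G S \<xi>))"
 proof (rule fubini_dom(1)[OF _ Wk_integrable integrable_mult_right[OF integrable_one_plus_norm_power[OF order_refl]]])
  show "(%(S, \<xi>). G S \<xi>) : borel_measurable (lborel \<Otimes>\<^sub>M lborel)" unfolding G_def by measurable
  show "norm (G S \<xi>) <= Wk k S * (C * (1 / (1 + sq \<xi>) ^ DIM('a)))" for S \<xi>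
   using C(2)[of "sq \<xi>" S] by (simp add: G_def norm_mult)
 qed
 have "(LBINT S. G S \<xi>) = cis (x \<bullet> \<xi>) * cor (Qo k (sq \<xi>))" for \<xi>
  unfolding G_def Qo_def by (simp only: integral_mult_right_zero integral_complex_of_real)
 moreover have "(LBINT \<xi>. G S \<xi>) = cor ((2 * pi) ^ DIM('a) * (Wk k S * qs k S x))" for S
 proof (cases "0 < S")
  case True
  hence "G S \<xi> = cor (Wk k S) * (cis (x \<bullet> \<xi>) * cor (Qk k ((1 + S) * (sq \<xi>))))" for \<xi> by (simp add: G_def)
  thus ?thesis using inv_fourier_Qk(2)[of "1 + S" k x] True unfolding Ex_def qs_def by simp
 qed (simp add: G_def Wk_zero)
 ultimately have "Ex (%\<xi>. cor (Qo k (sq \<xi>))) x = (LBINT S. cor ((2 * pi) ^ DIM('a) * (Wk k S * qs k S x)))"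
  using F unfolding Ex_def by simp
 thus "Ex (%\<xi>. cor (Qo k (sq \<xi>))) x = cor ((2 * pi) ^ DIM('a) * qo k x)"
  unfolding qo_def by (simp only: integral_complex_of_real integral_mult_right_zero)
qed

text \<open>Gamma(1/2), that is, the square root of pi. It is left as an integral, since the
  argument rests on its positivity and scaling.\<close>

definition c0 :: real where
 "c0 = (LBINT S. ind {0<..} S * (S powr (- 1 / 2) * exp (- S)))"

lemma half_gamma_integrable:
 assumes "b > 0"
 shows "Lint (%S::real. ind {0<..} S * (S powr (- 1 / 2) * exp (- (b * S))))"
proof (rule integrable_powr_half_dominated[of _ "1 / b"])
 have [measurable]: "{0::real<..} : sets borel" by simp
 show "(%S::real. ind {0<..} S * (S powr (- 1 / 2) * exp (- (b * S)))) : bmeas" by measurable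
 show "\<bar>ind {0<..} S * (S powr (- 1 / 2) * exp (- (b * S)))\<bar> <= S powr (- 1 / 2)" if "0 < S" for S
  using that assms by (simp add: mult_left_le)
 show "\<bar>ind {0<..} S * (S powr (- 1 / 2) * exp (- (b * S)))\<bar> <= 1 / b * S powr (- 3 / 2)" if "1 <= S" for S
 proof -
  have bS: "0 < b * S" using that assms by simp
  have "b * S <= exp (b * S)" using exp_ge_add_one_self[of "b * S"] by linarith
  hence "exp (- (b * S)) <= 1 / (b * S)" using bS by (simp add: exp_minus inverse_eq_divide divide_left_mono)
  hence "S powr (- 1 / 2) * exp (- (b * S)) <= S powr (- 1 / 2) * (1 / (b * S))" by (rule mult_left_mono) simp
  also have "\<dots> = 1 / b * S powr (- 3 / 2)" using that powr_diff[of S "- 1 / 2" 1] by simp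
  finally show ?thesis using that by simp
 qed
qed simp

lemma c0_pos: "0 < c0"
 unfolding c0_def by (rule integral_positive) (use half_gamma_integrable[of 1] in \<open>auto simp: indicator_def\<close>)

lemma half_gamma_scale:
 assumes "b > 0"
 shows "(LBINT S. ind {0<..} S * (S powr (- 1 / 2) * exp (- (b * S)))) = c0 * b powr (- 1 / 2)"
proof -
 let ?f = "%S::real. ind {0<..} S * (S powr (- 1 / 2) * exp (- S))"
 have i: "Lint ?f" using half_gamma_integrable[of 1] by simp
 have c: "c0 = b * (LBINT S. ?f (0 + b * S))" unfolding c0_def using integral_lborel_affine[OF i, of b 0] assms by simp
 have f: "?f (0 + b * S) = b powr (- 1 / 2) * (ind {0<..} S * (S powr (- 1 / 2) * exp (- (b * S))))" for S
  using assms by (auto simp: indicator_def powr_mult zero_less_mult_iff)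
 have "c0 = (b * b powr (- 1 / 2)) * (LBINT S. ind {0<..} S * (S powr (- 1 / 2) * exp (- (b * S))))"
  by (subst c, unfold f) simp
 moreover have "b powr 1 * b powr (- 1 / 2) * b powr (- 1 / 2) = b powr 0" unfolding powr_add[symmetric] by simp
 hence "b * b powr (- 1 / 2) * b powr (- 1 / 2) = 1" using assms by simp
 moreover have "X = c * p" if "c = (b * p) * X" "b * p * p = 1" for c X p :: real
 proof -
  have "c * p = (b * p * p) * X" unfolding that(1) by (simp only: mult_ac)
  thus ?thesis using that(2) by simp
 qed
 ultimately show ?thesis by blast
qed

text \<open>The fundamental theorem of calculus with \<open>Qk_deriv\<close>; the factor T is 1 in
  even dimension and 1 + S in odd dimension.\<close>

lemma Qk_FTC:
 assumes e: "0 < \<epsilon>" "\<epsilon> < 1" and T: "T > 0"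
 shows "(LBINT t. ind {\<epsilon><..<1} t * (\<rho> ^ (k + 1) * t ^ k * exp (- (T * t * \<rho>)))) = (Qk k (T * (\<epsilon> * \<rho>)) - Qk k (T * \<rho>)) / T ^ (k + 1)"
proof -
 let ?f = "%t. \<rho> ^ (k + 1) * t ^ k * exp (- (T * t * \<rho>))"
 have "(LBINT t. ?f t * ind {\<epsilon>..1} t) = - (Qk k (T * 1 * \<rho>) / T ^ (k + 1)) - - (Qk k (T * \<epsilon> * \<rho>) / T ^ (k + 1))"
 proof (rule integral_FTC_Icc_real)
  show "((%t. - (Qk k (T * t * \<rho>) / T ^ (k + 1))) has_real_derivative ?f t) (at t)" for t
  proof -
   have "((%t. Qk k (T * t * \<rho>)) has_real_derivative - ((T * t * \<rho>) ^ k * exp (- (T * t * \<rho>))) * (T * \<rho>)) (at t)"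
    by (rule DERIV_chain2[OF Qk_deriv]) (auto intro!: derivative_eq_intros)
   from DERIV_minus[OF DERIV_cdivide[OF this, of "T ^ (k + 1)"]] show ?thesis
    by (rule back_subst[of "%d. (_ has_real_derivative d) _"]) (use T in \<open>simp add: power_mult_distrib field_simps\<close>)
  qed
 qed (use e in \<open>auto intro!: continuous_intros\<close>)
 moreover have "(LBINT t. ind {\<epsilon><..<1} t * ?f t) = (LBINT t. ?f t * ind {\<epsilon>..1} t)"
 proof (rule integral_cong_AE)
  have [measurable]: "{\<epsilon><..<1} : sets borel" "{\<epsilon>..1} : sets borel" by simp_all
  show "(%t. ind {\<epsilon><..<1} t * ?f t) : borel_measurable lborel" "(%t. ?f t * ind {\<epsilon>..1} t) : borel_measurable lborel" by measurable
  have "AE t in lborel. t ~= \<epsilon> & t ~= 1" using AE_conjI[OF AE_lborel_singleton AE_lborel_singleton] .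
  thus "AE t in lborel. ind {\<epsilon><..<1} t * ?f t = ?f t * ind {\<epsilon>..1} t"
   by eventually_elim (auto simp: indicator_def)
 qed
 ultimately show ?thesis by (simp add: diff_divide_distrib mult.assoc)
qed

text \<open>One double integral over S and t in two orders: S first gives the left side by
  \<open>half_gamma_scale\<close>, t first gives the right side by \<open>Qk_FTC\<close>.\<close>

lemma Qo_symbol:
 fixes \<xi> :: "'a::euclidean_space"
 assumes n: "DIM('a) = 2 * k + 1" and e: "0 < \<epsilon>" "\<epsilon> < 1"
 shows "c0 * (norm \<xi> powr real DIM('a) * ee \<epsilon> \<xi>) = Qo k (\<epsilon> * (sq \<xi>)) - Qo k (sq \<xi>)"
proof (cases "\<xi> = 0")
 case False
 define \<rho> where "\<rho> = sq \<xi>"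
 have \<rho>: "\<rho> > 0" using False by (simp add: \<rho>_def)
 define G where "G S t = ind {0<..} S * (S powr (- 1 / 2) * exp (- (t * \<rho> * S))) * (ind {\<epsilon><..<1} t * (\<rho> ^ (k + 1) * t ^ k * exp (- (t * \<rho>))))" for S t
 have [measurable]: "{0::real<..} : sets borel" "{\<epsilon><..<1} : sets borel" by simp_all
 have er: "\<epsilon> * \<rho> > 0" using e \<rho> by simp
 have i1: "Lint (%t. ind {\<epsilon><..<1} t * \<rho> ^ (k + 1))"
  using e by (intro integrable_mult_left integrable_real_indicator) auto
 have F: "(LBINT t. (LBINT S. G S t)) = (LBINT S. (LBINT t. G S t))"
 proof (rule fubini_dom(1)[OF _ half_gamma_integrable[OF er] i1])
  show "(%(S, t). G S t) : borel_measurable (lborel \<Otimes>\<^sub>M lborel)" unfolding G_def by measurable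
  show "norm (G S t) <= ind {0<..} S * (S powr (- 1 / 2) * exp (- (\<epsilon> * \<rho> * S))) * (ind {\<epsilon><..<1} t * \<rho> ^ (k + 1))" for S t
  proof (cases "0 < S & t : {\<epsilon><..<1}")
   case True
   hence t: "0 < S" "\<epsilon> < t" "t < 1" "0 < t" using e by auto
   have "exp (- (t * \<rho> * S)) <= exp (- (\<epsilon> * \<rho> * S))" using t \<rho> by simp
   moreover have "t ^ k * exp (- (t * \<rho>)) <= 1 * 1" using t \<rho> by (intro mult_mono power_le_one) auto
   hence "\<rho> ^ (k + 1) * (t ^ k * exp (- (t * \<rho>))) <= \<rho> ^ (k + 1) * 1" using \<rho> by (intro mult_left_mono) auto
   ultimately have "(S powr (- 1 / 2) * exp (- (t * \<rho> * S))) * (\<rho> ^ (k + 1) * (t ^ k * exp (- (t * \<rho>)))) <= (S powr (- 1 / 2) * exp (- (\<epsilon> * \<rho> * S))) * (\<rho> ^ (k + 1) * 1)"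
    using t \<rho> by (intro mult_mono mult_nonneg_nonneg) auto
   thus ?thesis using t \<rho> by (simp add: G_def abs_mult mult.assoc)
  qed (auto simp: G_def)
 qed
 have inner1: "(LBINT S. G S t) = (c0 * norm \<xi> powr real DIM('a)) * (ew DIM('a) \<epsilon> t * exp (- t * (sq \<xi>)))" for t
 proof (cases "t : {\<epsilon><..<1}")
  case True
  hence t: "0 < t" "0 < t * \<rho>" using e \<rho> by auto
  have "(LBINT S. G S t) = c0 * (t * \<rho>) powr (- 1 / 2) * (\<rho> ^ (k + 1) * t ^ k * exp (- (t * \<rho>)))"
   unfolding G_def using half_gamma_scale[OF t(2)] True by simp
  also have "\<dots> = c0 * (\<rho> powr (- 1 / 2) * \<rho> powr real (k + 1)) * (t powr (- 1 / 2) * t powr real k) * exp (- (t * \<rho>))"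
   using t \<rho> by (simp add: powr_mult powr_realpow del: of_nat_add of_nat_Suc power_Suc)
  also have "\<rho> powr (- 1 / 2) * \<rho> powr real (k + 1) = norm \<xi> powr real DIM('a)"
  proof -
   have r: "\<rho> = norm \<xi> powr 2" using False by (simp add: \<rho>_def dot_square_norm powr_numeral)
   have "\<rho> powr (- 1 / 2) * \<rho> powr real (k + 1) = \<rho> powr (real DIM('a) / 2)"
    unfolding powr_add[symmetric] n by (simp add: field_simps)
   also have "\<dots> = norm \<xi> powr real DIM('a)" unfolding r powr_powr by simp
   finally show ?thesis .
  qed
  also have "t powr (- 1 / 2) * t powr real k = t powr (real DIM('a) / 2 - 1)"
   by (simp add: powr_add[symmetric] n field_simps)
  finally show ?thesis using True by (simp add: ew_def \<rho>_def mult_ac)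
 qed (simp add: G_def ew_zero)
 have inner2: "(LBINT t. G S t) = Wk k S * Qk k ((1 + S) * (\<epsilon> * \<rho>)) - Wk k S * Qk k ((1 + S) * \<rho>)" for S
 proof (cases "0 < S")
  case True
  have "G S t = S powr (- 1 / 2) * (ind {\<epsilon><..<1} t * (\<rho> ^ (k + 1) * t ^ k * exp (- ((1 + S) * t * \<rho>))))" for t
  proof -
   have "exp (- ((1 + S) * t * \<rho>)) = exp (- (t * \<rho> * S)) * exp (- (t * \<rho>))" by (simp add: algebra_simps flip: exp_add)
   thus ?thesis using True by (simp add: G_def)
  qed
  thus ?thesis using Qk_FTC[OF e, of "1 + S" \<rho> k] True by (simp add: Wk_def right_diff_distrib diff_divide_distrib)
 qed (simp add: G_def Wk_zero)
 have "c0 * (norm \<xi> powr real DIM('a) * ee \<epsilon> \<xi>) = (LBINT S. (LBINT t. G S t))"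
  unfolding F[symmetric] inner1 ee_def by simp
 also have "\<dots> = Qo k (\<epsilon> * \<rho>) - Qo k \<rho>"
  unfolding inner2 Qo_def using e \<rho> by (intro Bochner_Integration.integral_diff Wk_Qk_integrable) auto
 finally show ?thesis unfolding \<rho>_def .
qed simp

lemma qs_dpart:
 assumes S: "0 < S"
 shows "set js <= (Basis :: 'a::euclidean_space set) ==> dpart js (qs k S) (x::'a) = (1 / sqrt (1 + S)) ^ (DIM('a) + length js) * dpart js (Pk k) ((1 / sqrt (1 + S)) *\<^sub>R x)"
  and "Ck_on m UNIV (qs k S :: 'a => real)"
proof -
 let ?s = "1 / sqrt (1 + S)"
 have e: "qs k S = (%x::'a. ?s ^ DIM('a) * Pk k (?s *\<^sub>R x + 0))" by (simp add: qs_def[abs_def])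
 have ck: "Ck_on m UNIV (%x::'a. Pk k (?s *\<^sub>R x + 0))" for m
  using Ck_on_affine[OF open_UNIV PG_Ck[OF PG_Pk[of k]], of m ?s 0] by simp
 show "Ck_on m UNIV (qs k S :: 'a => real)" unfolding e by (rule Ck_on_linear[OF bounded_linear_mult_right open_UNIV ck])
 assume js: "set js <= (Basis :: 'a set)"
 show "dpart js (qs k S) x = ?s ^ (DIM('a) + length js) * dpart js (Pk k) (?s *\<^sub>R x)"
  unfolding e using dpart_linear[OF bounded_linear_mult_right open_UNIV ck js UNIV_I, of "?s ^ DIM('a)" x]
   dpart_affine[OF PG_Ck[OF PG_Pk] js, of k ?s 0 x] by (simp add: power_add)
qed

text \<open>The scale 1 + S is kept inside the decay factor; integrating it out over S determines
  the decay rate of \<open>qo\<close>.\<close>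

lemma Wk_qs_dpart_bound:
 assumes js: "set js <= (Basis :: 'a::euclidean_space set)"
 shows "EX C>=0. ALL S. ALL x::'a. \<bar>dpart js (%x. Wk k S * qs k S x) x\<bar> <= Wk k S * (C * ((1 / sqrt (1 + S)) ^ DIM('a) / (1 + (sq x) / (1 + S)) ^ N))"
proof -
 obtain C where C: "C >= 0" "!!x::'a. \<bar>dpart js (Pk k) x\<bar> <= C / (1 + sq x) ^ N" using PG_bound'[OF PG_dpart[OF PG_Pk js]] by metis
 have "\<bar>dpart js (%x. Wk k S * qs k S x) x\<bar> <= Wk k S * (C * ((1 / sqrt (1 + S)) ^ DIM('a) / (1 + (sq x) / (1 + S)) ^ N))" for S and x :: 'a
 proof (cases "0 < S")
  case True
  let ?s = "1 / sqrt (1 + S)"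
  have s: "0 <= ?s" "?s <= 1" using True by auto
  have i: "(?s *\<^sub>R x) \<bullet> (?s *\<^sub>R x) = (sq x) / (1 + S)" by (rule inner_scale_sqrt) (use True in simp)
  have d: "dpart js (%x. Wk k S * qs k S x) x = Wk k S * dpart js (qs k S) x"
   using dpart_linear[OF bounded_linear_mult_right open_UNIV qs_dpart(2)[OF True] js UNIV_I] .
  have "?s ^ (DIM('a) + length js) <= ?s ^ DIM('a)" using s by (intro power_decreasing) auto
  hence "?s ^ (DIM('a) + length js) * \<bar>dpart js (Pk k) (?s *\<^sub>R x)\<bar> <= ?s ^ DIM('a) * (C / (1 + (sq x) / (1 + S)) ^ N)"
   using C(2)[of "?s *\<^sub>R x", unfolded i] s by (intro mult_mono zero_le_power) auto
  hence "\<bar>dpart js (qs k S) x\<bar> <= ?s ^ DIM('a) * (C / (1 + (sq x) / (1 + S)) ^ N)"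
   unfolding qs_dpart(1)[OF True js] abs_mult using s(1) by (simp only: abs_of_nonneg zero_le_power)
  hence "Wk k S * \<bar>dpart js (qs k S) x\<bar> <= Wk k S * (?s ^ DIM('a) * (C / (1 + (sq x) / (1 + S)) ^ N))" by (rule mult_left_mono) simp
  thus ?thesis unfolding d abs_mult by (simp add: mult_ac)
 next
  case False
  hence "(%x::'a. Wk k S * qs k S x) = (%x. (0::real) *\<^sub>R 0)" by (simp add: Wk_zero)
  moreover have "dpart js (%x::'a. (0::real) *\<^sub>R (0::real)) x = 0"
   using dpart_linear[OF bounded_linear_scaleR_right[of 0] open_UNIV Ck_on_const js UNIV_I, of 0 x] by simp
  ultimately show ?thesis using False by (simp add: Wk_zero)
 qed
 thus ?thesis using C(1) by blast
qed

lemma Wk_qs_Ck: "Ck_on m UNIV (%x::'a::euclidean_space. Wk k S * qs k S x)"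
proof (cases "0 < S")
 case True
 thus ?thesis by (rule Ck_on_linear[OF bounded_linear_mult_right open_UNIV qs_dpart(2)])
qed (simp add: Wk_zero)

lemma qo_dpart:
 shows "Ck_on m UNIV (qo k :: 'a::euclidean_space => real)"
  and "set js <= Basis ==> Lint (%S. dpart js (%x. Wk k S * qs k S x) (x::'a)) &
   dpart js (qo k) x = (LBINT S. dpart js (%x. Wk k S * qs k S x) x)"
proof -
 have dom: "EX U w. open U & x0 : U & U <= UNIV & Lint w & (ALL S:space lborel. ALL x:U. norm (dpart js (%x. Wk k S * qs k S x) x) <= w S)"
  if js: "set js <= Basis" for js and x0 :: 'a
 proof -
  obtain C where C: "C >= 0" "!!S x::'a. \<bar>dpart js (%x. Wk k S * qs k S x) x\<bar> <= Wk k S * (C * ((1 / sqrt (1 + S)) ^ DIM('a) / (1 + (sq x) / (1 + S)) ^ 0))"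
   using Wk_qs_dpart_bound[OF js] by metis
  have "\<bar>dpart js (%x. Wk k S * qs k S x) x\<bar> <= Wk k S * C" for S and x :: 'a
  proof (cases "0 < S")
   case True
   hence "(1 / sqrt (1 + S)) ^ DIM('a) <= 1" by (intro power_le_one) auto
   hence "Wk k S * (C * (1 / sqrt (1 + S)) ^ DIM('a)) <= Wk k S * C" using C(1) by (intro mult_left_mono mult_left_le) auto
   thus ?thesis using C(2)[of S x] by simp
  qed (use C(2)[of S x] in \<open>simp add: Wk_zero\<close>)
  thus ?thesis by (intro exI[of _ UNIV] exI[of _ "%S. Wk k S * C"] conjI ballI integrable_mult_left Wk_integrable) auto
 qed
 have m: "(%S. Wk k S * qs k S x) : borel_measurable lborel" for x :: 'a unfolding qs_def by measurable
 show "Ck_on m UNIV (qo k :: 'a => real)" unfolding qo_def[abs_def]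
  by (rule Ck_on_integral(1)[OF open_UNIV m Wk_qs_Ck]) (use dom in auto)
 assume js: "set js <= (Basis :: 'a set)"
 show "Lint (%S. dpart js (%x. Wk k S * qs k S x) x) &
   dpart js (qo k) x = (LBINT S. dpart js (%x. Wk k S * qs k S x) x)" unfolding qo_def[abs_def]
  by (rule Ck_on_integral(2)[OF open_UNIV m Wk_qs_Ck, where N = "length js"]) (use dom js in auto)
qed

text \<open>The tail of order $|x|^{-2n}$ is all that remains of the nonlocality of the operator; it is exactly what
 the weight in the definition of \<open>L_s\<close> allows.\<close>

lemma qo_decay:
 assumes n: "DIM('a::euclidean_space) = 2 * k + 1" and js: "set js <= (Basis :: 'a set)"
 shows "EX C>=0. ALL x::'a. \<bar>dpart js (qo k) x\<bar> <= C / (1 + sq x) ^ DIM('a)"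
proof -
 let ?n = "DIM('a)"
 obtain C where C: "C >= 0" "!!S x::'a. \<bar>dpart js (%x. Wk k S * qs k S x) x\<bar> <= Wk k S * (C * ((1 / sqrt (1 + S)) ^ ?n / (1 + (sq x) / (1 + S)) ^ (?n + 1)))"
  using Wk_qs_dpart_bound[OF js] by metis
 have [measurable]: "{0::real<..} : sets borel" "{0::real<..<1} : sets borel" by simp_all
 define J where "J = ((LBINT S. ind {0<..} S * (1 / (1 + S) ^ (?n + 1))) :: real)"
 have Ji: "Lint (%S::real. ind {0<..} S * (1 / (1 + S) ^ (?n + 1)))"
 proof (rule integrable_dom[OF integrable_inverse_one_plus_square])
  have "1 / (1 + S) ^ (?n + 1) <= 1 / (1 + S\<^sup>2)" if "0 < S" for S :: real
  proof -
   have "1 + S\<^sup>2 <= (1 + S) ^ 2" using that by (simp add: power2_eq_square algebra_simps)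
   also have "\<dots> <= (1 + S) ^ (?n + 1)" using that DIM_positive[where 'a='a] by (intro power_increasing) auto
   finally have "1 + S\<^sup>2 <= (1 + S) ^ (?n + 1)" .
   moreover have "0 < (1 + S) ^ (?n + 1)" using that by (intro zero_less_power) simp
   ultimately show ?thesis by (intro divide_left_mono mult_pos_pos) (auto simp: add_pos_nonneg simp del: power_Suc)
  qed
  thus "AE S in lborel. norm (ind {0<..} S * (1 / (1 + (S::real)) ^ (?n + 1))) <= norm (1 / (1 + S\<^sup>2))"
   by (intro AE_I2) (auto simp: indicator_def)
 qed measurable
 \<comment> \<open>Scaling S by b shows that the tail integral is J b^(-n); with b = 1 + |x|^2 this
   is the claimed rate.\<close>
 have J: "Lint (%S. ind {0<..} S * (1 / (b + S) ^ (?n + 1)))" "(LBINT S. ind {0<..} S * (1 / (b + S) ^ (?n + 1))) = J / b ^ ?n" if b: "b >= 1" for b :: real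
 proof -
  have e: "ind {0<..} S * (1 / (b + S) ^ (?n + 1)) = (1 / b) ^ (?n + 1) * (ind {0<..} (0 + (1 / b) * S) * (1 / (1 + (0 + (1 / b) * S)) ^ (?n + 1)))" for S
  proof -
   have "1 + (1 / b) * S = (b + S) / b" using b by (simp add: field_simps)
   thus ?thesis using b by (simp add: indicator_def power_divide zero_less_divide_iff)
  qed
  show "Lint (%S. ind {0<..} S * (1 / (b + S) ^ (?n + 1)))" unfolding e
   using integrable_lborel_affine[OF Ji, of "1 / b" 0] b by (intro integrable_mult_right) simp
  have J': "J = (1 / b) * (LBINT S. ind {0<..} (0 + (1 / b) * S) * (1 / (1 + (0 + (1 / b) * S)) ^ (?n + 1)))"
   unfolding J_def using integral_lborel_affine[OF Ji, of "1 / b" 0] b by simp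
  show "(LBINT S. ind {0<..} S * (1 / (b + S) ^ (?n + 1))) = J / b ^ ?n"
   unfolding e integral_mult_right_zero J' using b by (simp add: power_divide)
 qed
 have U: "Lint (%S::real. ind {0<..<1} S * S powr (- 1 / 2))" using integrable_powr_unit[of "- 1 / 2"] by simp
 define I where "I = ((LBINT S. ind {0<..<1} S * S powr (- 1 / 2)) :: real)"
 \<comment> \<open>For S < 1 the singularity S^(-1/2) is kept and the full decay (1 + r)^(-n) is
   taken out. For S >= 1 one has S^(-1/2) sqrt (1 + S) <= 2, which leaves the tail integral.\<close>
 have bd: "Wk k S * (C * ((1 / sqrt (1 + S)) ^ ?n / (1 + r / (1 + S)) ^ (?n + 1))) <=
   2 * C * (ind {0<..<1} S * S powr (- 1 / 2) / (1 + r) ^ ?n + ind {0<..} S * (1 / ((1 + r) + S) ^ (?n + 1)))" if r: "r >= 0" for S r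
 proof (cases "0 < S")
  case True
  define R where "R = sqrt (1 + S)"
  have R: "R > 0" "1 + S = R\<^sup>2" using True by (auto simp: R_def)
  \<comment> \<open>This is where n = 2k + 1 enters: the powers of 1 + S combine to a single R =
    sqrt (1 + S), which S^(-1/2) balances for large S.\<close>
  have e0: "(1 / (1 + S) ^ (k + 1)) * ((1 / R) ^ ?n / (1 + r / (1 + S)) ^ (?n + 1)) = R / ((1 + r) + S) ^ (?n + 1)"
  proof -
   have "1 + r / (1 + S) = ((1 + r) + S) / (1 + S)" using True by (simp add: field_simps)
   hence "(1 / (1 + S) ^ (k + 1)) * ((1 / R) ^ ?n / (1 + r / (1 + S)) ^ (?n + 1)) = ((1 / (1 + S) ^ (k + 1)) * (1 / R) ^ ?n * (1 + S) ^ (?n + 1)) / ((1 + r) + S) ^ (?n + 1)"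
    by (simp add: power_divide)
   also have "(1 / (1 + S) ^ (k + 1)) * (1 / R) ^ ?n * (1 + S) ^ (?n + 1) = R"
   proof -
    have "(1 + S) ^ (?n + 1) = R * (1 + S) ^ (k + 1) * R ^ ?n"
     unfolding R(2) n by (simp add: power_mult[symmetric] power_add[symmetric] power_Suc[symmetric] del: power_Suc) 
    thus ?thesis using R by (simp add: power_divide)
   qed
   finally show ?thesis .
  qed
  have W: "Wk k S = S powr (- 1 / 2) * (1 / (1 + S) ^ (k + 1))" using True by (simp add: Wk_def)
  have com: "s * a * (C * b) = C * (s * (a * b))" for s a b :: real by (simp only: mult_ac)
  have e: "Wk k S * (C * ((1 / sqrt (1 + S)) ^ ?n / (1 + r / (1 + S)) ^ (?n + 1))) = C * ((S powr (- 1 / 2) * R) / ((1 + r) + S) ^ (?n + 1))"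
   unfolding W com R_def[symmetric] e0 by simp
  have sp: "S powr (- 1 / 2) = 1 / sqrt S" using True by (simp add: powr_minus powr_half_sqrt inverse_eq_divide)
  have s1: "S powr (- 1 / 2) * R <= 2 * S powr (- 1 / 2)" if "S < 1"
  proof -
   have "sqrt (1 + S) <= sqrt (2\<^sup>2)" using that by (intro real_sqrt_le_mono) simp
   hence "R <= 2" by (simp add: R_def)
   thus ?thesis using mult_left_mono[of R 2 "S powr (- 1 / 2)"] by simp
  qed
  have s2: "S powr (- 1 / 2) * R <= 2" if "S >= 1"
  proof -
   have "sqrt (1 + S) <= sqrt (2\<^sup>2 * S)" using that by (intro real_sqrt_le_mono) simp
   hence "R <= 2 * sqrt S" unfolding R_def by (simp only: real_sqrt_mult real_sqrt_abs abs_numeral)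
   thus ?thesis unfolding sp using True by (simp add: divide_le_eq)
  qed
  have p: "0 < (1 + r) + S" using r True by simp
  show ?thesis
  proof (cases "S < 1")
   case S: True
   have "(1 + r) ^ ?n <= ((1 + r) + S) ^ ?n" using r True by (intro power_mono) auto
   also have "\<dots> <= ((1 + r) + S) ^ (?n + 1)" using r True by (intro power_increasing) auto
   finally have "(S powr (- 1 / 2) * R) / ((1 + r) + S) ^ (?n + 1) <= 2 * S powr (- 1 / 2) / (1 + r) ^ ?n"
    using s1[OF S] r R True by (intro frac_le) auto
   also have "\<dots> <= 2 * S powr (- 1 / 2) / (1 + r) ^ ?n + 2 * (1 / ((1 + r) + S) ^ (?n + 1))" using p by simp
   finally have "C * ((S powr (- 1 / 2) * R) / ((1 + r) + S) ^ (?n + 1)) <= C * (2 * S powr (- 1 / 2) / (1 + r) ^ ?n + 2 * (1 / ((1 + r) + S) ^ (?n + 1)))"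
    using C(1) by (rule mult_left_mono)
   thus ?thesis unfolding e using S True by (simp add: distrib_left mult_ac)
  next
   case S: False
   have "(S powr (- 1 / 2) * R) / ((1 + r) + S) ^ (?n + 1) <= 2 / ((1 + r) + S) ^ (?n + 1)" using s2 S p by (intro divide_right_mono) auto
   from mult_left_mono[OF this C(1)] show ?thesis unfolding e using S True by (simp add: mult.commute[of C 2])
  qed
 qed (simp add: Wk_zero)
 have "\<bar>dpart js (qo k) x\<bar> <= (2 * C * (I + J)) / (1 + sq x) ^ ?n" for x :: 'a
 proof -
  let ?w = "%S. 2 * C * (ind {0<..<1} S * S powr (- 1 / 2) / (1 + sq x) ^ ?n + ind {0<..} S * (1 / ((1 + sq x) + S) ^ (?n + 1)))"
  have x1: "1 + sq x >= 1" by simp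
  have wi: "Lint ?w" by (intro integrable_mult_right Bochner_Integration.integrable_add integrable_divide U J(1)[OF x1])
  have "norm (dpart js (qo k) x) <= (LBINT S. ?w S)"
   unfolding conjunct2[OF qo_dpart(2)[OF js]]
   by (rule norm_integral_le[OF conjunct1[OF qo_dpart(2)[OF js]] wi]) (use order_trans[OF C(2) bd] in auto)
  also have "(LBINT S. ?w S) = 2 * C * (I / (1 + sq x) ^ ?n + J / (1 + sq x) ^ ?n)"
   unfolding integral_mult_right_zero I_def J(2)[OF x1, symmetric]
   by (subst Bochner_Integration.integral_add) (use U J(1)[OF x1] in auto)
  also have "\<dots> = (2 * C * (I + J)) / (1 + sq x) ^ ?n" by (simp add: add_divide_distrib distrib_left)
  finally show ?thesis by simp
 qed
 moreover have "0 <= I" "0 <= J" unfolding I_def J_def by (auto intro!: integral_nonneg_AE AE_I2 simp: indicator_def)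
 hence "0 <= 2 * C * (I + J)" using C(1) by simp
 ultimately show ?thesis by blast
qed

lemma qs_integral:
 assumes "0 < S"
 shows "Lint (qs k S :: 'a::euclidean_space => real)" "(LBINT x. qs k S (x::'a)) = fact k"
  "(LBINT x. \<bar>qs k S (x::'a)\<bar>) = (LBINT x. \<bar>Pk k (x::'a)\<bar>)"
proof -
 have e: "qs k S = (dil (Pk k) (1 + S) :: 'a => real)" by (simp add: qs_def dil_def fun_eq_iff)
 show "Lint (qs k S :: 'a => real)" "(LBINT x. qs k S (x::'a)) = fact k"
  "(LBINT x. \<bar>qs k S (x::'a)\<bar>) = (LBINT x. \<bar>Pk k (x::'a)\<bar>)"
  unfolding e using dil_integral[OF PG_integrable[OF PG_Pk], of "1 + S" k] assms by (simp_all add: Pk_integral)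
qed

text \<open>Dilations preserve the mass k! of \<open>Pk\<close>, so the mass of the superposition is
  k! times that of the weight.\<close>

lemma qo_integral: "(LBINT x. qo k (x::'a::euclidean_space)) = (LBINT S. Wk k S) * fact k"
proof -
 have i: "integrable (lborel \<Otimes>\<^sub>M lborel) (%(S, x::'a). Wk k S * qs k S x)"
 proof (rule lborel_pair.Fubini_integrable)
  show "(%(S, x::'a). Wk k S * qs k S x) : borel_measurable (lborel \<Otimes>\<^sub>M lborel)" unfolding qs_def by measurable
  have "(LBINT x. \<bar>Wk k S * qs k S (x::'a)\<bar>) = Wk k S * (LBINT x. \<bar>Pk k (x::'a)\<bar>)" for S
   by (cases "0 < S") (auto simp: abs_mult qs_integral(3) Wk_zero)
  thus "Lint (%S. LBINT y. norm ((%(S, x::'a). Wk k S * qs k S x) (S, y)))" using Wk_integrable by simp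
  have "Lint (%x. Wk k S * qs k S (x::'a))" for S
   using qs_integral(1) by (cases "0 < S") (auto simp: Wk_zero)
  thus "AE S in lborel. Lint (%y. (%(S, x::'a). Wk k S * qs k S x) (S, y))" by simp
 qed
 have e: "(LBINT x. Wk k S * qs k S (x::'a)) = Wk k S * fact k" for S
  using qs_integral(2) by (cases "0 < S") (auto simp: Wk_zero)
 show ?thesis unfolding qo_def lborel_pair.Fubini_integral[OF i] e by simp
qed

text \<open>Outside the unit ball the decay (1 + |x|^2)^(-n) of q beats the factor epsilon^(-n/2).
  The first bound makes the dilated kernels disappear there in the limit, the second is uniform in
  epsilon.\<close>

lemma dil_decay:
 fixes z :: "'a::euclidean_space"
 assumes e: "0 < \<epsilon>" "\<epsilon> < 1" and b: "!!x::'a. \<bar>q x\<bar> <= C / (1 + sq x) ^ DIM('a)" and z: "norm z >= 1"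
 shows "\<bar>dil q \<epsilon> z\<bar> <= C * sqrt \<epsilon>" "\<bar>dil q \<epsilon> z\<bar> <= (C * 2 ^ DIM('a)) / (1 + sq z) ^ DIM('a)"
proof -
 let ?n = "DIM('a)" and ?s = "1 / sqrt \<epsilon>" and ?Z = "sq z"
 have C: "C >= 0" using b[of 0] by simp
 have z1: "?Z >= 1" using power_mono[OF z, of 2] by (simp add: power2_norm_eq_inner)
 have p: "0 < 1 + ?Z / \<epsilon>" using e by (simp add: add_pos_nonneg)
 have "\<bar>dil q \<epsilon> z\<bar> = ?s ^ ?n * \<bar>q (?s *\<^sub>R z)\<bar>" using e by (simp add: dil_def abs_mult)
 also have "\<dots> <= ?s ^ ?n * (C / (1 + ?Z / \<epsilon>) ^ ?n)"
  using b[of "?s *\<^sub>R z"] e unfolding inner_scale_sqrt[OF e(1)] by (intro mult_left_mono) auto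
 also have "\<dots> = C * (?s / (1 + ?Z / \<epsilon>)) ^ ?n" by (simp add: power_divide power_mult_distrib mult_ac)
 finally have m: "\<bar>dil q \<epsilon> z\<bar> <= C * (?s / (1 + ?Z / \<epsilon>)) ^ ?n" .
 have "0 < ?Z / \<epsilon>" using e z1 by (intro divide_pos_pos) auto
 hence "?s / (1 + ?Z / \<epsilon>) <= ?s / (?Z / \<epsilon>)" using e p by (intro divide_left_mono mult_pos_pos) auto
 also have "\<dots> = (\<epsilon> / sqrt \<epsilon>) / ?Z" by simp
 also have "\<dots> = sqrt \<epsilon> / ?Z" using e by (simp only: real_div_sqrt less_imp_le)
 finally have s: "?s / (1 + ?Z / \<epsilon>) <= sqrt \<epsilon> / ?Z" .
 have nn: "0 <= ?s / (1 + ?Z / \<epsilon>)" using e p by simp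
 have "sqrt \<epsilon> / ?Z <= sqrt \<epsilon> / 1" using e z1 by (intro divide_left_mono) auto
 hence "(?s / (1 + ?Z / \<epsilon>)) ^ ?n <= sqrt \<epsilon> ^ ?n" using order_trans[OF s] nn by (intro power_mono) auto
 also have "\<dots> <= sqrt \<epsilon> ^ 1" using e DIM_positive[where 'a='a] by (intro power_decreasing) auto
 finally show "\<bar>dil q \<epsilon> z\<bar> <= C * sqrt \<epsilon>" using order_trans[OF m mult_left_mono[OF _ C]] by simp
 have "sqrt \<epsilon> / ?Z <= 2 / (1 + ?Z)"
 proof -
  have "sqrt \<epsilon> * (1 + ?Z) <= 1 * (2 * ?Z)" using e z1 by (intro mult_mono) auto
  thus ?thesis using z1 by (simp add: divide_simps)
 qed
 hence "(?s / (1 + ?Z / \<epsilon>)) ^ ?n <= (2 / (1 + ?Z)) ^ ?n" using order_trans[OF s] nn by (intro power_mono) auto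
 from order_trans[OF m mult_left_mono[OF this C]] show "\<bar>dil q \<epsilon> z\<bar> <= (C * 2 ^ ?n) / (1 + ?Z) ^ ?n" by (simp add: power_divide)
qed

text \<open>The translated truncations are Schwartz functions and are tested directly. For s = n/2
  the exponent n + 2s in \<open>L_s\<close> is 2n, and (1 + |x|^2)^(-n) is at most 1 / (1 +
  |x|^(2n)); so u can be paired with \<open>qo\<close> and all its derivatives, and this pairing is
  the smooth remainder.\<close>

lemma odd_representation:
 fixes u f :: "'a::euclidean_space => real"
 assumes n: "DIM('a) = 2 * k + 1" and sol: "solves_fl DIM('a) f u" and f: "Lint f"
 shows "EX c h. c >= 0 & (ALL k. Ck_on k UNIV h) & (AE a in lborel. u a = c * (LBINT x. f x * Phi (x - a)) + h a)"
proof -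
 let ?n = "DIM('a)"
 have Ls: "L_s (real ?n / 2) u" and S: "!!\<phi>. schwartz \<phi> ==>
   (LINT x|lborel. cor (u x) * frac_lap (real ?n / 2) \<phi> x) = (LINT x|lborel. cor (f x) * \<phi> x)"
  using sol n by (auto simp: solves_fl_def)
 have li: "loc_integrable u" and wi: "Lint (%x. \<bar>u x\<bar> / (1 + norm x powr (real ?n + 2 * (real ?n / 2))))"
  using Ls by (auto simp: L_s_def)
 note um = loc_integrable_measurable[OF li]
 note [measurable] = um
 have ui: "Lint (%x. \<bar>u x\<bar> * (K / (1 + sq x) ^ ?n))" for K
 proof (rule integrable_dom[OF integrable_mult_right[OF wi, of K]])
  have "1 / (1 + sq x) ^ ?n <= 1 / (1 + norm x powr (real ?n + 2 * (real ?n / 2)))" for x :: 'a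
  proof -
   have "norm x powr (real ?n + 2 * (real ?n / 2)) = (sq x) ^ ?n"
   proof (cases "x = 0")
    case False
    have "real ?n + 2 * (real ?n / 2) = real (2 * ?n)" by simp
    moreover have "norm x powr real (2 * ?n) = norm x ^ (2 * ?n)" using False by (intro powr_realpow) simp
    ultimately have "norm x powr (real ?n + 2 * (real ?n / 2)) = norm x ^ (2 * ?n)" by simp
    thus ?thesis by (simp add: power_mult dot_square_norm)
   qed (simp add: power_0_left)
   moreover have "1 ^ ?n + (sq x) ^ ?n <= (1 + sq x) ^ ?n"
   proof -
    obtain j where j: "?n = Suc j" using DIM_positive[where 'a='a] gr0_conv_Suc by blast
    have "(1 + sq x) * (1 + sq x) ^ j = (1 + sq x) ^ j + (sq x) * (1 + sq x) ^ j" by (simp add: algebra_simps)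
    moreover have "1 <= (1 + sq x) ^ j" by (intro one_le_power) simp
    moreover have "(sq x) * (sq x) ^ j <= (sq x) * (1 + sq x) ^ j" by (intro mult_left_mono power_mono) auto
    ultimately show ?thesis unfolding j power_Suc power_one mult_1 by linarith
   qed
   ultimately show ?thesis by (intro divide_left_mono mult_pos_pos) (auto simp: add_pos_nonneg intro!: zero_less_power)
  qed
  from mult_left_mono[OF this, of "\<bar>K\<bar> * \<bar>u _\<bar>"]
  show "AE x in lborel. norm (\<bar>u x\<bar> * (K / (1 + sq x) ^ ?n)) <= norm (K * (\<bar>u x\<bar> / (1 + norm x powr (real ?n + 2 * (real ?n / 2)))))"
   by (intro AE_I2) (simp add: abs_mult mult_ac)
 qed measurable
 let ?q = "qo k :: 'a => real"
 have qC: "continuous_on UNIV ?q" using Ck_on_continuous[OF qo_dpart(1)[of 0]] .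
 have qm [measurable]: "?q : bmeas" using qC by (rule borel_measurable_continuous_onI)
 have decay: "EX C>=0. ALL x::'a. \<bar>dpart js ?q x\<bar> <= C / (1 + sq x) ^ ?n" if "set js <= Basis" for js
  using qo_decay[OF n that] .
 obtain C where C: "C >= 0" "!!x::'a. \<bar>?q x\<bar> <= C / (1 + sq x) ^ ?n" using decay[of "[]"] by auto
 have qi: "Lint ?q" by (rule integrable_decay_bound[OF qm, of C ?n]) (use C in auto)
 define A where "A = (LBINT z. ?q z)"
 \<comment> \<open>The weight \<open>Wk k\<close> has positive mass, so the limit identity can be
   solved for u.\<close>
 have A: "A > 0" unfolding A_def qo_integral using integral_positive[OF Wk_integrable Wk_nonneg Wk_pos] by simp
 have shift: "C' / (1 + (x - a) \<bullet> (x - a)) ^ ?n <= (C' * (3 * (1 + R\<^sup>2)) ^ ?n) / (1 + sq x) ^ ?n"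
  if "a : cball 0 R" "0 <= C'" for x a :: 'a and R C' :: real
  using decay_shift[of "- a" R C' x ?n] that by simp
 have "AE a in lborel. A * u a = (LBINT x. u x * ?q (x - a)) + c0 * (LBINT x. f x * (1 * Phi (x - a)))"
 proof (rule weak_limit[where q = ?q and r = "%\<epsilon>. ?q" and \<theta> = "%_. 1"])
  show "EX w. Lint (%x. \<bar>u x\<bar> * w x) & (ALL \<epsilon>:{0<..<1}. ALL x.
    (LBINT a. ind (cball 0 R) a * \<bar>1 * dil ?q \<epsilon> (x - a)\<bar>) <= w x & (ALL a:cball 0 R. \<bar>?q (x - a)\<bar> <= w x))" for R
  proof -
   define M where "M = (3 * (1 + R\<^sup>2)) ^ ?n"
   define V where "V = ((LBINT a. ind (cball (0::'a) R) a) :: real)"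
   define L where "L = (LBINT z. \<bar>?q z\<bar>)"
   \<comment> \<open>One constant for three contributions: the dilated kernel at distance at least
     1, where \<open>dil_decay\<close> applies; the dilated kernel at distance below 1, measured by
     its L1 norm \<open>L\<close>; and the fixed kernel.\<close>
   define K where "K = V * (C * 2 ^ ?n * M) + L * (1 + (R + 1)\<^sup>2) ^ ?n + C * M + 1"
   have Vi: "Lint (%a::'a. ind (cball 0 R) a :: real)"
    using emeasure_bounded_finite[OF bounded_cball, of 0 R] by (intro integrable_real_indicator) auto
   have nn: "0 <= M" "0 <= V" "0 <= L" unfolding M_def V_def L_def by (auto intro!: integral_nonneg_AE AE_I2)
   hence K: "V * (C * 2 ^ ?n * M) + L * (1 + (R + 1)\<^sup>2) ^ ?n <= K" "C * M <= K" "0 < K"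
    using C(1) unfolding K_def by (auto intro!: add_nonneg_pos add_nonneg_nonneg mult_nonneg_nonneg)
   have p: "0 < 1 + sq x" for x :: 'a by (simp add: add_pos_nonneg)
   have w1: "(LBINT a. ind (cball 0 R) a * \<bar>1 * (dil ?q \<epsilon> (x - a))\<bar>) <= K / (1 + sq x) ^ ?n" if e: "\<epsilon> : {0<..<1}" for \<epsilon> x
   proof -
    have e0: "0 < \<epsilon>" using e by simp
    note Qi = integrable_abs[OF dil_integral(1)[OF qi e0]]
    note ti = integrable_lborel_translate(2)[OF Qi, of x] and tL = integral_lborel_translate(2)[OF Qi, of x, unfolded dil_integral(3)[OF qi e0], folded L_def]
    define B where "B = (C * 2 ^ ?n * M) / (1 + sq x) ^ ?n"
    \<comment> \<open>Switches on the near part, which occurs only for x within distance 1 of the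
      ball of centres.\<close>
    define cc :: real where "cc = (if norm x <= R + 1 then 1 else 0)"
    have B: "0 <= B" unfolding B_def using C(1) nn p[of x] by simp
    have i2: "Lint (%a. ind (cball 0 R) a * B + cc * \<bar>dil ?q \<epsilon> (x - a)\<bar>)"
     using Vi ti by (intro Bochner_Integration.integrable_add integrable_mult_left integrable_mult_right) auto
    have le: "ind (cball 0 R) a * \<bar>1 * (dil ?q \<epsilon> (x - a))\<bar> <=
     ind (cball 0 R) a * B + cc * \<bar>dil ?q \<epsilon> (x - a)\<bar>" for a
    proof (cases "a : cball 0 R")
     case aR: True
     show ?thesis
     proof (cases "norm (x - a) >= 1")
      case True
      have "\<bar>dil ?q \<epsilon> (x - a)\<bar> <= (C * 2 ^ ?n) / (1 + (x - a) \<bullet> (x - a)) ^ ?n"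
       by (rule dil_decay(2)) (use e C True in auto)
      also have "\<dots> <= B" unfolding B_def M_def using shift[OF aR, of "C * 2 ^ ?n" x] C(1) by simp
      finally have "\<bar>dil ?q \<epsilon> (x - a)\<bar> <= B" .
      moreover have "0 <= cc * \<bar>dil ?q \<epsilon> (x - a)\<bar>" by (simp add: cc_def)
      ultimately show ?thesis using aR by (simp only: indicator_simps mult_1)
     next
      case False
      have "norm x <= norm (x - a) + norm a" using norm_triangle_ineq[of "x - a" a] by simp
      hence "cc = 1" using False aR by (simp add: cc_def)
      thus ?thesis using aR B by simp
     qed
    qed (simp add: cc_def)
    have i1: "Lint (%a. ind (cball 0 R) a * \<bar>1 * (dil ?q \<epsilon> (x - a))\<bar>)"
     by (rule integrable_dom[OF ti]) (auto simp: indicator_def)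
    have "(LBINT a. ind (cball 0 R) a * \<bar>1 * (dil ?q \<epsilon> (x - a))\<bar>) <=
     (LBINT a. ind (cball 0 R) a * B + cc * \<bar>dil ?q \<epsilon> (x - a)\<bar>)"
     by (rule integral_mono[OF i1 i2 le])
    also have "\<dots> = (LBINT a. ind (cball (0::'a) R) a * B) + (LBINT a. cc * \<bar>dil ?q \<epsilon> (x - a)\<bar>)"
     by (rule Bochner_Integration.integral_add[OF integrable_mult_left[OF Vi] integrable_mult_right[OF ti]])
    also have "\<dots> = V * B + cc * L" unfolding V_def integral_mult_left_zero integral_mult_right_zero tL by (rule refl)
    also have "\<dots> <= (V * (C * 2 ^ ?n * M) + L * (1 + (R + 1)\<^sup>2) ^ ?n) / (1 + sq x) ^ ?n"
    proof -
     have "cc <= (1 + (R + 1)\<^sup>2) ^ ?n / (1 + sq x) ^ ?n"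
     proof (cases "norm x <= R + 1")
      case True
      have "sq x <= (R + 1)\<^sup>2" using power_mono[OF True norm_ge_zero, of 2] by (simp add: power2_norm_eq_inner)
      hence "(1 + sq x) ^ ?n <= (1 + (R + 1)\<^sup>2) ^ ?n" by (intro power_mono) auto
      thus ?thesis using True p[of x] by (simp add: cc_def le_divide_eq)
     qed (simp add: cc_def)
     from mult_left_mono[OF this nn(3)] show ?thesis by (simp add: B_def add_divide_distrib mult.commute)
    qed
    also have "\<dots> <= K / (1 + sq x) ^ ?n" using K(1) p[of x] by (intro divide_right_mono) auto
    finally show ?thesis .
   qed
   have w2: "\<bar>?q (x - a)\<bar> <= K / (1 + sq x) ^ ?n" if a: "a : cball 0 R" for x a
   proof -
    have "\<bar>?q (x - a)\<bar> <= (C * M) / (1 + sq x) ^ ?n" unfolding M_def using order_trans[OF C(2) shift[OF a C(1)]] .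
    also have "\<dots> <= K / (1 + sq x) ^ ?n" using K(2) p[of x] by (intro divide_right_mono) auto
    finally show ?thesis .
   qed
   show ?thesis by (intro exI[of _ "%x. K / (1 + sq x) ^ ?n"] conjI ballI allI ui w1 w2)
  qed
  show "(LBINT x. u x * (1 * (dil ?q \<epsilon> (x - a)) - ?q (x - a))) = c0 * (LBINT x. f x * (1 * phe \<epsilon> (x - a)))"
   if e: "\<epsilon> : {0<..<1}" for \<epsilon> a
  proof -
   have e': "0 < \<epsilon>" "\<epsilon> < 1" using e by auto
   let ?\<phi> = "%x. cor (phe \<epsilon> (x - a))"
   obtain B where "!!x::'a. \<bar>phe \<epsilon> x\<bar> <= B / (1 + sq x) ^ ?n" using phe_smooth_decay(2)[OF e'(1), of "[]" ?n] by auto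
   hence "Lint (%x::'a. cor (phe \<epsilon> x))" by (intro integrable_decay_bound[of _ B ?n]) auto
   from fourier_translate[OF this, of a] have ft: "fourier ?\<phi> \<xi> = cis (- (a \<bullet> \<xi>)) * cor (ee \<epsilon> \<xi>)" for \<xi>
    using fourier_phe[OF e'(1)] by simp
   have "frac_lap (real ?n / 2) ?\<phi> x = cor ((1 / c0) * (dil ?q \<epsilon> (x - a) - ?q (x - a)))" for x
   proof -
    have e1: "cor (norm \<xi> powr (2 * (real ?n / 2))) * fourier ?\<phi> \<xi> = cis (- (a \<bullet> \<xi>)) * (cor (norm \<xi> powr real ?n) * cor (ee \<epsilon> \<xi>))" for \<xi>
     unfolding ft by simp
    show ?thesis unfolding frac_lap_def e1 inv_fourier_Ex Ex_translate
     using kernel_pair[OF Qo_rdec_Ex Qo_symbol[OF n e'] e'(1), of "x - a"] c0_pos by simp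
   qed
   hence "(LBINT x. cor (u x * ((1 / c0) * (dil ?q \<epsilon> (x - a) - ?q (x - a))))) = (LBINT x. cor (f x * phe \<epsilon> (x - a)))"
    using S[OF schwartz_phe[OF e'(1), of a]] by simp
   hence "(LBINT x. (1 / c0) * (u x * (dil ?q \<epsilon> (x - a) - ?q (x - a)))) = (LBINT x. f x * phe \<epsilon> (x - a))"
    unfolding integral_complex_of_real of_real_eq_iff by (simp only: mult.left_commute[of "u _"])
   thus ?thesis unfolding integral_mult_right_zero using c0_pos by (simp add: field_simps)
  qed
  show "A = (LBINT z. ?q z)" by (rule A_def)
 qed (rule um loc_integrable_box[OF li] f qi qm tendsto_const | simp)+
 hence AE: "AE a in lborel. u a = (c0 / A) * (LBINT x. f x * Phi (x - a)) + (1 / A) * (LBINT x. u x * ?q (x - a))"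
  by eventually_elim (use A in \<open>simp add: field_simps\<close>)
 have "Ck_on m UNIV (%a. LBINT x. u x * ?q (x - a))" for m
 proof (rule weighted_convolution_Ck[OF um qo_dpart(1)])
  fix R :: real and js :: "'a list" assume js: "set js <= Basis"
  obtain C where C: "C >= 0" "!!x::'a. \<bar>dpart js ?q x\<bar> <= C / (1 + sq x) ^ ?n" using decay[OF js] by auto
  show "EX w. Lint (%x. \<bar>u x\<bar> * w x) & (ALL x. ALL a:cball 0 R. \<bar>dpart js ?q (x - a)\<bar> <= w x)"
   by (intro exI[of _ "%x. (C * (3 * (1 + R\<^sup>2)) ^ ?n) / (1 + sq x) ^ ?n"] conjI ui allI ballI order_trans[OF C(2) shift[OF _ C(1)]])
 qed
 hence "ALL m. Ck_on m UNIV (%a. (1 / A) * (LBINT x. u x * ?q (x - a)))"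
  by (intro allI Ck_on_linear[OF bounded_linear_mult_right open_UNIV])
 thus ?thesis using AE c0_pos A by (intro exI[of _ "c0 / A"] exI conjI) auto
qed

section \<open>Even dimension\<close>

lemma smooth_onD: "smooth_on \<Omega> f ==> Ck_on k \<Omega> f"
 by (simp add: smooth_on_def)

lemma smooth_partial: "smooth_on UNIV f ==> i : Basis ==> smooth_on UNIV (partial i f)"
 unfolding smooth_on_def using Ck_on_Suc by blast

lemma smooth_has_partial: "smooth_on UNIV f ==> i : Basis ==> has_partial i f x (partial i f x)"
 unfolding smooth_on_def using Ck_on_Suc by blast

lemma smooth_nlap:
 assumes "smooth_on UNIV f"
 shows "smooth_on UNIV (nlap f)"
proof -
 have "Ck_on k UNIV (%x. (- 1) *\<^sub>R (\<Sum>i\<in>Basis. partial i (partial i f) x))" for k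
  by (intro Ck_on_linear[OF bounded_linear_scaleR_right] Ck_on_sum smooth_onD smooth_partial assms) auto
 thus ?thesis unfolding smooth_on_def nlap_def[abs_def] by simp
qed

lemma smooth_nlap_pow: "smooth_on UNIV f ==> smooth_on UNIV ((nlap ^^ j) f)"
 by (induction j) (auto intro: smooth_nlap)

lemma smooth_nlap_pow_of_real:
 "smooth_on UNIV f ==> (nlap ^^ j) (%x. cor (f x)) = (%x. cor ((nlap ^^ j) f x))"
 by (induction j) (auto simp: nlap_of_real smooth_onD smooth_nlap_pow)

lemma dpart_sum:
 assumes "finite J" "set js <= Basis" "!!j. j : J ==> smooth_on UNIV (f j)"
 shows "dpart js (%x. \<Sum>j\<in>J. f j x) x = (\<Sum>j\<in>J. dpart js (f j) (x::'a::euclidean_space))"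
 using assms(1,3)
proof (induction J rule: finite_induct)
 case empty
 thus ?case using dpart_zero[of js] by (simp add: fun_eq_iff)
next
 case (insert j J)
 have "dpart js (%x. f j x + (\<Sum>j\<in>J. f j x)) x = dpart js (f j) x + dpart js (%x. \<Sum>j\<in>J. f j x) x"
  by (rule dpart_add[OF open_UNIV _ Ck_on_sum assms(2) UNIV_I]) (use insert.prems in \<open>auto intro: smooth_onD\<close>)
 thus ?case using insert by simp
qed

text \<open>Writes a power of the Laplacian through finitely many iterated partials, so that bounds
  and limits known for \<open>dpart\<close> carry over. Distinct choices of directions give distinct
  lists, which is why a set of lists is enough.\<close>

lemma nlap_pow_dpart:
 "EX L. finite L & (ALL l:L. set l <= (Basis :: 'a::euclidean_space set)) &
   (ALL f::'a => real. smooth_on UNIV f --> (ALL x. (nlap ^^ k) f x = (- 1) ^ k * (\<Sum>l\<in>L. dpart l f x)))"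
proof (induction k)
 case 0
 show ?case by (intro exI[of _ "{[]}"]) auto
next
 case (Suc k)
 then obtain L where L: "finite L" "!!l. l : L ==> set l <= (Basis :: 'a set)"
  "!!(f::'a => real) x. smooth_on UNIV f ==> (nlap ^^ k) f x = (- 1) ^ k * (\<Sum>l\<in>L. dpart l f x)" by blast
 define e :: "'a list \<times> 'a => 'a list" where "e = (%(l, i). l @ [i, i])"
 have inj: "inj_on e X" for X by (auto simp: e_def inj_on_def)
 show ?case
 proof (intro exI[of _ "e ` (L \<times> Basis)"] conjI allI impI)
  show "finite (e ` (L \<times> Basis))" using L(1) by simp
  show "ALL l:e ` (L \<times> Basis). set l <= Basis" using L(2) by (force simp: e_def)
  fix f :: "'a => real" and x assume f: "smooth_on UNIV f"
  have "dpart l (nlap f) x = - (\<Sum>i\<in>Basis. dpart (l @ [i, i]) f x)" if l: "l : L" for l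
  proof -
   have s: "smooth_on UNIV (%x. \<Sum>i\<in>Basis. partial i (partial i f) x)"
    unfolding smooth_on_def by (intro allI Ck_on_sum smooth_onD smooth_partial f) auto
   have "dpart l (nlap f) x = - dpart l (%x. \<Sum>i\<in>Basis. partial i (partial i f) x) x"
    unfolding nlap_def[abs_def] using dpart_linear[OF bounded_linear_minus[OF bounded_linear_ident] open_UNIV smooth_onD[OF s] L(2)[OF l] UNIV_I] by simp
   also have "dpart l (%x. \<Sum>i\<in>Basis. partial i (partial i f) x) x = (\<Sum>i\<in>Basis. dpart l (partial i (partial i f)) x)"
    by (rule dpart_sum[OF finite_Basis L(2)[OF l]]) (intro smooth_partial f)
   finally show ?thesis by (simp add: dpart_append)
  qed
  hence "(nlap ^^ k) (nlap f) x = (- 1) ^ k * (\<Sum>l\<in>L. - (\<Sum>i\<in>Basis. dpart (l @ [i, i]) f x))"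
   using L(3)[OF smooth_nlap[OF f], of x] by simp
  also have "\<dots> = (- 1) ^ Suc k * (\<Sum>l\<in>e ` (L \<times> Basis). dpart l f x)"
   unfolding sum.reindex[OF inj] by (simp add: e_def sum_negf sum.cartesian_product case_prod_beta)
  finally show "(nlap ^^ Suc k) f x = (- 1) ^ Suc k * (\<Sum>l\<in>e ` (L \<times> Basis). dpart l f x)"
   by (simp only: funpow_Suc_right o_apply)
 qed
qed

lemma nlap_pow_add:
 fixes f g :: "'a::euclidean_space => real"
 assumes "smooth_on UNIV f" "smooth_on UNIV g"
 shows "(nlap ^^ k) (%x. f x + g x) x = (nlap ^^ k) f x + (nlap ^^ k) g x"
proof -
 obtain L where L: "!!l. l : L ==> set l <= (Basis :: 'a set)"
  "!!(f::'a => real) x. smooth_on UNIV f ==> (nlap ^^ k) f x = (- 1) ^ k * (\<Sum>l\<in>L. dpart l f x)" using nlap_pow_dpart[of k] by metis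
 have "smooth_on UNIV (%x. f x + g x)" using assms unfolding smooth_on_def by (auto intro: Ck_on_add)
 moreover have "dpart l (%x. f x + g x) x = dpart l f x + dpart l g x" if "l : L" for l
  using dpart_add[OF open_UNIV smooth_onD[OF assms(1)] smooth_onD[OF assms(2)] L(1)[OF that] UNIV_I] .
 ultimately show ?thesis using assms by (simp add: L(2) sum.distrib distrib_left)
qed

section \<open>Fourier analysis of compactly supported smooth functions\<close>

text \<open>The radius is a parameter because differentiation preserves it, which expresses the
  locality of the operator.\<close>

definition csm :: "real => ('a::euclidean_space => real) => bool" where
 "csm R g \<longleftrightarrow> smooth_on UNIV g & (ALL x. norm x > R --> g x = 0)"

lemma csm_partial: "csm R g ==> i : Basis ==> csm R (partial i g)"
 unfolding csm_def using smooth_partial dpart_support[of R g _ "[i]"] by auto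

lemma csm_nlap: "csm R g ==> csm R (nlap g)"
 using csm_partial[of R "partial _ g"] csm_partial[of R g] smooth_nlap[of g] unfolding nlap_def[abs_def] csm_def
 by (auto intro!: sum.neutral)

lemma csm_nlap_pow: "csm R g ==> csm R ((nlap ^^ k) g)"
 by (induction k) (auto intro: csm_nlap)

lemma csm_add: "csm R f ==> csm R g ==> csm R (%x. f x + g x)"
 unfolding csm_def smooth_on_def by (auto intro: Ck_on_add)

lemma csm_measurable: "csm R g ==> g : bmeas"
 unfolding csm_def using Ck_on_continuous[OF smooth_onD] borel_measurable_continuous_onI by blast

lemma csm_decay:
 fixes g :: "'a::euclidean_space => real"
 assumes "csm R g"
 shows "EX C>=0. ALL x. \<bar>g x\<bar> <= C / (1 + sq x) ^ N"
proof -
 obtain B where B: "B >= 0" "!!x. \<bar>g x\<bar> <= B"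
  using support_bounded[of R g] assms Ck_on_continuous[OF smooth_onD] unfolding csm_def real_norm_def by metis
 have "\<bar>g x\<bar> <= (B * (1 + R\<^sup>2) ^ N) / (1 + sq x) ^ N" for x
 proof (cases "norm x <= R")
  case True
  have p: "0 < 1 + sq x" by (simp add: add_pos_nonneg)
  have "sq x <= R\<^sup>2" using power_mono[OF True norm_ge_zero, of 2] by (simp add: power2_norm_eq_inner)
  hence "\<bar>g x\<bar> * (1 + sq x) ^ N <= B * (1 + R\<^sup>2) ^ N" using B p by (intro mult_mono power_mono) auto
  thus ?thesis using p by (simp add: pos_le_divide_eq)
 qed (use assms B in \<open>auto simp: csm_def add_pos_nonneg\<close>)
 thus ?thesis using B(1) by (intro exI[of _ "B * (1 + R\<^sup>2) ^ N"]) auto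
qed

lemma csm_integrable: "csm R g ==> Lint (g :: 'a::euclidean_space => real)"
proof -
 assume g: "csm R g"
 obtain C where "!!x. \<bar>g x\<bar> <= C / (1 + sq x) ^ DIM('a)" using csm_decay[OF g] by blast
 thus ?thesis using csm_measurable[OF g] by (intro integrable_decay_bound[of _ C "DIM('a)"]) auto
qed

lemma csm_fourier_integrable:
 fixes g :: "'a::euclidean_space => real"
 assumes "csm R g"
 shows "Lint (%x. cis (- (x \<bullet> \<xi>)) * cor (g x))"
proof -
 note [measurable] = csm_measurable[OF assms]
 show ?thesis by (rule integrable_dom[OF csm_integrable[OF assms]]) (auto simp: norm_mult)
qed

text \<open>Integration by parts, in the form that a derivative of e^(-i x . xi) g has integral
  zero.\<close>

lemma fourier_partial:
 fixes g :: "'a::euclidean_space => real"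
 assumes g: "csm R g" and i: "i : Basis"
 shows "fourier (%x. cor (partial i g x)) \<xi> = \<i> * cor (i \<bullet> \<xi>) * fourier (%x. cor (g x)) \<xi>"
proof -
 let ?n = "DIM('a)"
 let ?f = "%x. cis (x \<bullet> (- \<xi>)) * cor (g x)"
 let ?f' = "%x. cis (x \<bullet> (- \<xi>)) * cor (partial i g x) + (\<i> * cor (i \<bullet> (- \<xi>)) * cis (x \<bullet> (- \<xi>))) * cor (g x)"
 note [measurable] = csm_measurable[OF g]
 obtain C where C: "C >= 0" "!!x. \<bar>g x\<bar> <= C / (1 + sq x) ^ ?n" using csm_decay[OF g] by metis
 obtain D where D: "D >= 0" "!!x. \<bar>partial i g x\<bar> <= D / (1 + sq x) ^ ?n" using csm_decay[OF csm_partial[OF g i]] by metis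
 have p: "0 < (1 + sq x) ^ ?n" for x :: 'a by (intro zero_less_power) (simp add: add_pos_nonneg)
 let ?K = "D + (1 + \<bar>i \<bullet> \<xi>\<bar>) * C"
 have z: "(LBINT x. ?f' x) = 0"
 proof (rule integral_partial_zero[OF i, where f = ?f and C = ?K and N = ?n])
  show "?f : bmeas" by measurable
  show "has_partial i ?f x (?f' x)" for x
   by (rule has_partial_mult[OF has_partial_cis has_partial_linear[OF bounded_linear_of_real smooth_has_partial]]) (use g i in \<open>auto simp: csm_def\<close>)
  show "norm (?f x) <= ?K / (1 + sq x) ^ ?n" for x
  proof -
   have "C <= ?K" using C(1) D(1) by (simp add: distrib_right)
   from divide_right_mono[OF this less_imp_le[OF p[of x]]] show ?thesis using C(2)[of x] by (simp add: norm_mult)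
  qed
  show "norm (?f' x) <= ?K / (1 + sq x) ^ ?n" for x
  proof -
   have "norm (?f' x) <= norm (cis (x \<bullet> (- \<xi>)) * cor (partial i g x)) + norm ((\<i> * cor (i \<bullet> (- \<xi>)) * cis (x \<bullet> (- \<xi>))) * cor (g x))"
    by (rule norm_triangle_ineq)
   also have "\<dots> = \<bar>partial i g x\<bar> + \<bar>i \<bullet> \<xi>\<bar> * \<bar>g x\<bar>" by (simp add: norm_mult)
   also have "\<dots> <= D / (1 + sq x) ^ ?n + (1 + \<bar>i \<bullet> \<xi>\<bar>) * (C / (1 + sq x) ^ ?n)" using C(2)[of x] D(2)[of x] by (intro add_mono mult_mono) auto
   finally show ?thesis by (simp add: add_divide_distrib)
  qed
 qed simp
 have e: "?f' x = cis (- (x \<bullet> \<xi>)) * cor (partial i g x) - \<i> * cor (i \<bullet> \<xi>) * (cis (- (x \<bullet> \<xi>)) * cor (g x))" for x by simp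
 have d: "(LBINT x. cis (- (x \<bullet> \<xi>)) * cor (partial i g x) - \<i> * cor (i \<bullet> \<xi>) * (cis (- (x \<bullet> \<xi>)) * cor (g x))) =
   (LBINT x. cis (- (x \<bullet> \<xi>)) * cor (partial i g x)) - (LBINT x. \<i> * cor (i \<bullet> \<xi>) * (cis (- (x \<bullet> \<xi>)) * cor (g x)))"
  by (rule Bochner_Integration.integral_diff[OF csm_fourier_integrable[OF csm_partial[OF g i]] integrable_mult_right[OF csm_fourier_integrable[OF g]]])
 show ?thesis using trans[OF sym[OF d] z[unfolded e]] unfolding fourier_def integral_mult_right_zero by simp
qed

lemma fourier_nlap:
 fixes g :: "'a::euclidean_space => real"
 assumes g: "csm R g"
 shows "fourier (%x. cor (nlap g x)) \<xi> = cor (sq \<xi>) * fourier (%x. cor (g x)) \<xi>"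
proof -
 have "fourier (%x. cor (nlap g x)) \<xi> = - (\<Sum>i\<in>Basis. fourier (%x. cor (partial i (partial i g) x)) \<xi>)"
  unfolding fourier_def nlap_def using csm_fourier_integrable[OF csm_partial[OF csm_partial[OF g]]]
  by (simp add: sum_distrib_left)
 also have "\<dots> = - (\<Sum>i\<in>Basis. (\<i> * cor (i \<bullet> \<xi>)) * ((\<i> * cor (i \<bullet> \<xi>)) * fourier (%x. cor (g x)) \<xi>))"
  by (simp add: fourier_partial[OF csm_partial[OF g]] fourier_partial[OF g])
 also have "\<dots> = (\<Sum>i\<in>Basis. cor ((\<xi> \<bullet> i) * (\<xi> \<bullet> i)) * fourier (%x. cor (g x)) \<xi>)"
 proof -
  have "(\<i> * z) * ((\<i> * z) * w) = (\<i> * \<i>) * (z * z * w)" for z w by (simp only: mult_ac)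
  thus ?thesis unfolding sum_negf[symmetric] by (intro sum.cong refl) (simp add: inner_commute)
 qed
 also have "\<dots> = cor (sq \<xi>) * fourier (%x. cor (g x)) \<xi>"
  unfolding euclidean_inner[of \<xi> \<xi>] by (simp only: of_real_sum sum_distrib_right)
 finally show ?thesis .
qed

lemma fourier_nlap_pow:
 "csm R g ==> fourier (%x. cor ((nlap ^^ k) g x)) \<xi> = cor ((sq \<xi>) ^ k) * fourier (%x. cor (g x)) \<xi>"
 by (induction k) (simp_all add: fourier_nlap[OF csm_nlap_pow])

text \<open>Adding the negative Laplacian multiplies the transform by 1 + |xi|^2, so the induction
  hypothesis for g + \<open>nlap g\<close> yields one more power of decay for g.\<close>

lemma fourier_csm_rdec:
 fixes g :: "'a::euclidean_space => real"
 assumes g: "csm R g"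
 shows "rdec (fourier (%x. cor (g x)))"
 unfolding rdec_def
proof (intro conjI allI)
 note [measurable] = csm_measurable[OF g]
 show "fourier (%x. cor (g x)) : bmeas" unfolding fourier_def[abs_def] by measurable
 fix N
 show "EX C. ALL \<xi>. norm (fourier (%x. cor (g x)) \<xi>) <= C / (1 + sq \<xi>) ^ N" using g
 proof (induction N arbitrary: g)
  case 0
  have "norm (fourier (%x. cor (g x)) \<xi>) <= (LBINT x. \<bar>g x\<bar>)" for \<xi>
   unfolding fourier_def using csm_integrable[OF 0] by (intro norm_integral_le csm_fourier_integrable[OF 0] integrable_abs) (auto simp: norm_mult)
  thus ?case by auto
 next
  case (Suc N)
  let ?F = "%g. fourier (%x. cor (g x))"
  let ?g = "%x. g x + nlap g x"
  obtain C where C: "!!\<xi>. norm (?F ?g \<xi>) <= C / (1 + sq \<xi>) ^ N" using Suc.IH[OF csm_add[OF Suc.prems csm_nlap[OF Suc.prems]]] by blast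
  have "norm (?F g \<xi>) <= C / (1 + sq \<xi>) ^ Suc N" for \<xi>
  proof -
   have p: "0 < 1 + sq \<xi>" by (simp add: add_pos_nonneg)
   have "?F ?g \<xi> = ?F g \<xi> + ?F (nlap g) \<xi>"
    unfolding fourier_def using csm_fourier_integrable[OF Suc.prems] csm_fourier_integrable[OF csm_nlap[OF Suc.prems]]
    by (simp add: distrib_left)
   also have "\<dots> = cor (1 + sq \<xi>) * ?F g \<xi>" unfolding fourier_nlap[OF Suc.prems] by (simp add: distrib_right)
   finally have "(1 + sq \<xi>) * norm (?F g \<xi>) <= C / (1 + sq \<xi>) ^ N" using C[of \<xi>] p by (simp only: norm_mult norm_of_real abs_of_pos)
   thus ?thesis using p by (simp add: pos_le_divide_eq mult_ac)
  qed
  thus ?case by blast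
 qed
qed

lemma hk_convolution_limit:
 fixes g :: "'a::euclidean_space => real"
 assumes g: "csm R g" and e: "!!j. 0 < e j" "e \<longlonglongrightarrow> 0"
 shows "(%j::nat. LBINT y. hk (e j) (x - y) * g y) \<longlonglongrightarrow> g x"
proof -
 note [measurable] = csm_measurable[OF g]
 have gc: "continuous_on UNIV g" using g Ck_on_continuous[OF smooth_onD] unfolding csm_def by blast
 obtain B where B: "!!x. \<bar>g x\<bar> <= B" using csm_decay[OF g, of 0] by auto
 have s0: "(%j. sqrt (e j)) \<longlonglongrightarrow> 0" using tendsto_real_sqrt[OF e(2)] by simp
 have "(LBINT y. hk (e j) (x - y) * g y) = (LBINT y. hk 1 y * g (x - sqrt (e j) *\<^sub>R y))" for j
 proof -
  have d: "hk (e j) = (dil (hk 1) (e j) :: 'a => real)" unfolding dil_def by (intro ext hk_scale e(1))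
  have i: "Lint (%z. g (x - z) * hk (e j) z)"
   by (rule integrable_dom[OF integrable_mult_left[OF hk_integrable[OF e(1)[of j]], of B]])
    (use B hk_nonneg[OF e(1)[of j]] in \<open>auto simp: abs_mult mult.commute[of "\<bar>g _\<bar>"] intro!: AE_I2 mult_left_mono order_trans[OF B abs_ge_self]\<close>)
  have "(LBINT y. hk (e j) (x - y) * g y) = (LBINT z. g (x - z) * hk (e j) z)"
   using integral_lborel_translate(2)[OF i, of x] by (simp add: mult.commute)
  thus ?thesis using dil_substitution[OF e(1) i[unfolded d]] unfolding d by (simp add: mult.commute)
 qed
 moreover have "(%j. LBINT y. hk 1 y * g (x - sqrt (e j) *\<^sub>R y)) \<longlonglongrightarrow> (LBINT y. hk 1 (y::'a) * g x)"
 proof (rule integral_dominated_convergence[where w = "%y. hk 1 y * B"])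
  show "Lint (%y::'a. hk 1 y * B)" by (intro integrable_mult_left hk_integrable) simp
  show "AE y in lborel. (%j. hk 1 y * g (x - sqrt (e j) *\<^sub>R y)) \<longlonglongrightarrow> hk 1 y * g x"
  proof (intro AE_I2 tendsto_mult tendsto_const)
   fix y :: 'a
   have "(%j. x - sqrt (e j) *\<^sub>R y) \<longlonglongrightarrow> x - 0 *\<^sub>R y" by (intro tendsto_intros s0)
   thus "(%j. g (x - sqrt (e j) *\<^sub>R y)) \<longlonglongrightarrow> g x"
    using isCont_tendsto_compose[of x g] gc by (simp add: continuous_on_eq_continuous_at)
  qed
  show "AE y in lborel. norm (hk 1 y * g (x - sqrt (e j) *\<^sub>R y)) <= hk 1 y * B" for j
   using B hk_nonneg[of 1] by (intro AE_I2) (auto simp: abs_mult intro!: mult_mono)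
 qed measurable
 ultimately show ?thesis using hk_integral[of 1, where 'a='a] by simp
qed

text \<open>Gaussian regularisation: a factor exp(-t |xi|^2) turns the double integral into
  convolution with the heat kernel, and t -> 0 recovers g.\<close>

lemma fourier_inversion:
 fixes g :: "'a::euclidean_space => real"
 assumes g: "csm R g"
 shows "Ex (fourier (%x. cor (g x))) x = cor ((2 * pi) ^ DIM('a) * g x)"
proof -
 note [measurable] = csm_measurable[OF g]
 let ?F = "fourier (%x. cor (g x))"
 note F = fourier_csm_rdec[OF g]
 have Fm [measurable]: "?F : bmeas" using F by (simp add: rdec_def)
 have step: "(LBINT \<xi>. cis (x \<bullet> \<xi>) * (cor (exp (- t * (sq \<xi>))) * ?F \<xi>)) = cor ((2 * pi) ^ DIM('a) * (LBINT y. hk t (x - y) * g y))"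
  if t: "0 < t" for t
 proof -
  define G where "G \<xi> y = cor (g y) * (cis ((x - y) \<bullet> \<xi>) * cor (exp (- t * (sq \<xi>))))" for \<xi> y
  have "(LBINT y. (LBINT \<xi>. G \<xi> y)) = (LBINT \<xi>. (LBINT y. G \<xi> y))"
  proof (rule fubini_dom(1))
   show "(%(\<xi>, y). G \<xi> y) : borel_measurable (lborel \<Otimes>\<^sub>M lborel)" unfolding G_def by measurable
   show "Lint (%\<xi>::'a. exp (- t * (sq \<xi>)))" using integrable_norm[OF rdec_integrable[OF rdec_gauss[OF t, where 'a='a]]] by simp
   show "Lint (%y. \<bar>g y\<bar>)" by (intro integrable_abs csm_integrable[OF g])
   show "norm (G \<xi> y) <= exp (- t * (sq \<xi>)) * \<bar>g y\<bar>" for \<xi> y by (simp add: G_def norm_mult)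
  qed
  moreover have "(LBINT y. G \<xi> y) = cis (x \<bullet> \<xi>) * (cor (exp (- t * (sq \<xi>))) * ?F \<xi>)" for \<xi>
  proof -
   have "G \<xi> y = (cis (x \<bullet> \<xi>) * cor (exp (- t * (sq \<xi>)))) * (cis (- (y \<bullet> \<xi>)) * cor (g y))" for y
   proof -
    have "cis ((x - y) \<bullet> \<xi>) = cis (x \<bullet> \<xi>) * cis (- (y \<bullet> \<xi>))" by (simp add: inner_diff_left cis_mult)
    thus ?thesis by (simp only: G_def mult_ac)
   qed
   thus ?thesis unfolding fourier_def by (simp only: integral_mult_right_zero mult.assoc)
  qed
  moreover have "(LBINT \<xi>. G \<xi> y) = cor ((2 * pi) ^ DIM('a) * (hk t (x - y) * g y))" for y
   unfolding G_def integral_mult_right_zero using Ex_gauss[OF t, of "x - y"] unfolding Ex_def by simp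
  ultimately show ?thesis by (simp only: integral_complex_of_real integral_mult_right_zero)
 qed
 define e :: "nat => real" where "e j = inverse (real (Suc j))" for j
 have e: "0 < e j" "e \<longlonglongrightarrow> 0" for j unfolding e_def[abs_def] using LIMSEQ_inverse_real_of_nat by auto
 have "(%j. LBINT \<xi>. cis (x \<bullet> \<xi>) * (cor (exp (- e j * (sq \<xi>))) * ?F \<xi>)) \<longlonglongrightarrow> (LBINT \<xi>. cis (x \<bullet> \<xi>) * ?F \<xi>)"
 proof (rule integral_dominated_convergence[OF _ _ integrable_norm[OF rdec_integrable[OF F]]])
  show "AE \<xi> in lborel. (%j. cis (x \<bullet> \<xi>) * (cor (exp (- e j * (sq \<xi>))) * ?F \<xi>)) \<longlonglongrightarrow> cis (x \<bullet> \<xi>) * ?F \<xi>"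
  proof (intro AE_I2)
   fix \<xi> :: 'a
   have "(%j. cor (exp (- e j * (sq \<xi>)))) \<longlonglongrightarrow> cor (exp (- 0 * (sq \<xi>)))" by (intro tendsto_intros e)
   hence "(%j. cis (x \<bullet> \<xi>) * (cor (exp (- e j * (sq \<xi>))) * ?F \<xi>)) \<longlonglongrightarrow> cis (x \<bullet> \<xi>) * (cor (exp (- 0 * (sq \<xi>))) * ?F \<xi>)"
    by (intro tendsto_mult tendsto_const)
   thus "(%j. cis (x \<bullet> \<xi>) * (cor (exp (- e j * (sq \<xi>))) * ?F \<xi>)) \<longlonglongrightarrow> cis (x \<bullet> \<xi>) * ?F \<xi>" by simp
  qed
  show "AE \<xi> in lborel. norm (cis (x \<bullet> \<xi>) * (cor (exp (- e j * (sq \<xi>))) * ?F \<xi>)) <= norm (?F \<xi>)" for j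
   using e(1)[of j] by (intro AE_I2) (simp add: norm_mult mult_left_le_one_le)
 qed measurable
 moreover have "(%j. cor ((2 * pi) ^ DIM('a) * (LBINT y. hk (e j) (x - y) * g y))) \<longlonglongrightarrow> cor ((2 * pi) ^ DIM('a) * g x)"
  by (intro tendsto_of_real tendsto_mult tendsto_const hk_convolution_limit[OF g] e)
 ultimately show ?thesis unfolding Ex_def step[OF e(1)] by (rule LIMSEQ_unique)
qed

lemma norm_powr_double: "k > 0 ==> norm \<xi> powr real (2 * k) = (sq \<xi>) ^ k"
proof (cases "\<xi> = 0")
 case False
 hence "norm \<xi> powr real (2 * k) = norm \<xi> ^ (2 * k)" by (intro powr_realpow) simp
 thus ?thesis by (simp add: power_mult dot_square_norm)
qed (simp add: power_0_left)

text \<open>Here the Fourier definition becomes local: for integer order the operator is a power of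
  the Laplacian and preserves supports.\<close>

lemma frac_lap_csm:
 fixes g :: "'a::euclidean_space => real"
 assumes g: "csm R g" and k: "k > 0"
 shows "frac_lap (real k) (%x. cor (g (x - a))) x = cor ((nlap ^^ k) g (x - a))"
proof -
 have "fourier (%x. cor (g (x - a))) \<xi> = cis (- (a \<bullet> \<xi>)) * fourier (%x. cor (g x)) \<xi>" for \<xi>
  by (rule fourier_translate) (use csm_integrable[OF g] in auto)
 hence "cor (norm \<xi> powr (2 * real k)) * fourier (%x. cor (g (x - a))) \<xi> =
   cis (- (a \<bullet> \<xi>)) * fourier (%x. cor ((nlap ^^ k) g x)) \<xi>" for \<xi>
  using norm_powr_double[OF k, of \<xi>] fourier_nlap_pow[OF g, of k \<xi>] by simp
 thus ?thesis unfolding frac_lap_def inv_fourier_Ex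
  by (simp add: Ex_translate fourier_inversion[OF csm_nlap_pow[OF g]])
qed

lemma Qk_symbol:
 fixes \<xi> :: "'a::euclidean_space"
 assumes n: "DIM('a) = 2 * Suc j" and e: "0 < \<epsilon>" "\<epsilon> < 1"
 shows "1 * (norm \<xi> powr real DIM('a) * ee \<epsilon> \<xi>) = Qk j (\<epsilon> * (sq \<xi>)) - Qk j (sq \<xi>)"
proof -
 have h: "(sq \<xi>) ^ (j + 1) * (ew DIM('a) \<epsilon> t * exp (- t * (sq \<xi>))) = ind {\<epsilon><..<1} t * ((sq \<xi>) ^ (j + 1) * t ^ j * exp (- (1 * t * (sq \<xi>))))" for t
 proof (cases "t : {\<epsilon><..<1}")
  case True
  moreover have "real DIM('a) / 2 - 1 = real j" by (simp add: n field_simps)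
  ultimately have "t powr (real DIM('a) / 2 - 1) = t ^ j" using e by (simp add: powr_realpow)
  thus ?thesis using True by (simp add: ew_def)
 qed (simp add: ew_zero)
 have "(sq \<xi>) ^ (j + 1) * ee \<epsilon> \<xi> = (LBINT t. ind {\<epsilon><..<1} t * ((sq \<xi>) ^ (j + 1) * t ^ j * exp (- (1 * t * (sq \<xi>)))))"
  unfolding ee_def integral_mult_right_zero[symmetric] h by (rule refl)
 thus ?thesis using Qk_FTC[OF e zero_less_one, of "sq \<xi>" j] norm_powr_double[of "Suc j" \<xi>] unfolding n by simp
qed

text \<open>The truncation without cutoff is handled on the Fourier side, where its image is
  explicit; the effect of the cutoff is then accounted for by locality.\<close>

lemma nlap_pow_phe:
 fixes x :: "'a::euclidean_space"
 assumes n: "DIM('a) = 2 * Suc j" and e: "0 < \<epsilon>" "\<epsilon> < 1"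
 shows "(nlap ^^ Suc j) (phe \<epsilon>) x = dil (Pk j) \<epsilon> x - Pk j x"
proof -
 let ?c = "cor (1 / (2 * pi) ^ DIM('a))"
 note r = ee_rdec[OF e(1), where 'a='a]
 have ps: "smooth_on UNIV (phe \<epsilon> :: 'a => real)" using phe_smooth_decay(1)[OF e(1)] by (auto simp: smooth_on_def)
 have "(%x::'a. cor (phe \<epsilon> x)) = Ex (%\<xi>. ?c * cor (ee \<epsilon> \<xi>))"
 proof
  show "cor (phe \<epsilon> x) = Ex (%\<xi>. ?c * cor (ee \<epsilon> \<xi>)) x" for x :: 'a
   unfolding Ex_cmult Ex_ee[OF e(1)] unfolding of_real_mult[symmetric] by simp
 qed
 hence "(nlap ^^ Suc j) (%x. cor (phe \<epsilon> x)) x = Ex (%\<xi>. cor ((sq \<xi>) ^ Suc j) * (?c * cor (ee \<epsilon> \<xi>))) x"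
  using conjunct1[OF Ex_nlap_pow[OF rdec_cmult[OF r, of ?c], of "Suc j"]] by (simp only:)
 also have "\<dots> = Ex (%\<xi>. ?c * (cor (norm \<xi> powr real DIM('a)) * cor (ee \<epsilon> \<xi>))) x"
  unfolding n norm_powr_double[OF zero_less_Suc] by (simp only: mult.left_commute)
 also have "\<dots> = cor (dil (Pk j) \<epsilon> x - Pk j x)"
  unfolding Ex_cmult kernel_pair[OF Qk_rdec_and_Ex Qk_symbol[OF n e] e(1) one_neq_zero] by simp
 finally show ?thesis
  unfolding smooth_nlap_pow_of_real[OF ps] of_real_eq_iff .
qed

text \<open>As u is only locally integrable, \<open>phe\<close> must be cut off by \<theta>. The
  discarded part (1 - \<theta>) \<open>phe\<close> lives away from the singularity, so its image
  under the operator stays bounded and converges as epsilon tends to 0; by locality the error kernel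
  is supported in radius 2, where local integrability of u suffices.\<close>

lemma even_representation:
 fixes u f :: "'a::euclidean_space => real"
 assumes n: "DIM('a) = 2 * Suc j" and sol: "solves_fl DIM('a) f u" and f: "Lint f"
 shows "EX c h. c >= 0 & (ALL k. Ck_on k UNIV h) & (AE a in lborel. u a = c * (LBINT x. f x * Phi (x - a)) + h a)"
proof -
 let ?n = "DIM('a)"
 let ?k = "Suc j"
 have li: "loc_integrable u" and S: "!!\<phi>. test_fun \<phi> ==>
   (LINT x|lborel. cor (u x) * frac_lap (real ?k) \<phi> x) = (LINT x|lborel. cor (f x) * \<phi> x)"
 proof -
  have h: "real ?n / 2 = real ?k" using n by simp
  show "loc_integrable u" "!!\<phi>. test_fun \<phi> ==>
   (LINT x|lborel. cor (u x) * frac_lap (real ?k) \<phi> x) = (LINT x|lborel. cor (f x) * \<phi> x)"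
   using sol n unfolding solves_fl_def h by auto
 qed
 note um = loc_integrable_measurable[OF li]
 have fm [measurable]: "f : bmeas" using f by auto
 note [measurable] = um
 define \<theta> :: "'a => real" where "\<theta> = cutoff 2"
 define \<eta> where "\<eta> x = 1 - \<theta> x" for x
 have \<theta>m [measurable]: "\<theta> : bmeas" unfolding \<theta>_def by measurable
 have \<theta>0: "\<theta> x = 0" if "norm x >= 2" for x unfolding \<theta>_def by (rule cutoff_eq_0) (use that in auto)
 have \<theta>1: "\<theta> x = 1" if "norm x <= 1" for x unfolding \<theta>_def by (rule cutoff_eq_1) (use that in auto)
 have \<theta>b: "0 <= \<theta> x" "\<theta> x <= 1" for x unfolding \<theta>_def by (rule cutoff_bounds)+
 have \<theta>c: "continuous_on UNIV \<theta>" unfolding \<theta>_def using Ck_on_continuous[OF cutoff_Ck[of 0]] .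
 have \<eta>: "bsmooth \<eta>" "!!x. norm x < 1 ==> \<eta> x = 0"
  unfolding \<eta>_def[abs_def] using bsmooth_one_minus[OF bsmooth_cutoff[of 2]] \<theta>1 by (auto simp: \<theta>_def)
 let ?q = "Pk j :: 'a => real"
 have qC: "EX C>=0. ALL x::'a. \<bar>?q x\<bar> <= C / (1 + sq x) ^ ?n" by (rule PG_bound'[OF PG_Pk])
 have qi: "Lint ?q" by (rule PG_integrable[OF PG_Pk])
 have ps: "smooth_on UNIV (phe \<epsilon> :: 'a => real)" if "0 < \<epsilon>" for \<epsilon> using phe_smooth_decay(1)[OF that] by (auto simp: smooth_on_def)
 note cw = cut_weighted[of 1 \<eta>, OF zero_less_one \<eta>]
 \<comment> \<open>The image of the discarded part of the truncation; \<open>N0\<close> is its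
   limit, with the full kernel in place of the truncated one.\<close>
 define Ne where "Ne \<epsilon> = (nlap ^^ ?k) (%x. \<eta> x * phe \<epsilon> x)" for \<epsilon>
 define N0 where "N0 = (nlap ^^ ?k) (%x. \<eta> x * Phi x)"
 have es: "smooth_on UNIV (%x. \<eta> x * phe \<epsilon> x)" and
  ed: "set js <= Basis ==> Lint (%t. ew ?n \<epsilon> t * dpart js (%x. \<eta> x * hk t x) x) &
   dpart js (%x. \<eta> x * phe \<epsilon> x) x = (LBINT t. ew ?n \<epsilon> t * dpart js (%x. \<eta> x * hk t x) x)" if "0 <= \<epsilon>" for \<epsilon> js x
  using cw[OF _ ew_measurable ew_nonneg ew_le_hw[OF that]] unfolding phe_def by auto
 have ps0: "smooth_on UNIV (%x. \<eta> x * Phi x)" and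
  pd: "set js <= Basis ==> Lint (%t. hw ?n t * dpart js (%x. \<eta> x * hk t x) x) &
   dpart js (%x. \<eta> x * Phi x) x = (LBINT t. hw ?n t * dpart js (%x. \<eta> x * hk t x) x)" for js x
  using cw[OF _ hw_measurable hw_nonneg order_refl] unfolding Phi_def by auto
 obtain L where L: "finite L" "!!l. l : L ==> set l <= (Basis :: 'a set)"
  "!!(f::'a => real) x. smooth_on UNIV f ==> (nlap ^^ ?k) f x = (- 1) ^ ?k * (\<Sum>l\<in>L. dpart l f x)" using nlap_pow_dpart[of ?k] by metis
 have db: "EX B. ALL \<epsilon>:{0..<1}. ALL x. \<bar>dpart l (%x. \<eta> x * phe \<epsilon> x) x\<bar> <= B" if l: "set l <= Basis" for l
 proof -
  obtain B where B: "!!\<omega> x. \<omega> : bmeas ==> (!!t. 0 <= \<omega> t & \<omega> t <= hw ?n t) ==>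
    \<bar>dpart l (%x. \<eta> x * (LBINT t. \<omega> t * hk t x)) x\<bar> <= B" using cut_weighted_bound[of 1 l \<eta>, OF zero_less_one l \<eta>] by blast
  have "\<bar>dpart l (%x. \<eta> x * phe \<epsilon> x) x\<bar> <= B" if "0 <= \<epsilon>" for \<epsilon> x
   using B[OF ew_measurable, of ?n \<epsilon> x] ew_le_hw[OF that] unfolding phe_def by simp
  thus ?thesis by (intro exI[of _ B]) auto
 qed
 have "EX B. ALL \<epsilon>:{0<..<1}. ALL x. \<bar>Ne \<epsilon> x\<bar> <= B"
 proof -
  obtain B where B: "!!l \<epsilon> x. l : L ==> \<epsilon> : {0..<1} ==> \<bar>dpart l (%x. \<eta> x * phe \<epsilon> x) x\<bar> <= B l" using db L(2) by metis
  have "\<bar>Ne \<epsilon> x\<bar> <= (\<Sum>l\<in>L. B l)" if "\<epsilon> : {0<..<1}" for \<epsilon> x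
   unfolding Ne_def using that B by (subst L(3)[OF es]) (auto simp: abs_mult power_abs intro!: order_trans[OF sum_abs] sum_mono)
  thus ?thesis by blast
 qed
 then obtain BN where BN: "!!\<epsilon> x. \<epsilon> : {0<..<1} ==> \<bar>Ne \<epsilon> x\<bar> <= BN" by blast
 have Nlim: "(%i. Ne (\<epsilon> i) x) \<longlonglongrightarrow> N0 x" if e: "\<epsilon> \<longlonglongrightarrow> 0" "!!i. 0 < \<epsilon> i & \<epsilon> i < 1" for \<epsilon> :: "nat => real" and x
 proof -
  have "(%i. dpart l (%x. \<eta> x * phe (\<epsilon> i) x) x) \<longlonglongrightarrow> dpart l (%x. \<eta> x * Phi x) x" if l: "l : L" for l
  proof -
   have e0: "0 <= \<epsilon> i" for i using e(2)[of i] by simp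
   let ?D = "%t. dpart l (%x. \<eta> x * hk t x) x"
   have "(%i. LBINT t. ew ?n (\<epsilon> i) t * ?D t) \<longlonglongrightarrow> (LBINT t. hw ?n t * ?D t)"
   proof (rule integral_dominated_convergence[where w = "%t. \<bar>hw ?n t * ?D t\<bar>"])
    show "(%t. hw ?n t * ?D t) : borel_measurable lborel" using pd[OF L(2)[OF l], of x] by auto
    show "(%t. ew ?n (\<epsilon> i) t * ?D t) : borel_measurable lborel" for i using ed[OF e0 L(2)[OF l], of i x] by auto
    show "Lint (%t. \<bar>hw ?n t * ?D t\<bar>)" using pd[OF L(2)[OF l], of x] by (intro integrable_abs) blast
    show "AE t in lborel. norm (ew ?n (\<epsilon> i) t * ?D t) <= \<bar>hw ?n t * ?D t\<bar>" for i
     using ew_le_hw[OF e0] by (intro AE_I2) (simp add: abs_mult mult_right_mono)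
    show "AE t in lborel. (%i. ew ?n (\<epsilon> i) t * ?D t) \<longlonglongrightarrow> hw ?n t * ?D t"
     by (intro AE_I2 tendsto_mult tendsto_const ew_tendsto e(1)) (use e(2) in blast)
   qed
   thus ?thesis using ed[OF e0 L(2)[OF l]] pd[OF L(2)[OF l]] by simp
  qed
  hence "(%i. (- 1) ^ ?k * (\<Sum>l\<in>L. dpart l (%x. \<eta> x * phe (\<epsilon> i) x) x)) \<longlonglongrightarrow> (- 1) ^ ?k * (\<Sum>l\<in>L. dpart l (%x. \<eta> x * Phi x) x)"
   by (intro tendsto_mult tendsto_const tendsto_sum)
  moreover have "Ne (\<epsilon> i) x = (- 1) ^ ?k * (\<Sum>l\<in>L. dpart l (%x. \<eta> x * phe (\<epsilon> i) x) x)" for i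
   unfolding Ne_def by (rule L(3)[OF es]) (use e(2)[of i] in simp)
  ultimately show ?thesis unfolding N0_def L(3)[OF ps0] by simp
 qed
 have Nm [measurable]: "Ne \<epsilon> : bmeas" if "0 < \<epsilon>" for \<epsilon>
  unfolding Ne_def by (rule borel_measurable_continuous_onI[OF Ck_on_continuous[OF smooth_onD[OF smooth_nlap_pow[OF es[OF less_imp_le[OF that]], of ?k], of 0]]])
 have N0s: "smooth_on UNIV N0" unfolding N0_def by (rule smooth_nlap_pow[OF ps0])

 \<comment> \<open>Chosen so that the operator maps the cut truncation to \<theta> times the dilated
   kernel, minus r. The value 0 for epsilon <= 0 gives measurability for every epsilon, as
   \<open>weak_limit\<close> asks.\<close>
 define r where "r \<epsilon> z = (if 0 < \<epsilon> then ?q z - \<eta> z * dil ?q \<epsilon> z + Ne \<epsilon> z else 0)" for \<epsilon> z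
 define r0 where "r0 z = ?q z + N0 z" for z
 have \<eta>m [measurable]: "\<eta> : bmeas" unfolding \<eta>_def[abs_def] by measurable
 have rm: "r \<epsilon> : bmeas" for \<epsilon>
 proof (cases "0 < \<epsilon>")
  case True
  note [measurable] = Nm[OF True]
  have "r \<epsilon> = (%z. ?q z - \<eta> z * dil ?q \<epsilon> z + Ne \<epsilon> z)" using True by (simp add: r_def[abs_def])
  thus ?thesis by simp
 qed (simp add: r_def[abs_def])
 have r0s: "smooth_on UNIV r0" unfolding smooth_on_def r0_def[abs_def] by (intro allI Ck_on_add PG_Ck[OF PG_Pk] smooth_onD[OF N0s]) auto
 have r0m: "r0 : bmeas" using Ck_on_continuous[OF smooth_onD[OF r0s]] by (rule borel_measurable_continuous_onI)
 obtain C where C: "C >= 0" "!!x::'a. \<bar>?q x\<bar> <= C / (1 + sq x) ^ ?n" using qC by auto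
 have Cb: "\<bar>?q x\<bar> <= C" for x
 proof -
  have "(1::real) <= (1 + sq x) ^ ?n" by (intro one_le_power) simp
  hence "C / (1 + sq x) ^ ?n <= C / 1" using C(1) by (intro divide_left_mono) (auto simp: add_pos_nonneg intro!: zero_less_power)
  thus ?thesis using C(2)[of x] by simp
 qed
 \<comment> \<open>On the support of \<eta> the dilated kernel is O(sqrt epsilon), so it disappears
   from the limit \<open>r0\<close>.\<close>
 have qeb: "\<bar>\<eta> z * dil ?q \<epsilon> z\<bar> <= C * sqrt \<epsilon>" if e: "0 < \<epsilon>" "\<epsilon> < 1" for \<epsilon> z
 proof (cases "norm z < 1")
  case False
  hence "\<bar>dil ?q \<epsilon> z\<bar> <= C * sqrt \<epsilon>" by (intro dil_decay(1)[OF e]) (use C in auto)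
  moreover have "\<bar>\<eta> z\<bar> <= 1" using \<theta>b[of z] by (simp add: \<eta>_def)
  ultimately have "\<bar>\<eta> z\<bar> * \<bar>dil ?q \<epsilon> z\<bar> <= 1 * (C * sqrt \<epsilon>)" by (intro mult_mono) auto
  thus ?thesis by (simp add: abs_mult)
 qed (use \<eta>(2) C(1) e in simp)
 have rlim: "(%i. r (\<epsilon> i) z) \<longlonglongrightarrow> r0 z" if e: "\<epsilon> \<longlonglongrightarrow> 0" "!!i. 0 < \<epsilon> i & \<epsilon> i < 1" for \<epsilon> :: "nat => real" and z
 proof -
  have c: "(%i. C * sqrt (\<epsilon> i)) \<longlonglongrightarrow> 0" using tendsto_mult[OF tendsto_const[of C] tendsto_real_sqrt[OF e(1)]] by simp
  have "norm (\<eta> z * dil ?q (\<epsilon> i) z) <= C * sqrt (\<epsilon> i)" for i using qeb[of "\<epsilon> i" z] e(2)[of i] by (simp only: real_norm_def)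
  hence "(%i. \<eta> z * dil ?q (\<epsilon> i) z) \<longlonglongrightarrow> 0" by (intro Lim_null_comparison[OF always_eventually c] allI)
  from tendsto_add[OF tendsto_diff[OF tendsto_const[of "?q z"] this] Nlim[OF e, of z]]
  have l: "(%i. ?q z - \<eta> z * dil ?q (\<epsilon> i) z + Ne (\<epsilon> i) z) \<longlonglongrightarrow> r0 z" by (simp only: r0_def diff_zero)
  have "r (\<epsilon> i) z = ?q z - \<eta> z * dil ?q (\<epsilon> i) z + Ne (\<epsilon> i) z" for i using e(2)[of i] by (simp only: r_def if_True)
  thus ?thesis using l by (simp only:)
 qed
 have ts: "smooth_on UNIV (%x. \<theta> x * phe \<epsilon> x)" if "0 < \<epsilon>" for \<epsilon>
  unfolding smooth_on_def \<theta>_def by (intro allI Ck_on_mult cutoff_Ck smooth_onD[OF ps[OF that]]) auto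
 have lap: "(nlap ^^ ?k) (%x. \<theta> x * phe \<epsilon> x) z = \<theta> z * dil ?q \<epsilon> z - r \<epsilon> z" if e: "0 < \<epsilon>" "\<epsilon> < 1" for \<epsilon> z
 proof -
  have "(%x. \<theta> x * phe \<epsilon> x + \<eta> x * phe \<epsilon> x) = phe \<epsilon>" by (simp add: \<eta>_def fun_eq_iff algebra_simps)
  hence "(nlap ^^ ?k) (%x. \<theta> x * phe \<epsilon> x) z + Ne \<epsilon> z = dil ?q \<epsilon> z - ?q z"
   using nlap_pow_add[OF ts[OF e(1)] es, of \<epsilon> ?k z] nlap_pow_phe[OF n e, of z] e(1) unfolding Ne_def by simp
  thus ?thesis using e(1) by (simp add: r_def \<eta>_def algebra_simps)
 qed
 have cs: "csm 2 (%x. \<theta> x * phe \<epsilon> x)" if "0 < \<epsilon>" for \<epsilon>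
  unfolding csm_def using ts[OF that] \<theta>0 by simp
 \<comment> \<open>Outside radius 2 the image of the cut truncation and \<theta> both vanish, hence
   so does r. Its definition as a sum of kernels without compact support does not show this.\<close>
 have rsupp: "r \<epsilon> z = 0" if "0 < \<epsilon>" "\<epsilon> < 1" "norm z > 2" for \<epsilon> z
  using lap[OF that(1,2), of z] csm_nlap_pow[OF cs[OF that(1)], of ?k] that(3) \<theta>0[of z] unfolding csm_def by simp
 define B where "B = C + C + BN"
 have rb: "\<bar>r \<epsilon> z\<bar> <= B" if "0 < \<epsilon>" "\<epsilon> < 1" for \<epsilon> z
 proof -
  have "C * sqrt \<epsilon> <= C * 1" using C(1) that by (intro mult_left_mono) auto
  moreover have "\<bar>Ne \<epsilon> z\<bar> <= BN" using BN[of \<epsilon> z] that by simp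
  moreover have "r \<epsilon> z = ?q z - \<eta> z * dil ?q \<epsilon> z + Ne \<epsilon> z" using that by (simp only: r_def if_True)
  ultimately show ?thesis using Cb[of z] qeb[OF that, of z] unfolding B_def by linarith
 qed
 have B0: "0 <= B" using rb[of "1 / 2" 0] by simp
 \<comment> \<open>The support of the error kernels passes to their pointwise limit.\<close>
 have r0supp: "r0 z = 0" if z: "norm z > 2" for z
 proof -
  define e :: "nat => real" where "e i = inverse (real (Suc (Suc i)))" for i
  have e: "0 < e i & e i < 1" for i by (auto simp: e_def inverse_less_1_iff)
  have e0: "e \<longlonglongrightarrow> 0" unfolding e_def[abs_def] using LIMSEQ_Suc[OF LIMSEQ_inverse_real_of_nat] by simp
  have "(%i. r (e i) z) \<longlonglongrightarrow> r0 z" by (rule rlim[OF e0 e])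
  moreover have "r (e i) z = 0" for i using rsupp e z by blast
  ultimately have "(%i. 0) \<longlonglongrightarrow> r0 z" by simp
  thus ?thesis by (simp add: LIMSEQ_const_iff)
 qed
 have ind: "x : cball 0 (R + 2)" if "a : cball 0 R" "~ norm (x - a) > 2" for x a :: 'a and R
  using norm_triangle_ineq[of "x - a" a] that by simp

 have AE0: "AE a in lborel. fact j * u a = (LBINT x. u x * r0 (x - a)) + 1 * (LBINT x. f x * (\<theta> (x - a) * Phi (x - a)))"
 proof (rule weak_limit[where q = ?q and r = r])
  show "isCont \<theta> 0" using \<theta>c by (simp add: continuous_on_eq_continuous_at)
  show "(%i. r (\<epsilon> i) z) \<longlonglongrightarrow> r0 z" if "\<epsilon> \<longlonglongrightarrow> 0" "!!i. 0 < \<epsilon> i & \<epsilon> i < 1" for z \<epsilon> by (rule rlim[OF that])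
  show "EX w. Lint (%x. \<bar>u x\<bar> * w x) & (ALL \<epsilon>:{0<..<1}. ALL x.
    (LBINT a. ind (cball 0 R) a * \<bar>\<theta> (x - a) * dil ?q \<epsilon> (x - a)\<bar>) <= w x & (ALL a:cball 0 R. \<bar>r \<epsilon> (x - a)\<bar> <= w x))" for R
  proof -
   define I where "I = (LBINT z. \<bar>?q z\<bar>)"
   have I0: "0 <= I" unfolding I_def by (intro integral_nonneg_AE AE_I2) simp
   define K where "K = I + B + 1"
   let ?w = "%x::'a. K * ind (cball 0 (R + 2)) x"
   have K: "I <= K" "B <= K" "1 <= K" using I0 B0 by (auto simp: K_def)
   have w1: "(LBINT a. ind (cball 0 R) a * \<bar>\<theta> (x - a) * dil ?q \<epsilon> (x - a)\<bar>) <= ?w x" if e: "\<epsilon> : {0<..<1}" for \<epsilon> x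
   proof (cases "x : cball 0 (R + 2)")
    case True
    have e0: "0 < \<epsilon>" using e by simp
    note Qi = integrable_abs[OF dil_integral(1)[OF qi e0]]
    note ti = integrable_lborel_translate(2)[OF Qi, of x] and tI = integral_lborel_translate(2)[OF Qi, of x, unfolded dil_integral(3)[OF qi e0], folded I_def]
    have le: "norm (ind (cball 0 R) a * \<bar>\<theta> (x - a) * dil ?q \<epsilon> (x - a)\<bar>) <= \<bar>dil ?q \<epsilon> (x - a)\<bar>" for a
     using \<theta>b[of "x - a"] by (auto simp: indicator_def abs_mult intro!: mult_left_le_one_le)
    have "norm (LBINT a. ind (cball 0 R) a * \<bar>\<theta> (x - a) * dil ?q \<epsilon> (x - a)\<bar>) <= (LBINT a. \<bar>dil ?q \<epsilon> (x - a)\<bar>)"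
    proof (rule norm_integral_le[OF _ ti le])
     show "Lint (%a. ind (cball 0 R) a * \<bar>\<theta> (x - a) * dil ?q \<epsilon> (x - a)\<bar>)"
     proof (rule integrable_dom[OF ti])
      have [measurable]: "cball (0::'a) R : sets borel" by simp
      show "(%a. ind (cball 0 R) a * \<bar>\<theta> (x - a) * dil ?q \<epsilon> (x - a)\<bar>) : borel_measurable lborel" by measurable
     qed (use le in auto)
    qed
    thus ?thesis using True K(1) tI by simp
   next
    case False
    hence "ind (cball 0 R) a * \<bar>\<theta> (x - a) * dil ?q \<epsilon> (x - a)\<bar> = 0" for a
    proof (cases "a : cball 0 R")
     case True
     hence "norm (x - a) > 2" using ind[of a R x] False by blast
     thus ?thesis using \<theta>0[of "x - a"] by simp
    qed simp
    hence "(LBINT a. ind (cball 0 R) a * \<bar>\<theta> (x - a) * dil ?q \<epsilon> (x - a)\<bar>) = 0" by (simp only: Bochner_Integration.integral_zero)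
    thus ?thesis using False by simp
   qed
   have w2: "\<bar>r \<epsilon> (x - a)\<bar> <= ?w x" if "\<epsilon> : {0<..<1}" "a : cball 0 R" for \<epsilon> x a
    using rb[of \<epsilon> "x - a"] rsupp[of \<epsilon> "x - a"] ind[OF that(2), of x] K that by (cases "norm (x - a) > 2") auto
   show ?thesis by (intro exI[of _ ?w] conjI ballI allI loc_integrable_cball[OF li] w1 w2)
  qed
  show "(LBINT x. u x * (\<theta> (x - a) * dil ?q \<epsilon> (x - a) - r \<epsilon> (x - a))) = 1 * (LBINT x. f x * (\<theta> (x - a) * phe \<epsilon> (x - a)))"
   if e: "\<epsilon> : {0<..<1}" for \<epsilon> a
  proof -
   have e': "0 < \<epsilon>" "\<epsilon> < 1" using e by auto
   let ?g = "%x. \<theta> x * phe \<epsilon> x"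
   let ?\<phi> = "%x. cor (?g (x - a))"
   have "test_fun ?\<phi>" unfolding test_fun_def smooth_on_def
   proof (intro conjI allI exI[of _ "cball a 2"])
    fix m
    have "Ck_on m UNIV (%x. ?g (1 *\<^sub>R x + (- a)))"
     using Ck_on_affine[OF open_UNIV smooth_onD, of ?g m 1 "- a"] cs[OF e'(1)] by (simp add: csm_def)
    thus "Ck_on m UNIV ?\<phi>" using Ck_on_linear[OF bounded_linear_of_real open_UNIV, of m "%x. ?g (x - a)"] by simp
    show "x ~: cball a 2 --> ?\<phi> x = 0" for x using \<theta>0[of "x - a"] by (simp add: dist_norm norm_minus_commute)
   qed simp
   from S[OF this] have "(LBINT x. cor (u x) * cor (\<theta> (x - a) * dil ?q \<epsilon> (x - a) - r \<epsilon> (x - a))) = (LBINT x. cor (f x) * ?\<phi> x)"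
    unfolding frac_lap_csm[OF cs[OF e'(1)] zero_less_Suc] lap[OF e'] .
   thus ?thesis unfolding of_real_mult[symmetric] integral_complex_of_real of_real_eq_iff by simp
  qed
  show "fact j = (LBINT z. ?q z)" by (simp add: Pk_integral)
  show "\<theta> 0 = 1" using \<theta>1[of 0] by simp
  show "\<bar>\<theta> z\<bar> <= 1" for z using \<theta>b[of z] by simp
 qed (rule um loc_integrable_box[OF li] f qi \<theta>m rm r0m)+
 \<comment> \<open>Removes the cutoff from the potential: (1 - \<theta>) \<open>Phi\<close> is
   smooth with bounded derivatives, so its convolution with the integrable f joins the smooth
   remainder.\<close>
 have \<eta>\<Phi>: "bsmooth (%x. \<eta> x * Phi x)" by (rule cut_Phi[OF zero_less_one \<eta>])
 define H where "H a = (LBINT y. (\<eta> (a - y) * Phi (a - y)) * f y)" for a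
 have Hi: "Lint (%y. (\<eta> (a - y) * Phi (a - y)) * f y)" and HC: "Ck_on m UNIV H" for a m
  unfolding H_def[abs_def] using bsmooth_convolution[OF \<eta>\<Phi> f] by auto
 have ev: "\<eta> (a - y) * Phi (a - y) = \<eta> (y - a) * Phi (y - a)" for a y
 proof -
  have "Phi (- z) = Phi z" "\<theta> (- z) = \<theta> z" for z :: 'a unfolding Phi_def \<theta>_def cutoff_def by simp_all
  from this[of "y - a"] show ?thesis by (simp add: \<eta>_def)
 qed
 have "AE a in lborel. u a = (1 / fact j) * (LBINT x. f x * Phi (x - a)) + (1 / fact j) * ((LBINT x. u x * r0 (x - a)) + (- 1) * H a)"
  using AE0 L1_convolution(1)[OF Phi_integrable f]
 proof eventually_elim
  case (elim a)
  have "(LBINT x. f x * (\<theta> (x - a) * Phi (x - a))) = (LBINT x. f x * Phi (x - a) - (\<eta> (a - x) * Phi (a - x)) * f x)"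
   unfolding ev by (rule Bochner_Integration.integral_cong) (auto simp: \<eta>_def algebra_simps)
  also have "\<dots> = (LBINT x. f x * Phi (x - a)) - H a" unfolding H_def by (rule Bochner_Integration.integral_diff[OF elim(2) Hi])
  finally have "fact j * u a = (LBINT x. u x * r0 (x - a)) + ((LBINT x. f x * Phi (x - a)) - H a)" using elim(1) by simp
  hence "u a = (1 / fact j) * ((LBINT x. u x * r0 (x - a)) + ((LBINT x. f x * Phi (x - a)) - H a))" by (simp add: field_simps)
  thus ?case by (simp add: algebra_simps)
 qed
 moreover have "Ck_on m UNIV (%a. (1 / fact j) * ((LBINT x. u x * r0 (x - a)) + (- 1) * H a))" for m
 proof (intro Ck_on_linear[OF bounded_linear_mult_right open_UNIV] Ck_on_add open_UNIV HC)
  show "Ck_on m UNIV (%a. LBINT x. u x * r0 (x - a))"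
  proof (rule weighted_convolution_Ck[OF um smooth_onD[OF r0s]])
   fix R :: real and js :: "'a list" assume js: "set js <= Basis"
   obtain D where D: "!!x. \<bar>dpart js r0 x\<bar> <= D" using bsmooth_support[of r0 2] smooth_onD[OF r0s] r0supp js unfolding bsmooth_def by blast
   have "\<bar>dpart js r0 (x - a)\<bar> <= D * ind (cball 0 (R + 2)) x" if "a : cball 0 R" for x a
    using D[of "x - a"] ind[OF that, of x] dpart_support[of 2 r0 "x - a" js] r0supp order_trans[OF abs_ge_zero D[of 0]]
    by (cases "norm (x - a) > 2") (auto simp: indicator_def)
   thus "EX w. Lint (%x. \<bar>u x\<bar> * w x) & (ALL x. ALL a:cball 0 R. \<bar>dpart js r0 (x - a)\<bar> <= w x)"
    using loc_integrable_cball[OF li, of D "R + 2"] by (intro exI[of _ "%x. D * ind (cball 0 (R + 2)) x"]) auto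
  qed
 qed
 ultimately show ?thesis by (intro exI[of _ "1 / fact j"] exI conjI allI) auto
qed

theorem theorem2p1:
  fixes u :: "'a::euclidean_space \<Rightarrow> real" and \<alpha> :: real
  assumes "DIM('a) \<ge> 2" and "\<alpha> > -1" and "P0 \<alpha> u"
  shows "((\<alpha> \<in> {-1<..<0} \<or> (\<exists>k::nat. real DIM('a) * \<alpha> - 1 = 2 * real k)) \<longrightarrow>
           (\<exists>v. (AE x in lborel. u x = v x) \<and> smooth_on (UNIV - {0}) v \<and>
                (\<forall>s. 0 < s \<and> s < real DIM('a) * (1 + \<alpha>) \<longrightarrow> Cs_loc s v))) \<and>
         ((\<alpha> > 0 \<and> real DIM('a) * \<alpha> \<notin> \<nat>) \<longrightarrow>
           (\<exists>v. (AE x in lborel. u x = v x) \<and> smooth_on (UNIV - {0}) v \<and>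
                Cs_loc (real DIM('a) * (1 + \<alpha>)) v)) \<and>
         ((\<exists>k::nat. real DIM('a) * \<alpha> = 2 * real k) \<longrightarrow>
           (\<exists>v. (AE x in lborel. u x = v x) \<and> smooth_on UNIV v))"
proof -
 let ?m = "real DIM('a)"
 let ?f = "%x. norm x powr (?m * \<alpha>) * exp (?m * u x)"
 have sol: "solves_fl DIM('a) ?f u" and f: "Lint ?f" using assms(3) by (auto simp: P0_def)
 have "EX c h. c >= 0 & (ALL k. Ck_on k UNIV h) & (AE a in lborel. u a = c * (LBINT x. ?f x * Phi (x - a)) + h a)"
 proof (cases "even DIM('a)")
  case True
  then obtain k where "DIM('a) = 2 * k" by (rule evenE)
  then obtain j where "DIM('a) = 2 * Suc j" using assms(1) by (cases k) auto
  thus ?thesis using even_representation[OF _ sol f] by blast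
 next
  case False
  then obtain k where "DIM('a) = 2 * k + 1" by (rule oddE)
  thus ?thesis using odd_representation[OF _ sol f] by blast
 qed
 then obtain c h where c: "c >= 0" and h: "!!k. Ck_on k UNIV h"
  and ae: "AE a in lborel. u a = c * (LBINT x. ?f x * Phi (x - a)) + h a" by blast
 \<comment> \<open>The representative: given by the formula at every point, with the default value
   of the integral wherever it might diverge.\<close>
 define v where "v a = c * (LBINT y. Phi (a - y) * ?f y) + h a" for a
 have "Phi (- z) = Phi z" for z :: 'a unfolding Phi_def by simp
 from this[of "_ - _"] have "(LBINT x. ?f x * Phi (x - a)) = (LBINT y. Phi (a - y) * ?f y)" for a
  by (simp add: mult.commute)
 hence uv: "AE x in lborel. u x = v x" using ae by (simp add: v_def)
 \<comment> \<open>The density is rewritten with v in the exponent, so that v becomes a potential of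
   its own exponential; the two densities agree almost everywhere.\<close>
 let ?g = "%y. norm y powr (?m * \<alpha>) * exp (?m * v y)"
 have pr: "pot_repr c h ?f v" using f h by (simp add: pot_repr_def v_def)
 have [measurable]: "v : bmeas" by (rule pot_repr_measurable[OF pr])
 have R: "pot_repr c h ?g v"
 proof (rule pot_repr_cong[OF pr])
  show "AE y in lborel. ?f y = ?g y" using uv by eventually_elim simp
 qed measurable
 \<comment> \<open>The condition alpha > -1 enters as local integrability of the weight.\<close>
 have p: "- ?m < ?m * \<alpha>" using mult_strict_left_mono[OF assms(2), of ?m] by simp
 have lb: "EX r>0. EX M. ALL y:ball x0 r. \<bar>v y\<bar> <= M" for x0
  by (rule potential_locally_bounded[OF R c _ p refl]) simp
 note concl = regularity_conclusion[OF assms(1) _ reflexive R lb refl assms(2)]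
 show ?thesis using uv concl by (intro conjI impI exI[of _ v] allI) auto
qed

end
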